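(* Each homologically disconnected non-negatively graded cdga $A$ is isomorphic to a finite product $\prod_{i\in J}A_i$ of homologically connected non-negatively graded cdgas $A_i$. This isomorphism extends to a natural equivalence of categories $$\mathrm{ho}\mathscr A^{dc}_{\ge 0}\ \sim\ \mathrm{Prod}(\mathrm{ho}\mathscr A^{c}_{\ge 0}).$$ Each homologically disconnected ($\mathbb Z$-graded) cdga $A$ is weakly equivalent to a finite product $\prod_{i\in J}A_i$ of homologically connected cdgas $A_i$. As in the previous case, one has an equivalence of categories $$\mathrm{ho}\mathscr A^{dc}\ \sim\ \mathrm{Prod}(\mathrm{ho}\mathscr A^{c}).$$
   Context: $\Bbbk$ is a fixed field of characteristic zero. A cdga is a unital commutative differential graded associative $\Bbbk$-algebra with cohomological grading, by $\mathbb Z$ unless stated otherwise. $\mathscr A$ is the category of cdgas, $\mathscr A_{\ge 0}\subset\mathscr A$ the full subcategory of non-negatively graded cdgas. Both are closed model categories in which weak equivalences are the morphisms inducing isomorphisms of cohomology and fibrations are the surjective morphisms. A cdga $A$ is homologically connected if $H^0(A)=\Bbbk$ and $H^n(A)=0$ for $n<0$; it is homologically disconnected if $H^n(A)=0$ for $n<0$ and $H^0(A)\cong\prod_{i\in J}\Bbbk$ for some nonempty finite set $J$. $\mathrm{ho}\mathscr A^{dc}$, $\mathrm{ho}\mathscr A^{c}$ (resp. $\mathrm{ho}\mathscr A^{dc}_{\ge 0}$, $\mathrm{ho}\mathscr A^{c}_{\ge 0}$) denote the full subcategories of $\mathrm{ho}\mathscr A$ (resp. $\mathrm{ho}\mathscr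 A_{\ge 0}$) whose objects are homologically disconnected, respectively homologically connected, cdgas. For a category $\mathcal C$, $\mathrm{Prod}(\mathcal C)$ is the category whose objects are formal finite products $A_1\times\cdots\times A_s$, $s\ge 1$, of objects of $\mathcal C$, with morphism sets $$\mathrm{Prod}(\mathcal C)\big(A_1\times\cdots\times A_s,\,B_1\times\cdots\times B_t\big):=\prod_{1\le j\le t}\ \bigcup_{1\le i\le s}\mathcal C(A_i,B_j)$$ (disjoint union over $i$) and the obvious composition. *)

theory Defs
  imports "HOL-Algebra.Module" "HOL-Algebra.QuotRing"
begin

section \<open>Categories, functors, equivalences\<close>

text \<open>
  Hom-sets of different pairs of objects need not be disjoint, so composition takes the three
  objects as arguments: \<open>Comp C X Y Z g f\<close> is the composite of \<open>f : X \<rightarrow> Y\<close> and \<open>g : Y \<rightarrow> Z\<close>.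
\<close>

record ('o, 'm) cat =
  Obj :: "'o set"
  Hom :: "'o \<Rightarrow> 'o \<Rightarrow> 'm set"
  Ident :: "'o \<Rightarrow> 'm"
  Comp :: "'o \<Rightarrow> 'o \<Rightarrow> 'o \<Rightarrow> 'm \<Rightarrow> 'm \<Rightarrow> 'm"

locale category =
  fixes C :: "('o, 'm) cat"
  assumes ident_in: "X \<in> Obj C \<Longrightarrow> Ident C X \<in> Hom C X X"
    and comp_in: "\<lbrakk>X \<in> Obj C; Y \<in> Obj C; Z \<in> Obj C; f \<in> Hom C X Y; g \<in> Hom C Y Z\<rbrakk>
      \<Longrightarrow> Comp C X Y Z g f \<in> Hom C X Z"
    and comp_ident: "\<lbrakk>X \<in> Obj C; Y \<in> Obj C; f \<in> Hom C X Y\<rbrakk> \<Longrightarrow> Comp C X X Y f (Ident C X) = f"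
    and ident_comp: "\<lbrakk>X \<in> Obj C; Y \<in> Obj C; f \<in> Hom C X Y\<rbrakk> \<Longrightarrow> Comp C X Y Y (Ident C Y) f = f"
    and comp_assoc: "\<lbrakk>X \<in> Obj C; Y \<in> Obj C; Z \<in> Obj C; V \<in> Obj C;
      f \<in> Hom C X Y; g \<in> Hom C Y Z; h \<in> Hom C Z V\<rbrakk>
      \<Longrightarrow> Comp C X Z V h (Comp C X Y Z g f) = Comp C X Y V (Comp C Y Z V h g) f"

definition full_subcat :: "('o, 'm) cat \<Rightarrow> ('o \<Rightarrow> bool) \<Rightarrow> ('o, 'm) cat" where
  "full_subcat C P = C\<lparr>Obj := {X \<in> Obj C. P X}\<rparr>"

definition iso_in :: "('o, 'm) cat \<Rightarrow> 'o \<Rightarrow> 'o \<Rightarrow> 'm \<Rightarrow> bool" where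
  "iso_in C X Y f \<longleftrightarrow> f \<in> Hom C X Y \<and>
     (\<exists>g \<in> Hom C Y X. Comp C X Y X g f = Ident C X \<and> Comp C Y X Y f g = Ident C Y)"

record ('o, 'm, 'p, 'n) func =
  FObj :: "'o \<Rightarrow> 'p"
  FMap :: "'o \<Rightarrow> 'o \<Rightarrow> 'm \<Rightarrow> 'n"

definition is_functor :: "('o, 'm) cat \<Rightarrow> ('p, 'n) cat \<Rightarrow> ('o, 'm, 'p, 'n) func \<Rightarrow> bool" where
  "is_functor C D F \<longleftrightarrow> category C \<and> category D \<and>
     (\<forall>X \<in> Obj C. FObj F X \<in> Obj D) \<and>
     (\<forall>X \<in> Obj C. \<forall>Y \<in> Obj C. \<forall>f \<in> Hom C X Y. FMap F X Y f \<in> Hom D (FObj F X) (FObj F Y)) \<and>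
     (\<forall>X \<in> Obj C. FMap F X X (Ident C X) = Ident D (FObj F X)) \<and>
     (\<forall>X \<in> Obj C. \<forall>Y \<in> Obj C. \<forall>Z \<in> Obj C. \<forall>f \<in> Hom C X Y. \<forall>g \<in> Hom C Y Z.
        FMap F X Z (Comp C X Y Z g f) =
        Comp D (FObj F X) (FObj F Y) (FObj F Z) (FMap F Y Z g) (FMap F X Y f))"

definition id_func :: "('o, 'm, 'o, 'm) func" where
  "id_func = \<lparr>FObj = (\<lambda>X. X), FMap = (\<lambda>X Y f. f)\<rparr>"

definition comp_func ::
    "('p, 'n, 'q, 'l) func \<Rightarrow> ('o, 'm, 'p, 'n) func \<Rightarrow> ('o, 'm, 'q, 'l) func" where
  "comp_func G F = \<lparr>FObj = (\<lambda>X. FObj G (FObj F X)),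
     FMap = (\<lambda>X Y f. FMap G (FObj F X) (FObj F Y) (FMap F X Y f))\<rparr>"

definition natural_iso :: "('o, 'm) cat \<Rightarrow> ('p, 'n) cat \<Rightarrow> ('o, 'm, 'p, 'n) func \<Rightarrow>
    ('o, 'm, 'p, 'n) func \<Rightarrow> ('o \<Rightarrow> 'n) \<Rightarrow> bool" where
  "natural_iso C D F G \<eta> \<longleftrightarrow>
     (\<forall>X \<in> Obj C. iso_in D (FObj F X) (FObj G X) (\<eta> X)) \<and>
     (\<forall>X \<in> Obj C. \<forall>Y \<in> Obj C. \<forall>f \<in> Hom C X Y.
        Comp D (FObj F X) (FObj F Y) (FObj G Y) (\<eta> Y) (FMap F X Y f) =
        Comp D (FObj F X) (FObj G X) (FObj G Y) (FMap G X Y f) (\<eta> X))"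

definition is_equivalence :: "('o, 'm) cat \<Rightarrow> ('p, 'n) cat \<Rightarrow> ('o, 'm, 'p, 'n) func \<Rightarrow> bool" where
  "is_equivalence C D F \<longleftrightarrow> is_functor C D F \<and>
     (\<exists>G \<eta> \<epsilon>. is_functor D C G \<and>
        natural_iso C C id_func (comp_func G F) \<eta> \<and>
        natural_iso D D (comp_func F G) id_func \<epsilon>)"


section \<open>The category of formal finite products\<close>

text \<open>
  A formal product \<open>A\<^sub>1 \<times> \<cdots> \<times> A\<^sub>s\<close>, \<open>s \<ge> 1\<close>, is a nonempty list.  An element of the disjoint union
  of the sets \<open>C(A\<^sub>i, B\<^sub>j)\<close> over \<open>i\<close> is a pair of an index \<open>i\<close> (counted from 0) and a morphism.
\<close>

definition Prod_cat :: "('o, 'm) cat \<Rightarrow> ('o list, (nat \<times> 'm) list) cat" where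
  "Prod_cat C = \<lparr>
     Obj = {As. As \<noteq> [] \<and> set As \<subseteq> Obj C},
     Hom = (\<lambda>As Bs. {fs. length fs = length Bs \<and>
       (\<forall>j < length Bs. fst (fs ! j) < length As \<and>
          snd (fs ! j) \<in> Hom C (As ! fst (fs ! j)) (Bs ! j))}),
     Ident = (\<lambda>As. map (\<lambda>i. (i, Ident C (As ! i))) [0..<length As]),
     Comp = (\<lambda>As Bs Cs gs fs. map (\<lambda>k.
       let (j, g) = gs ! k; (i, f) = fs ! j
       in (i, Comp C (As ! i) (Bs ! j) (Cs ! k) g f)) [0..<length Cs])\<rparr>"


section \<open>Localization of a category\<close>

text \<open>
  The Gabriel--Zisman construction of \<open>C[W\<^sup>-\<^sup>1]\<close>: the objects are those of \<open>C\<close>, the morphisms are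
  zigzags of morphisms of \<open>C\<close> and formal inverses of morphisms in \<open>W\<close>, modulo the congruence
  generated by the relations below.  \<open>Fwd X Y f\<close> stands for \<open>f : X \<rightarrow> Y\<close>, and \<open>Inv X Y w\<close> for the
  formal inverse, going from \<open>Y\<close> to \<open>X\<close>, of \<open>w : X \<rightarrow> Y\<close>.  Zigzags are read from left to right.
\<close>

datatype ('o, 'm) step = Fwd 'o 'o 'm | Inv 'o 'o 'm

inductive zigzag ::
    "('o, 'm) cat \<Rightarrow> ('o \<Rightarrow> 'o \<Rightarrow> 'm set) \<Rightarrow> 'o \<Rightarrow> 'o \<Rightarrow> ('o, 'm) step list \<Rightarrow> bool"
  for C W where
  zz_nil: "X \<in> Obj C \<Longrightarrow> zigzag C W X X []"
| zz_fwd: "\<lbrakk>X \<in> Obj C; f \<in> Hom C X Y; zigzag C W Y Z p\<rbrakk> \<Longrightarrow> zigzag C W X Z (Fwd X Y f # p)"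
| zz_inv: "\<lbrakk>Y \<in> Obj C; w \<in> Hom C X Y \<inter> W X Y; zigzag C W X Z p\<rbrakk>
    \<Longrightarrow> zigzag C W Y Z (Inv X Y w # p)"

inductive zz_eq :: "('o, 'm) cat \<Rightarrow> ('o \<Rightarrow> 'o \<Rightarrow> 'm set) \<Rightarrow> 'o \<Rightarrow> 'o \<Rightarrow>
    ('o, 'm) step list \<Rightarrow> ('o, 'm) step list \<Rightarrow> bool"
  for C W where
  zz_refl: "zigzag C W X Y p \<Longrightarrow> zz_eq C W X Y p p"
| zz_sym: "zz_eq C W X Y p q \<Longrightarrow> zz_eq C W X Y q p"
| zz_trans: "\<lbrakk>zz_eq C W X Y p q; zz_eq C W X Y q r\<rbrakk> \<Longrightarrow> zz_eq C W X Y p r"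
| zz_cong: "\<lbrakk>zigzag C W X Y r; zz_eq C W Y Z p q; zigzag C W Z V s\<rbrakk>
    \<Longrightarrow> zz_eq C W X V (r @ p @ s) (r @ q @ s)"
| zz_ident: "X \<in> Obj C \<Longrightarrow> zz_eq C W X X [Fwd X X (Ident C X)] []"
| zz_comp: "\<lbrakk>X \<in> Obj C; Y \<in> Obj C; Z \<in> Obj C; f \<in> Hom C X Y; g \<in> Hom C Y Z\<rbrakk>
    \<Longrightarrow> zz_eq C W X Z [Fwd X Y f, Fwd Y Z g] [Fwd X Z (Comp C X Y Z g f)]"
| zz_fwd_inv: "\<lbrakk>X \<in> Obj C; Y \<in> Obj C; w \<in> Hom C X Y \<inter> W X Y\<rbrakk>
    \<Longrightarrow> zz_eq C W X X [Fwd X Y w, Inv X Y w] []"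
| zz_inv_fwd: "\<lbrakk>X \<in> Obj C; Y \<in> Obj C; w \<in> Hom C X Y \<inter> W X Y\<rbrakk>
    \<Longrightarrow> zz_eq C W Y Y [Inv X Y w, Fwd X Y w] []"

definition zz_class :: "('o, 'm) cat \<Rightarrow> ('o \<Rightarrow> 'o \<Rightarrow> 'm set) \<Rightarrow> 'o \<Rightarrow> 'o \<Rightarrow>
    ('o, 'm) step list \<Rightarrow> ('o, 'm) step list set" where
  "zz_class C W X Y p = {q. zz_eq C W X Y p q}"

definition localization :: "('o, 'm) cat \<Rightarrow> ('o \<Rightarrow> 'o \<Rightarrow> 'm set) \<Rightarrow>
    ('o, ('o, 'm) step list set) cat" where
  "localization C W = \<lparr>
     Obj = Obj C,
     Hom = (\<lambda>X Y. {zz_class C W X Y p | p. zigzag C W X Y p}),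
     Ident = (\<lambda>X. zz_class C W X X []),
     Comp = (\<lambda>X Y Z Q P. \<Union>p \<in> P. \<Union>q \<in> Q. zz_class C W X Z (p @ q))\<rparr>"

definition weak_zigzag ::
    "('o, 'm) cat \<Rightarrow> ('o \<Rightarrow> 'o \<Rightarrow> 'm set) \<Rightarrow> 'o \<Rightarrow> 'o \<Rightarrow> ('o, 'm) step list \<Rightarrow> bool" where
  "weak_zigzag C W = zigzag (C\<lparr>Hom := \<lambda>X Y. Hom C X Y \<inter> W X Y\<rparr>) W"

definition weakly_equivalent ::
    "('o, 'm) cat \<Rightarrow> ('o \<Rightarrow> 'o \<Rightarrow> 'm set) \<Rightarrow> 'o \<Rightarrow> 'o \<Rightarrow> bool" where
  "weakly_equivalent C W X Y \<longleftrightarrow> (\<exists>p. weak_zigzag C W X Y p)"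


section \<open>Commutative differential graded algebras\<close>

definition linear_maps ::
    "'k ring \<Rightarrow> ('k, 'a) module \<Rightarrow> ('k, 'b) module \<Rightarrow> ('a \<Rightarrow> 'b) set" where
  "linear_maps K M N = {f \<in> carrier M \<rightarrow> carrier N.
     (\<forall>x \<in> carrier M. \<forall>y \<in> carrier M. f (x \<oplus>\<^bsub>M\<^esub> y) = f x \<oplus>\<^bsub>N\<^esub> f y) \<and>
     (\<forall>c \<in> carrier K. \<forall>x \<in> carrier M. f (c \<odot>\<^bsub>M\<^esub> x) = c \<odot>\<^bsub>N\<^esub> f x)}"

text \<open>
  A graded algebra is given by its homogeneous components \<open>gr A n\<close>, \<open>n \<in> \<int>\<close>, which are
  \<open>K\<close>-modules (the fields \<open>mult\<close> and \<open>one\<close> of these module records play no role), and by products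
  \<open>mul A i j : A\<^sup>i \<times> A\<^sup>j \<rightarrow> A\<^sup>i\<^sup>+\<^sup>j\<close>.  Carriers are subsets of a type \<open>'a\<close>, which serves as the
  universe.  Nothing is assumed about \<open>'a\<close>: a nonzero cdga exists only if \<open>K\<close> injects into it, and
  for \<open>K\<close> infinite \<open>'a\<close> then has room for finite products, path objects and localizations.
\<close>

record ('k, 'a) dga =
  gr :: "int \<Rightarrow> ('k, 'a) module"
  mul :: "int \<Rightarrow> int \<Rightarrow> 'a \<Rightarrow> 'a \<Rightarrow> 'a"
  unity :: "'a"
  dif :: "int \<Rightarrow> 'a \<Rightarrow> 'a"

text \<open>\<open>signed M n x\<close> is \<open>(-1)\<^sup>n x\<close>.\<close>

definition signed :: "('k, 'a) module \<Rightarrow> int \<Rightarrow> 'a \<Rightarrow> 'a" where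
  "signed M n x = (if even n then x else \<ominus>\<^bsub>M\<^esub> x)"

locale cdga =
  fixes K :: "'k ring" and A :: "('k, 'a) dga"
  assumes gr_module: "module K (gr A n)"
    and mul_left: "y \<in> carrier (gr A j)
      \<Longrightarrow> (\<lambda>x. mul A i j x y) \<in> linear_maps K (gr A i) (gr A (i + j))"
    and mul_right: "x \<in> carrier (gr A i)
      \<Longrightarrow> (\<lambda>y. mul A i j x y) \<in> linear_maps K (gr A j) (gr A (i + j))"
    and mul_assoc: "\<lbrakk>x \<in> carrier (gr A i); y \<in> carrier (gr A j); z \<in> carrier (gr A k)\<rbrakk>
      \<Longrightarrow> mul A (i + j) k (mul A i j x y) z = mul A i (j + k) x (mul A j k y z)"
    and unity_in: "unity A \<in> carrier (gr A 0)"
    and unity_mul: "x \<in> carrier (gr A n) \<Longrightarrow> mul A 0 n (unity A) x = x"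
    and mul_unity: "x \<in> carrier (gr A n) \<Longrightarrow> mul A n 0 x (unity A) = x"
    and mul_commute: "\<lbrakk>x \<in> carrier (gr A i); y \<in> carrier (gr A j)\<rbrakk>
      \<Longrightarrow> mul A i j x y = signed (gr A (i + j)) (i * j) (mul A j i y x)"
    and dif_linear: "dif A n \<in> linear_maps K (gr A n) (gr A (n + 1))"
    and dif_dif: "x \<in> carrier (gr A n) \<Longrightarrow> dif A (n + 1) (dif A n x) = \<zero>\<^bsub>gr A (n + 2)\<^esub>"
    and leibniz: "\<lbrakk>x \<in> carrier (gr A i); y \<in> carrier (gr A j)\<rbrakk>
      \<Longrightarrow> dif A (i + j) (mul A i j x y) =
          mul A (i + 1) j (dif A i x) y \<oplus>\<^bsub>gr A (i + j + 1)\<^esub>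
          signed (gr A (i + j + 1)) i (mul A i (j + 1) x (dif A j y))"

text \<open>Components are required to be \<open>undefined\<close> off the carriers, so that equal morphisms are equal.\<close>

definition cdga_hom ::
    "'k ring \<Rightarrow> ('k, 'a) dga \<Rightarrow> ('k, 'b) dga \<Rightarrow> (int \<Rightarrow> 'a \<Rightarrow> 'b) set" where
  "cdga_hom K A B = {f.
     (\<forall>n. f n \<in> linear_maps K (gr A n) (gr B n) \<inter> extensional (carrier (gr A n))) \<and>
     (\<forall>i j. \<forall>x \<in> carrier (gr A i). \<forall>y \<in> carrier (gr A j).
        f (i + j) (mul A i j x y) = mul B i j (f i x) (f j y)) \<and>
     f 0 (unity A) = unity B \<and>
     (\<forall>n. \<forall>x \<in> carrier (gr A n). f (n + 1) (dif A n x) = dif B n (f n x))}"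

definition cdga_iso ::
    "'k ring \<Rightarrow> ('k, 'a) dga \<Rightarrow> ('k, 'b) dga \<Rightarrow> (int \<Rightarrow> 'a \<Rightarrow> 'b) set" where
  "cdga_iso K A B =
     {f \<in> cdga_hom K A B. \<forall>n. bij_betw (f n) (carrier (gr A n)) (carrier (gr B n))}"

definition cdga_cat :: "'k ring \<Rightarrow> (('k, 'a) dga, int \<Rightarrow> 'a \<Rightarrow> 'a) cat" where
  "cdga_cat K = \<lparr>
     Obj = {A. cdga K A},
     Hom = cdga_hom K,
     Ident = (\<lambda>A n. \<lambda>x \<in> carrier (gr A n). x),
     Comp = (\<lambda>A B C g f n. compose (carrier (gr A n)) (g n) (f n))\<rparr>"

definition nonneg_graded :: "('k, 'a) dga \<Rightarrow> bool" where
  "nonneg_graded A \<longleftrightarrow> (\<forall>n < 0. carrier (gr A n) = {\<zero>\<^bsub>gr A n\<^esub>})"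


subsection \<open>Products\<close>

definition prod_module :: "'i set \<Rightarrow> ('i \<Rightarrow> ('k, 'a) module) \<Rightarrow> ('k, 'i \<Rightarrow> 'a) module" where
  "prod_module J M = \<lparr>
     carrier = (\<Pi>\<^sub>E j\<in>J. carrier (M j)),
     mult = (\<lambda>x y. \<lambda>j\<in>J. x j \<otimes>\<^bsub>M j\<^esub> y j),
     one = (\<lambda>j\<in>J. \<one>\<^bsub>M j\<^esub>),
     zero = (\<lambda>j\<in>J. \<zero>\<^bsub>M j\<^esub>),
     add = (\<lambda>x y. \<lambda>j\<in>J. x j \<oplus>\<^bsub>M j\<^esub> y j),
     smult = (\<lambda>c x. \<lambda>j\<in>J. c \<odot>\<^bsub>M j\<^esub> x j)\<rparr>"

definition cdga_prod :: "'i set \<Rightarrow> ('i \<Rightarrow> ('k, 'a) dga) \<Rightarrow> ('k, 'i \<Rightarrow> 'a) dga" where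
  "cdga_prod J A = \<lparr>
     gr = (\<lambda>n. prod_module J (\<lambda>j. gr (A j) n)),
     mul = (\<lambda>m n x y. \<lambda>j\<in>J. mul (A j) m n (x j) (y j)),
     unity = (\<lambda>j\<in>J. unity (A j)),
     dif = (\<lambda>n x. \<lambda>j\<in>J. dif (A j) n (x j))\<rparr>"

abbreviation cdga_prod_list :: "('k, 'a) dga list \<Rightarrow> ('k, nat \<Rightarrow> 'a) dga" where
  "cdga_prod_list As \<equiv> cdga_prod {..<length As} ((!) As)"

text \<open>
  The product of cdgas with carriers in \<open>'a\<close> has its carriers in a different type.  \<open>P\<close>, with
  carriers in \<open>'a\<close> again, is a product of the list \<open>As\<close> with projections \<open>p\<close> if the \<open>p i\<close> are the
  components of an isomorphism from \<open>P\<close> onto the product.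
\<close>

definition is_cdga_prod :: "'k ring \<Rightarrow> ('k, 'a) dga \<Rightarrow> ('k, 'a) dga list \<Rightarrow>
    (nat \<Rightarrow> int \<Rightarrow> 'a \<Rightarrow> 'a) \<Rightarrow> bool" where
  "is_cdga_prod K P As p \<longleftrightarrow>
     (\<forall>i < length As. p i \<in> cdga_hom K P (As ! i)) \<and>
     (\<lambda>n. \<lambda>x \<in> carrier (gr P n). \<lambda>i \<in> {..<length As}. p i n x) \<in> cdga_iso K P (cdga_prod_list As)"


subsection \<open>Cohomology\<close>

definition cocycles :: "('k, 'a) dga \<Rightarrow> int \<Rightarrow> 'a set" where
  "cocycles A n = a_kernel (gr A n) (gr A (n + 1)) (dif A n)"

definition coboundaries :: "('k, 'a) dga \<Rightarrow> int \<Rightarrow> 'a set" where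
  "coboundaries A n = dif A (n - 1) ` carrier (gr A (n - 1))"

definition coh_class :: "('k, 'a) dga \<Rightarrow> int \<Rightarrow> 'a \<Rightarrow> 'a set" where
  "coh_class A n x = coboundaries A n +>\<^bsub>gr A n\<^esub> x"

definition cohomology :: "('k, 'a) dga \<Rightarrow> int \<Rightarrow> 'a set set" where
  "cohomology A n = coh_class A n ` cocycles A n"

definition coh_map ::
    "('k, 'a) dga \<Rightarrow> ('k, 'b) dga \<Rightarrow> (int \<Rightarrow> 'a \<Rightarrow> 'b) \<Rightarrow> int \<Rightarrow> 'a set \<Rightarrow> 'b set" where
  "coh_map A B f n X = (\<Union>x \<in> X. coh_class B n (f n x))"

definition quasi_iso ::
    "'k ring \<Rightarrow> ('k, 'a) dga \<Rightarrow> ('k, 'b) dga \<Rightarrow> (int \<Rightarrow> 'a \<Rightarrow> 'b) set" where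
  "quasi_iso K A B = {f \<in> cdga_hom K A B.
     \<forall>n. bij_betw (coh_map A B f n) (cohomology A n) (cohomology B n)}"

definition H0_algebra :: "('k, 'a) dga \<Rightarrow> ('k, 'a set) module" where
  "H0_algebra A = \<lparr>
     carrier = cohomology A 0,
     mult = (\<lambda>X Y. \<Union>x \<in> X. \<Union>y \<in> Y. coh_class A 0 (mul A 0 0 x y)),
     one = coh_class A 0 (unity A),
     zero = coboundaries A 0,
     add = (\<lambda>X Y. X <+>\<^bsub>gr A 0\<^esub> Y),
     smult = (\<lambda>c X. \<Union>x \<in> X. coh_class A 0 (c \<odot>\<^bsub>gr A 0\<^esub> x))\<rparr>"

definition algebra_isomorphic ::
    "'k ring \<Rightarrow> ('k, 'a) module \<Rightarrow> ('k, 'b) module \<Rightarrow> bool" where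
  "algebra_isomorphic K R S \<longleftrightarrow>
     (\<exists>h \<in> ring_iso R S. \<forall>c \<in> carrier K. \<forall>x \<in> carrier R. h (c \<odot>\<^bsub>R\<^esub> x) = c \<odot>\<^bsub>S\<^esub> h x)"

definition base_algebra :: "'k ring \<Rightarrow> ('k, 'k) module" where
  "base_algebra K = ring.extend K \<lparr>smult = (\<otimes>\<^bsub>K\<^esub>)\<rparr>"

definition homologically_connected :: "'k ring \<Rightarrow> ('k, 'a) dga \<Rightarrow> bool" where
  "homologically_connected K A \<longleftrightarrow>
     algebra_isomorphic K (H0_algebra A) (base_algebra K) \<and>
     (\<forall>n < 0. cohomology A n = {coboundaries A n})"

definition homologically_disconnected :: "'k ring \<Rightarrow> ('k, 'a) dga \<Rightarrow> bool" where
  "homologically_disconnected K A \<longleftrightarrow>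
     (\<forall>n < 0. cohomology A n = {coboundaries A n}) \<and>
     (\<exists>J :: nat set. finite J \<and> J \<noteq> {} \<and>
        algebra_isomorphic K (H0_algebra A) (prod_module J (\<lambda>_. base_algebra K)))"


subsection \<open>Homotopy categories\<close>

definition cdga_nonneg_cat :: "'k ring \<Rightarrow> (('k, 'a) dga, int \<Rightarrow> 'a \<Rightarrow> 'a) cat" where
  "cdga_nonneg_cat K = full_subcat (cdga_cat K) nonneg_graded"

type_synonym ('k, 'a) ho_mor = "(('k, 'a) dga, int \<Rightarrow> 'a \<Rightarrow> 'a) step list set"

definition ho_cdga :: "'k ring \<Rightarrow> (('k, 'a) dga, ('k, 'a) ho_mor) cat" where
  "ho_cdga K = localization (cdga_cat K) (quasi_iso K)"

definition ho_cdga_nonneg :: "'k ring \<Rightarrow> (('k, 'a) dga, ('k, 'a) ho_mor) cat" where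
  "ho_cdga_nonneg K = localization (cdga_nonneg_cat K) (quasi_iso K)"

definition ho_c :: "'k ring \<Rightarrow> (('k, 'a) dga, ('k, 'a) ho_mor) cat" where
  "ho_c K = full_subcat (ho_cdga K) (homologically_connected K)"

definition ho_dc :: "'k ring \<Rightarrow> (('k, 'a) dga, ('k, 'a) ho_mor) cat" where
  "ho_dc K = full_subcat (ho_cdga K) (homologically_disconnected K)"

definition ho_c_nonneg :: "'k ring \<Rightarrow> (('k, 'a) dga, ('k, 'a) ho_mor) cat" where
  "ho_c_nonneg K = full_subcat (ho_cdga_nonneg K) (homologically_connected K)"

definition ho_dc_nonneg :: "'k ring \<Rightarrow> (('k, 'a) dga, ('k, 'a) ho_mor) cat" where
  "ho_dc_nonneg K = full_subcat (ho_cdga_nonneg K) (homologically_disconnected K)"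

text \<open>
  Let \<open>\<Phi>\<close> send the objects of \<open>D\<close>, a full subcategory of \<open>H\<close>, to formal products of objects of
  \<open>H\<close>, and let \<open>\<pi> A i\<close> be a morphism of \<open>H\<close> from \<open>A\<close> to the \<open>i\<close>-th factor of \<open>\<Phi> A\<close>.  The \<open>\<pi>\<close> are
  natural if for \<open>f : A \<rightarrow> B\<close> and for each component \<open>(i, g)\<close> of \<open>\<Phi> f\<close>, with \<open>g\<close> from the \<open>i\<close>-th
  factor of \<open>\<Phi> A\<close> to the \<open>j\<close>-th factor of \<open>\<Phi> B\<close>, one has \<open>g \<circ> \<pi> A i = \<pi> B j \<circ> f\<close>.  So \<open>\<Phi> f\<close>
  represents \<open>f\<close> under the decompositions of \<open>A\<close> and \<open>B\<close>.
\<close>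

definition natural_projections :: "('o, 'm) cat \<Rightarrow> ('o, 'm) cat \<Rightarrow>
    ('o, 'm, 'o list, (nat \<times> 'm) list) func \<Rightarrow> ('o \<Rightarrow> nat \<Rightarrow> 'm) \<Rightarrow> bool" where
  "natural_projections H D \<Phi> \<pi> \<longleftrightarrow>
     (\<forall>A \<in> Obj D. \<forall>B \<in> Obj D. \<forall>f \<in> Hom D A B. \<forall>j < length (FObj \<Phi> B).
        let (i, g) = FMap \<Phi> A B f ! j
        in Comp H A (FObj \<Phi> A ! i) (FObj \<Phi> B ! j) g (\<pi> A i) =
           Comp H A B (FObj \<Phi> B ! j) (\<pi> B j) f)"

end

theory Submission
  imports Defs
begin

text \<open>
  Let \<open>\<epsilon> \<in> H\<^sup>0(A)\<close> be idempotent. As a coset it is a multiplicative set of cocycles, and the localization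
  \<open>A\<^sub>\<epsilon>\<close> of \<open>A\<close> at it satisfies \<open>H(A\<^sub>\<epsilon>) = \<epsilon>H(A)\<close>. No representative of \<open>\<epsilon>\<close> is chosen, so \<open>A\<^sub>\<epsilon>\<close> is strictly
  functorial in the pair \<open>(A, \<epsilon>)\<close>. If \<open>H\<^sup>0(A)\<close> is a finite product of copies of \<open>K\<close> with primitive
  idempotents \<open>\<epsilon>\<^sub>i\<close>, then \<open>A \<rightarrow> \<Prod>A\<^sub>\<epsilon>\<^sub>i\<close> is a quasi-isomorphism with connected factors. It is an isomorphism
  when \<open>A\<close> is non-negatively graded, since then \<open>\<epsilon>\<^sub>i\<close> has only one element.

  For the equivalences, two facts about the localized category are needed, and both hold without
  calculus of fractions or model structures. First, finite products of cdgas remain products: the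
  functors \<open>- \<times> Z\<close> preserve quasi-isomorphisms, hence act on zigzags. Secondly, for connected \<open>X\<close> every
  morphism \<open>A \<rightarrow> X\<close> factors through exactly one \<open>A\<^sub>\<epsilon>\<^sub>i\<close>, in a unique way: idempotents can be transported
  along a zigzag from \<open>A\<close> to \<open>X\<close>, exactly one \<open>\<epsilon>\<^sub>i\<close> becomes \<open>1\<close> in \<open>H\<^sup>0(X) = K\<close>, and localizing the whole
  zigzag at \<open>\<epsilon>\<^sub>i\<close> gives the factorization. Together these facts identify the morphisms between
  disconnected cdgas with those between the formal products of their components.
\<close>

section \<open>Splittings into connected objects\<close>

text \<open>A zigzag representing a morphism of the homotopy category passes through arbitrary
  cdgas: \<open>H\<^sup>0\<close> may have any shape there, and negative cohomology need not vanish.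
  Whatever is done to a zigzag must therefore make sense for all objects and respect formal
  inverses. Idempotents of \<open>H\<^sup>0\<close> meet both demands, because quasi-isomorphisms
  are bijective on them and they can be transported in either direction; a cocycle chosen to
  represent an idempotent would not be matched by morphisms. The price is that 1 is rarely among the
  denominators, so that the map to a localization has to be written a \<mapsto> sa/s.

  The non-negatively graded and the \<int>-graded statements are instances of one argument, for a
  class of cdgas containing 0 and closed under binary products and localizations.

  All objects have their carriers in one type, and coding pairs requires this type to be infinite.
  In characteristic 0 the field is infinite, so over a finite type there is no connected or
  disconnected cdga at all, and the statements become trivial.\<close>

lemma full_subcat_simps [simp]:
  "Obj (full_subcat C P) = {X \<in> Obj C. P X}" "Hom (full_subcat C P) = Hom C"
  "Ident (full_subcat C P) = Ident C" "Comp (full_subcat C P) = Comp C"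
  by (simp_all add: full_subcat_def)

lemma category_full_subcat:
  assumes "category C"
  shows "category (full_subcat C P)"
proof -
  interpret category C by fact
  show ?thesis
    by unfold_locales (auto simp: ident_in comp_in comp_ident ident_comp intro!: comp_assoc)
qed

section \<open>Formal finite products form a category\<close>

lemma Prod_cat_simps:
  "Obj (Prod_cat C) = {As. As \<noteq> [] \<and> set As \<subseteq> Obj C}"
  "fs \<in> Hom (Prod_cat C) As Bs \<longleftrightarrow> length fs = length Bs \<and>
     (\<forall>j < length Bs. fst (fs ! j) < length As \<and> snd (fs ! j) \<in> Hom C (As ! fst (fs ! j)) (Bs ! j))"
  "length (Ident (Prod_cat C) As) = length As"
  "i < length As \<Longrightarrow> Ident (Prod_cat C) As ! i = (i, Ident C (As ! i))"
  "length (Comp (Prod_cat C) As Bs Cs gs fs) = length Cs"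
  "k < length Cs \<Longrightarrow> Comp (Prod_cat C) As Bs Cs gs fs ! k =
     (fst (fs ! fst (gs ! k)), Comp C (As ! fst (fs ! fst (gs ! k))) (Bs ! fst (gs ! k)) (Cs ! k)
        (snd (gs ! k)) (snd (fs ! fst (gs ! k))))"
  by (auto simp: Prod_cat_def case_prod_beta Let_def)

lemma category_Prod_cat:
  assumes "category C"
  shows "category (Prod_cat C)"
proof -
  interpret category C by fact
  have mem: "As ! i \<in> Obj C" if "As \<in> Obj (Prod_cat C)" "i < length As" for As i
    using that by (auto simp: Prod_cat_simps)
  show ?thesis
  proof
    fix X assume "X \<in> Obj (Prod_cat C)"
    then show "Ident (Prod_cat C) X \<in> Hom (Prod_cat C) X X"
      using mem[of X] by (auto simp: Prod_cat_simps ident_in)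
  next
    fix X Y Z f g
    assume "X \<in> Obj (Prod_cat C)" "Y \<in> Obj (Prod_cat C)" "Z \<in> Obj (Prod_cat C)"
      "f \<in> Hom (Prod_cat C) X Y" "g \<in> Hom (Prod_cat C) Y Z"
    then show "Comp (Prod_cat C) X Y Z g f \<in> Hom (Prod_cat C) X Z"
      using mem by (auto simp: Prod_cat_simps(2-) intro!: comp_in)
  next
    fix X Y f assume "X \<in> Obj (Prod_cat C)" "Y \<in> Obj (Prod_cat C)" "f \<in> Hom (Prod_cat C) X Y"
    then show "Comp (Prod_cat C) X X Y f (Ident (Prod_cat C) X) = f"
      using mem by (auto simp: Prod_cat_simps(2-) comp_ident intro!: nth_equalityI prod_eqI)
  next
    fix X Y f assume "X \<in> Obj (Prod_cat C)" "Y \<in> Obj (Prod_cat C)" "f \<in> Hom (Prod_cat C) X Y"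
    then show "Comp (Prod_cat C) X Y Y (Ident (Prod_cat C) Y) f = f"
      using mem by (auto simp: Prod_cat_simps(2-) ident_comp intro!: nth_equalityI prod_eqI)
  next
    fix X Y Z V f g h
    assume "X \<in> Obj (Prod_cat C)" "Y \<in> Obj (Prod_cat C)" "Z \<in> Obj (Prod_cat C)"
      "V \<in> Obj (Prod_cat C)" "f \<in> Hom (Prod_cat C) X Y" "g \<in> Hom (Prod_cat C) Y Z"
      "h \<in> Hom (Prod_cat C) Z V"
    then show "Comp (Prod_cat C) X Z V h (Comp (Prod_cat C) X Y Z g f) =
        Comp (Prod_cat C) X Y V (Comp (Prod_cat C) Y Z V h g) f"
      using mem by (auto simp: Prod_cat_simps(2-) intro!: nth_equalityI prod_eqI comp_assoc)
  qed
qed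

section \<open>Splittings, and matrices of morphisms between split objects\<close>

definition product_cone :: "('o, 'm) cat \<Rightarrow> 'o \<Rightarrow> 'o list \<Rightarrow> (nat \<Rightarrow> 'm) \<Rightarrow> bool" where
  "product_cone D A Bs \<pi> \<longleftrightarrow> (\<forall>i < length Bs. \<pi> i \<in> Hom D A (Bs ! i)) \<and>
     (\<forall>X \<in> Obj D. \<forall>f. (\<forall>i < length Bs. f i \<in> Hom D X (Bs ! i)) \<longrightarrow>
        (\<exists>!h. h \<in> Hom D X A \<and> (\<forall>i < length Bs. Comp D X A (Bs ! i) (\<pi> i) h = f i)))"

text \<open>The two halves control different variables. \<open>product_cone\<close> describes the
  maps into \<open>A\<close>; the last clause says that the maps from \<open>A\<close> to an object
  \<open>X\<close> with \<open>P X\<close> form the disjoint union of the sets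
  \<open>Hom D (Bs ! i) X\<close>. Combined, they turn the morphisms between two split objects into
  morphisms of formal products.\<close>

definition connected_splitting ::
    "('o, 'm) cat \<Rightarrow> ('o \<Rightarrow> bool) \<Rightarrow> 'o \<Rightarrow> 'o list \<Rightarrow> (nat \<Rightarrow> 'm) \<Rightarrow> bool" where
  "connected_splitting D P A Bs \<pi> \<longleftrightarrow> A \<in> Obj D \<and> Bs \<noteq> [] \<and>
     (\<forall>B \<in> set Bs. B \<in> Obj D \<and> P B) \<and> product_cone D A Bs \<pi> \<and>
     (\<forall>X \<in> Obj D. P X \<longrightarrow> (\<forall>h \<in> Hom D A X.
        \<exists>!ig. fst ig < length Bs \<and> snd ig \<in> Hom D (Bs ! fst ig) X \<and>
          Comp D A (Bs ! fst ig) X (snd ig) (\<pi> (fst ig)) = h))"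

context category
begin

context
  fixes P :: "'o \<Rightarrow> bool"
begin

abbreviation "splits A Bs \<pi> \<equiv> connected_splitting C P A Bs \<pi>"
abbreviation "PC \<equiv> Prod_cat (full_subcat C P)"

text \<open>\<open>gs\<close> is the matrix of \<open>f\<close> with respect to the two splittings.\<close>

definition represents ::
    "'o \<Rightarrow> 'o list \<Rightarrow> (nat \<Rightarrow> 'm) \<Rightarrow> 'o \<Rightarrow> 'o list \<Rightarrow> (nat \<Rightarrow> 'm) \<Rightarrow> 'm \<Rightarrow> (nat \<times> 'm) list \<Rightarrow> bool" where
  "represents A Bs \<pi> A' Cs \<rho> f gs \<longleftrightarrow> f \<in> Hom C A A' \<and> gs \<in> Hom PC Bs Cs \<and>
     (\<forall>j < length Cs. Comp C A (Bs ! fst (gs ! j)) (Cs ! j) (snd (gs ! j)) (\<pi> (fst (gs ! j))) =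
        Comp C A A' (Cs ! j) (\<rho> j) f)"

lemma splits_Obj:
  assumes "splits A Bs \<pi>"
  shows "A \<in> Obj C" "Bs \<in> Obj PC" "i < length Bs \<Longrightarrow> Bs ! i \<in> Obj C" "i < length Bs \<Longrightarrow> P (Bs ! i)"
    "i < length Bs \<Longrightarrow> \<pi> i \<in> Hom C A (Bs ! i)"
  using assms by (auto simp: connected_splitting_def Prod_cat_simps product_cone_def)

text \<open>The \<open>j\<close>-th entry is the unique factorization of \<open>\<rho> j\<close>
  after \<open>f\<close> through one of the factors of \<open>A\<close>. This uses the maps out of
  \<open>A\<close>, that is, the last clause of \<open>connected_splitting\<close>.\<close>

lemma represents_ex1:
  assumes A: "splits A Bs \<pi>" and A': "splits A' Cs \<rho>" and f: "f \<in> Hom C A A'"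
  shows "\<exists>!gs. represents A Bs \<pi> A' Cs \<rho> f gs"
proof -
  define Q where "Q j ig \<longleftrightarrow> fst ig < length Bs \<and> snd ig \<in> Hom C (Bs ! fst ig) (Cs ! j) \<and>
    Comp C A (Bs ! fst ig) (Cs ! j) (snd ig) (\<pi> (fst ig)) = Comp C A A' (Cs ! j) (\<rho> j) f" for j ig
  have ex1: "\<exists>!ig. Q j ig" if j: "j < length Cs" for j
  proof -
    have "Comp C A A' (Cs ! j) (\<rho> j) f \<in> Hom C A (Cs ! j)"
      using splits_Obj[OF A] splits_Obj[OF A'] f j by (auto intro: comp_in)
    then show ?thesis
      using A splits_Obj[OF A'] j unfolding connected_splitting_def Q_def by blast
  qed
  have rep: "represents A Bs \<pi> A' Cs \<rho> f gs \<longleftrightarrow> length gs = length Cs \<and> (\<forall>j < length Cs. Q j (gs ! j))"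
    for gs
    using f by (auto simp: represents_def Prod_cat_simps(2) Q_def)
  show ?thesis
    unfolding rep
  proof (rule ex1I)
    show "length (map (\<lambda>j. THE ig. Q j ig) [0..<length Cs]) = length Cs \<and>
        (\<forall>j < length Cs. Q j (map (\<lambda>j. THE ig. Q j ig) [0..<length Cs] ! j))"
      using theI'[OF ex1] by simp
  next
    fix gs assume gs: "length gs = length Cs \<and> (\<forall>j < length Cs. Q j (gs ! j))"
    then have "(THE ig. Q j ig) = gs ! j" if "j < length Cs" for j
      using the1_equality[OF ex1[OF that], of "gs ! j"] that by blast
    then show "gs = map (\<lambda>j. THE ig. Q j ig) [0..<length Cs]"
      using gs by (intro nth_equalityI) simp_all
  qed
qed

text \<open>Here the product property of \<open>A'\<close> is used: the entries of
  \<open>gs\<close>, composed with the projections of \<open>A\<close>, form a cone over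
  \<open>Cs\<close>. Together with \<open>represents_ex1\<close> this makes morphisms and matrices
  correspond bijectively.\<close>

lemma represents_ex1_mor:
  assumes A: "splits A Bs \<pi>" and A': "splits A' Cs \<rho>" and gs: "gs \<in> Hom PC Bs Cs"
  shows "\<exists>!f. represents A Bs \<pi> A' Cs \<rho> f gs"
proof -
  define F where "F j = Comp C A (Bs ! fst (gs ! j)) (Cs ! j) (snd (gs ! j)) (\<pi> (fst (gs ! j)))" for j
  have "F j \<in> Hom C A (Cs ! j)" if "j < length Cs" for j
    unfolding F_def using gs that splits_Obj[OF A] splits_Obj[OF A']
    by (auto simp: Prod_cat_simps(2) intro!: comp_in)
  then have "\<exists>!f. f \<in> Hom C A A' \<and> (\<forall>j < length Cs. Comp C A A' (Cs ! j) (\<rho> j) f = F j)"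
    using A' splits_Obj(1)[OF A] by (simp add: connected_splitting_def product_cone_def)
  then show ?thesis
    using gs unfolding represents_def F_def by metis
qed

lemma represents_ident:
  assumes "splits A Bs \<pi>"
  shows "represents A Bs \<pi> A Bs \<pi> (Ident C A) (Ident PC Bs)"
  unfolding represents_def
proof (intro conjI)
  show "Ident PC Bs \<in> Hom PC Bs Bs"
    using category.ident_in[OF category_Prod_cat[OF category_full_subcat[OF category_axioms]]]
      splits_Obj(2)[OF assms] .
qed (use splits_Obj[OF assms] in \<open>auto simp: Prod_cat_simps(4) ident_in ident_comp comp_ident\<close>)

text \<open>Pasting of the squares for \<open>f\<close> and \<open>g\<close>: entry \<open>k\<close>
  of the composite involves only the index \<open>j\<close> selected by \<open>gs\<close> and the
  index \<open>i\<close> selected by \<open>fs\<close>. Since matrices and morphisms determine each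
  other, all functor laws below come from this lemma and \<open>represents_ident\<close>.\<close>

lemma represents_comp:
  assumes A: "splits A Bs \<pi>" and A': "splits A' Cs \<rho>" and A'': "splits A'' Ds \<sigma>"
    and f: "represents A Bs \<pi> A' Cs \<rho> f fs" and g: "represents A' Cs \<rho> A'' Ds \<sigma> g gs"
  shows "represents A Bs \<pi> A'' Ds \<sigma> (Comp C A A' A'' g f) (Comp PC Bs Cs Ds gs fs)"
proof -
  note O = splits_Obj[OF A] splits_Obj[OF A'] splits_Obj[OF A'']
  have fH: "f \<in> Hom C A A'" "fs \<in> Hom PC Bs Cs" and gH: "g \<in> Hom C A' A''" "gs \<in> Hom PC Cs Ds"
    using f g by (auto simp: represents_def)
  show ?thesis
    unfolding represents_def
  proof (intro conjI allI impI)
    show "Comp C A A' A'' g f \<in> Hom C A A''"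
      using O fH gH by (auto intro: comp_in)
    show "Comp PC Bs Cs Ds gs fs \<in> Hom PC Bs Ds"
      using category.comp_in[OF category_Prod_cat[OF category_full_subcat[OF category_axioms]]] O fH gH
      by blast
  next
    fix k assume k: "k < length Ds"
    define j where "j = fst (gs ! k)"
    define i where "i = fst (fs ! j)"
    define u where "u = snd (gs ! k)"
    define v where "v = snd (fs ! j)"
    have j: "j < length Cs" and u: "u \<in> Hom C (Cs ! j) (Ds ! k)"
      using gH(2) k by (auto simp: Prod_cat_simps(2) j_def u_def)
    have i: "i < length Bs" and v: "v \<in> Hom C (Bs ! i) (Cs ! j)"
      using fH(2) j by (auto simp: Prod_cat_simps(2) i_def v_def)
    have "Comp C A (Bs ! i) (Ds ! k) (Comp C (Bs ! i) (Cs ! j) (Ds ! k) u v) (\<pi> i) =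
        Comp C A (Cs ! j) (Ds ! k) u (Comp C A (Bs ! i) (Cs ! j) v (\<pi> i))"
      using O i j k u v by (simp add: comp_assoc)
    also have "Comp C A (Bs ! i) (Cs ! j) v (\<pi> i) = Comp C A A' (Cs ! j) (\<rho> j) f"
      using f j by (simp add: represents_def i_def v_def)
    also have "Comp C A (Cs ! j) (Ds ! k) u \<dots> = Comp C A A' (Ds ! k) (Comp C A' (Cs ! j) (Ds ! k) u (\<rho> j)) f"
      using O i j k u v fH by (simp add: comp_assoc)
    also have "Comp C A' (Cs ! j) (Ds ! k) u (\<rho> j) = Comp C A' A'' (Ds ! k) (\<sigma> k) g"
      using g k by (simp add: represents_def j_def u_def)
    also have "Comp C A A' (Ds ! k) \<dots> f = Comp C A A'' (Ds ! k) (\<sigma> k) (Comp C A A' A'' g f)"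
      using O k fH gH by (simp add: comp_assoc)
    finally show "Comp C A (Bs ! fst (Comp PC Bs Cs Ds gs fs ! k)) (Ds ! k)
        (snd (Comp PC Bs Cs Ds gs fs ! k)) (\<pi> (fst (Comp PC Bs Cs Ds gs fs ! k))) =
      Comp C A A'' (Ds ! k) (\<sigma> k) (Comp C A A' A'' g f)"
      using k by (simp add: Prod_cat_simps(6) i_def j_def u_def v_def)
  qed
qed

text \<open>Two splittings of one object differ by the matrix of its identity; the matrix of the
  identity in the opposite direction is an inverse. This supplies the counit of the
  equivalence.\<close>

lemma represents_iso_Prod:
  assumes A: "splits A Bs \<pi>" and A': "splits A Cs \<rho>"
    and gs: "represents A Bs \<pi> A Cs \<rho> (Ident C A) gs"
  shows "iso_in PC Bs Cs gs"
proof -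
  have I: "Ident C A \<in> Hom C A A" "Comp C A A A (Ident C A) (Ident C A) = Ident C A"
    using splits_Obj(1)[OF A] by (auto simp: ident_in ident_comp)
  obtain hs where hs: "represents A Cs \<rho> A Bs \<pi> (Ident C A) hs"
    using represents_ex1[OF A' A I(1)] by blast
  have "Comp PC Bs Cs Bs hs gs = Ident PC Bs"
    using represents_comp[OF A A' A gs hs] represents_ident[OF A] represents_ex1[OF A A I(1)] I(2)
    by metis
  moreover have "Comp PC Cs Bs Cs gs hs = Ident PC Cs"
    using represents_comp[OF A' A A' hs gs] represents_ident[OF A'] represents_ex1[OF A' A' I(1)] I(2)
    by metis
  ultimately show ?thesis
    using gs hs unfolding iso_in_def represents_def by blast
qed

text \<open>Objects split into the same list are isomorphic through the morphism with identity
  matrix. This supplies the unit of the equivalence.\<close>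

lemma represents_iso_mor:
  assumes A: "splits A Bs \<pi>" and A': "splits A' Bs \<rho>"
    and f: "represents A Bs \<pi> A' Bs \<rho> f (Ident PC Bs)"
  shows "iso_in C A A' f"
proof -
  interpret PC: category PC
    by (rule category_Prod_cat[OF category_full_subcat[OF category_axioms]])
  note O = splits_Obj(2)[OF A]
  have I: "Ident PC Bs \<in> Hom PC Bs Bs" "Comp PC Bs Bs Bs (Ident PC Bs) (Ident PC Bs) = Ident PC Bs"
    using PC.ident_in[OF O] PC.ident_comp[OF O O] by auto
  obtain g where g: "represents A' Bs \<rho> A Bs \<pi> g (Ident PC Bs)"
    using represents_ex1_mor[OF A' A I(1)] by blast
  have "Comp C A A' A g f = Ident C A"
    using represents_comp[OF A A' A f g] represents_ident[OF A] represents_ex1_mor[OF A A I(1)] I(2)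
    by metis
  moreover have "Comp C A' A A' f g = Ident C A'"
    using represents_comp[OF A' A A' g f] represents_ident[OF A'] represents_ex1_mor[OF A' A' I(1)] I(2)
    by metis
  ultimately show ?thesis
    using f g unfolding iso_in_def represents_def by blast
qed

text \<open>\<open>\<Phi>\<close> takes a morphism to its matrix; the quasi-inverse chooses an
  object for each list and takes a matrix to its morphism. Each identity to be shown equates two
  matrices of one morphism or two morphisms with one matrix. Naturality of the projections is the
  equation that defines \<open>represents\<close>.\<close>

lemma splitting_equivalence:
  assumes Q: "\<And>A. \<lbrakk>A \<in> Obj C; Q A\<rbrakk> \<Longrightarrow> splits A (Fs A) (\<pi> A)"
    and P: "\<And>Bs. Bs \<in> Obj PC \<Longrightarrow> \<exists>A \<rho>. Q A \<and> splits A Bs \<rho>"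
  shows "\<exists>\<Phi>. FObj \<Phi> = Fs \<and> is_equivalence (full_subcat C Q) PC \<Phi> \<and>
    natural_projections C (full_subcat C Q) \<Phi> \<pi>"
proof -
  interpret PC: category PC
    by (rule category_Prod_cat[OF category_full_subcat[OF category_axioms]])
  interpret QC: category "full_subcat C Q"
    by (rule category_full_subcat[OF category_axioms])
  obtain GO \<rho> where G: "\<And>Bs. Bs \<in> Obj PC \<Longrightarrow> Q (GO Bs) \<and> splits (GO Bs) Bs (\<rho> Bs)"
    using P by metis
  define \<Phi> where "\<Phi> = \<lparr>FObj = Fs, FMap = (\<lambda>A B f. THE gs. represents A (Fs A) (\<pi> A) B (Fs B) (\<pi> B) f gs)\<rparr>"
  define \<Gamma> where "\<Gamma> = \<lparr>FObj = GO, FMap = (\<lambda>Bs Cs gs. THE f. represents (GO Bs) Bs (\<rho> Bs) (GO Cs) Cs (\<rho> Cs) f gs)\<rparr>"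
  have FO: "FObj \<Phi> = Fs" and GO: "FObj \<Gamma> = GO"
    by (simp_all add: \<Phi>_def \<Gamma>_def)
  have Phi: "represents A (Fs A) (\<pi> A) B (Fs B) (\<pi> B) f (FMap \<Phi> A B f)"
    if "A \<in> Obj C" "Q A" "B \<in> Obj C" "Q B" "f \<in> Hom C A B" for A B f
    using theI'[OF represents_ex1[OF Q Q that(5)]] that by (simp add: \<Phi>_def)
  have Gam: "represents (GO Bs) Bs (\<rho> Bs) (GO Cs) Cs (\<rho> Cs) (FMap \<Gamma> Bs Cs gs) gs"
    if "Bs \<in> Obj PC" "Cs \<in> Obj PC" "gs \<in> Hom PC Bs Cs" for Bs Cs gs
    using theI'[OF represents_ex1_mor[OF _ _ that(3)]] G that by (simp add: \<Gamma>_def)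
  have FsO: "Fs A \<in> Obj PC" if "A \<in> Obj C" "Q A" for A
    using splits_Obj(2)[OF Q] that by simp
  have GOO: "GO Bs \<in> Obj C" "Q (GO Bs)" "splits (GO Bs) Bs (\<rho> Bs)" if "Bs \<in> Obj PC" for Bs
    using splits_Obj(1) G that by blast+
  have un: "gs = hs" if "represents A Bs \<pi>' A' Cs \<rho>' f gs" "represents A Bs \<pi>' A' Cs \<rho>' f hs"
      "splits A Bs \<pi>'" "splits A' Cs \<rho>'" for A Bs \<pi>' A' Cs \<rho>' f gs hs
    using represents_ex1[OF that(3,4)] that(1,2) unfolding represents_def by metis
  have un_mor: "f = g" if "represents A Bs \<pi>' A' Cs \<rho>' f gs" "represents A Bs \<pi>' A' Cs \<rho>' g gs"
      "splits A Bs \<pi>'" "splits A' Cs \<rho>'" for A Bs \<pi>' A' Cs \<rho>' f g gs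
    using represents_ex1_mor[OF that(3,4)] that(1,2) unfolding represents_def by metis
  have Phi_functor: "is_functor (full_subcat C Q) PC \<Phi>"
    unfolding is_functor_def
  proof (intro conjI ballI)
    fix A B f assume "A \<in> Obj (full_subcat C Q)" "B \<in> Obj (full_subcat C Q)" "f \<in> Hom (full_subcat C Q) A B"
    then show "FMap \<Phi> A B f \<in> Hom PC (FObj \<Phi> A) (FObj \<Phi> B)"
      using Phi by (simp add: FO represents_def)
  next
    fix A assume A: "A \<in> Obj (full_subcat C Q)"
    show "FMap \<Phi> A A (Ident (full_subcat C Q) A) = Ident PC (FObj \<Phi> A)"
      using A un[OF Phi[of A A "Ident C A"] represents_ident] Q by (simp add: FO ident_in)
  next
    fix A B D f g
    assume "A \<in> Obj (full_subcat C Q)" "B \<in> Obj (full_subcat C Q)" "D \<in> Obj (full_subcat C Q)"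
      "f \<in> Hom (full_subcat C Q) A B" "g \<in> Hom (full_subcat C Q) B D"
    then show "FMap \<Phi> A D (Comp (full_subcat C Q) A B D g f) =
        Comp PC (FObj \<Phi> A) (FObj \<Phi> B) (FObj \<Phi> D) (FMap \<Phi> B D g) (FMap \<Phi> A B f)"
      using un[OF Phi[of A D "Comp C A B D g f"]
          represents_comp[OF Q[of A] Q[of B] Q[of D] Phi[of A B f] Phi[of B D g]]] Q
      by (simp add: FO comp_in)
  qed (auto simp: FO PC.category_axioms QC.category_axioms FsO)
  have Gam_functor: "is_functor PC (full_subcat C Q) \<Gamma>"
    unfolding is_functor_def
  proof (intro conjI ballI)
    fix A B f assume "A \<in> Obj PC" "B \<in> Obj PC" "f \<in> Hom PC A B"
    then show "FMap \<Gamma> A B f \<in> Hom (full_subcat C Q) (FObj \<Gamma> A) (FObj \<Gamma> B)"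
      using Gam by (simp add: GO represents_def)
  next
    fix A assume A: "A \<in> Obj PC"
    show "FMap \<Gamma> A A (Ident PC A) = Ident (full_subcat C Q) (FObj \<Gamma> A)"
      using A un_mor[OF Gam[of A A "Ident PC A"] represents_ident] GOO by (simp add: GO PC.ident_in)
  next
    fix A B D f g
    assume "A \<in> Obj PC" "B \<in> Obj PC" "D \<in> Obj PC" "f \<in> Hom PC A B" "g \<in> Hom PC B D"
    then show "FMap \<Gamma> A D (Comp PC A B D g f) =
        Comp (full_subcat C Q) (FObj \<Gamma> A) (FObj \<Gamma> B) (FObj \<Gamma> D) (FMap \<Gamma> B D g) (FMap \<Gamma> A B f)"
      using un_mor[OF Gam[of A D "Comp PC A B D g f"]
          represents_comp[OF GOO(3)[of A] GOO(3)[of B] GOO(3)[of D] Gam[of A B f] Gam[of B D g]]]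
        GOO PC.comp_in[of A B D f g]
      by (simp add: GO)
  qed (auto simp: GO PC.category_axioms QC.category_axioms GOO)
  define \<eta> where "\<eta> A = (THE f. represents A (Fs A) (\<pi> A) (GO (Fs A)) (Fs A) (\<rho> (Fs A)) f (Ident PC (Fs A)))" for A
  have eta: "represents A (Fs A) (\<pi> A) (GO (Fs A)) (Fs A) (\<rho> (Fs A)) (\<eta> A) (Ident PC (Fs A))"
    if "A \<in> Obj C" "Q A" for A
    unfolding \<eta>_def
    by (rule theI'[OF represents_ex1_mor]) (use that Q GOO FsO PC.ident_in in auto)
  define \<epsilon> where "\<epsilon> Bs = (THE gs. represents (GO Bs) (Fs (GO Bs)) (\<pi> (GO Bs)) (GO Bs) Bs (\<rho> Bs) (Ident C (GO Bs)) gs)" for Bs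
  have eps: "represents (GO Bs) (Fs (GO Bs)) (\<pi> (GO Bs)) (GO Bs) Bs (\<rho> Bs) (Ident C (GO Bs)) (\<epsilon> Bs)"
    if "Bs \<in> Obj PC" for Bs
    unfolding \<epsilon>_def
    by (rule theI'[OF represents_ex1]) (use that Q GOO ident_in in auto)
  have nat_eta: "natural_iso (full_subcat C Q) (full_subcat C Q) id_func (comp_func \<Gamma> \<Phi>) \<eta>"
    unfolding natural_iso_def id_func_def comp_func_def
  proof (simp add: FO GO, intro conjI allI ballI impI; (elim conjE)?)
    fix A assume A: "A \<in> Obj C" "Q A"
    show "iso_in (full_subcat C Q) A (GO (Fs A)) (\<eta> A)"
      using represents_iso_mor[OF Q[OF A] GOO(3)[OF FsO[OF A]] eta[OF A]] by (simp add: iso_in_def)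
  next
    fix A B f assume A: "A \<in> Obj C" "Q A" and B: "B \<in> Obj C" "Q B" and f: "f \<in> Hom C A B"
    let ?G = "FMap \<Gamma> (Fs A) (Fs B) (FMap \<Phi> A B f)"
    note F = Phi[OF A B f]
    then have H: "FMap \<Phi> A B f \<in> Hom PC (Fs A) (Fs B)" by (simp add: represents_def)
    show "Comp C A B (GO (Fs B)) (\<eta> B) f = Comp C A (GO (Fs A)) (GO (Fs B)) ?G (\<eta> A)"
      \<comment> \<open>Both composites have the matrix \<open>FMap \<Phi> A B f\<close>.\<close>
      using un_mor[OF represents_comp[OF Q[OF A] Q[OF B] GOO(3)[OF FsO[OF B]] F eta[OF B],
            unfolded PC.ident_comp[OF FsO[OF A] FsO[OF B] H]]
          represents_comp[OF Q[OF A] GOO(3)[OF FsO[OF A]] GOO(3)[OF FsO[OF B]] eta[OF A]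
            Gam[OF FsO[OF A] FsO[OF B] H], unfolded PC.comp_ident[OF FsO[OF A] FsO[OF B] H]]
          Q[OF A] GOO(3)[OF FsO[OF B]]] .
  qed
  have nat_eps: "natural_iso PC PC (comp_func \<Phi> \<Gamma>) id_func \<epsilon>"
    unfolding natural_iso_def id_func_def comp_func_def
  proof (simp add: FO GO, intro conjI ballI)
    fix Bs assume B: "Bs \<in> Obj PC"
    show "iso_in PC (Fs (GO Bs)) Bs (\<epsilon> Bs)"
      using represents_iso_Prod[OF Q[OF GOO(1,2)[OF B]] GOO(3)[OF B] eps[OF B]] .
  next
    fix Bs Cs gs assume B: "Bs \<in> Obj PC" and D: "Cs \<in> Obj PC" and gs: "gs \<in> Hom PC Bs Cs"
    let ?g = "FMap \<Gamma> Bs Cs gs"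
    note F = Gam[OF B D gs]
    then have H: "?g \<in> Hom C (GO Bs) (GO Cs)" by (simp add: represents_def)
    note sB = Q[OF GOO(1,2)[OF B]] and sD = Q[OF GOO(1,2)[OF D]]
    show "Comp PC (Fs (GO Bs)) (Fs (GO Cs)) Cs (\<epsilon> Cs) (FMap \<Phi> (GO Bs) (GO Cs) ?g) =
        Comp PC (Fs (GO Bs)) Bs Cs gs (\<epsilon> Bs)"
      \<comment> \<open>Both matrices represent \<open>?g\<close>.\<close>
      using un[OF represents_comp[OF sB sD GOO(3)[OF D] Phi[OF GOO(1,2)[OF B] GOO(1,2)[OF D] H] eps[OF D],
            unfolded ident_comp[OF GOO(1)[OF B] GOO(1)[OF D] H]]
          represents_comp[OF sB GOO(3)[OF B] GOO(3)[OF D] eps[OF B] F,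
            unfolded comp_ident[OF GOO(1)[OF B] GOO(1)[OF D] H]] sB GOO(3)[OF D]] .
  qed
  have "natural_projections C (full_subcat C Q) \<Phi> \<pi>"
    unfolding natural_projections_def
    using Phi by (auto simp: FO represents_def case_prod_beta Let_def)
  then show ?thesis
    using FO Phi_functor Gam_functor nat_eta nat_eps unfolding is_equivalence_def by blast
qed

end

end

section \<open>Zigzags\<close>

locale loc_pair = category C for C :: "('o, 'm) cat" +
  fixes W :: "'o \<Rightarrow> 'o \<Rightarrow> 'm set"
begin

abbreviation "zz \<equiv> zigzag C W"
abbreviation "eqv \<equiv> zz_eq C W"
abbreviation "cl \<equiv> zz_class C W"

lemma zigzag_Obj: "zz X Y p \<Longrightarrow> X \<in> Obj C \<and> Y \<in> Obj C"
  by (induction rule: zigzag.induct) auto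

lemma zigzag_append: "zz X Y p \<Longrightarrow> zz Y Z q \<Longrightarrow> zz X Z (p @ q)"
  by (induction rule: zigzag.induct) (auto intro: zigzag.intros)

lemma zigzag_Fwd: "\<lbrakk>X \<in> Obj C; Y \<in> Obj C; f \<in> Hom C X Y\<rbrakk> \<Longrightarrow> zz X Y [Fwd X Y f]"
  by (auto intro!: zigzag.intros)

lemma zigzag_Inv: "\<lbrakk>X \<in> Obj C; Y \<in> Obj C; f \<in> Hom C X Y; f \<in> W X Y\<rbrakk> \<Longrightarrow> zz Y X [Inv X Y f]"
  by (auto intro!: zigzag.intros)

lemma eqv_zigzag: "eqv X Y p q \<Longrightarrow> zz X Y p \<and> zz X Y q"
proof (induction rule: zz_eq.induct)
  case (zz_cong X Y r Z p q V s)
  then show ?case by (auto intro: zigzag_append)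
next
  case (zz_fwd_inv X Y w)
  then show ?case by (auto intro!: zigzag.intros)
next
  case (zz_inv_fwd X Y w)
  then show ?case by (auto intro!: zigzag.intros)
qed (auto intro!: zigzag.intros ident_in intro: comp_in)

declare zz_trans [trans]

lemma eqv_append:
  assumes p: "eqv X Y p p'" and q: "eqv Y Z q q'"
  shows "eqv X Z (p @ q) (p' @ q')"
proof -
  have z: "zz X Y p'" "zz Y Z q" "zz X X []" "zz Z Z []"
    using eqv_zigzag[OF p] eqv_zigzag[OF q] zigzag_Obj by (blast intro: zz_nil)+
  have "eqv X Z (p @ q) (p' @ q)" using zz_cong[OF z(3) p z(2)] by simp
  also have "eqv X Z \<dots> (p' @ q')" using zz_cong[OF z(1) q z(4)] by simp
  finally show ?thesis .
qed

lemma eqv_append_left: "zz X Y p \<Longrightarrow> eqv Y Z q q' \<Longrightarrow> eqv X Z (p @ q) (p @ q')"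
  by (rule eqv_append[OF zz_refl])

lemma eqv_append_right: "eqv X Y p p' \<Longrightarrow> zz Y Z q \<Longrightarrow> eqv X Z (p @ q) (p' @ q)"
  by (rule eqv_append[OF _ zz_refl])

lemma cl_eq_iff: "zz X Y p \<Longrightarrow> cl X Y p = cl X Y q \<longleftrightarrow> eqv X Y p q"
  unfolding zz_class_def set_eq_iff mem_Collect_eq by (metis zz_refl zz_sym zz_trans)

lemma mem_cl: "q \<in> cl X Y p \<longleftrightarrow> eqv X Y p q"
  by (simp add: zz_class_def)

lemma localization_simps:
  "Obj (localization C W) = Obj C"
  "P \<in> Hom (localization C W) X Y \<longleftrightarrow> (\<exists>p. zz X Y p \<and> P = cl X Y p)"
  "Ident (localization C W) X = cl X X []"
  by (auto simp: localization_def)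

lemma cl_in_Hom: "zz X Y p \<Longrightarrow> cl X Y p \<in> Hom (localization C W) X Y"
  by (auto simp: localization_simps)

text \<open>Composition is well defined: the sets united over the representatives all coincide, and
  there is at least one.\<close>

lemma comp_cl:
  assumes p: "zz X Y p" and q: "zz Y Z q"
  shows "Comp (localization C W) X Y Z (cl Y Z q) (cl X Y p) = cl X Z (p @ q)"
proof -
  have *: "cl X Z (p' @ q') = cl X Z (p @ q)" if "eqv X Y p p'" "eqv Y Z q q'" for p' q'
    using cl_eq_iff[OF zigzag_append[OF p q]] eqv_append[OF that] by metis
  have "Comp (localization C W) X Y Z (cl Y Z q) (cl X Y p) =
      (\<Union>p' \<in> cl X Y p. \<Union>q' \<in> cl Y Z q. cl X Z (p' @ q'))"
    by (simp add: localization_def)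
  also have "\<dots> = (\<Union>p' \<in> cl X Y p. \<Union>q' \<in> cl Y Z q. cl X Z (p @ q))"
    by (intro SUP_cong refl *) (simp_all add: mem_cl)
  also have "\<dots> = cl X Z (p @ q)"
    using mem_cl[of p X Y p] mem_cl[of q Y Z q] zz_refl[OF p] zz_refl[OF q] by auto
  finally show ?thesis .
qed

lemma category_localization: "category (localization C W)"
proof
  fix X assume "X \<in> Obj (localization C W)"
  then show "Ident (localization C W) X \<in> Hom (localization C W) X X"
    by (auto simp: localization_simps intro: zigzag.intros)
next
  fix X Y Z f g
  assume "f \<in> Hom (localization C W) X Y" "g \<in> Hom (localization C W) Y Z"
  then show "Comp (localization C W) X Y Z g f \<in> Hom (localization C W) X Z"
    by (auto simp: localization_simps comp_cl intro: zigzag_append)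
next
  fix X Y f assume "X \<in> Obj (localization C W)" "f \<in> Hom (localization C W) X Y"
  then show "Comp (localization C W) X X Y f (Ident (localization C W) X) = f"
    by (auto simp: localization_simps comp_cl zz_nil)
next
  fix X Y f assume "Y \<in> Obj (localization C W)" "f \<in> Hom (localization C W) X Y"
  then show "Comp (localization C W) X Y Y (Ident (localization C W) Y) f = f"
    by (auto simp: localization_simps comp_cl zz_nil)
next
  fix X Y Z V f g h
  assume "f \<in> Hom (localization C W) X Y" "g \<in> Hom (localization C W) Y Z"
    "h \<in> Hom (localization C W) Z V"
  then show "Comp (localization C W) X Z V h (Comp (localization C W) X Y Z g f) =
      Comp (localization C W) X Y V (Comp (localization C W) Y Z V h g) f"
    by (auto simp: localization_simps comp_cl zigzag_append)
qed

lemma eqv_square: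
  assumes "X \<in> Obj C" "Y \<in> Obj C" "Y' \<in> Obj C" "Z \<in> Obj C"
    and "f \<in> Hom C X Y" "g \<in> Hom C Y Z" "f' \<in> Hom C X Y'" "g' \<in> Hom C Y' Z"
    and "Comp C X Y Z g f = Comp C X Y' Z g' f'"
  shows "eqv X Z [Fwd X Y f, Fwd Y Z g] [Fwd X Y' f', Fwd Y' Z g']"
  using zz_comp[of X C Y Z f g W] zz_comp[of X C Y' Z f' g' W] assms by (auto intro: zz_trans zz_sym)

text \<open>Both words can be preceded by the formal inverse of \<open>w\<close>.\<close>

lemma eqv_cancel_left:
  assumes w: "X \<in> Obj C" "Y \<in> Obj C" "w \<in> Hom C X Y" "w \<in> W X Y"
    and p: "zz Y Z p" "zz Y Z q" and e: "eqv X Z (Fwd X Y w # p) (Fwd X Y w # q)"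
  shows "eqv Y Z p q"
proof -
  have i: "eqv Y Y [] [Inv X Y w, Fwd X Y w]"
    using zz_inv_fwd[of X C Y w W] w by (auto intro: zz_sym)
  have "eqv Y Z p ([Inv X Y w] @ Fwd X Y w # p)"
    using eqv_append_right[OF i p(1)] by simp
  also have "eqv Y Z \<dots> ([Inv X Y w] @ Fwd X Y w # q)"
    using eqv_append_left[OF zigzag_Inv e] w by simp
  also have "eqv Y Z \<dots> q"
    using eqv_append_right[OF zz_sym[OF i] p(2)] by simp
  finally show ?thesis .
qed

lemma eqv_cancel_right:
  assumes w: "Y \<in> Obj C" "Z \<in> Obj C" "w \<in> Hom C Y Z" "w \<in> W Y Z"
    and p: "zz X Y p" "zz X Y q" and e: "eqv X Z (p @ [Fwd Y Z w]) (q @ [Fwd Y Z w])"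
  shows "eqv X Y p q"
proof -
  have i: "eqv Y Y [] [Fwd Y Z w, Inv Y Z w]"
    using zz_fwd_inv[of Y C Z w W] w by (auto intro: zz_sym)
  have "eqv X Y p ((p @ [Fwd Y Z w]) @ [Inv Y Z w])"
    using eqv_append_left[OF p(1) i] by simp
  also have "eqv X Y \<dots> ((q @ [Fwd Y Z w]) @ [Inv Y Z w])"
    using eqv_append_right[OF e zigzag_Inv] w by blast
  also have "eqv X Y \<dots> q"
    using eqv_append_left[OF p(2) zz_sym[OF i]] by simp
  finally show ?thesis .
qed

section \<open>Functors and natural transformations acting on zigzags\<close>

definition relative_functor :: "('o, 'm, 'o, 'm) func \<Rightarrow> bool" where
  "relative_functor F \<longleftrightarrow> is_functor C C F \<and>
     (\<forall>X \<in> Obj C. \<forall>Y \<in> Obj C. \<forall>f \<in> Hom C X Y \<inter> W X Y. FMap F X Y f \<in> W (FObj F X) (FObj F Y))"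

fun smap :: "('o, 'm, 'o, 'm) func \<Rightarrow> ('o, 'm) step \<Rightarrow> ('o, 'm) step" where
  "smap F (Fwd X Y f) = Fwd (FObj F X) (FObj F Y) (FMap F X Y f)"
| "smap F (Inv X Y f) = Inv (FObj F X) (FObj F Y) (FMap F X Y f)"

lemma smap_zigzag:
  assumes F: "relative_functor F"
  shows "zz X Y p \<Longrightarrow> zz (FObj F X) (FObj F Y) (map (smap F) p)"
proof (induction rule: zigzag.induct)
  case (zz_fwd X f Y Z p)
  then show ?case
    using F zigzag_Obj[of Y Z p] by (auto simp: relative_functor_def is_functor_def intro!: zigzag.intros)
next
  case (zz_inv Y w X Z p)
  then show ?case
    using F zigzag_Obj[of X Z p] by (auto simp: relative_functor_def is_functor_def intro!: zigzag.intros)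
qed (use F in \<open>auto simp: relative_functor_def is_functor_def intro!: zigzag.intros\<close>)

lemma smap_eqv:
  assumes F: "relative_functor F"
  shows "eqv X Y p q \<Longrightarrow> eqv (FObj F X) (FObj F Y) (map (smap F) p) (map (smap F) q)"
proof (induction rule: zz_eq.induct)
  case (zz_cong X Y r Z p q V s)
  then show ?case using smap_zigzag[OF F] by (auto intro: zz_eq.zz_cong)
next
  case (zz_comp X Y Z f g)
  then show ?case
    using F zz_eq.zz_comp[of "FObj F X" C "FObj F Y" "FObj F Z" "FMap F X Y f" "FMap F Y Z g" W]
    by (auto simp: relative_functor_def is_functor_def)
next
  case (zz_ident X)
  then show ?case
    using F zz_eq.zz_ident[of "FObj F X" C W] by (auto simp: relative_functor_def is_functor_def)
qed (use F smap_zigzag[OF F] in \<open>auto simp: relative_functor_def is_functor_def intro: zz_eq.intros\<close>)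

abbreviation (input) idf :: "('o, 'm, 'o, 'm) func" where "idf \<equiv> id_func"

lemma relative_functor_id: "relative_functor id_func"
  by (auto simp: relative_functor_def is_functor_def id_func_def category_axioms)

lemma smap_id: "map (smap id_func) p = p"
proof -
  have "smap id_func s = s" for s by (cases s) (auto simp: id_func_def)
  then show ?thesis by (simp add: map_idI)
qed

text \<open>Naturality has to be tested on morphisms of \<open>C\<close> only: the square of a
  formal inverse follows from the square of \<open>w\<close>. The components \<open>\<eta> X\<close>
  may themselves be zigzags, which \<open>interchange\<close> exploits.\<close>

lemma natural_zigzag:
  assumes F: "relative_functor F" and G: "relative_functor G"
    and \<eta>: "\<And>X. X \<in> Obj C \<Longrightarrow> zz (FObj F X) (FObj G X) (\<eta> X)"
    and nat: "\<And>X Y f. \<lbrakk>X \<in> Obj C; Y \<in> Obj C; f \<in> Hom C X Y\<rbrakk> \<Longrightarrow>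
      eqv (FObj F X) (FObj G Y) (map (smap F) [Fwd X Y f] @ \<eta> Y) (\<eta> X @ map (smap G) [Fwd X Y f])"
  shows "zz X Y p \<Longrightarrow> eqv (FObj F X) (FObj G Y) (map (smap F) p @ \<eta> Y) (\<eta> X @ map (smap G) p)"
proof (induction rule: zigzag.induct)
  case (zz_nil X)
  then show ?case using \<eta> by (auto intro: zz_refl)
next
  case (zz_fwd X f Y Z p)
  have Y: "Y \<in> Obj C" using zz_fwd zigzag_Obj by blast
  have "eqv (FObj F X) (FObj G Z) (map (smap F) [Fwd X Y f] @ map (smap F) p @ \<eta> Z)
      (map (smap F) [Fwd X Y f] @ \<eta> Y @ map (smap G) p)"
    by (rule eqv_append_left[OF smap_zigzag[OF F zigzag_Fwd] zz_fwd.IH]) (use zz_fwd Y in auto)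
  also have "eqv (FObj F X) (FObj G Z) \<dots> (\<eta> X @ map (smap G) [Fwd X Y f] @ map (smap G) p)"
    using eqv_append_right[OF nat smap_zigzag[OF G zz_fwd.hyps(3)]] zz_fwd Y by simp
  finally show ?case by simp
next
  case (zz_inv Y w X Z p)
  have X: "X \<in> Obj C" using zz_inv zigzag_Obj by blast
  define Fw where "Fw = map (smap F) [Fwd X Y w]"
  define Gw where "Gw = map (smap G) [Fwd X Y w]"
  define Fi where "Fi = map (smap F) [Inv X Y w]"
  define Gi where "Gi = map (smap G) [Inv X Y w]"
  have zF: "zz (FObj F Y) (FObj F X) Fi" and zG: "zz (FObj G Y) (FObj G X) Gi"
    unfolding Fi_def Gi_def using smap_zigzag[OF F zigzag_Inv] smap_zigzag[OF G zigzag_Inv] zz_inv X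
    by auto
  have cF: "eqv (FObj F Y) (FObj F Y) (Fi @ Fw) []"
    using smap_eqv[OF F zz_inv_fwd] zz_inv X by (simp add: Fi_def Fw_def)
  have cG: "eqv (FObj G X) (FObj G X) (Gw @ Gi) []"
    using smap_eqv[OF G zz_fwd_inv] zz_inv X by (simp add: Gi_def Gw_def)
  have sq: "eqv (FObj F X) (FObj G Y) (Fw @ \<eta> Y) (\<eta> X @ Gw)"
    unfolding Fw_def Gw_def using nat zz_inv X by blast
  have zYX: "zz (FObj F Y) (FObj G X) (\<eta> Y @ Gi)"
    using \<eta> zz_inv zG by (auto intro: zigzag_append)
  \<comment> \<open>This is \<open>sq\<close>, composed with \<open>Fi\<close> at the front and
    \<open>Gi\<close> at the end.\<close>
  have main: "eqv (FObj F Y) (FObj G X) (Fi @ \<eta> X) (\<eta> Y @ Gi)"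
  proof -
    have "eqv (FObj F Y) (FObj G X) (Fi @ \<eta> X) ((Fi @ \<eta> X) @ Gw @ Gi)"
      using eqv_append_left[OF zigzag_append[OF zF \<eta>[OF X]] zz_sym[OF cG]] by simp
    also have "eqv (FObj F Y) (FObj G X) \<dots> (Fi @ (Fw @ \<eta> Y) @ Gi)"
      using zz_cong[OF zF zz_sym[OF sq] zG] by simp
    also have "eqv (FObj F Y) (FObj G X) \<dots> (\<eta> Y @ Gi)"
      using eqv_append_right[OF cF zYX] by simp
    finally show ?thesis .
  qed
  have "eqv (FObj F Y) (FObj G Z) (Fi @ map (smap F) p @ \<eta> Z) (Fi @ \<eta> X @ map (smap G) p)"
    by (rule eqv_append_left[OF zF zz_inv.IH])
  also have "eqv (FObj F Y) (FObj G Z) \<dots> (\<eta> Y @ Gi @ map (smap G) p)"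
    using eqv_append_right[OF main smap_zigzag[OF G zz_inv.hyps(3)]] by simp
  finally show ?case by (simp add: Fi_def Gi_def)
qed

end

section \<open>Products in a localization\<close>

text \<open>Stability of \<open>W\<close> is asked for products with an identity, in either
  variable, and \<open>W\<close> is not known to be closed under composition. A product of two
  members of \<open>W\<close> is therefore treated one factor at a time.\<close>

locale loc_products = loc_pair +
  fixes bp :: "'a \<Rightarrow> 'a \<Rightarrow> 'a" and p1 p2 :: "'a \<Rightarrow> 'a \<Rightarrow> 'b"
    and pair :: "'a \<Rightarrow> 'a \<Rightarrow> 'a \<Rightarrow> 'b \<Rightarrow> 'b \<Rightarrow> 'b" and T :: 'a and bang :: "'a \<Rightarrow> 'b"
  assumes bp_Obj: "\<lbrakk>X \<in> Obj C; Y \<in> Obj C\<rbrakk> \<Longrightarrow> bp X Y \<in> Obj C"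
    and p1_in: "\<lbrakk>X \<in> Obj C; Y \<in> Obj C\<rbrakk> \<Longrightarrow> p1 X Y \<in> Hom C (bp X Y) X"
    and p2_in: "\<lbrakk>X \<in> Obj C; Y \<in> Obj C\<rbrakk> \<Longrightarrow> p2 X Y \<in> Hom C (bp X Y) Y"
    and pair_in: "\<lbrakk>X \<in> Obj C; Y \<in> Obj C; Z \<in> Obj C; f \<in> Hom C Z X; g \<in> Hom C Z Y\<rbrakk>
      \<Longrightarrow> pair Z X Y f g \<in> Hom C Z (bp X Y)"
    and p1_pair: "\<lbrakk>X \<in> Obj C; Y \<in> Obj C; Z \<in> Obj C; f \<in> Hom C Z X; g \<in> Hom C Z Y\<rbrakk>
      \<Longrightarrow> Comp C Z (bp X Y) X (p1 X Y) (pair Z X Y f g) = f"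
    and p2_pair: "\<lbrakk>X \<in> Obj C; Y \<in> Obj C; Z \<in> Obj C; f \<in> Hom C Z X; g \<in> Hom C Z Y\<rbrakk>
      \<Longrightarrow> Comp C Z (bp X Y) Y (p2 X Y) (pair Z X Y f g) = g"
    and pair_unique: "\<lbrakk>X \<in> Obj C; Y \<in> Obj C; Z \<in> Obj C; h \<in> Hom C Z (bp X Y); k \<in> Hom C Z (bp X Y);
      Comp C Z (bp X Y) X (p1 X Y) h = Comp C Z (bp X Y) X (p1 X Y) k;
      Comp C Z (bp X Y) Y (p2 X Y) h = Comp C Z (bp X Y) Y (p2 X Y) k\<rbrakk> \<Longrightarrow> h = k"
    and W_bp_left: "\<lbrakk>X \<in> Obj C; X' \<in> Obj C; Y \<in> Obj C; f \<in> Hom C X X'; f \<in> W X X'\<rbrakk> \<Longrightarrow>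
      pair (bp X Y) X' Y (Comp C (bp X Y) X X' f (p1 X Y)) (p2 X Y) \<in> W (bp X Y) (bp X' Y)"
    and W_bp_right: "\<lbrakk>X \<in> Obj C; Y \<in> Obj C; Y' \<in> Obj C; g \<in> Hom C Y Y'; g \<in> W Y Y'\<rbrakk> \<Longrightarrow>
      pair (bp X Y) X Y' (p1 X Y) (Comp C (bp X Y) Y Y' g (p2 X Y)) \<in> W (bp X Y) (bp X Y')"
    and T_Obj: "T \<in> Obj C"
    and bang_in: "X \<in> Obj C \<Longrightarrow> bang X \<in> Hom C X T"
    and bang_unique: "\<lbrakk>X \<in> Obj C; f \<in> Hom C X T\<rbrakk> \<Longrightarrow> f = bang X"
begin

text \<open>A zigzag ending at \<open>T\<close> collapses from its end. Behind the formal inverse of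
  \<open>w\<close>, the map \<open>bang X\<close> is rewritten as \<open>w\<close> followed by
  \<open>bang Y\<close>, and \<open>w\<close> cancels.\<close>

lemma terminal_zigzag: "zz X Y p \<Longrightarrow> Y = T \<Longrightarrow> eqv X T p [Fwd X T (bang X)]"
proof (induction rule: zigzag.induct)
  case (zz_nil X)
  then show ?case
    using zz_ident[of T C W] bang_unique[OF _ ident_in[OF T_Obj]] by (auto intro: zz_sym)
next
  case (zz_fwd X f Y Z p)
  have Y: "Y \<in> Obj C" using zz_fwd zigzag_Obj by blast
  have "eqv X T ([Fwd X Y f] @ p) ([Fwd X Y f] @ [Fwd Y T (bang Y)])"
    by (rule eqv_append_left[OF zigzag_Fwd]) (use zz_fwd Y in auto)
  also have "eqv X T \<dots> [Fwd X T (bang X)]"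
    using zz_comp[of X C Y T f "bang Y" W] bang_unique[of X "Comp C X Y T (bang Y) f"] zz_fwd Y
    by (auto simp: bang_in T_Obj comp_in)
  finally show ?case by simp
next
  case (zz_inv Y w X Z p)
  have X: "X \<in> Obj C" using zz_inv zigzag_Obj by blast
  have c: "Comp C X Y T (bang Y) w = bang X"
    using bang_unique[of X "Comp C X Y T (bang Y) w"] zz_inv X by (auto simp: bang_in T_Obj comp_in)
  have "eqv Y T ([Inv X Y w] @ p) ([Inv X Y w] @ [Fwd X T (bang X)])"
    by (rule eqv_append_left[OF zigzag_Inv]) (use zz_inv X in auto)
  also have "eqv Y T \<dots> ([Inv X Y w] @ [Fwd X Y w, Fwd Y T (bang Y)])"
    using zz_comp[of X C Y T w "bang Y" W] zz_inv X c
    by (intro eqv_append_left[OF zigzag_Inv]) (auto simp: bang_in T_Obj intro: zz_sym)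
  also have "eqv Y T \<dots> [Fwd Y T (bang Y)]"
    using eqv_append_right[OF zz_inv_fwd[of X C Y w W] zigzag_Fwd[of Y T "bang Y"]] zz_inv X
    by (simp add: bang_in T_Obj)
  finally show ?case by simp
qed

section \<open>Products of morphisms, and products of zigzags with a fixed object\<close>

definition bm :: "'a \<Rightarrow> 'a \<Rightarrow> 'a \<Rightarrow> 'a \<Rightarrow> 'b \<Rightarrow> 'b \<Rightarrow> 'b" where
  "bm X X' Y Y' f g =
     pair (bp X Y) X' Y' (Comp C (bp X Y) X X' f (p1 X Y)) (Comp C (bp X Y) Y Y' g (p2 X Y))"

context
  fixes X X' Y Y' f g
  assumes O: "X \<in> Obj C" "X' \<in> Obj C" "Y \<in> Obj C" "Y' \<in> Obj C" "f \<in> Hom C X X'" "g \<in> Hom C Y Y'"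
begin

lemma bm_in: "bm X X' Y Y' f g \<in> Hom C (bp X Y) (bp X' Y')"
  unfolding bm_def using O by (auto intro!: pair_in comp_in bp_Obj p1_in p2_in)

lemma p1_bm: "Comp C (bp X Y) (bp X' Y') X' (p1 X' Y') (bm X X' Y Y' f g) = Comp C (bp X Y) X X' f (p1 X Y)"
  unfolding bm_def using O p1_in[of X Y] p2_in[of X Y] by (auto intro!: p1_pair bp_Obj intro: comp_in bp_Obj)

lemma p2_bm: "Comp C (bp X Y) (bp X' Y') Y' (p2 X' Y') (bm X X' Y Y' f g) = Comp C (bp X Y) Y Y' g (p2 X Y)"
  unfolding bm_def using O p1_in[of X Y] p2_in[of X Y] by (auto intro!: p2_pair bp_Obj intro: comp_in bp_Obj)

end

lemma bm_comp:
  assumes "X \<in> Obj C" "X' \<in> Obj C" "X'' \<in> Obj C" "Y \<in> Obj C" "Y' \<in> Obj C" "Y'' \<in> Obj C"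
    "f \<in> Hom C X X'" "f' \<in> Hom C X' X''" "g \<in> Hom C Y Y'" "g' \<in> Hom C Y' Y''"
  shows "Comp C (bp X Y) (bp X' Y') (bp X'' Y'') (bm X' X'' Y' Y'' f' g') (bm X X' Y Y' f g) =
    bm X X'' Y Y'' (Comp C X X' X'' f' f) (Comp C Y Y' Y'' g' g)"
proof (rule pair_unique[where Z = "bp X Y"])
  show "Comp C (bp X Y) (bp X'' Y'') X'' (p1 X'' Y'')
      (Comp C (bp X Y) (bp X' Y') (bp X'' Y'') (bm X' X'' Y' Y'' f' g') (bm X X' Y Y' f g)) =
    Comp C (bp X Y) (bp X'' Y'') X'' (p1 X'' Y'') (bm X X'' Y Y'' (Comp C X X' X'' f' f) (Comp C Y Y' Y'' g' g))"
    (is "?l = ?r")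
  proof -
    have "?l = Comp C (bp X Y) (bp X' Y') X'' (Comp C (bp X' Y') X' X'' f' (p1 X' Y')) (bm X X' Y Y' f g)"
      using assms by (simp add: comp_assoc bp_Obj p1_in bm_in p1_bm)
    also have "\<dots> = Comp C (bp X Y) X X'' (Comp C X X' X'' f' f) (p1 X Y)"
      using assms by (simp add: comp_assoc[symmetric] bp_Obj p1_in bm_in p1_bm)
    also have "\<dots> = ?r"
      using assms by (simp add: p1_bm comp_in)
    finally show ?thesis .
  qed
  show "Comp C (bp X Y) (bp X'' Y'') Y'' (p2 X'' Y'')
      (Comp C (bp X Y) (bp X' Y') (bp X'' Y'') (bm X' X'' Y' Y'' f' g') (bm X X' Y Y' f g)) =
    Comp C (bp X Y) (bp X'' Y'') Y'' (p2 X'' Y'') (bm X X'' Y Y'' (Comp C X X' X'' f' f) (Comp C Y Y' Y'' g' g))"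
    (is "?l = ?r")
  proof -
    have "?l = Comp C (bp X Y) (bp X' Y') Y'' (Comp C (bp X' Y') Y' Y'' g' (p2 X' Y')) (bm X X' Y Y' f g)"
      using assms by (simp add: comp_assoc bp_Obj p2_in bm_in p2_bm)
    also have "\<dots> = Comp C (bp X Y) Y Y'' (Comp C Y Y' Y'' g' g) (p2 X Y)"
      using assms by (simp add: comp_assoc[symmetric] bp_Obj p2_in bm_in p2_bm)
    also have "\<dots> = ?r"
      using assms by (simp add: p2_bm comp_in)
    finally show ?thesis .
  qed
qed (use assms comp_in[OF bp_Obj[of X Y] bp_Obj[of X' Y'] bp_Obj[of X'' Y'']] in
    \<open>simp_all add: bp_Obj comp_in bm_in\<close>)

lemma bm_ident:
  assumes "X \<in> Obj C" "Y \<in> Obj C"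
  shows "bm X X Y Y (Ident C X) (Ident C Y) = Ident C (bp X Y)"
  by (rule pair_unique[where Z = "bp X Y" and X = X and Y = Y])
    (use assms in \<open>simp_all add: bp_Obj bm_in ident_in p1_bm p2_bm ident_comp comp_ident p1_in p2_in\<close>)

definition lfun :: "'a \<Rightarrow> ('a, 'b, 'a, 'b) func" where
  "lfun Z = \<lparr>FObj = (\<lambda>X. bp X Z), FMap = (\<lambda>X Y f. bm X Y Z Z f (Ident C Z))\<rparr>"

definition rfun :: "'a \<Rightarrow> ('a, 'b, 'a, 'b) func" where
  "rfun Z = \<lparr>FObj = (\<lambda>X. bp Z X), FMap = (\<lambda>X Y f. bm Z Z X Y (Ident C Z) f)\<rparr>"

lemma lfun_simps [simp]: "FObj (lfun Z) X = bp X Z" "FMap (lfun Z) X Y f = bm X Y Z Z f (Ident C Z)"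
  and rfun_simps [simp]: "FObj (rfun Z) X = bp Z X" "FMap (rfun Z) X Y f = bm Z Z X Y (Ident C Z) f"
  by (simp_all add: lfun_def rfun_def)

lemma relative_functor_lfun:
  assumes Z: "Z \<in> Obj C"
  shows "relative_functor (lfun Z)"
  unfolding relative_functor_def is_functor_def
proof (intro conjI ballI)
  fix X Y f assume "X \<in> Obj C" "Y \<in> Obj C" "f \<in> Hom C X Y \<inter> W X Y"
  then show "FMap (lfun Z) X Y f \<in> W (FObj (lfun Z) X) (FObj (lfun Z) Y)"
    using Z W_bp_left[of X Y Z f] by (simp add: bm_def ident_comp bp_Obj p2_in)
qed (use Z in \<open>simp_all add: category_axioms bp_Obj bm_ident bm_in ident_in bm_comp ident_comp\<close>)

lemma relative_functor_rfun:
  assumes Z: "Z \<in> Obj C"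
  shows "relative_functor (rfun Z)"
  unfolding relative_functor_def is_functor_def
proof (intro conjI ballI)
  fix X Y f assume "X \<in> Obj C" "Y \<in> Obj C" "f \<in> Hom C X Y \<inter> W X Y"
  then show "FMap (rfun Z) X Y f \<in> W (FObj (rfun Z) X) (FObj (rfun Z) Y)"
    using Z W_bp_right[of Z X Y f] by (simp add: bm_def ident_comp bp_Obj p1_in)
qed (use Z in \<open>simp_all add: category_axioms bp_Obj bm_ident bm_in ident_in bm_comp ident_comp\<close>)

abbreviation "lz Z \<equiv> map (smap (lfun Z))"
abbreviation "rz Z \<equiv> map (smap (rfun Z))"

lemma lz_zigzag: "Z \<in> Obj C \<Longrightarrow> zz X Y p \<Longrightarrow> zz (bp X Z) (bp Y Z) (lz Z p)"
  using smap_zigzag[OF relative_functor_lfun, of Z X Y p] by simp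

lemma rz_zigzag: "Z \<in> Obj C \<Longrightarrow> zz X Y p \<Longrightarrow> zz (bp Z X) (bp Z Y) (rz Z p)"
  using smap_zigzag[OF relative_functor_rfun, of Z X Y p] by simp

lemma lz_eqv: "Z \<in> Obj C \<Longrightarrow> eqv X Y p q \<Longrightarrow> eqv (bp X Z) (bp Y Z) (lz Z p) (lz Z q)"
  using smap_eqv[OF relative_functor_lfun, of Z X Y p q] by simp

lemma rz_eqv: "Z \<in> Obj C \<Longrightarrow> eqv X Y p q \<Longrightarrow> eqv (bp Z X) (bp Z Y) (rz Z p) (rz Z q)"
  using smap_eqv[OF relative_functor_rfun, of Z X Y p q] by simp

text \<open>\<open>natural_zigzag\<close> is used twice. For a morphism \<open>f\<close> in the
  first variable, its products with identities are natural along \<open>q\<close>; this in turn says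
  that the zigzags \<open>rz X q\<close> commute with morphisms in the first variable, so they are
  natural along \<open>p\<close>.\<close>

lemma interchange:
  assumes p: "zz X X' p" and q: "zz Y Y' q"
  shows "eqv (bp X Y) (bp X' Y') (lz Y p @ rz X' q) (rz X q @ lz Y' p)"
proof -
  have Y: "Y \<in> Obj C" "Y' \<in> Obj C" using q zigzag_Obj by auto
  have step: "eqv (bp X Y) (bp X' Y') (rz X q @ lz Y' [Fwd X X' f]) (lz Y [Fwd X X' f] @ rz X' q)"
    if X: "X \<in> Obj C" "X' \<in> Obj C" and f: "f \<in> Hom C X X'" for X X' f
  proof -
    have "eqv (FObj (rfun X) Y) (FObj (rfun X') Y')
        (map (smap (rfun X)) q @ [Fwd (bp X Y') (bp X' Y') (bm X X' Y' Y' f (Ident C Y'))])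
        ([Fwd (bp X Y) (bp X' Y) (bm X X' Y Y f (Ident C Y))] @ map (smap (rfun X')) q)"
    proof (rule natural_zigzag[OF relative_functor_rfun relative_functor_rfun _ _ q])
      fix Z Z' g assume "Z \<in> Obj C" "Z' \<in> Obj C" "g \<in> Hom C Z Z'"
      then show "eqv (FObj (rfun X) Z) (FObj (rfun X') Z')
          (map (smap (rfun X)) [Fwd Z Z' g] @ [Fwd (bp X Z') (bp X' Z') (bm X X' Z' Z' f (Ident C Z'))])
          ([Fwd (bp X Z) (bp X' Z) (bm X X' Z Z f (Ident C Z))] @ map (smap (rfun X')) [Fwd Z Z' g])"
        using X f by (auto intro!: eqv_square simp: bp_Obj bm_in ident_in bm_comp ident_comp comp_ident)
    qed (use X f in \<open>auto intro!: zigzag_Fwd bp_Obj bm_in ident_in\<close>)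
    then show ?thesis by simp
  qed
  have "eqv (FObj (lfun Y) X) (FObj (lfun Y') X') (map (smap (lfun Y)) p @ rz X' q)
      (rz X q @ map (smap (lfun Y')) p)"
    by (rule natural_zigzag[OF relative_functor_lfun relative_functor_lfun _ _ p])
      (use Y step rz_zigzag[OF _ q] in \<open>auto intro: zz_sym\<close>)
  then show ?thesis by simp
qed

section \<open>The diagonal is natural along zigzags\<close>

definition diag :: "'a \<Rightarrow> 'b" where
  "diag X = pair X X X (Ident C X) (Ident C X)"

definition dz :: "'a \<Rightarrow> ('a, 'b) step list" where
  "dz X = [Fwd X (bp X X) (diag X)]"

lemma diag:
  assumes "X \<in> Obj C"
  shows "diag X \<in> Hom C X (bp X X)" "Comp C X (bp X X) X (p1 X X) (diag X) = Ident C X"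
    "Comp C X (bp X X) X (p2 X X) (diag X) = Ident C X"
  unfolding diag_def using assms by (auto intro!: pair_in ident_in p1_pair p2_pair)

lemma dz_zigzag: "X \<in> Obj C \<Longrightarrow> zz X (bp X X) (dz X)"
  unfolding dz_def by (auto intro!: zigzag_Fwd bp_Obj diag)

lemma bm_diag:
  assumes "X \<in> Obj C" "Y \<in> Obj C" "Z \<in> Obj C" "f \<in> Hom C X Y" "g \<in> Hom C X Z"
  shows "Comp C X (bp X X) (bp Y Z) (bm X Y X Z f g) (diag X) = pair X Y Z f g"
proof (rule pair_unique[where Z = X and X = Y and Y = Z])
  show "Comp C X (bp Y Z) Y (p1 Y Z) (Comp C X (bp X X) (bp Y Z) (bm X Y X Z f g) (diag X)) =
      Comp C X (bp Y Z) Y (p1 Y Z) (pair X Y Z f g)"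
    using assms by (simp add: comp_assoc bp_Obj bm_in diag p1_in p1_bm p1_pair)
      (simp add: comp_assoc[symmetric] bp_Obj diag p1_in comp_ident)
  show "Comp C X (bp Y Z) Z (p2 Y Z) (Comp C X (bp X X) (bp Y Z) (bm X Y X Z f g) (diag X)) =
      Comp C X (bp Y Z) Z (p2 Y Z) (pair X Y Z f g)"
    using assms by (simp add: comp_assoc bp_Obj bm_in diag p2_in p2_bm p2_pair)
      (simp add: comp_assoc[symmetric] bp_Obj diag p2_in comp_ident)
qed (use assms in \<open>auto intro!: bp_Obj comp_in[of X "bp X X"] bm_in diag pair_in\<close>)

lemma diag_natural:
  assumes "X \<in> Obj C" "Y \<in> Obj C" "f \<in> Hom C X Y"
  shows "Comp C X Y (bp Y Y) (diag Y) f = pair X Y Y f f"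
proof (rule pair_unique[where Z = X and X = Y and Y = Y])
  show "Comp C X (bp Y Y) Y (p1 Y Y) (Comp C X Y (bp Y Y) (diag Y) f) =
      Comp C X (bp Y Y) Y (p1 Y Y) (pair X Y Y f f)"
    using assms by (simp add: comp_assoc bp_Obj diag p1_in p1_pair ident_comp)
  show "Comp C X (bp Y Y) Y (p2 Y Y) (Comp C X Y (bp Y Y) (diag Y) f) =
      Comp C X (bp Y Y) Y (p2 Y Y) (pair X Y Y f f)"
    using assms by (simp add: comp_assoc bp_Obj diag p2_in p2_pair ident_comp)
qed (use assms in \<open>auto intro!: bp_Obj comp_in[of X Y] bm_in diag pair_in\<close>)

text \<open>The word \<open>dz X @ lz X p @ rz Y q\<close> will be the pairing of two zigzags
  \<open>p\<close> and \<open>q\<close>; on single morphisms it agrees with the pairing in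
  \<open>C\<close>.\<close>

lemma dz_fwd:
  assumes "X \<in> Obj C" "Y \<in> Obj C" "Z \<in> Obj C" "f \<in> Hom C X Y" "g \<in> Hom C X Z"
  shows "eqv X (bp Y Z) (dz X @ lz X [Fwd X Y f] @ rz Y [Fwd X Z g]) [Fwd X (bp Y Z) (pair X Y Z f g)]"
proof -
  have "eqv X (bp Y Z) (dz X @ (lz X [Fwd X Y f] @ rz Y [Fwd X Z g]))
      (dz X @ [Fwd (bp X X) (bp Y Z) (bm X Y X Z f g)])"
    by (rule eqv_append_left[OF dz_zigzag])
      (use assms zz_comp[of "bp X X" C "bp Y X" "bp Y Z" "bm X Y X X f (Ident C X)" "bm Y Y X Z (Ident C Y) g" W]
        in \<open>simp_all add: bp_Obj bm_in ident_in bm_comp ident_comp comp_ident\<close>)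
  also have "eqv X (bp Y Z) \<dots> [Fwd X (bp Y Z) (pair X Y Z f g)]"
    using assms zz_comp[of X C "bp X X" "bp Y Z" "diag X" "bm X Y X Z f g" W]
    by (simp add: bp_Obj bm_in bm_diag diag dz_def)
  finally show ?thesis by simp
qed

lemma dz_natural: "zz X Y r \<Longrightarrow> eqv X (bp Y Y) (r @ dz Y) (dz X @ lz X r @ rz Y r)"
proof (induction rule: zigzag.induct)
  case (zz_nil X)
  then show ?case using dz_zigzag by (auto intro: zz_refl)
next
  case (zz_fwd X f Y Z r)
  have Y: "Y \<in> Obj C" and Z: "Z \<in> Obj C" using zz_fwd zigzag_Obj by auto
  note X = zz_fwd.hyps(1)
  have zf: "zz X Y [Fwd X Y f]" using X Y zz_fwd.hyps by (auto intro: zigzag_Fwd)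
  note zr = zz_fwd.hyps(3)
  have "eqv X (bp Z Z) ([Fwd X Y f] @ r @ dz Z) ([Fwd X Y f] @ (dz Y @ lz Y r @ rz Z r))"
    by (rule eqv_append_left[OF zf zz_fwd.IH])
  also have "eqv X (bp Y Y) ([Fwd X Y f] @ dz Y) (dz X @ lz X [Fwd X Y f] @ rz Y [Fwd X Y f])"
    using zz_trans[OF _ zz_sym[OF dz_fwd[OF X Y Y]], of "[Fwd X Y f] @ dz Y" f f]
      zz_comp[of X C Y "bp Y Y" f "diag Y" W] X Y zz_fwd.hyps
    by (simp add: dz_def diag_natural bp_Obj diag)
  then have "eqv X (bp Z Z) ([Fwd X Y f] @ (dz Y @ lz Y r @ rz Z r))
      ((dz X @ lz X [Fwd X Y f]) @ (rz Y [Fwd X Y f] @ lz Y r) @ rz Z r)"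
    using eqv_append_right[OF _ zigzag_append[OF lz_zigzag[OF Y zr] rz_zigzag[OF Z zr]]] by fastforce
  also have "eqv X (bp Z Z) \<dots> ((dz X @ lz X [Fwd X Y f]) @ (lz X r @ rz Z [Fwd X Y f]) @ rz Z r)"
    by (rule zz_cong[OF zigzag_append[OF dz_zigzag[OF X] lz_zigzag[OF X zf]]
          zz_sym[OF interchange[OF zr zf]] rz_zigzag[OF Z zr]])
  finally show ?case by simp
next
  case (zz_inv Y w X Z r)
  have X: "X \<in> Obj C" and Z: "Z \<in> Obj C" using zz_inv zigzag_Obj by auto
  note Y = zz_inv.hyps(1)
  have w: "w \<in> Hom C X Y" "w \<in> W X Y" using zz_inv by auto
  let ?w = "[Fwd X Y w]" and ?v = "[Inv X Y w]"
  have zw: "zz X Y ?w" and zv: "zz Y X ?v"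
    using X Y w by (auto intro: zigzag_Fwd zigzag_Inv)
  have vw: "eqv Y Y (?v @ ?w) []" and wv: "eqv X X (?w @ ?v) []"
    using zz_inv_fwd[of X C Y w W] zz_fwd_inv[of X C Y w W] X Y w by auto
  note zr = zz_inv.hyps(3)
  \<comment> \<open>The square of \<open>w\<close> read backwards. The two copies of
    \<open>w\<close> are interchanged first, so that the formal inverses meet them in the order in
    which they cancel.\<close>
  have *: "eqv Y (bp X X) (?v @ dz X) (dz Y @ lz Y ?v @ rz X ?v)"
  proof -
    have zl: "zz (bp Y Y) (bp X Y) (lz Y ?v)" and zrv: "zz (bp X Y) (bp X X) (rz X ?v)"
      using lz_zigzag[OF Y zv] rz_zigzag[OF X zv] by auto
    have "eqv X (bp Y Y) (?w @ dz Y) [Fwd X (bp Y Y) (pair X Y Y w w)]"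
      using zz_comp[of X C Y "bp Y Y" w "diag Y" W] X Y w
      by (simp add: dz_def diag_natural bp_Obj diag)
    also have "eqv X (bp Y Y) \<dots> (dz X @ lz X ?w @ rz Y ?w)"
      using zz_sym[OF dz_fwd[OF X Y Y w(1) w(1)]] .
    also have "eqv X (bp Y Y) \<dots> (dz X @ rz X ?w @ lz Y ?w)"
      by (rule eqv_append_left[OF dz_zigzag[OF X] interchange[OF zw zw]])
    finally have 1: "eqv X (bp Y Y) (?w @ dz Y) (dz X @ rz X ?w @ lz Y ?w)" .
    have wl: "eqv (bp X Y) (bp X Y) (lz Y ?w @ lz Y ?v) []"
      using lz_eqv[OF Y wv] by simp
    have wr: "eqv (bp X X) (bp X X) (rz X ?w @ rz X ?v) []"
      using rz_eqv[OF X wv] by simp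
    have zrw: "zz (bp X X) (bp X Y) (rz X ?w)" using rz_zigzag[OF X zw] .
    have zd: "zz Y (bp Y Y) (dz Y)" "zz X (bp X X) (dz X)" using dz_zigzag X Y by auto
    have "eqv Y (bp X X) (dz Y @ lz Y ?v @ rz X ?v) ((?v @ ?w) @ (dz Y @ lz Y ?v @ rz X ?v))"
      using eqv_append_right[OF zz_sym[OF vw] zigzag_append[OF zd(1) zigzag_append[OF zl zrv]]] by simp
    also have "eqv Y (bp X X) \<dots> (?v @ (dz X @ rz X ?w @ lz Y ?w) @ (lz Y ?v @ rz X ?v))"
      using zz_cong[OF zv 1 zigzag_append[OF zl zrv]] by simp
    also have "eqv Y (bp X X) \<dots> ((?v @ dz X @ rz X ?w) @ [] @ rz X ?v)"
      using zz_cong[OF zigzag_append[OF zv zigzag_append[OF zd(2) zrw]] wl zrv] by simp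
    also have "eqv Y (bp X X) \<dots> ((?v @ dz X) @ [])"
      using eqv_append_left[OF zigzag_append[OF zv zd(2)] wr] by simp
    finally show ?thesis by (auto intro: zz_sym)
  qed
  have "eqv Y (bp Z Z) (?v @ r @ dz Z) (?v @ (dz X @ lz X r @ rz Z r))"
    by (rule eqv_append_left[OF zv zz_inv.IH])
  also have "eqv Y (bp Z Z) \<dots> ((dz Y @ lz Y ?v) @ (rz X ?v @ lz X r) @ rz Z r)"
    using eqv_append_right[OF * zigzag_append[OF lz_zigzag[OF X zr] rz_zigzag[OF Z zr]]] by simp
  also have "eqv Y (bp Z Z) \<dots> ((dz Y @ lz Y ?v) @ (lz Y r @ rz Z ?v) @ rz Z r)"
    by (rule zz_cong[OF zigzag_append[OF dz_zigzag[OF Y] lz_zigzag[OF Y zv]]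
          zz_sym[OF interchange[OF zr zv]] rz_zigzag[OF Z zr]])
  finally show ?case by simp
qed

section \<open>Pairing of zigzags\<close>

abbreviation "z1 X Y \<equiv> [Fwd (bp X Y) X (p1 X Y)]"
abbreviation "z2 X Y \<equiv> [Fwd (bp X Y) Y (p2 X Y)]"

lemma z1_zigzag: "\<lbrakk>X \<in> Obj C; Y \<in> Obj C\<rbrakk> \<Longrightarrow> zz (bp X Y) X (z1 X Y)"
  and z2_zigzag: "\<lbrakk>X \<in> Obj C; Y \<in> Obj C\<rbrakk> \<Longrightarrow> zz (bp X Y) Y (z2 X Y)"
  by (auto intro!: zigzag_Fwd bp_Obj p1_in p2_in)

lemma lz_z1:
  assumes p: "zz X X' p" and Z: "Z \<in> Obj C"
  shows "eqv (bp X Z) X' (lz Z p @ z1 X' Z) (z1 X Z @ p)"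
proof -
  have "eqv (FObj (lfun Z) X) (FObj idf X') (map (smap (lfun Z)) p @ z1 X' Z)
      (z1 X Z @ map (smap idf) p)"
  proof (rule natural_zigzag[OF relative_functor_lfun[OF Z] relative_functor_id _ _ p])
    fix X Y f assume "X \<in> Obj C" "Y \<in> Obj C" "f \<in> Hom C X Y"
    then show "eqv (FObj (lfun Z) X) (FObj idf Y) (map (smap (lfun Z)) [Fwd X Y f] @ z1 Y Z)
      (z1 X Z @ map (smap idf) [Fwd X Y f])"
      using Z by (auto simp: id_func_def p1_bm ident_in bp_Obj bm_in p1_in intro!: eqv_square)
  qed (use Z in \<open>auto simp: id_func_def intro!: z1_zigzag\<close>)
  then show ?thesis by (simp add: smap_id) (simp add: id_func_def)
qed

lemma rz_z2:
  assumes p: "zz X X' p" and Z: "Z \<in> Obj C"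
  shows "eqv (bp Z X) X' (rz Z p @ z2 Z X') (z2 Z X @ p)"
proof -
  have "eqv (FObj (rfun Z) X) (FObj idf X') (map (smap (rfun Z)) p @ z2 Z X')
      (z2 Z X @ map (smap idf) p)"
  proof (rule natural_zigzag[OF relative_functor_rfun[OF Z] relative_functor_id _ _ p])
    fix X Y f assume "X \<in> Obj C" "Y \<in> Obj C" "f \<in> Hom C X Y"
    then show "eqv (FObj (rfun Z) X) (FObj idf Y) (map (smap (rfun Z)) [Fwd X Y f] @ z2 Z Y)
      (z2 Z X @ map (smap idf) [Fwd X Y f])"
      using Z by (auto simp: id_func_def p2_bm ident_in bp_Obj bm_in p2_in intro!: eqv_square)
  qed (use Z in \<open>auto simp: id_func_def intro!: z2_zigzag\<close>)
  then show ?thesis by (simp add: smap_id) (simp add: id_func_def)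
qed

text \<open>Projection to the first factor forgets a zigzag in the second. This is naturality
  towards a constant functor, done by hand because such a functor preserves \<open>W\<close> only if
  an identity lies in it.\<close>

lemma rz_z1: "zz X X' p \<Longrightarrow> Z \<in> Obj C \<Longrightarrow> eqv (bp Z X) Z (rz Z p @ z1 Z X') (z1 Z X)"
proof (induction rule: zigzag.induct)
  case (zz_nil X)
  then show ?case using z1_zigzag by (auto intro: zz_refl)
next
  case (zz_fwd X f Y V p)
  have Y: "Y \<in> Obj C" using zz_fwd zigzag_Obj by blast
  have c: "eqv (bp Z X) Z (rz Z [Fwd X Y f] @ z1 Z Y) (z1 Z X)"
    using zz_comp[of "bp Z X" C "bp Z Y" Z "bm Z Z X Y (Ident C Z) f" "p1 Z Y" W] zz_fwd Y
    by (simp add: bp_Obj bm_in p1_in p1_bm ident_in ident_comp)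
  have "eqv (bp Z X) Z (rz Z [Fwd X Y f] @ rz Z p @ z1 Z V) (rz Z [Fwd X Y f] @ z1 Z Y)"
    by (rule eqv_append_left[OF rz_zigzag[OF _ zigzag_Fwd]]) (use zz_fwd Y in auto)
  then show ?case using c by (auto intro: zz_trans)
next
  case (zz_inv Y w X V p)
  have X: "X \<in> Obj C" using zz_inv zigzag_Obj by blast
  have v: "zz (bp Z Y) (bp Z X) (rz Z [Inv X Y w])"
    by (rule rz_zigzag[OF _ zigzag_Inv]) (use zz_inv X in auto)
  have c: "eqv (bp Z X) Z (z1 Z X) (rz Z [Fwd X Y w] @ z1 Z Y)"
    using zz_comp[of "bp Z X" C "bp Z Y" Z "bm Z Z X Y (Ident C Z) w" "p1 Z Y" W] zz_inv X
    by (auto simp: bp_Obj bm_in p1_in p1_bm ident_in ident_comp intro: zz_sym)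
  have vw: "eqv (bp Z Y) (bp Z Y) (rz Z [Inv X Y w] @ rz Z [Fwd X Y w]) []"
    using rz_eqv[OF _ zz_inv_fwd, of Z X Y w] zz_inv X by simp
  have "eqv (bp Z Y) Z (rz Z [Inv X Y w] @ rz Z p @ z1 Z V) (rz Z [Inv X Y w] @ z1 Z X)"
    by (rule eqv_append_left[OF v]) (use zz_inv X in auto)
  also have "eqv (bp Z Y) Z \<dots> (rz Z [Inv X Y w] @ rz Z [Fwd X Y w] @ z1 Z Y)"
    by (rule eqv_append_left[OF v c])
  also have "eqv (bp Z Y) Z \<dots> (z1 Z Y)"
    using eqv_append_right[OF vw z1_zigzag] zz_inv by simp
  finally show ?case by simp
qed

lemma lz_z2: "zz X X' p \<Longrightarrow> Z \<in> Obj C \<Longrightarrow> eqv (bp X Z) Z (lz Z p @ z2 X' Z) (z2 X Z)"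
proof (induction rule: zigzag.induct)
  case (zz_nil X)
  then show ?case using z2_zigzag by (auto intro: zz_refl)
next
  case (zz_fwd X f Y V p)
  have Y: "Y \<in> Obj C" using zz_fwd zigzag_Obj by blast
  have c: "eqv (bp X Z) Z (lz Z [Fwd X Y f] @ z2 Y Z) (z2 X Z)"
    using zz_comp[of "bp X Z" C "bp Y Z" Z "bm X Y Z Z f (Ident C Z)" "p2 Y Z" W] zz_fwd Y
    by (simp add: bp_Obj bm_in p2_in p2_bm ident_in ident_comp)
  have "eqv (bp X Z) Z (lz Z [Fwd X Y f] @ lz Z p @ z2 V Z) (lz Z [Fwd X Y f] @ z2 Y Z)"
    by (rule eqv_append_left[OF lz_zigzag[OF _ zigzag_Fwd]]) (use zz_fwd Y in auto)
  then show ?case using c by (auto intro: zz_trans)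
next
  case (zz_inv Y w X V p)
  have X: "X \<in> Obj C" using zz_inv zigzag_Obj by blast
  have v: "zz (bp Y Z) (bp X Z) (lz Z [Inv X Y w])"
    by (rule lz_zigzag[OF _ zigzag_Inv]) (use zz_inv X in auto)
  have c: "eqv (bp X Z) Z (z2 X Z) (lz Z [Fwd X Y w] @ z2 Y Z)"
    using zz_comp[of "bp X Z" C "bp Y Z" Z "bm X Y Z Z w (Ident C Z)" "p2 Y Z" W] zz_inv X
    by (auto simp: bp_Obj bm_in p2_in p2_bm ident_in ident_comp intro: zz_sym)
  have vw: "eqv (bp Y Z) (bp Y Z) (lz Z [Inv X Y w] @ lz Z [Fwd X Y w]) []"
    using lz_eqv[OF _ zz_inv_fwd, of Z X Y w] zz_inv X by simp
  have "eqv (bp Y Z) Z (lz Z [Inv X Y w] @ lz Z p @ z2 V Z) (lz Z [Inv X Y w] @ z2 X Z)"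
    by (rule eqv_append_left[OF v]) (use zz_inv X in auto)
  also have "eqv (bp Y Z) Z \<dots> (lz Z [Inv X Y w] @ lz Z [Fwd X Y w] @ z2 Y Z)"
    by (rule eqv_append_left[OF v c])
  also have "eqv (bp Y Z) Z \<dots> (z2 Y Z)"
    using eqv_append_right[OF vw z2_zigzag] zz_inv by simp
  finally show ?case by simp
qed

text \<open>The pairing is the diagonal, followed by \<open>p\<close> in the first factor and
  \<open>q\<close> in the second. Projection to \<open>Y\<close> discards \<open>q\<close> at once;
  for the projection to \<open>Z\<close> the two parts are interchanged, so that \<open>p\<close> is
  the last one and is discarded.\<close>

lemma zigzag_pair_ex:
  assumes p: "zz X Y p" and q: "zz X Z q"
  shows "\<exists>r. zz X (bp Y Z) r \<and> eqv X Y (r @ z1 Y Z) p \<and> eqv X Z (r @ z2 Y Z) q"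
proof (intro exI conjI)
  have O: "X \<in> Obj C" "Y \<in> Obj C" "Z \<in> Obj C" using p q zigzag_Obj by auto
  let ?r = "dz X @ lz X p @ rz Y q"
  note zs = dz_zigzag[OF O(1)] lz_zigzag[OF O(1) p] rz_zigzag[OF O(2) q]
  show "zz X (bp Y Z) ?r" by (rule zigzag_append[OF zs(1) zigzag_append[OF zs(2,3)]])
  have d1: "eqv X X (dz X @ z1 X X) []" and d2: "eqv X X (dz X @ z2 X X) []"
    unfolding dz_def
    using zz_trans[OF zz_comp[of X C "bp X X" X "diag X" _ W]] zz_ident[of X C W] O(1)
    by (simp_all add: bp_Obj diag p1_in p2_in)
  have "eqv X Y ((dz X @ lz X p) @ rz Y q @ z1 Y Z) ((dz X @ lz X p) @ z1 Y X)"
    by (rule eqv_append_left[OF zigzag_append[OF zs(1,2)] rz_z1[OF q O(2)]])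
  also have "eqv X Y \<dots> (dz X @ z1 X X @ p)"
    using eqv_append_left[OF zs(1) lz_z1[OF p O(1)]] by simp
  also have "eqv X Y \<dots> p"
    using eqv_append_right[OF d1 p] by simp
  finally show "eqv X Y (?r @ z1 Y Z) p" by simp
  have "eqv X Z (dz X @ (lz X p @ rz Y q) @ z2 Y Z) (dz X @ (rz X q @ lz Z p) @ z2 Y Z)"
    by (rule zz_cong[OF zs(1) interchange[OF p q] z2_zigzag[OF O(2,3)]])
  also have "eqv X Z \<dots> ((dz X @ rz X q) @ z2 X Z)"
    using eqv_append_left[OF zigzag_append[OF zs(1) rz_zigzag[OF O(1) q]] lz_z2[OF p O(3)]] by simp
  also have "eqv X Z \<dots> (dz X @ z2 X X @ q)"
    using eqv_append_left[OF zs(1) rz_z2[OF q O(1)]] by simp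
  also have "eqv X Z \<dots> q"
    using eqv_append_right[OF d2 q] by simp
  finally show "eqv X Z (?r @ z2 Y Z) q" by simp
qed

text \<open>A zigzag into a product is the pairing of its components: the pairing of the two
  projections is the identity of \<open>bp Y Z\<close>, and naturality of the diagonal moves
  \<open>r\<close> into both factors. Uniqueness follows, since the right hand side depends only on
  the classes of the components.\<close>

lemma zigzag_pair_eta:
  assumes r: "zz X (bp Y Z) r" and O: "Y \<in> Obj C" "Z \<in> Obj C"
  shows "eqv X (bp Y Z) r (dz X @ lz X (r @ z1 Y Z) @ rz Y (r @ z2 Y Z))"
proof -
  let ?P = "bp Y Z"
  have X: "X \<in> Obj C" and P: "?P \<in> Obj C" using r zigzag_Obj by auto
  note z = z1_zigzag[OF O] z2_zigzag[OF O]
  have "pair ?P Y Z (p1 Y Z) (p2 Y Z) = Ident C ?P"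
    by (rule pair_unique[OF O P])
      (use O P in \<open>simp_all add: pair_in p1_in p2_in ident_in p1_pair p2_pair comp_ident\<close>)
  then have "eqv ?P ?P (dz ?P @ lz ?P (z1 Y Z) @ rz Y (z2 Y Z)) []"
    using zz_trans[OF dz_fwd[OF P O p1_in[OF O] p2_in[OF O]]] zz_ident[OF P] by simp
  then have "eqv X ?P r (r @ dz ?P @ lz ?P (z1 Y Z) @ rz Y (z2 Y Z))"
    using eqv_append_left[OF r] zz_sym by fastforce
  also have "eqv X ?P \<dots> ((dz X @ lz X r @ rz ?P r) @ lz ?P (z1 Y Z) @ rz Y (z2 Y Z))"
    using eqv_append_right[OF dz_natural[OF r] zigzag_append[OF lz_zigzag[OF P z(1)] rz_zigzag[OF O(1) z(2)]]]
    by simp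
  also have "eqv X ?P \<dots> ((dz X @ lz X r) @ (lz X (z1 Y Z) @ rz Y r) @ rz Y (z2 Y Z))"
    using zz_cong[OF zigzag_append[OF dz_zigzag[OF X] lz_zigzag[OF X r]]
        zz_sym[OF interchange[OF z(1) r]] rz_zigzag[OF O(1) z(2)]] by simp
  finally show ?thesis by simp
qed

lemma zigzag_pair_unique:
  assumes r: "zz X (bp Y Z) r" "zz X (bp Y Z) s" and O: "Y \<in> Obj C" "Z \<in> Obj C"
    and e: "eqv X Y (r @ z1 Y Z) (s @ z1 Y Z)" "eqv X Z (r @ z2 Y Z) (s @ z2 Y Z)"
  shows "eqv X (bp Y Z) r s"
proof -
  have X: "X \<in> Obj C" using r zigzag_Obj by auto
  have "eqv X (bp Y Z) (dz X @ lz X (r @ z1 Y Z) @ rz Y (r @ z2 Y Z))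
      (dz X @ lz X (s @ z1 Y Z) @ rz Y (s @ z2 Y Z))"
    by (rule eqv_append_left[OF dz_zigzag[OF X] eqv_append[OF lz_eqv[OF X e(1)] rz_eqv[OF O(1) e(2)]]])
  then show ?thesis
    using zigzag_pair_eta[OF r(1) O] zz_sym[OF zigzag_pair_eta[OF r(2) O]] by (blast intro: zz_trans)
qed

section \<open>Products of lists of objects\<close>

fun lprod :: "'a list \<Rightarrow> 'a" where
  "lprod [] = T"
| "lprod (B # Bs) = bp B (lprod Bs)"

fun lproj :: "'a list \<Rightarrow> nat \<Rightarrow> 'b" where
  "lproj [] i = bang T"
| "lproj (B # Bs) 0 = p1 B (lprod Bs)"
| "lproj (B # Bs) (Suc i) =
     Comp C (bp B (lprod Bs)) (lprod Bs) (Bs ! i) (lproj Bs i) (p2 B (lprod Bs))"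

lemma lprod_Obj: "set Bs \<subseteq> Obj C \<Longrightarrow> lprod Bs \<in> Obj C"
  by (induction Bs) (auto simp: T_Obj bp_Obj)

lemma lproj_in: "set Bs \<subseteq> Obj C \<Longrightarrow> i < length Bs \<Longrightarrow> lproj Bs i \<in> Hom C (lprod Bs) (Bs ! i)"
proof (induction Bs arbitrary: i)
  case (Cons B Bs)
  then show ?case
    using lprod_Obj[of Bs] comp_in[of "bp B (lprod Bs)" "lprod Bs" "Bs ! (i - 1)" "p2 B (lprod Bs)"]
    by (cases i) (auto simp: p1_in p2_in bp_Obj nth_mem subset_iff)
qed simp

lemma lprod_tuple_ex:
  assumes "set Bs \<subseteq> Obj C" "X \<in> Obj C" "\<And>i. i < length Bs \<Longrightarrow> f i \<in> Hom C X (Bs ! i)"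
  shows "\<exists>m \<in> Hom C X (lprod Bs). \<forall>i < length Bs. Comp C X (lprod Bs) (Bs ! i) (lproj Bs i) m = f i"
  using assms
proof (induction Bs arbitrary: f)
  case Nil
  then show ?case using bang_in by auto
next
  case (Cons B Bs)
  then obtain m where m: "m \<in> Hom C X (lprod Bs)"
      "\<forall>i < length Bs. Comp C X (lprod Bs) (Bs ! i) (lproj Bs i) m = f (Suc i)"
    using Cons.IH[of "\<lambda>i. f (Suc i)"] by fastforce
  have O: "B \<in> Obj C" "lprod Bs \<in> Obj C" "X \<in> Obj C" and f: "f 0 \<in> Hom C X B"
    using Cons.prems lprod_Obj[of Bs] Cons.prems(3)[of 0] by auto
  let ?m = "pair X B (lprod Bs) (f 0) m"
  have "Comp C X (bp B (lprod Bs)) ((B # Bs) ! i) (lproj (B # Bs) i) ?m = f i"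
    if i: "i < length (B # Bs)" for i
  proof (cases i)
    case 0
    then show ?thesis using O f m by (simp add: p1_pair)
  next
    case (Suc j)
    then have "Bs ! j \<in> Obj C" "lproj Bs j \<in> Hom C (lprod Bs) (Bs ! j)"
      using i Cons.prems lproj_in[of Bs j] nth_mem[of j Bs] by auto
    then show ?thesis
      using O f m i Suc by (simp add: comp_assoc[symmetric] bp_Obj p2_in pair_in p2_pair)
  qed
  then show ?case using pair_in[OF O(1,2,3) f m(1)] by auto
qed

text \<open>The list is built from the binary product, and the empty list is where
  \<open>terminal_zigzag\<close> enters. The later projections factor through \<open>z2\<close>,
  which is the fact \<open>fact\<close>.\<close>

lemma lprod_zigzag:
  assumes "set Bs \<subseteq> Obj C" "X \<in> Obj C"
  shows "(\<forall>i < length Bs. zz X (Bs ! i) (f i)) \<Longrightarrow>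
      \<exists>r. zz X (lprod Bs) r \<and> (\<forall>i < length Bs. eqv X (Bs ! i) (r @ [Fwd (lprod Bs) (Bs ! i) (lproj Bs i)]) (f i))"
    and "\<lbrakk>zz X (lprod Bs) r; zz X (lprod Bs) s;
      \<forall>i < length Bs. eqv X (Bs ! i) (r @ [Fwd (lprod Bs) (Bs ! i) (lproj Bs i)])
        (s @ [Fwd (lprod Bs) (Bs ! i) (lproj Bs i)])\<rbrakk> \<Longrightarrow> eqv X (lprod Bs) r s"
  using assms
proof (induction Bs arbitrary: f r s)
  case Nil
  {
    case 1
    then show ?case using zigzag_Fwd[of X T "bang X"] by (auto simp: bang_in T_Obj)
  next
    case 2
    then show ?case using terminal_zigzag[of X T r] terminal_zigzag[of X T s]
      by (auto intro: zz_trans zz_sym)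
  }
next
  case (Cons B Bs)
  have fact: "eqv (bp B (lprod Bs)) (Bs ! i) [Fwd (bp B (lprod Bs)) (Bs ! i) (lproj (B # Bs) (Suc i))]
      (z2 B (lprod Bs) @ [Fwd (lprod Bs) (Bs ! i) (lproj Bs i)])"
    if "i < length Bs" "set (B # Bs) \<subseteq> Obj C" for i
    using that zz_sym[OF zz_comp[of "bp B (lprod Bs)" C "lprod Bs" "Bs ! i" "p2 B (lprod Bs)" "lproj Bs i" W]]
      lproj_in[of Bs i] lprod_Obj[of Bs] nth_mem[of i Bs]
    by (simp add: bp_Obj p2_in subset_iff)
  {
    case 1
    then have O: "B \<in> Obj C" "lprod Bs \<in> Obj C" "set (B # Bs) \<subseteq> Obj C" using lprod_Obj[of Bs] by auto
    obtain q where q: "zz X (lprod Bs) q"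
        "\<forall>i < length Bs. eqv X (Bs ! i) (q @ [Fwd (lprod Bs) (Bs ! i) (lproj Bs i)]) (f (Suc i))"
      using Cons.IH(1)[of "\<lambda>i. f (Suc i)"] 1 by fastforce
    have f0: "zz X B (f 0)" using 1 by force
    obtain r where r: "zz X (bp B (lprod Bs)) r" "eqv X B (r @ z1 B (lprod Bs)) (f 0)"
        "eqv X (lprod Bs) (r @ z2 B (lprod Bs)) q"
      using zigzag_pair_ex[OF f0 q(1)] by blast
    have "eqv X ((B # Bs) ! i) (r @ [Fwd (lprod (B # Bs)) ((B # Bs) ! i) (lproj (B # Bs) i)]) (f i)"
      if i: "i < length (B # Bs)" for i
    proof (cases i)
      case 0
      then show ?thesis using r by simp
    next
      case (Suc j)
      then have j: "j < length Bs" using i by simp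
      have z: "zz (lprod Bs) (Bs ! j) [Fwd (lprod Bs) (Bs ! j) (lproj Bs j)]"
        using j O lproj_in[of Bs j] nth_mem[of j Bs] by (auto intro!: zigzag_Fwd)
      have "eqv X (Bs ! j) (r @ [Fwd (bp B (lprod Bs)) (Bs ! j) (lproj (B # Bs) (Suc j))])
          (r @ z2 B (lprod Bs) @ [Fwd (lprod Bs) (Bs ! j) (lproj Bs j)])"
        by (rule eqv_append_left[OF r(1) fact[OF j O(3)]])
      also have "eqv X (Bs ! j) \<dots> (q @ [Fwd (lprod Bs) (Bs ! j) (lproj Bs j)])"
        using eqv_append_right[OF r(3) z] by simp
      also have "eqv X (Bs ! j) \<dots> (f (Suc j))" using q j by blast
      finally show ?thesis using Suc by simp
    qed
    then show ?case using r by auto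
  next
    case 2
    then have O: "B \<in> Obj C" "lprod Bs \<in> Obj C" "set (B # Bs) \<subseteq> Obj C" using lprod_Obj[of Bs] by auto
    have r: "zz X (bp B (lprod Bs)) r" "zz X (bp B (lprod Bs)) s" using 2 by auto
    have z2r: "zz X (lprod Bs) (r @ z2 B (lprod Bs))" "zz X (lprod Bs) (s @ z2 B (lprod Bs))"
      using zigzag_append[OF r(1) z2_zigzag[OF O(1,2)]] zigzag_append[OF r(2) z2_zigzag[OF O(1,2)]] .
    have "eqv X B (r @ z1 B (lprod Bs)) (s @ z1 B (lprod Bs))"
      using 2(3) by force
    moreover have "eqv X (lprod Bs) (r @ z2 B (lprod Bs)) (s @ z2 B (lprod Bs))"
    proof (rule Cons.IH(2)[OF z2r], intro allI impI)
      fix j assume j: "j < length Bs"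
      have "eqv X (Bs ! j) (r @ z2 B (lprod Bs) @ [Fwd (lprod Bs) (Bs ! j) (lproj Bs j)])
          (r @ [Fwd (bp B (lprod Bs)) (Bs ! j) (lproj (B # Bs) (Suc j))])"
        by (rule zz_sym[OF eqv_append_left[OF r(1) fact[OF j O(3)]]])
      also have "eqv X (Bs ! j) \<dots> (s @ [Fwd (bp B (lprod Bs)) (Bs ! j) (lproj (B # Bs) (Suc j))])"
        using 2(3) j by fastforce
      also have "eqv X (Bs ! j) \<dots> (s @ z2 B (lprod Bs) @ [Fwd (lprod Bs) (Bs ! j) (lproj Bs j)])"
        by (rule eqv_append_left[OF r(2) fact[OF j O(3)]])
      finally show "eqv X (Bs ! j) ((r @ z2 B (lprod Bs)) @ [Fwd (lprod Bs) (Bs ! j) (lproj Bs j)])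
          ((s @ z2 B (lprod Bs)) @ [Fwd (lprod Bs) (Bs ! j) (lproj Bs j)])" by simp
    qed (use 2 in auto)
    ultimately show ?case using zigzag_pair_unique[OF r O(1,2)] by simp
  }
qed

text \<open>\<open>A\<close> is not a product in \<open>C\<close>, but it maps to one by a member
  \<open>m\<close> of \<open>W\<close>, which becomes invertible in the localization.\<close>

lemma product_cone_localization:
  assumes Bs: "set Bs \<subseteq> Obj C" and A: "A \<in> Obj C"
    and m: "m \<in> Hom C A (lprod Bs)" "m \<in> W A (lprod Bs)"
    and f: "\<And>i. i < length Bs \<Longrightarrow> Comp C A (lprod Bs) (Bs ! i) (lproj Bs i) m = f i"
  shows "product_cone (localization C W) A Bs (\<lambda>i. cl A (Bs ! i) [Fwd A (Bs ! i) (f i)])"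
proof -
  let ?P = "lprod Bs"
  have P: "?P \<in> Obj C" using lprod_Obj[OF Bs] .
  have Bi: "Bs ! i \<in> Obj C" "lproj Bs i \<in> Hom C ?P (Bs ! i)" "f i \<in> Hom C A (Bs ! i)"
    if "i < length Bs" for i
  proof -
    show "Bs ! i \<in> Obj C" "lproj Bs i \<in> Hom C ?P (Bs ! i)"
      using Bs that lproj_in[OF Bs] by (auto simp: subset_iff)
    then show "f i \<in> Hom C A (Bs ! i)" using comp_in[OF A P _ m(1)] f[OF that] by metis
  qed
  have zf: "zz A (Bs ! i) [Fwd A (Bs ! i) (f i)]" if "i < length Bs" for i
    using Bi[OF that] A by (auto intro: zigzag_Fwd)
  have fe: "eqv A (Bs ! i) [Fwd A ?P m, Fwd ?P (Bs ! i) (lproj Bs i)] [Fwd A (Bs ! i) (f i)]"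
    if "i < length Bs" for i
    using zz_comp[OF A P _ m(1) Bi(2)[OF that]] Bi(1)[OF that] f[OF that] by simp
  have ze: "zz A ?P [Fwd A ?P m]" using A P m by (auto intro: zigzag_Fwd)
  show ?thesis
    unfolding product_cone_def
  proof (intro conjI allI impI ballI)
    fix i assume "i < length Bs"
    then show "cl A (Bs ! i) [Fwd A (Bs ! i) (f i)] \<in> Hom (localization C W) A (Bs ! i)"
      using zf cl_in_Hom by blast
  next
    fix X g assume X: "X \<in> Obj (localization C W)"
      and g: "\<forall>i < length Bs. g i \<in> Hom (localization C W) X (Bs ! i)"
    have XO: "X \<in> Obj C" using X by (simp add: localization_simps)
    obtain q where q: "\<forall>i < length Bs. zz X (Bs ! i) (q i) \<and> g i = cl X (Bs ! i) (q i)"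
      using g unfolding localization_simps by metis
    obtain r where r: "zz X ?P r"
        "\<forall>i < length Bs. eqv X (Bs ! i) (r @ [Fwd ?P (Bs ! i) (lproj Bs i)]) (q i)"
      using lprod_zigzag(1)[OF Bs XO] q by blast
    \<comment> \<open>The solution \<open>r\<close> for the product \<open>?P\<close> is carried
      back to \<open>A\<close> by the formal inverse of \<open>m\<close>.\<close>
    let ?h = "r @ [Inv A ?P m]"
    have zi: "zz ?P A [Inv A ?P m]" using A P m by (auto intro: zigzag_Inv)
    have h: "zz X A ?h" using zigzag_append[OF r(1) zi] .
    have im: "eqv ?P ?P [Inv A ?P m, Fwd A ?P m] []" using zz_inv_fwd[OF A P] m by blast
    have sol: "eqv X (Bs ! i) (s @ [Fwd A (Bs ! i) (f i)]) (q i) \<longleftrightarrow>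
        eqv X (Bs ! i) ((s @ [Fwd A ?P m]) @ [Fwd ?P (Bs ! i) (lproj Bs i)]) (q i)"
      if "zz X A s" "i < length Bs" for s i
      using eqv_append_left[OF that(1) fe[OF that(2)]] by (auto intro: zz_trans zz_sym)
    have "eqv X ?P (?h @ [Fwd A ?P m]) r"
      using eqv_append_left[OF r(1) im] by simp
    then have "eqv X (Bs ! i) ((?h @ [Fwd A ?P m]) @ [Fwd ?P (Bs ! i) (lproj Bs i)]) (q i)"
      if "i < length Bs" for i
      using zz_trans[OF eqv_append_right[OF _ zigzag_Fwd[OF P Bi(1,2)]]] r(2) that by blast
    then have hq: "eqv X (Bs ! i) (?h @ [Fwd A (Bs ! i) (f i)]) (q i)" if "i < length Bs" for i
      using sol[OF h] that by blast
    show "\<exists>!h. h \<in> Hom (localization C W) X A \<and>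
        (\<forall>i < length Bs. Comp (localization C W) X A (Bs ! i) (cl A (Bs ! i) [Fwd A (Bs ! i) (f i)]) h = g i)"
    proof (rule ex1I[of _ "cl X A ?h"], intro conjI allI impI)
      show "cl X A ?h \<in> Hom (localization C W) X A" using cl_in_Hom[OF h] .
      fix i assume i: "i < length Bs"
      show "Comp (localization C W) X A (Bs ! i) (cl A (Bs ! i) [Fwd A (Bs ! i) (f i)]) (cl X A ?h) = g i"
        unfolding comp_cl[OF h zf[OF i]]
        using hq[OF i] q i cl_eq_iff[OF zigzag_append[OF h zf[OF i]]] by auto
    next
      fix k assume k: "k \<in> Hom (localization C W) X A \<and>
        (\<forall>i < length Bs. Comp (localization C W) X A (Bs ! i) (cl A (Bs ! i) [Fwd A (Bs ! i) (f i)]) k = g i)"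
      then obtain s where s: "zz X A s" "k = cl X A s" by (auto simp: localization_simps)
      have sq: "eqv X (Bs ! i) (s @ [Fwd A (Bs ! i) (f i)]) (q i)" if i: "i < length Bs" for i
      proof -
        have "Comp (localization C W) X A (Bs ! i) (cl A (Bs ! i) [Fwd A (Bs ! i) (f i)]) (cl X A s) = g i"
          using k i s(2) by blast
        then have "cl X (Bs ! i) (s @ [Fwd A (Bs ! i) (f i)]) = cl X (Bs ! i) (q i)"
          unfolding comp_cl[OF s(1) zf[OF i]] using q i by simp
        then show ?thesis using cl_eq_iff[OF zigzag_append[OF s(1) zf[OF i]]] by blast
      qed
      have "eqv X (Bs ! i) ((s @ [Fwd A ?P m]) @ [Fwd ?P (Bs ! i) (lproj Bs i)])
          ((?h @ [Fwd A ?P m]) @ [Fwd ?P (Bs ! i) (lproj Bs i)])" if "i < length Bs" for i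
        by (rule zz_trans[OF iffD1[OF sol[OF s(1) that] sq[OF that]]
              zz_sym[OF iffD1[OF sol[OF h that] hq[OF that]]]])
      then have "eqv X ?P (s @ [Fwd A ?P m]) (?h @ [Fwd A ?P m])"
        by (intro lprod_zigzag(2)[OF Bs XO] zigzag_append[OF s(1) ze] zigzag_append[OF h ze]) auto
      then have "eqv X A s ?h" by (rule eqv_cancel_right[OF A P m s(1) h])
      then show "k = cl X A ?h" using cl_eq_iff[OF s(1)] s(2) by blast
    qed
  qed
qed

end

section \<open>Idempotents and zigzags\<close>

text \<open>
  \<open>I X\<close> plays the role of the set of idempotents of \<open>H\<^sup>0(X)\<close>, \<open>LO X \<epsilon>\<close> that of the localization of \<open>X\<close>
  at \<open>\<epsilon>\<close>, with canonical map \<open>lm X \<epsilon>\<close>, and \<open>Sys X es\<close> says that \<open>es\<close> is a complete orthogonal system.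
\<close>

locale loc_idempotents = loc_pair +
  fixes I :: "'a \<Rightarrow> 'e set" and push :: "'a \<Rightarrow> 'a \<Rightarrow> 'b \<Rightarrow> 'e \<Rightarrow> 'e" and top :: "'a \<Rightarrow> 'e"
    and LO :: "'a \<Rightarrow> 'e \<Rightarrow> 'a" and lm :: "'a \<Rightarrow> 'e \<Rightarrow> 'b" and LM :: "'a \<Rightarrow> 'a \<Rightarrow> 'b \<Rightarrow> 'e \<Rightarrow> 'b"
    and Sys :: "'a \<Rightarrow> 'e list \<Rightarrow> bool" and conn :: "'a \<Rightarrow> bool"
  assumes push_in: "\<lbrakk>X \<in> Obj C; Y \<in> Obj C; f \<in> Hom C X Y; e \<in> I X\<rbrakk> \<Longrightarrow> push X Y f e \<in> I Y"
    and push_ident: "\<lbrakk>X \<in> Obj C; e \<in> I X\<rbrakk> \<Longrightarrow> push X X (Ident C X) e = e"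
    and push_comp: "\<lbrakk>X \<in> Obj C; Y \<in> Obj C; Z \<in> Obj C; f \<in> Hom C X Y; g \<in> Hom C Y Z; e \<in> I X\<rbrakk>
      \<Longrightarrow> push X Z (Comp C X Y Z g f) e = push Y Z g (push X Y f e)"
    and push_W: "\<lbrakk>X \<in> Obj C; Y \<in> Obj C; f \<in> Hom C X Y; f \<in> W X Y\<rbrakk> \<Longrightarrow> bij_betw (push X Y f) (I X) (I Y)"
    and top_in: "X \<in> Obj C \<Longrightarrow> top X \<in> I X"
    and push_top: "\<lbrakk>X \<in> Obj C; Y \<in> Obj C; f \<in> Hom C X Y\<rbrakk> \<Longrightarrow> push X Y f (top X) = top Y"
    and LO_Obj: "\<lbrakk>X \<in> Obj C; e \<in> I X\<rbrakk> \<Longrightarrow> LO X e \<in> Obj C"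
    and lm_in: "\<lbrakk>X \<in> Obj C; e \<in> I X\<rbrakk> \<Longrightarrow> lm X e \<in> Hom C X (LO X e)"
    and LM_in: "\<lbrakk>X \<in> Obj C; Y \<in> Obj C; f \<in> Hom C X Y; e \<in> I X\<rbrakk>
      \<Longrightarrow> LM X Y f e \<in> Hom C (LO X e) (LO Y (push X Y f e))"
    and LM_ident: "\<lbrakk>X \<in> Obj C; e \<in> I X\<rbrakk> \<Longrightarrow> LM X X (Ident C X) e = Ident C (LO X e)"
    and LM_comp: "\<lbrakk>X \<in> Obj C; Y \<in> Obj C; Z \<in> Obj C; f \<in> Hom C X Y; g \<in> Hom C Y Z; e \<in> I X\<rbrakk>
      \<Longrightarrow> LM X Z (Comp C X Y Z g f) e =
        Comp C (LO X e) (LO Y (push X Y f e)) (LO Z (push Y Z g (push X Y f e)))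
          (LM Y Z g (push X Y f e)) (LM X Y f e)"
    and LM_W: "\<lbrakk>X \<in> Obj C; Y \<in> Obj C; f \<in> Hom C X Y; f \<in> W X Y; e \<in> I X\<rbrakk>
      \<Longrightarrow> LM X Y f e \<in> W (LO X e) (LO Y (push X Y f e))"
    and lm_natural: "\<lbrakk>X \<in> Obj C; Y \<in> Obj C; f \<in> Hom C X Y; e \<in> I X\<rbrakk>
      \<Longrightarrow> Comp C X (LO X e) (LO Y (push X Y f e)) (LM X Y f e) (lm X e) =
        Comp C X Y (LO Y (push X Y f e)) (lm Y (push X Y f e)) f"
    and lm_top_W: "X \<in> Obj C \<Longrightarrow> lm X (top X) \<in> W X (LO X (top X))"
    and Sys_in: "\<lbrakk>X \<in> Obj C; Sys X es\<rbrakk> \<Longrightarrow> set es \<subseteq> I X"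
    and Sys_push: "\<lbrakk>X \<in> Obj C; Y \<in> Obj C; f \<in> Hom C X Y; Sys X es\<rbrakk> \<Longrightarrow> Sys Y (map (push X Y f) es)"
    and Sys_reflect: "\<lbrakk>X \<in> Obj C; Y \<in> Obj C; f \<in> Hom C X Y; f \<in> W X Y; set es \<subseteq> I X;
      Sys Y (map (push X Y f) es)\<rbrakk> \<Longrightarrow> Sys X es"
    and Sys_conn: "\<lbrakk>X \<in> Obj C; conn X; Sys X es\<rbrakk> \<Longrightarrow> \<exists>!i. i < length es \<and> es ! i = top X"
begin

text \<open>Transport of idempotents along a zigzag, and the induced zigzag between the localizations.\<close>

fun trans :: "'e \<Rightarrow> ('a, 'b) step list \<Rightarrow> 'e" where
  "trans e [] = e"
| "trans e (Fwd X Y f # p) = trans (push X Y f e) p"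
| "trans e (Inv X Y w # p) = trans (inv_into (I X) (push X Y w) e) p"

fun lift :: "'e \<Rightarrow> ('a, 'b) step list \<Rightarrow> ('a, 'b) step list" where
  "lift e [] = []"
| "lift e (Fwd X Y f # p) = Fwd (LO X e) (LO Y (push X Y f e)) (LM X Y f e) # lift (push X Y f e) p"
| "lift e (Inv X Y w # p) = (let e' = inv_into (I X) (push X Y w) e
     in Inv (LO X e') (LO Y e) (LM X Y w e') # lift e' p)"

lemma trans_append: "trans e (p @ q) = trans (trans e p) q"
  by (induction e p rule: trans.induct) auto

lemma lift_append: "lift e (p @ q) = lift e p @ lift (trans e p) q"
  by (induction e p rule: lift.induct) (auto simp: Let_def)

lemma pull:
  assumes "X \<in> Obj C" "Y \<in> Obj C" "f \<in> Hom C X Y" "f \<in> W X Y" "e \<in> I Y"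
  shows "inv_into (I X) (push X Y f) e \<in> I X" "push X Y f (inv_into (I X) (push X Y f) e) = e"
  using push_W[OF assms(1-4)] assms(5)
  by (auto simp: bij_betw_def intro: inv_into_into f_inv_into_f)

lemma pull_push:
  assumes "X \<in> Obj C" "Y \<in> Obj C" "f \<in> Hom C X Y" "f \<in> W X Y" "e \<in> I X"
  shows "inv_into (I X) (push X Y f) (push X Y f e) = e"
  using push_W[OF assms(1-4)] assms(5) by (auto simp: bij_betw_def)

lemma trans_lift: "zz X Y p \<Longrightarrow> e \<in> I X \<Longrightarrow> trans e p \<in> I Y \<and> zz (LO X e) (LO Y (trans e p)) (lift e p)"
proof (induction arbitrary: e rule: zigzag.induct)
  case (zz_nil X)
  then show ?case by (auto intro!: zigzag.intros LO_Obj)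
next
  case (zz_fwd X f Y Z p)
  then show ?case using zigzag_Obj[of Y Z p] by (auto intro!: zigzag.intros LO_Obj LM_in push_in)
next
  case (zz_inv Y w X Z p)
  have X: "X \<in> Obj C" using zz_inv zigzag_Obj by blast
  let ?e = "inv_into (I X) (push X Y w) e"
  have e: "?e \<in> I X" "push X Y w ?e = e" using pull zz_inv X by auto
  then show ?case
    using zz_inv X LM_in[of X Y w ?e] LM_W[of X Y w ?e] by (auto simp: Let_def intro!: zigzag.intros LO_Obj)
qed

text \<open>Each relation that generates the congruence is respected because \<open>push\<close> and
  \<open>LM\<close> are functorial, \<open>push\<close> is bijective along \<open>W\<close>, and
  \<open>LM\<close> maps \<open>W\<close> into \<open>W\<close>. So transport and lift depend on the
  class of a zigzag only.\<close>

lemma trans_lift_eqv: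
  "eqv X Y p q \<Longrightarrow> e \<in> I X \<Longrightarrow> trans e p = trans e q \<and> eqv (LO X e) (LO Y (trans e p)) (lift e p) (lift e q)"
proof (induction arbitrary: e rule: zz_eq.induct)
  case (zz_refl X Y p)
  then show ?case using trans_lift by (auto intro: zz_eq.zz_refl)
next
  case (zz_sym X Y p q)
  then show ?case by (metis zz_eq.zz_sym)
next
  case (zz_trans X Y p q r)
  then show ?case by (metis zz_eq.zz_trans)
next
  case (zz_cong X Y r Z p q V s)
  have r: "trans e r \<in> I Y" "zz (LO X e) (LO Y (trans e r)) (lift e r)"
    using trans_lift zz_cong by auto
  have e: "trans (trans e r) p = trans (trans e r) q"
    "eqv (LO Y (trans e r)) (LO Z (trans (trans e r) p)) (lift (trans e r) p) (lift (trans e r) q)"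
    using zz_cong.IH[OF r(1)] by auto
  have "zz Y Z p" using zz_cong eqv_zigzag by blast
  then have "trans (trans e r) p \<in> I Z" using trans_lift r by blast
  then show ?case
    using zz_eq.zz_cong[OF r(2) e(2)] trans_lift[OF zz_cong.hyps(3)] e(1)
    by (simp add: trans_append lift_append)
next
  case (zz_ident X)
  then show ?case
    using zz_eq.zz_ident[OF LO_Obj, of X e] by (simp add: push_ident LM_ident)
next
  case (zz_comp X Y Z f g)
  then show ?case
    using zz_eq.zz_comp[of "LO X e" C "LO Y (push X Y f e)" "LO Z (push Y Z g (push X Y f e))"
        "LM X Y f e" "LM Y Z g (push X Y f e)" W]
    by (simp add: push_comp LM_comp LO_Obj LM_in push_in)
next
  case (zz_fwd_inv X Y w)
  then show ?case
    using zz_eq.zz_fwd_inv[of "LO X e" C "LO Y (push X Y w e)" "LM X Y w e" W]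
    by (simp add: pull_push Let_def LO_Obj LM_in LM_W push_in)
next
  case (zz_inv_fwd X Y w)
  let ?e = "inv_into (I X) (push X Y w) e"
  have e: "?e \<in> I X" "push X Y w ?e = e" using pull zz_inv_fwd by auto
  then show ?case
    using zz_eq.zz_inv_fwd[of "LO X ?e" C "LO Y e" "LM X Y w ?e" W] zz_inv_fwd
      LM_in[of X Y w ?e] LM_W[of X Y w ?e]
    by (simp add: Let_def LO_Obj)
qed

abbreviation "lmz X e \<equiv> [Fwd X (LO X e) (lm X e)]"

lemma lmz_zigzag: "X \<in> Obj C \<Longrightarrow> e \<in> I X \<Longrightarrow> zz X (LO X e) (lmz X e)"
  by (auto intro!: zigzag_Fwd LO_Obj lm_in)

text \<open>The localizations are a functor of the pair of an object and an idempotent, not of the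
  object alone. The argument of \<open>natural_zigzag\<close> is therefore repeated with
  \<open>e\<close> varying along the zigzag.\<close>

lemma lift_natural:
  "zz X Y p \<Longrightarrow> e \<in> I X \<Longrightarrow> eqv X (LO Y (trans e p)) (lmz X e @ lift e p) (p @ lmz Y (trans e p))"
proof (induction arbitrary: e rule: zigzag.induct)
  case (zz_nil X)
  then show ?case using lmz_zigzag by (auto intro: zz_refl)
next
  case (zz_fwd X f Y Z p)
  have Y: "Y \<in> Obj C" using zz_fwd zigzag_Obj by blast
  let ?e = "push X Y f e"
  have e: "?e \<in> I Y" using zz_fwd Y push_in by blast
  let ?F = "Fwd (LO X e) (LO Y ?e) (LM X Y f e)"
  have "eqv X (LO Y ?e) (lmz X e @ [?F]) ([Fwd X Y f] @ lmz Y ?e)"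
    using eqv_square[of X "LO X e" Y "LO Y ?e" "lm X e" "LM X Y f e" f "lm Y ?e"] zz_fwd Y e
    by (simp add: LO_Obj lm_in LM_in lm_natural)
  then have "eqv X (LO Z (trans ?e p)) ((lmz X e @ [?F]) @ lift ?e p) (([Fwd X Y f] @ lmz Y ?e) @ lift ?e p)"
    using eqv_append_right trans_lift[OF zz_fwd.hyps(3) e] by blast
  also have "eqv X (LO Z (trans ?e p)) \<dots> ([Fwd X Y f] @ p @ lmz Z (trans ?e p))"
    using eqv_append_left[OF zigzag_Fwd zz_fwd.IH[OF e]] zz_fwd Y by simp
  finally show ?case by simp
next
  case (zz_inv Y w X Z p)
  have X: "X \<in> Obj C" using zz_inv zigzag_Obj by blast
  have w: "Y \<in> Obj C" "w \<in> Hom C X Y" "w \<in> W X Y" using zz_inv by auto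
  let ?e = "inv_into (I X) (push X Y w) e"
  have e: "?e \<in> I X" "push X Y w ?e = e" using pull[OF X w] zz_inv by auto
  let ?F = "[Fwd (LO X ?e) (LO Y e) (LM X Y w ?e)]" and ?G = "[Inv (LO X ?e) (LO Y e) (LM X Y w ?e)]"
  let ?v = "[Inv X Y w]"
  have L: "LM X Y w ?e \<in> Hom C (LO X ?e) (LO Y e)" "LM X Y w ?e \<in> W (LO X ?e) (LO Y e)"
    using LM_in[OF X w(1,2) e(1)] LM_W[OF X w e(1)] e(2) by auto
  have O: "LO X ?e \<in> Obj C" "LO Y e \<in> Obj C" using LO_Obj X e w zz_inv by auto
  have zG: "zz (LO Y e) (LO X ?e) ?G" and zv: "zz Y X ?v"
    using O L X w by (auto intro: zigzag_Inv)
  have FG: "eqv (LO X ?e) (LO X ?e) (?F @ ?G) []"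
    using zz_fwd_inv[OF O, of "LM X Y w ?e" W] L by simp
  have vw: "eqv Y Y (?v @ [Fwd X Y w]) []"
    using zz_inv_fwd[OF X w(1), of w W] w by simp
  have sq: "eqv X (LO Y e) ([Fwd X Y w] @ lmz Y e) (lmz X ?e @ ?F)"
    using eqv_square[of X Y "LO X ?e" "LO Y e" w "lm Y e" "lm X ?e" "LM X Y w ?e"] X w e O L
      lm_natural[OF X w(1,2) e(1)] zz_inv.prems
    by (simp add: lm_in)
  have zlX: "zz X (LO X ?e) (lmz X ?e)" and zlY: "zz Y (LO Y e) (lmz Y e)"
    using lmz_zigzag X w e zz_inv by auto
  have main: "eqv Y (LO X ?e) (lmz Y e @ ?G) (?v @ lmz X ?e)"
  proof -
    have "eqv Y (LO X ?e) (lmz Y e @ ?G) ((?v @ [Fwd X Y w]) @ lmz Y e @ ?G)"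
      using zz_sym[OF eqv_append_right[OF vw zigzag_append[OF zlY zG]]] by simp
    also have "eqv Y (LO X ?e) \<dots> (?v @ (lmz X ?e @ ?F) @ ?G)"
      using zz_cong[OF zv sq zG] by simp
    also have "eqv Y (LO X ?e) \<dots> (?v @ lmz X ?e)"
      using eqv_append_left[OF zigzag_append[OF zv zlX] FG] by simp
    finally show ?thesis .
  qed
  have "eqv Y (LO Z (trans ?e p)) ((lmz Y e @ ?G) @ lift ?e p) ((?v @ lmz X ?e) @ lift ?e p)"
    by (rule eqv_append_right[OF main]) (use trans_lift[OF zz_inv.hyps(3) e(1)] in blast)
  also have "eqv Y (LO Z (trans ?e p)) \<dots> (?v @ p @ lmz Z (trans ?e p))"
    using eqv_append_left[OF zv zz_inv.IH[OF e(1)]] by simp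
  finally show ?case by (simp add: Let_def)
qed

section \<open>Zigzags into a connected object factor through one localization\<close>

lemma trans_top: "zz X Y p \<Longrightarrow> trans (top X) p = top Y"
proof (induction rule: zigzag.induct)
  case (zz_fwd X f Y Z p)
  then show ?case using zigzag_Obj[of Y Z p] by (simp add: push_top)
next
  case (zz_inv Y w X Z p)
  have X: "X \<in> Obj C" using zz_inv zigzag_Obj by blast
  have "inv_into (I X) (push X Y w) (top Y) = top X"
    using pull_push[of X Y w "top X"] zz_inv X push_top top_in by simp
  then show ?case using zz_inv by simp
qed simp

text \<open>Formal inverses are the reason for \<open>Sys_reflect\<close>: the idempotents pulled
  back along \<open>w\<close> are known to form a system only after being pushed forward
  again.\<close>

lemma Sys_trans: "zz X Y p \<Longrightarrow> Sys X es \<Longrightarrow> Sys Y (map (\<lambda>e. trans e p) es)"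
proof (induction arbitrary: es rule: zigzag.induct)
  case (zz_fwd X f Y Z p)
  then show ?case using Sys_push[of X Y f es] zigzag_Obj[of Y Z p] by (fastforce simp: comp_def)
next
  case (zz_inv Y w X Z p)
  have X: "X \<in> Obj C" using zz_inv zigzag_Obj by blast
  let ?es = "map (inv_into (I X) (push X Y w)) es"
  have es: "set es \<subseteq> I Y" using Sys_in zz_inv by blast
  then have "map (push X Y w) ?es = es" "set ?es \<subseteq> I X"
    using pull[of X Y w] X zz_inv.hyps by (auto simp: subset_iff intro!: map_idI)
  then have "Sys X ?es" using Sys_reflect[of X Y w ?es] zz_inv X by auto
  then show ?case using zz_inv.IH by (fastforce simp: comp_def)
qed simp

text \<open>After localization at \<open>e\<close> the morphism \<open>f\<close> is invertible,
  while localization at the top idempotent changes \<open>B\<close> and \<open>X\<close> only by a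
  weak equivalence. Hence zigzags from \<open>B\<close> to \<open>X\<close> correspond to zigzags
  from \<open>LO A e\<close> to \<open>LO X (top X)\<close>, and a zigzag \<open>p\<close> from
  \<open>A\<close> lifts to one of these if it carries \<open>e\<close> to
  \<open>top X\<close>.\<close>

lemma connected_factorization:
  assumes A: "A \<in> Obj C" "B \<in> Obj C" "f \<in> Hom C A B" "e \<in> I A"
    and top: "push A B f e = top B" and W: "LM A B f e \<in> W (LO A e) (LO B (top B))"
    and X: "X \<in> Obj C"
  shows "\<lbrakk>zz B X g; zz B X h; eqv A X ([Fwd A B f] @ g) ([Fwd A B f] @ h)\<rbrakk> \<Longrightarrow> eqv B X g h"
    and "\<lbrakk>zz A X p; trans e p = top X\<rbrakk> \<Longrightarrow> \<exists>g. zz B X g \<and> eqv A X ([Fwd A B f] @ g) p"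
proof -
  let ?A = "LO A e" and ?B = "LO B (top B)" and ?X = "LO X (top X)"
  have O: "?A \<in> Obj C" "?B \<in> Obj C" "?X \<in> Obj C" "LM A B f e \<in> Hom C ?A ?B"
    using LO_Obj top_in A X LM_in[OF A] top by auto
  have lB: "lm B (top B) \<in> Hom C B ?B" "lm B (top B) \<in> W B ?B"
    and lX: "lm X (top X) \<in> Hom C X ?X" "lm X (top X) \<in> W X ?X"
    using A X by (auto intro: lm_in top_in lm_top_W)
  {
    assume g: "zz B X g" and h: "zz B X h" and eq: "eqv A X ([Fwd A B f] @ g) ([Fwd A B f] @ h)"
    have tg: "trans (top B) g = top X" and th: "trans (top B) h = top X"
      using trans_top g h by auto
    \<comment> \<open>Lifting at \<open>e\<close> turns the common first letter into a member of
      \<open>W\<close>, so it can be cancelled.\<close>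
    have "eqv ?A ?X (Fwd ?A ?B (LM A B f e) # lift (top B) g) (Fwd ?A ?B (LM A B f e) # lift (top B) h)"
      using trans_lift_eqv[OF eq A(4)] top tg th by simp
    then have l: "eqv ?B ?X (lift (top B) g) (lift (top B) h)"
      using eqv_cancel_left[OF O(1,2,4) W] trans_lift[OF g top_in] trans_lift[OF h top_in] A tg th by metis
    have "eqv B ?X (g @ lmz X (top X)) (lmz B (top B) @ lift (top B) g)"
      using zz_sym[OF lift_natural[OF g top_in]] A tg by simp
    also have "eqv B ?X \<dots> (lmz B (top B) @ lift (top B) h)"
      by (rule eqv_append_left[OF lmz_zigzag[OF A(2) top_in[OF A(2)]] l])
    also have "eqv B ?X \<dots> (h @ lmz X (top X))"
      using lift_natural[OF h top_in] A th by simp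
    finally show "eqv B X g h"
      using eqv_cancel_right[OF X O(3) lX g h] by blast
  next
    assume p: "zz A X p" and tp: "trans e p = top X"
    let ?i = "[Inv ?A ?B (LM A B f e)]" and ?j = "[Inv X ?X (lm X (top X))]"
    let ?lB = "lmz B (top B)"
    have zi: "zz ?B ?A ?i" and zj: "zz ?X X ?j"
      using O W X lX by (auto intro: zigzag_Inv)
    have zl: "zz ?A ?X (lift e p)" using trans_lift[OF p A(4)] tp by simp
    have zB: "zz B ?B ?lB" using lmz_zigzag[OF A(2) top_in[OF A(2)]] .
    have zA: "zz A ?A (lmz A e)" using lmz_zigzag A by blast
    \<comment> \<open>From \<open>B\<close> to its localization, back along the localized
      \<open>f\<close>, then along the lift of \<open>p\<close>, and finally from the localization
      of \<open>X\<close> back to \<open>X\<close>.\<close>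
    let ?g = "?lB @ ?i @ lift e p @ ?j"
    have g: "zz B X ?g" using zB zi zl zj by (blast intro: zigzag_append)
    have sq: "eqv A ?B ([Fwd A B f] @ ?lB) (lmz A e @ [Fwd ?A ?B (LM A B f e)])"
      using eqv_square[of A B ?A ?B f "lm B (top B)" "lm A e" "LM A B f e"] A O lB lm_in lm_natural[OF A] top
      by simp
    have FI: "eqv ?A ?A ([Fwd ?A ?B (LM A B f e)] @ ?i) []"
      using zz_fwd_inv[OF O(1,2), of "LM A B f e" W] O W by simp
    have lj: "eqv X X (lmz X (top X) @ ?j) []"
      using zz_fwd_inv[OF X O(3), of "lm X (top X)" W] lX by simp
    have "eqv A X (([Fwd A B f] @ ?lB) @ ?i @ lift e p @ ?j)
        ((lmz A e @ [Fwd ?A ?B (LM A B f e)]) @ ?i @ lift e p @ ?j)"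
      by (rule eqv_append_right[OF sq zigzag_append[OF zi zigzag_append[OF zl zj]]])
    also have "eqv A X \<dots> (lmz A e @ [] @ lift e p @ ?j)"
      using zz_cong[OF zA FI zigzag_append[OF zl zj]] by simp
    also have "eqv A X \<dots> ((p @ lmz X (top X)) @ ?j)"
      using eqv_append_right[OF lift_natural[OF p A(4)]] tp zj by simp
    also have "eqv A X \<dots> p"
      using eqv_append_left[OF p lj] by simp
    finally show "\<exists>g. zz B X g \<and> eqv A X ([Fwd A B f] @ g) p" using g by auto
  }
qed

text \<open>A zigzag \<open>q\<close> from \<open>A\<close> to a connected \<open>X\<close> carries
  \<open>es\<close> to a system at \<open>X\<close>, exactly one entry of which is the top. Only
  that index can carry a factorization, since a zigzag through \<open>Bs ! j\<close> sends
  \<open>es ! j\<close> to the top; there \<open>connected_factorization\<close> gives existence and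
  uniqueness.\<close>

lemma connected_splitting_localization:
  assumes A: "A \<in> Obj C" "Sys A es" and len: "length Bs = length es" "Bs \<noteq> []"
    and B: "\<And>i. i < length Bs \<Longrightarrow> Bs ! i \<in> Obj C \<and> conn (Bs ! i) \<and> p i \<in> Hom C A (Bs ! i) \<and>
      push A (Bs ! i) (p i) (es ! i) = top (Bs ! i) \<and>
      LM A (Bs ! i) (p i) (es ! i) \<in> W (LO A (es ! i)) (LO (Bs ! i) (top (Bs ! i)))"
    and cone: "product_cone (localization C W) A Bs (\<lambda>i. cl A (Bs ! i) [Fwd A (Bs ! i) (p i)])"
  shows "connected_splitting (localization C W) conn A Bs (\<lambda>i. cl A (Bs ! i) [Fwd A (Bs ! i) (p i)])"
  unfolding connected_splitting_def
proof (intro conjI ballI impI)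
  show "A \<in> Obj (localization C W)" using A by (simp add: localization_simps)
  fix D assume "D \<in> set Bs"
  then show "D \<in> Obj (localization C W)" "conn D" using B by (auto simp: in_set_conv_nth localization_simps)
next
  fix X h assume X: "X \<in> Obj (localization C W)" "conn X" and h: "h \<in> Hom (localization C W) A X"
  have XO: "X \<in> Obj C" using X by (simp add: localization_simps)
  obtain q where q: "zz A X q" "h = cl A X q" using h by (auto simp: localization_simps)
  have es: "es ! i \<in> I A" if "i < length es" for i
    using Sys_in[OF A] that by auto
  obtain i where i: "i < length es" "trans (es ! i) q = top X"
    and i_unique: "\<And>j. j < length es \<Longrightarrow> trans (es ! j) q = top X \<Longrightarrow> j = i"
    using Sys_conn[OF XO X(2) Sys_trans[OF q(1) A(2)]] by auto
  have zp: "zz A (Bs ! j) [Fwd A (Bs ! j) (p j)]" if "j < length es" for j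
    using A B[of j] that len by (auto intro: zigzag_Fwd)
  note cf = connected_factorization[OF A(1) _ _ es _ _ XO]
  obtain g where g: "zz (Bs ! i) X g" "eqv A X ([Fwd A (Bs ! i) (p i)] @ g) q"
    using cf(2)[OF _ _ i(1) _ _ q(1) i(2), of "Bs ! i" "p i"] B[of i] i len by auto
  show "\<exists>!ig. fst ig < length Bs \<and> snd ig \<in> Hom (localization C W) (Bs ! fst ig) X \<and>
      Comp (localization C W) A (Bs ! fst ig) X (snd ig) (cl A (Bs ! fst ig) [Fwd A (Bs ! fst ig) (p (fst ig))]) = h"
  proof (rule ex1I[of _ "(i, cl (Bs ! i) X g)"])
    show "fst (i, cl (Bs ! i) X g) < length Bs \<and>
        snd (i, cl (Bs ! i) X g) \<in> Hom (localization C W) (Bs ! fst (i, cl (Bs ! i) X g)) X \<and>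
        Comp (localization C W) A (Bs ! fst (i, cl (Bs ! i) X g)) X (snd (i, cl (Bs ! i) X g))
          (cl A (Bs ! fst (i, cl (Bs ! i) X g)) [Fwd A (Bs ! fst (i, cl (Bs ! i) X g)) (p (fst (i, cl (Bs ! i) X g)))]) = h"
      using i len g q cl_in_Hom[OF g(1)] comp_cl[OF zp[OF i(1)] g(1)]
        cl_eq_iff[OF zigzag_append[OF zp[OF i(1)] g(1)]] by simp
  next
    fix jk
    assume jk: "fst jk < length Bs \<and> snd jk \<in> Hom (localization C W) (Bs ! fst jk) X \<and>
      Comp (localization C W) A (Bs ! fst jk) X (snd jk) (cl A (Bs ! fst jk) [Fwd A (Bs ! fst jk) (p (fst jk))]) = h"
    obtain j k where jk_eq: "jk = (j, k)" by (cases jk)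
    have j: "j < length es" using jk jk_eq len by simp
    obtain k' where k': "zz (Bs ! j) X k'" "k = cl (Bs ! j) X k'"
      using jk jk_eq by (auto simp: localization_simps)
    have e: "eqv A X ([Fwd A (Bs ! j) (p j)] @ k') q"
      using jk jk_eq k'(2) q(2) comp_cl[OF zp[OF j] k'(1)] cl_eq_iff[OF zigzag_append[OF zp[OF j] k'(1)], of q]
      by simp
    have "trans (es ! j) q = trans (es ! j) ([Fwd A (Bs ! j) (p j)] @ k')"
      using trans_lift_eqv[OF e es[OF j]] by simp
    also have "\<dots> = top X" using B[of j] j len trans_top[OF k'(1)] by simp
    finally have ji: "j = i" using i_unique j by blast
    have "eqv A X ([Fwd A (Bs ! i) (p i)] @ k') ([Fwd A (Bs ! i) (p i)] @ g)"
      using e g(2) ji by (auto intro: zz_trans zz_sym)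
    then have "eqv (Bs ! i) X k' g"
      using cf(1)[OF _ _ i(1), of "Bs ! i" "p i" k' g] B[of i] i len k' g ji by auto
    then show "jk = (i, cl (Bs ! i) X g)"
      using jk_eq ji k' cl_eq_iff[OF k'(1)] by simp
  qed
qed (use len cone in auto)

end

section \<open>Arithmetic in a cdga\<close>

lemma linear_mapsD:
  assumes "f \<in> linear_maps K M N"
  shows "x \<in> carrier M \<Longrightarrow> f x \<in> carrier N"
    "x \<in> carrier M \<Longrightarrow> y \<in> carrier M \<Longrightarrow> f (x \<oplus>\<^bsub>M\<^esub> y) = f x \<oplus>\<^bsub>N\<^esub> f y"
    "c \<in> carrier K \<Longrightarrow> x \<in> carrier M \<Longrightarrow> f (c \<odot>\<^bsub>M\<^esub> x) = c \<odot>\<^bsub>N\<^esub> f x"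
  using assms by (auto simp: linear_maps_def)

lemma linear_maps_zero_neg:
  assumes f: "f \<in> linear_maps K M N" and "abelian_group M" "abelian_group N"
  shows "f \<zero>\<^bsub>M\<^esub> = \<zero>\<^bsub>N\<^esub>" "x \<in> carrier M \<Longrightarrow> f (\<ominus>\<^bsub>M\<^esub> x) = \<ominus>\<^bsub>N\<^esub> f x"
proof -
  interpret M: abelian_group M by fact
  interpret N: abelian_group N by fact
  have "f \<zero>\<^bsub>M\<^esub> \<oplus>\<^bsub>N\<^esub> f \<zero>\<^bsub>M\<^esub> = f \<zero>\<^bsub>M\<^esub> \<oplus>\<^bsub>N\<^esub> \<zero>\<^bsub>N\<^esub>"
    using linear_mapsD(1,2)[OF f] by (metis M.l_zero M.zero_closed N.r_zero)
  then show z: "f \<zero>\<^bsub>M\<^esub> = \<zero>\<^bsub>N\<^esub>"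
    using linear_mapsD(1)[OF f] by (metis M.zero_closed N.add.l_cancel_one' N.r_zero N.a_closed)
  assume x: "x \<in> carrier M"
  then have "f (\<ominus>\<^bsub>M\<^esub> x) \<oplus>\<^bsub>N\<^esub> f x = \<zero>\<^bsub>N\<^esub>"
    using linear_mapsD(2)[OF f, of "\<ominus>\<^bsub>M\<^esub> x" x] z by (simp add: M.l_neg)
  then show "f (\<ominus>\<^bsub>M\<^esub> x) = \<ominus>\<^bsub>N\<^esub> f x"
    using x linear_mapsD(1)[OF f] by (metis M.a_inv_closed N.minus_equality)
qed

context cdga
begin

sublocale gr: abelian_group "gr A n" for n
  using gr_module[of n] by (rule module.axioms)

sublocale K: cring K
  using gr_module[of 0] by (rule module.axioms)

lemma smult_rules:
  shows smult_closed [simp]: "\<lbrakk>c \<in> carrier K; x \<in> carrier (gr A n)\<rbrakk> \<Longrightarrow> c \<odot>\<^bsub>gr A n\<^esub> x \<in> carrier (gr A n)"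
    and smult_l_distr: "\<lbrakk>c \<in> carrier K; d \<in> carrier K; x \<in> carrier (gr A n)\<rbrakk>
      \<Longrightarrow> (c \<oplus>\<^bsub>K\<^esub> d) \<odot>\<^bsub>gr A n\<^esub> x = c \<odot>\<^bsub>gr A n\<^esub> x \<oplus>\<^bsub>gr A n\<^esub> d \<odot>\<^bsub>gr A n\<^esub> x"
    and smult_r_distr: "\<lbrakk>c \<in> carrier K; x \<in> carrier (gr A n); y \<in> carrier (gr A n)\<rbrakk>
      \<Longrightarrow> c \<odot>\<^bsub>gr A n\<^esub> (x \<oplus>\<^bsub>gr A n\<^esub> y) = c \<odot>\<^bsub>gr A n\<^esub> x \<oplus>\<^bsub>gr A n\<^esub> c \<odot>\<^bsub>gr A n\<^esub> y"
    and smult_assoc1: "\<lbrakk>c \<in> carrier K; d \<in> carrier K; x \<in> carrier (gr A n)\<rbrakk>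
      \<Longrightarrow> (c \<otimes>\<^bsub>K\<^esub> d) \<odot>\<^bsub>gr A n\<^esub> x = c \<odot>\<^bsub>gr A n\<^esub> (d \<odot>\<^bsub>gr A n\<^esub> x)"
    and smult_one [simp]: "x \<in> carrier (gr A n) \<Longrightarrow> \<one>\<^bsub>K\<^esub> \<odot>\<^bsub>gr A n\<^esub> x = x"
  using gr_module[of n] by (simp_all add: module_def module_axioms_def)

lemma mul_rules:
  assumes "x \<in> carrier (gr A i)" "y \<in> carrier (gr A j)"
  shows mul_closed [simp]: "mul A i j x y \<in> carrier (gr A (i + j))"
    and mul_add_left: "x' \<in> carrier (gr A i) \<Longrightarrow>
      mul A i j (x \<oplus>\<^bsub>gr A i\<^esub> x') y = mul A i j x y \<oplus>\<^bsub>gr A (i + j)\<^esub> mul A i j x' y"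
    and mul_add_right: "y' \<in> carrier (gr A j) \<Longrightarrow>
      mul A i j x (y \<oplus>\<^bsub>gr A j\<^esub> y') = mul A i j x y \<oplus>\<^bsub>gr A (i + j)\<^esub> mul A i j x y'"
    and mul_smult_left: "c \<in> carrier K \<Longrightarrow> mul A i j (c \<odot>\<^bsub>gr A i\<^esub> x) y = c \<odot>\<^bsub>gr A (i + j)\<^esub> mul A i j x y"
    and mul_smult_right: "c \<in> carrier K \<Longrightarrow> mul A i j x (c \<odot>\<^bsub>gr A j\<^esub> y) = c \<odot>\<^bsub>gr A (i + j)\<^esub> mul A i j x y"
    and mul_neg_right: "mul A i j x (\<ominus>\<^bsub>gr A j\<^esub> y) = \<ominus>\<^bsub>gr A (i + j)\<^esub> mul A i j x y"
  using linear_mapsD[OF mul_left[OF assms(2), of i]] linear_mapsD[OF mul_right[OF assms(1), of j]]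
    linear_maps_zero_neg(2)[OF mul_right[OF assms(1), of j] gr.abelian_group_axioms gr.abelian_group_axioms]
    assms by simp_all

lemma mul_zero_left [simp]: "y \<in> carrier (gr A j) \<Longrightarrow> mul A i j \<zero>\<^bsub>gr A i\<^esub> y = \<zero>\<^bsub>gr A (i + j)\<^esub>"
  using linear_maps_zero_neg(1)[OF mul_left gr.abelian_group_axioms gr.abelian_group_axioms] .

lemma mul_zero_right [simp]: "x \<in> carrier (gr A i) \<Longrightarrow> mul A i j x \<zero>\<^bsub>gr A j\<^esub> = \<zero>\<^bsub>gr A (i + j)\<^esub>"
  using linear_maps_zero_neg(1)[OF mul_right gr.abelian_group_axioms gr.abelian_group_axioms] .

lemma dif_rules:
  assumes "x \<in> carrier (gr A n)"
  shows dif_closed [simp]: "dif A n x \<in> carrier (gr A (n + 1))"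
    and dif_add: "y \<in> carrier (gr A n) \<Longrightarrow> dif A n (x \<oplus>\<^bsub>gr A n\<^esub> y) = dif A n x \<oplus>\<^bsub>gr A (n + 1)\<^esub> dif A n y"
    and dif_smult: "c \<in> carrier K \<Longrightarrow> dif A n (c \<odot>\<^bsub>gr A n\<^esub> x) = c \<odot>\<^bsub>gr A (n + 1)\<^esub> dif A n x"
    and dif_neg: "dif A n (\<ominus>\<^bsub>gr A n\<^esub> x) = \<ominus>\<^bsub>gr A (n + 1)\<^esub> dif A n x"
  using assms linear_mapsD[OF dif_linear[of n]]
    linear_maps_zero_neg(2)[OF dif_linear[of n] gr.abelian_group_axioms gr.abelian_group_axioms]
  by auto

lemma dif_zero [simp]: "dif A n \<zero>\<^bsub>gr A n\<^esub> = \<zero>\<^bsub>gr A (n + 1)\<^esub>"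
  using linear_maps_zero_neg(1)[OF dif_linear gr.abelian_group_axioms gr.abelian_group_axioms] .

lemma signed_closed [simp]: "x \<in> carrier (gr A n) \<Longrightarrow> signed (gr A n) k x \<in> carrier (gr A n)"
  by (simp add: signed_def)

declare unity_in [simp]

text \<open>Multiplication by elements of degree 0 has sign-free rules; stating them separately
  keeps the degree \<open>n\<close> instead of \<open>0 + n\<close>.\<close>

abbreviation act :: "int \<Rightarrow> 'a \<Rightarrow> 'a \<Rightarrow> 'a" where "act n s x \<equiv> mul A 0 n s x"

lemma act_closed [simp]: "\<lbrakk>s \<in> carrier (gr A 0); x \<in> carrier (gr A n)\<rbrakk> \<Longrightarrow> act n s x \<in> carrier (gr A n)"
  using mul_closed[of s 0 x n] by simp

lemma act_commute: "\<lbrakk>s \<in> carrier (gr A 0); x \<in> carrier (gr A n)\<rbrakk> \<Longrightarrow> mul A n 0 x s = act n s x"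
  using mul_commute[of s 0 x n] by (simp add: signed_def)

lemma act_comm0: "\<lbrakk>s \<in> carrier (gr A 0); t \<in> carrier (gr A 0)\<rbrakk> \<Longrightarrow> act 0 s t = act 0 t s"
  using act_commute[of t s 0] by simp

lemma act_act:
  "\<lbrakk>s \<in> carrier (gr A 0); t \<in> carrier (gr A 0); x \<in> carrier (gr A n)\<rbrakk> \<Longrightarrow> act n (act 0 s t) x = act n s (act n t x)"
  using mul_assoc[of s 0 t 0 x n] by simp

lemma act_lcomm:
  "\<lbrakk>s \<in> carrier (gr A 0); t \<in> carrier (gr A 0); x \<in> carrier (gr A n)\<rbrakk> \<Longrightarrow> act n s (act n t x) = act n t (act n s x)"
  using act_act[of s t x n] act_act[of t s x n] act_comm0 by simp

lemma act_mul_left: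
  "\<lbrakk>s \<in> carrier (gr A 0); x \<in> carrier (gr A i); y \<in> carrier (gr A j)\<rbrakk>
    \<Longrightarrow> mul A i j (act i s x) y = act (i + j) s (mul A i j x y)"
  using mul_assoc[of s 0 x i y j] by simp

lemma act_mul_right:
  assumes "s \<in> carrier (gr A 0)" "x \<in> carrier (gr A i)" "y \<in> carrier (gr A j)"
  shows "mul A i j x (act j s y) = act (i + j) s (mul A i j x y)"
  using mul_assoc[of x i s 0 y j] act_commute[of s x i] act_mul_left[OF assms] assms by simp

lemma act_add: "\<lbrakk>s \<in> carrier (gr A 0); x \<in> carrier (gr A n); y \<in> carrier (gr A n)\<rbrakk>
    \<Longrightarrow> act n s (x \<oplus>\<^bsub>gr A n\<^esub> y) = act n s x \<oplus>\<^bsub>gr A n\<^esub> act n s y"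
  using mul_add_right[of s 0 x n y] by simp

lemma act_add_left: "\<lbrakk>s \<in> carrier (gr A 0); t \<in> carrier (gr A 0); x \<in> carrier (gr A n)\<rbrakk>
    \<Longrightarrow> act n (s \<oplus>\<^bsub>gr A 0\<^esub> t) x = act n s x \<oplus>\<^bsub>gr A n\<^esub> act n t x"
  using mul_add_left[of s 0 x n t] by simp

lemma act_smult: "\<lbrakk>c \<in> carrier K; s \<in> carrier (gr A 0); x \<in> carrier (gr A n)\<rbrakk>
    \<Longrightarrow> act n s (c \<odot>\<^bsub>gr A n\<^esub> x) = c \<odot>\<^bsub>gr A n\<^esub> act n s x"
  using mul_smult_right[of s 0 x n c] by simp

lemma act_neg: "\<lbrakk>s \<in> carrier (gr A 0); x \<in> carrier (gr A n)\<rbrakk> \<Longrightarrow> act n s (\<ominus>\<^bsub>gr A n\<^esub> x) = \<ominus>\<^bsub>gr A n\<^esub> act n s x"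
  using mul_neg_right[of s 0 x n] by simp

lemma act_zero [simp]: "s \<in> carrier (gr A 0) \<Longrightarrow> act n s \<zero>\<^bsub>gr A n\<^esub> = \<zero>\<^bsub>gr A n\<^esub>"
  and zero_act [simp]: "x \<in> carrier (gr A n) \<Longrightarrow> act n \<zero>\<^bsub>gr A 0\<^esub> x = \<zero>\<^bsub>gr A n\<^esub>"
  using mul_zero_right[of s 0 n] mul_zero_left[of x n 0] by auto

lemma unity_act [simp]: "x \<in> carrier (gr A n) \<Longrightarrow> act n (unity A) x = x"
  by (rule unity_mul)

section \<open>Cocycles and cohomology classes\<close>

lemma cocycles_iff: "x \<in> cocycles A n \<longleftrightarrow> x \<in> carrier (gr A n) \<and> dif A n x = \<zero>\<^bsub>gr A (n + 1)\<^esub>"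
  by (auto simp: cocycles_def a_kernel_def kernel_def)

lemma coboundariesE:
  assumes "x \<in> coboundaries A n"
  obtains y where "y \<in> carrier (gr A (n - 1))" "x = dif A (n - 1) y"
  using assms by (auto simp: coboundaries_def)

lemma coboundariesI: "y \<in> carrier (gr A (n - 1)) \<Longrightarrow> dif A (n - 1) y \<in> coboundaries A n"
  by (auto simp: coboundaries_def)

lemma cocycles_carrier [simp]: "x \<in> cocycles A n \<Longrightarrow> x \<in> carrier (gr A n)"
  by (simp add: cocycles_iff)

lemma coboundaries_cocycles [simp]: "x \<in> coboundaries A n \<Longrightarrow> x \<in> cocycles A n"
  using dif_closed[of _ "n - 1"] dif_dif[of _ "n - 1"] by (auto simp: cocycles_iff add.commute elim!: coboundariesE)

lemma coboundaries_carrier [simp]: "x \<in> coboundaries A n \<Longrightarrow> x \<in> carrier (gr A n)"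
  by (rule cocycles_carrier[OF coboundaries_cocycles])

lemma cocycles_closed [simp]:
  "\<zero>\<^bsub>gr A n\<^esub> \<in> cocycles A n"
  "\<lbrakk>x \<in> cocycles A n; y \<in> cocycles A n\<rbrakk> \<Longrightarrow> x \<oplus>\<^bsub>gr A n\<^esub> y \<in> cocycles A n"
  "x \<in> cocycles A n \<Longrightarrow> \<ominus>\<^bsub>gr A n\<^esub> x \<in> cocycles A n"
  "\<lbrakk>c \<in> carrier K; x \<in> cocycles A n\<rbrakk> \<Longrightarrow> c \<odot>\<^bsub>gr A n\<^esub> x \<in> cocycles A n"
proof -
  have "c \<odot>\<^bsub>gr A n\<^esub> \<zero>\<^bsub>gr A n\<^esub> = \<zero>\<^bsub>gr A n\<^esub>" if "c \<in> carrier K" for c n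
    using module.smult_r_null[OF gr_module that] .
  then show "\<lbrakk>c \<in> carrier K; x \<in> cocycles A n\<rbrakk> \<Longrightarrow> c \<odot>\<^bsub>gr A n\<^esub> x \<in> cocycles A n"
    by (auto simp: cocycles_iff dif_smult)
qed (auto simp: cocycles_iff dif_add dif_neg)

lemma coboundaries_zero [simp]: "\<zero>\<^bsub>gr A n\<^esub> \<in> coboundaries A n"
  using coboundariesI[of "\<zero>\<^bsub>gr A (n - 1)\<^esub>" n] by simp

lemma coboundaries_add [simp]:
  assumes "x \<in> coboundaries A n" "y \<in> coboundaries A n"
  shows "x \<oplus>\<^bsub>gr A n\<^esub> y \<in> coboundaries A n"
proof -
  obtain x' y' where x': "x' \<in> carrier (gr A (n - 1))" "x = dif A (n - 1) x'"
    and y': "y' \<in> carrier (gr A (n - 1))" "y = dif A (n - 1) y'"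
    using assms by (auto elim!: coboundariesE)
  then have "x \<oplus>\<^bsub>gr A n\<^esub> y = dif A (n - 1) (x' \<oplus>\<^bsub>gr A (n - 1)\<^esub> y')" by (simp add: dif_add)
  then show ?thesis using coboundariesI[of "x' \<oplus>\<^bsub>gr A (n - 1)\<^esub> y'" n] x' y' by simp
qed

lemma coboundaries_neg [simp]:
  assumes "x \<in> coboundaries A n"
  shows "\<ominus>\<^bsub>gr A n\<^esub> x \<in> coboundaries A n"
proof -
  obtain y where y: "y \<in> carrier (gr A (n - 1))" "x = dif A (n - 1) y"
    using assms by (rule coboundariesE)
  then have "\<ominus>\<^bsub>gr A n\<^esub> x = dif A (n - 1) (\<ominus>\<^bsub>gr A (n - 1)\<^esub> y)" by (simp add: dif_neg)
  then show ?thesis using coboundariesI[of "\<ominus>\<^bsub>gr A (n - 1)\<^esub> y" n] y by simp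
qed

lemma coboundaries_smult [simp]:
  assumes "c \<in> carrier K" "x \<in> coboundaries A n"
  shows "c \<odot>\<^bsub>gr A n\<^esub> x \<in> coboundaries A n"
proof -
  obtain y where y: "y \<in> carrier (gr A (n - 1))" "x = dif A (n - 1) y"
    using assms by (blast elim: coboundariesE)
  then have "c \<odot>\<^bsub>gr A n\<^esub> x = dif A (n - 1) (c \<odot>\<^bsub>gr A (n - 1)\<^esub> y)" using assms by (simp add: dif_smult)
  then show ?thesis using coboundariesI[of "c \<odot>\<^bsub>gr A (n - 1)\<^esub> y" n] y assms by simp
qed

lemma dif_act:
  assumes "s \<in> cocycles A 0" "x \<in> carrier (gr A n)"
  shows "dif A n (act n s x) = act (n + 1) s (dif A n x)"
  using leibniz[of s 0 x n] assms act_closed[OF _ dif_closed[OF assms(2)], of s]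
  by (simp add: cocycles_iff signed_def add.commute)

text \<open>The Leibniz rule for 1 = 1 * 1 reads d1 = d1 + d1.\<close>

lemma unity_cocycle [simp]: "unity A \<in> cocycles A 0"
proof -
  let ?d = "dif A 0 (unity A)"
  have d: "?d \<in> carrier (gr A 1)" using dif_closed[OF unity_in] by simp
  have "?d = ?d \<oplus>\<^bsub>gr A 1\<^esub> ?d"
    using leibniz[OF unity_in unity_in] d mul_unity[OF d] unity_mul[OF d] mul_unity[OF unity_in]
    by (simp add: signed_def)
  then have "?d = \<zero>\<^bsub>gr A 1\<^esub>" using d by (metis gr.add.l_cancel_one' gr.a_closed)
  then show ?thesis by (simp add: cocycles_iff)
qed

lemma act_cocycles [simp]: "\<lbrakk>s \<in> cocycles A 0; x \<in> cocycles A n\<rbrakk> \<Longrightarrow> act n s x \<in> cocycles A n"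
  by (simp add: cocycles_iff[of _ n] cocycles_iff[of "act n s x"] dif_act)

lemma act_coboundaries [simp]:
  assumes "s \<in> cocycles A 0" "x \<in> coboundaries A n"
  shows "act n s x \<in> coboundaries A n"
proof -
  obtain y where y: "y \<in> carrier (gr A (n - 1))" "x = dif A (n - 1) y"
    using assms by (blast elim: coboundariesE)
  then have "act n s x = dif A (n - 1) (act (n - 1) s y)" using assms dif_act[of s y "n - 1"] by simp
  then show ?thesis using coboundariesI[of "act (n - 1) s y" n] y assms by simp
qed

text \<open>The other term of the Leibniz rule contains dx = 0. So exact elements of degree 0 act as
  0 on cohomology.\<close>

lemma dif_mul_cocycle:
  assumes "y \<in> carrier (gr A (- 1))" "x \<in> cocycles A n"
  shows "act n (dif A (- 1) y) x = dif A (n - 1) (mul A (- 1) n y x)"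
proof -
  have "dif A (- 1 + n) (mul A (- 1) n y x) = act n (dif A (- 1) y) x"
    using leibniz[of y "- 1" x n] assms mul_closed[of y "- 1" "\<zero>\<^bsub>gr A (n + 1)\<^esub>" "n + 1"]
      dif_closed[OF assms(1)]
    by (simp add: cocycles_iff signed_def)
  then show ?thesis by simp
qed

lemma coboundary_act [simp]:
  assumes "s \<in> coboundaries A 0" "x \<in> cocycles A n"
  shows "act n s x \<in> coboundaries A n"
proof -
  obtain y where y: "y \<in> carrier (gr A (- 1))" "s = dif A (- 1) y"
    using assms by (auto elim: coboundariesE)
  then show ?thesis
    using dif_mul_cocycle[OF y(1) assms(2)] coboundariesI[of "mul A (- 1) n y x" n] mul_closed[of y "- 1" x n] assms
    by simp
qed

lemma coh_class_iff: "y \<in> coh_class A n x \<longleftrightarrow> (\<exists>b \<in> coboundaries A n. y = b \<oplus>\<^bsub>gr A n\<^esub> x)"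
  by (auto simp: coh_class_def a_r_coset_def r_coset_def)

lemma coh_class_minus_iff:
  assumes "x \<in> carrier (gr A n)" "y \<in> carrier (gr A n)"
  shows "y \<in> coh_class A n x \<longleftrightarrow> y \<ominus>\<^bsub>gr A n\<^esub> x \<in> coboundaries A n"
proof
  assume "y \<in> coh_class A n x"
  then obtain b where "b \<in> coboundaries A n" "y = b \<oplus>\<^bsub>gr A n\<^esub> x" by (auto simp: coh_class_iff)
  then show "y \<ominus>\<^bsub>gr A n\<^esub> x \<in> coboundaries A n"
    using assms by (simp add: gr.minus_eq gr.a_assoc gr.r_neg)
next
  assume "y \<ominus>\<^bsub>gr A n\<^esub> x \<in> coboundaries A n"
  then show "y \<in> coh_class A n x"
    using assms by (auto simp: coh_class_iff gr.minus_eq gr.a_assoc gr.l_neg intro!: bexI[of _ "y \<ominus>\<^bsub>gr A n\<^esub> x"])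
qed

lemma coh_class_refl [simp]: "x \<in> carrier (gr A n) \<Longrightarrow> x \<in> coh_class A n x"
  by (auto simp: coh_class_iff intro!: bexI[of _ "\<zero>\<^bsub>gr A n\<^esub>"])

lemma coh_class_sym:
  assumes "y \<in> coh_class A n x" "x \<in> carrier (gr A n)"
  shows "x \<in> coh_class A n y"
proof -
  obtain b where b: "b \<in> coboundaries A n" "y = b \<oplus>\<^bsub>gr A n\<^esub> x" using assms by (auto simp: coh_class_iff)
  then have "x = \<ominus>\<^bsub>gr A n\<^esub> b \<oplus>\<^bsub>gr A n\<^esub> y"
    using assms by (simp add: gr.a_assoc[symmetric] gr.l_neg)
  then show ?thesis using b coboundaries_neg by (auto simp: coh_class_iff)
qed

lemma coh_class_trans:
  assumes "z \<in> coh_class A n y" "y \<in> coh_class A n x" "x \<in> carrier (gr A n)"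
  shows "z \<in> coh_class A n x"
proof -
  obtain b c where "b \<in> coboundaries A n" "y = b \<oplus>\<^bsub>gr A n\<^esub> x" "c \<in> coboundaries A n" "z = c \<oplus>\<^bsub>gr A n\<^esub> y"
    using assms by (auto simp: coh_class_iff)
  then have "z = (c \<oplus>\<^bsub>gr A n\<^esub> b) \<oplus>\<^bsub>gr A n\<^esub> x" "c \<oplus>\<^bsub>gr A n\<^esub> b \<in> coboundaries A n"
    using assms by (simp_all add: gr.a_assoc)
  then show ?thesis by (auto simp: coh_class_iff)
qed

lemma coh_class_eq:
  assumes "y \<in> coh_class A n x" "x \<in> carrier (gr A n)"
  shows "coh_class A n y = coh_class A n x"
proof -
  have y: "y \<in> carrier (gr A n)" using assms by (auto simp: coh_class_iff)
  then show ?thesis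
    using coh_class_trans[of _ n x y] coh_class_trans[of _ n y x] coh_class_sym[OF assms] assms by blast
qed

lemma coh_class_eq_iff:
  "\<lbrakk>x \<in> carrier (gr A n); y \<in> carrier (gr A n)\<rbrakk> \<Longrightarrow> coh_class A n y = coh_class A n x \<longleftrightarrow> y \<in> coh_class A n x"
  using coh_class_eq coh_class_refl by blast

lemma coh_class_zero: "coh_class A n \<zero>\<^bsub>gr A n\<^esub> = coboundaries A n"
  by (auto simp: coh_class_iff)

lemma coh_class_cocycle: "\<lbrakk>y \<in> coh_class A n x; x \<in> cocycles A n\<rbrakk> \<Longrightarrow> y \<in> cocycles A n"
  by (auto simp: coh_class_iff)

lemma coh_class_coboundary: "\<lbrakk>y \<in> coh_class A n x; x \<in> carrier (gr A n)\<rbrakk> \<Longrightarrow> y \<in> coboundaries A n \<longleftrightarrow> x \<in> coboundaries A n"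
  using coh_class_eq[of y n x] coh_class_eq_iff[of "\<zero>\<^bsub>gr A n\<^esub>" n] coh_class_refl[of y n]
  by (metis coboundaries_carrier coh_class_eq_iff coh_class_sym coh_class_zero gr.zero_closed)

lemma coh_class_add:
  assumes "x' \<in> coh_class A n x" "y' \<in> coh_class A n y" "x \<in> carrier (gr A n)" "y \<in> carrier (gr A n)"
  shows "x' \<oplus>\<^bsub>gr A n\<^esub> y' \<in> coh_class A n (x \<oplus>\<^bsub>gr A n\<^esub> y)"
proof -
  obtain b c where bc: "b \<in> coboundaries A n" "x' = b \<oplus>\<^bsub>gr A n\<^esub> x" "c \<in> coboundaries A n" "y' = c \<oplus>\<^bsub>gr A n\<^esub> y"
    using assms by (auto simp: coh_class_iff)
  then have "x' \<oplus>\<^bsub>gr A n\<^esub> y' = (b \<oplus>\<^bsub>gr A n\<^esub> c) \<oplus>\<^bsub>gr A n\<^esub> (x \<oplus>\<^bsub>gr A n\<^esub> y)"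
    using assms by (simp add: gr.a_assoc gr.a_lcomm)
  then show ?thesis using coboundaries_add[of b n c] bc by (auto simp: coh_class_iff)
qed

lemma coh_class_smult:
  assumes "c \<in> carrier K" "x' \<in> coh_class A n x" "x \<in> carrier (gr A n)"
  shows "c \<odot>\<^bsub>gr A n\<^esub> x' \<in> coh_class A n (c \<odot>\<^bsub>gr A n\<^esub> x)"
  using assms by (auto simp: coh_class_iff smult_r_distr)

lemma coh_class_act:
  assumes "s' \<in> coh_class A 0 s" "x' \<in> coh_class A n x" "s \<in> cocycles A 0" "x \<in> cocycles A n"
  shows "act n s' x' \<in> coh_class A n (act n s x)"
proof -
  have s': "s' \<in> cocycles A 0" and x': "x' \<in> cocycles A n" using assms coh_class_cocycle by blast+
  obtain b c where bc: "b \<in> coboundaries A 0" "s' = b \<oplus>\<^bsub>gr A 0\<^esub> s" "c \<in> coboundaries A n" "x' = c \<oplus>\<^bsub>gr A n\<^esub> x"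
    using assms by (auto simp: coh_class_iff)
  \<comment> \<open>The difference of the products is (s' - s) x' + s (x' - x), with one exact
    factor in each term.\<close>
  then have "act n s' x' = (act n b x' \<oplus>\<^bsub>gr A n\<^esub> act n s c) \<oplus>\<^bsub>gr A n\<^esub> act n s x"
    using assms x' by (simp add: act_add_left act_add gr.a_ac)
  moreover have "act n b x' \<oplus>\<^bsub>gr A n\<^esub> act n s c \<in> coboundaries A n"
    using bc assms x' by simp
  ultimately show ?thesis by (auto simp: coh_class_iff)
qed

lemma cohomologyE:
  assumes "X \<in> cohomology A n"
  obtains x where "x \<in> cocycles A n" "X = coh_class A n x"
  using assms by (auto simp: cohomology_def)

lemma cohomologyI: "x \<in> cocycles A n \<Longrightarrow> coh_class A n x \<in> cohomology A n"
  by (simp add: cohomology_def)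

lemma cohomology_mem:
  assumes "X \<in> cohomology A n" "x \<in> X"
  shows "x \<in> cocycles A n" "X = coh_class A n x"
proof -
  obtain y where y: "y \<in> cocycles A n" "X = coh_class A n y" using assms(1) by (rule cohomologyE)
  then show "x \<in> cocycles A n" "X = coh_class A n x"
    using coh_class_cocycle[of x n y] coh_class_eq[of x n y] assms(2) by auto
qed

lemma cohomology_nonempty: "X \<in> cohomology A n \<Longrightarrow> \<exists>x. x \<in> X"
  using coh_class_refl cocycles_carrier by (blast elim: cohomologyE)

lemma coh_class_eq_coboundaries:
  "x \<in> carrier (gr A n) \<Longrightarrow> coh_class A n x = coboundaries A n \<longleftrightarrow> x \<in> coboundaries A n"
  using coh_class_eq_iff[of "\<zero>\<^bsub>gr A n\<^esub>" n x] by (simp add: coh_class_zero)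

lemma cohomology_trivial_iff:
  "cohomology A n = {coboundaries A n} \<longleftrightarrow> (\<forall>x \<in> cocycles A n. x \<in> coboundaries A n)"
proof -
  have "coboundaries A n \<in> cohomology A n"
    unfolding cohomology_def by (rule image_eqI[of _ _ "\<zero>\<^bsub>gr A n\<^esub>"]) (simp_all add: coh_class_zero)
  then have "cohomology A n = {coboundaries A n} \<longleftrightarrow> (\<forall>X \<in> cohomology A n. X = coboundaries A n)"
    by blast
  then show ?thesis by (simp add: cohomology_def coh_class_eq_coboundaries)
qed

end

section \<open>Morphisms of cdgas and quasi-isomorphisms\<close>

locale cdga_mor = A: cdga K A + B: cdga K B for K :: "'k ring" and A :: "('k, 'a) dga" and B :: "('k, 'b) dga" +
  fixes f
  assumes f_hom: "f \<in> cdga_hom K A B"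
begin

lemma f_linear: "f n \<in> linear_maps K (gr A n) (gr B n)"
  using f_hom by (simp add: cdga_hom_def)

lemma f_rules:
  assumes "x \<in> carrier (gr A n)"
  shows f_closed [simp]: "f n x \<in> carrier (gr B n)"
    and f_add: "y \<in> carrier (gr A n) \<Longrightarrow> f n (x \<oplus>\<^bsub>gr A n\<^esub> y) = f n x \<oplus>\<^bsub>gr B n\<^esub> f n y"
    and f_smult: "c \<in> carrier K \<Longrightarrow> f n (c \<odot>\<^bsub>gr A n\<^esub> x) = c \<odot>\<^bsub>gr B n\<^esub> f n x"
    and f_neg: "f n (\<ominus>\<^bsub>gr A n\<^esub> x) = \<ominus>\<^bsub>gr B n\<^esub> f n x"
    and f_dif: "f (n + 1) (dif A n x) = dif B n (f n x)"
    and f_mul: "z \<in> carrier (gr A m) \<Longrightarrow> f (n + m) (mul A n m x z) = mul B n m (f n x) (f m z)"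
proof -
  show "f (n + 1) (dif A n x) = dif B n (f n x)"
    "z \<in> carrier (gr A m) \<Longrightarrow> f (n + m) (mul A n m x z) = mul B n m (f n x) (f m z)"
    using f_hom assms unfolding cdga_hom_def by blast+
qed (use assms linear_mapsD[OF f_linear[of n]]
    linear_maps_zero_neg(2)[OF f_linear[of n] A.gr.abelian_group_axioms B.gr.abelian_group_axioms] in blast)+

lemma f_act: "\<lbrakk>s \<in> carrier (gr A 0); x \<in> carrier (gr A n)\<rbrakk> \<Longrightarrow> f n (A.act n s x) = B.act n (f 0 s) (f n x)"
  using f_mul[of s 0 x n] by simp

lemma f_zero [simp]: "f n \<zero>\<^bsub>gr A n\<^esub> = \<zero>\<^bsub>gr B n\<^esub>"
  using linear_maps_zero_neg(1)[OF f_linear A.gr.abelian_group_axioms B.gr.abelian_group_axioms] .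

lemma f_unity [simp]: "f 0 (unity A) = unity B"
  using f_hom by (simp add: cdga_hom_def)

lemma f_cocycles [simp]: "x \<in> cocycles A n \<Longrightarrow> f n x \<in> cocycles B n"
  by (auto simp: A.cocycles_iff B.cocycles_iff f_dif[symmetric])

lemma f_coboundaries [simp]:
  assumes "x \<in> coboundaries A n"
  shows "f n x \<in> coboundaries B n"
proof -
  obtain y where "y \<in> carrier (gr A (n - 1))" "x = dif A (n - 1) y" using assms by (rule A.coboundariesE)
  then show ?thesis using f_dif[of y "n - 1"] B.coboundariesI[of "f (n - 1) y" n] by simp
qed

lemma f_coh_class: "\<lbrakk>y \<in> coh_class A n x; x \<in> carrier (gr A n)\<rbrakk> \<Longrightarrow> f n y \<in> coh_class B n (f n x)"
  by (auto simp: A.coh_class_iff B.coh_class_iff f_add)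

lemma coh_map_class:
  assumes "x \<in> carrier (gr A n)"
  shows "coh_map A B f n (coh_class A n x) = coh_class B n (f n x)"
proof -
  have "coh_class B n (f n y) = coh_class B n (f n x)" if "y \<in> coh_class A n x" for y
    using B.coh_class_eq[OF f_coh_class[OF that assms]] assms by simp
  then show ?thesis unfolding coh_map_def using A.coh_class_refl[OF assms] by blast
qed

text \<open>The induced maps are additive, so injectivity can be tested on differences of cocycles.
  In this form the later arguments work with elements and never with cosets.\<close>

lemma quasi_iso_iff:
  "f \<in> quasi_iso K A B \<longleftrightarrow> (\<forall>n. (\<forall>x \<in> cocycles A n. f n x \<in> coboundaries B n \<longrightarrow> x \<in> coboundaries A n) \<and>
     (\<forall>y \<in> cocycles B n. \<exists>x \<in> cocycles A n. y \<in> coh_class B n (f n x)))"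
proof -
  have inj: "inj_on (coh_map A B f n) (cohomology A n) \<longleftrightarrow>
      (\<forall>x \<in> cocycles A n. f n x \<in> coboundaries B n \<longrightarrow> x \<in> coboundaries A n)" (is "?l \<longleftrightarrow> ?r") for n
  proof
    assume l: ?l
    show ?r
    proof (intro ballI impI)
      fix x assume x: "x \<in> cocycles A n" "f n x \<in> coboundaries B n"
      then have "coh_map A B f n (coh_class A n x) = coh_map A B f n (coh_class A n \<zero>\<^bsub>gr A n\<^esub>)"
        by (simp add: coh_map_class B.coh_class_eq_coboundaries B.coh_class_zero)
      then have "coh_class A n x = coh_class A n \<zero>\<^bsub>gr A n\<^esub>"
        by (rule inj_onD[OF l _ A.cohomologyI A.cohomologyI]) (use x in simp_all)
      then show "x \<in> coboundaries A n"
        using x A.coh_class_refl[of x n] by (simp add: A.coh_class_zero)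
    qed
  next
    assume r: ?r
    show ?l
    proof (rule inj_onI)
      fix X Y assume "X \<in> cohomology A n" "Y \<in> cohomology A n" and e: "coh_map A B f n X = coh_map A B f n Y"
      then obtain x y where x: "x \<in> cocycles A n" "X = coh_class A n x" and y: "y \<in> cocycles A n" "Y = coh_class A n y"
        by (auto elim!: A.cohomologyE)
      have "f n x \<in> coh_class B n (f n y)"
        using e x y by (simp add: coh_map_class B.coh_class_eq_iff)
      then have "f n (x \<ominus>\<^bsub>gr A n\<^esub> y) \<in> coboundaries B n"
        using x y by (simp add: B.coh_class_minus_iff A.gr.minus_eq B.gr.minus_eq f_add f_neg)
      moreover have "x \<ominus>\<^bsub>gr A n\<^esub> y \<in> cocycles A n" using x y by (simp add: A.gr.minus_eq)
      ultimately have "x \<ominus>\<^bsub>gr A n\<^esub> y \<in> coboundaries A n" using r by blast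
      then show "X = Y" using x y by (simp add: A.coh_class_eq_iff A.coh_class_minus_iff)
    qed
  qed
  have surj: "coh_map A B f n ` cohomology A n = cohomology B n \<longleftrightarrow>
      (\<forall>y \<in> cocycles B n. \<exists>x \<in> cocycles A n. y \<in> coh_class B n (f n x))" (is "?l \<longleftrightarrow> ?r") for n
  proof -
    have "coh_map A B f n ` cohomology A n = (\<lambda>x. coh_class B n (f n x)) ` cocycles A n"
      unfolding cohomology_def image_image by (intro image_cong refl) (simp add: coh_map_class)
    moreover have "\<dots> \<subseteq> coh_class B n ` cocycles B n" by auto
    ultimately have "?l \<longleftrightarrow> coh_class B n ` cocycles B n \<subseteq> (\<lambda>x. coh_class B n (f n x)) ` cocycles A n"
      unfolding cohomology_def by auto
    also have "\<dots> \<longleftrightarrow> (\<forall>y \<in> cocycles B n. \<exists>x \<in> cocycles A n. coh_class B n y = coh_class B n (f n x))"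
      by (simp add: image_subset_iff) (simp add: image_iff)
    also have "\<dots> \<longleftrightarrow> ?r" by (intro ball_cong bex_cong) (simp_all add: B.coh_class_eq_iff)
    finally show ?thesis .
  qed
  show ?thesis using f_hom by (simp add: quasi_iso_def bij_betw_def inj surj)
qed

lemma quasi_isoD:
  assumes "f \<in> quasi_iso K A B"
  shows "\<lbrakk>x \<in> cocycles A n; f n x \<in> coboundaries B n\<rbrakk> \<Longrightarrow> x \<in> coboundaries A n"
    and "z \<in> cocycles B n \<Longrightarrow> \<exists>x \<in> cocycles A n. z \<in> coh_class B n (f n x)"
    and "\<lbrakk>x \<in> cocycles A n; y \<in> cocycles A n; f n x \<in> coh_class B n (f n y)\<rbrakk> \<Longrightarrow> x \<in> coh_class A n y"
proof -
  have *: "\<lbrakk>x \<in> cocycles A n; f n x \<in> coboundaries B n\<rbrakk> \<Longrightarrow> x \<in> coboundaries A n" for x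
    using assms quasi_iso_iff by blast
  show "z \<in> cocycles B n \<Longrightarrow> \<exists>x \<in> cocycles A n. z \<in> coh_class B n (f n x)"
    using assms quasi_iso_iff by blast
  show "\<lbrakk>x \<in> cocycles A n; f n x \<in> coboundaries B n\<rbrakk> \<Longrightarrow> x \<in> coboundaries A n" by (rule *)
  assume "x \<in> cocycles A n" "y \<in> cocycles A n" "f n x \<in> coh_class B n (f n y)"
  then show "x \<in> coh_class A n y"
    using *[of "x \<ominus>\<^bsub>gr A n\<^esub> y"]
    by (simp add: A.coh_class_minus_iff B.coh_class_minus_iff A.gr.minus_eq B.gr.minus_eq f_add f_neg)
qed

end

lemma cdga_hom_eqI:
  assumes "f \<in> cdga_hom K A B" "g \<in> cdga_hom K A B" "\<And>n x. x \<in> carrier (gr A n) \<Longrightarrow> f n x = g n x"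
  shows "f = g"
proof
  fix n
  show "f n = g n"
    using assms by (intro extensionalityI[of _ "carrier (gr A n)"]) (auto simp: cdga_hom_def)
qed

lemma cdga_homI:
  assumes "\<And>n x. x \<in> carrier (gr A n) \<Longrightarrow> f n x \<in> carrier (gr B n)"
    and "\<And>n x. x \<notin> carrier (gr A n) \<Longrightarrow> f n x = undefined"
    and "\<And>n x y. \<lbrakk>x \<in> carrier (gr A n); y \<in> carrier (gr A n)\<rbrakk> \<Longrightarrow> f n (x \<oplus>\<^bsub>gr A n\<^esub> y) = f n x \<oplus>\<^bsub>gr B n\<^esub> f n y"
    and "\<And>n c x. \<lbrakk>c \<in> carrier K; x \<in> carrier (gr A n)\<rbrakk> \<Longrightarrow> f n (c \<odot>\<^bsub>gr A n\<^esub> x) = c \<odot>\<^bsub>gr B n\<^esub> f n x"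
    and "\<And>i j x y. \<lbrakk>x \<in> carrier (gr A i); y \<in> carrier (gr A j)\<rbrakk>
      \<Longrightarrow> f (i + j) (mul A i j x y) = mul B i j (f i x) (f j y)"
    and "f 0 (unity A) = unity B"
    and "\<And>n x. x \<in> carrier (gr A n) \<Longrightarrow> f (n + 1) (dif A n x) = dif B n (f n x)"
  shows "f \<in> cdga_hom K A B"
  using assms by (auto simp: cdga_hom_def linear_maps_def extensional_def)

section \<open>The category of cdgas\<close>

definition hom_comp :: "('k, 'a) dga \<Rightarrow> (int \<Rightarrow> 'b \<Rightarrow> 'c) \<Rightarrow> (int \<Rightarrow> 'a \<Rightarrow> 'b) \<Rightarrow> int \<Rightarrow> 'a \<Rightarrow> 'c" where
  "hom_comp A g f = (\<lambda>n. compose (carrier (gr A n)) (g n) (f n))"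

lemma hom_comp_apply [simp]: "x \<in> carrier (gr A n) \<Longrightarrow> hom_comp A g f n x = g n (f n x)"
  by (simp add: hom_comp_def compose_def)

definition hom_id :: "('k, 'a) dga \<Rightarrow> int \<Rightarrow> 'a \<Rightarrow> 'a" where
  "hom_id A = (\<lambda>n. \<lambda>x \<in> carrier (gr A n). x)"

lemma hom_id_apply [simp]: "x \<in> carrier (gr A n) \<Longrightarrow> hom_id A n x = x"
  by (simp add: hom_id_def)

lemma cdga_cat_simps [simp]:
  "Obj (cdga_cat K) = {A. cdga K A}" "Hom (cdga_cat K) = cdga_hom K"
  "Ident (cdga_cat K) = hom_id" "Comp (cdga_cat K) A B C g f = hom_comp A g f"
  by (simp_all add: cdga_cat_def hom_comp_def hom_id_def fun_eq_iff)

lemma hom_comp_in: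
  assumes "cdga K A" "cdga K B" "cdga K C" "f \<in> cdga_hom K A B" "g \<in> cdga_hom K B C"
  shows "hom_comp A g f \<in> cdga_hom K A C"
proof -
  interpret f: cdga_mor K A B f using assms by (simp add: cdga_mor_def cdga_mor_axioms_def)
  interpret g: cdga_mor K B C g using assms by (simp add: cdga_mor_def cdga_mor_axioms_def)
  show ?thesis
    by (rule cdga_homI)
      (auto simp: f.f_add g.f_add f.f_smult g.f_smult f.f_mul g.f_mul f.f_dif g.f_dif hom_comp_def compose_def)
qed

lemma hom_id_in: "cdga K A \<Longrightarrow> hom_id A \<in> cdga_hom K A A"
proof -
  assume "cdga K A"
  then interpret cdga K A .
  show ?thesis by (rule cdga_homI) (auto simp: hom_id_def)
qed

lemma category_cdga_cat: "category (cdga_cat K)"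
proof
  fix X Y Z V f g h
  assume a: "X \<in> Obj (cdga_cat K)" "Y \<in> Obj (cdga_cat K)" "Z \<in> Obj (cdga_cat K)" "V \<in> Obj (cdga_cat K)"
    "f \<in> Hom (cdga_cat K) X Y" "g \<in> Hom (cdga_cat K) Y Z" "h \<in> Hom (cdga_cat K) Z V"
  then have "f n x \<in> carrier (gr Y n)" if "x \<in> carrier (gr X n)" for n x
    using that by (auto simp: cdga_hom_def linear_maps_def)
  then show "Comp (cdga_cat K) X Z V h (Comp (cdga_cat K) X Y Z g f) =
      Comp (cdga_cat K) X Y V (Comp (cdga_cat K) Y Z V h g) f"
    by (auto simp: hom_comp_def compose_def fun_eq_iff)
next
  fix X Y Z f g assume "X \<in> Obj (cdga_cat K)" "Y \<in> Obj (cdga_cat K)" "Z \<in> Obj (cdga_cat K)"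
    "f \<in> Hom (cdga_cat K) X Y" "g \<in> Hom (cdga_cat K) Y Z"
  then show "Comp (cdga_cat K) X Y Z g f \<in> Hom (cdga_cat K) X Z" by (auto intro: hom_comp_in)
next
  fix X Y f assume "X \<in> Obj (cdga_cat K)" "Y \<in> Obj (cdga_cat K)" "f \<in> Hom (cdga_cat K) X Y"
  then show "Comp (cdga_cat K) X X Y f (Ident (cdga_cat K) X) = f"
    using hom_comp_in[OF _ _ _ hom_id_in] by (auto intro!: cdga_hom_eqI)
next
  fix X Y f assume a: "X \<in> Obj (cdga_cat K)" "Y \<in> Obj (cdga_cat K)" "f \<in> Hom (cdga_cat K) X Y"
  then have "f n x \<in> carrier (gr Y n)" if "x \<in> carrier (gr X n)" for n x
    using that by (auto simp: cdga_hom_def linear_maps_def)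
  then show "Comp (cdga_cat K) X Y Y (Ident (cdga_cat K) Y) f = f"
    using a hom_comp_in[OF _ _ _ _ hom_id_in] by (auto intro!: cdga_hom_eqI)
qed (auto intro: hom_id_in)

section \<open>Localization at a multiplicative set of cocycles\<close>

text \<open>
  Fractions and products must have their carriers in the same type again; this is why pairs are coded.
\<close>

definition encode :: "'a \<times> 'a \<Rightarrow> 'a" where "encode = (SOME f. inj f)"

definition decode :: "'a \<Rightarrow> 'a \<times> 'a" where "decode = inv_into UNIV encode"

lemma inj_encode:
  assumes "infinite (UNIV :: 'a set)"
  shows "inj (encode :: 'a \<times> 'a \<Rightarrow> 'a)"
proof -
  have "\<exists>f :: 'a \<times> 'a \<Rightarrow> 'a. bij_betw f (UNIV \<times> UNIV) UNIV"
    using card_of_Times_same_infinite[OF assms] card_of_ordIso by blast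
  then have "\<exists>f :: 'a \<times> 'a \<Rightarrow> 'a. inj f" by (auto simp: bij_betw_def)
  then show ?thesis unfolding encode_def by (rule someI_ex)
qed

lemma decode_encode: "infinite (UNIV :: 'a set) \<Longrightarrow> decode (encode p) = (p :: 'a \<times> 'a)"
  unfolding decode_def by (rule inv_into_f_f[OF inj_encode]) simp_all

text \<open>
  \<open>frac A S n a s\<close> is the fraction \<open>a / s\<close>, with \<open>a\<close> of degree \<open>n\<close>: a pair coded in the carrier type and
  chosen among the equivalent pairs.
\<close>

definition frac :: "('k, 'a) dga \<Rightarrow> 'a set \<Rightarrow> int \<Rightarrow> 'a \<Rightarrow> 'a \<Rightarrow> 'a" where
  "frac A S n a s = encode (SOME p. fst p \<in> carrier (gr A n) \<and> snd p \<in> S \<and>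
     (\<exists>u \<in> S. mul A 0 n u (mul A 0 n (snd p) a) = mul A 0 n u (mul A 0 n s (fst p))))"

abbreviation numer :: "'a \<Rightarrow> 'a" where "numer x \<equiv> fst (decode x)"
abbreviation denom :: "'a \<Rightarrow> 'a" where "denom x \<equiv> snd (decode x)"

text \<open>The usual formulas are applied to the representatives that \<open>decode\<close>
  returns; independence of the representatives is the content of \<open>fr_dif\<close>,
  \<open>fr_smult\<close>, \<open>fr_mul\<close> and \<open>fr_add_gen\<close>. The unit is s/s for
  an arbitrary \<open>s\<close>, as \<open>S\<close> may lack 1.\<close>

definition frac_dga :: "('k, 'a) dga \<Rightarrow> 'a set \<Rightarrow> ('k, 'a) dga" where
  "frac_dga A S = \<lparr>
     gr = (\<lambda>n. \<lparr>carrier = {frac A S n a s | a s. a \<in> carrier (gr A n) \<and> s \<in> S},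
       mult = (\<lambda>x y. undefined), one = undefined,
       zero = frac A S n \<zero>\<^bsub>gr A n\<^esub> (SOME s. s \<in> S),
       add = (\<lambda>x y. frac A S n
         (mul A 0 n (denom y) (numer x) \<oplus>\<^bsub>gr A n\<^esub> mul A 0 n (denom x) (numer y))
         (mul A 0 0 (denom x) (denom y))),
       smult = (\<lambda>c x. frac A S n (c \<odot>\<^bsub>gr A n\<^esub> numer x) (denom x))\<rparr>),
     mul = (\<lambda>i j x y. frac A S (i + j) (mul A i j (numer x) (numer y)) (mul A 0 0 (denom x) (denom y))),
     unity = frac A S 0 (SOME s. s \<in> S) (SOME s. s \<in> S),
     dif = (\<lambda>n x. frac A S (n + 1) (dif A n (numer x)) (denom x))\<rparr>"

text \<open>The canonical map a \<mapsto> sa/s, which avoids 1 as a denominator; by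
  \<open>un_eq\<close> every \<open>s\<close> in \<open>S\<close> gives the same value.\<close>

definition frac_unit :: "('k, 'a) dga \<Rightarrow> 'a set \<Rightarrow> int \<Rightarrow> 'a \<Rightarrow> 'a" where
  "frac_unit A S n = (\<lambda>a \<in> carrier (gr A n). frac A S n (mul A 0 n (SOME s. s \<in> S) a) (SOME s. s \<in> S))"

definition frac_map :: "('k, 'a) dga \<Rightarrow> 'a set \<Rightarrow> ('k, 'b) dga \<Rightarrow> 'b set \<Rightarrow> (int \<Rightarrow> 'a \<Rightarrow> 'b) \<Rightarrow> int \<Rightarrow> 'a \<Rightarrow> 'b" where
  "frac_map A S B T f n =
     (\<lambda>x \<in> carrier (gr (frac_dga A S) n). frac B T n (f n (numer x)) (f 0 (denom x)))"

text \<open>Denominators are cocycles of degree 0, so that d(a/s) = da/s and no signs appear in the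
  formulas for fractions.\<close>

locale cdga_frac = cdga K A for K :: "'k ring" and A :: "('k, 'a) dga" +
  fixes S :: "'a set"
  assumes inf: "infinite (UNIV :: 'a set)"
    and S_cocycles: "S \<subseteq> cocycles A 0"
    and S_nonempty: "S \<noteq> {}"
    and S_mult: "\<lbrakk>s \<in> S; t \<in> S\<rbrakk> \<Longrightarrow> act 0 s t \<in> S"
begin

abbreviation "F \<equiv> frac_dga A S"
abbreviation "fr \<equiv> frac A S"

lemma S_rules [simp]: "s \<in> S \<Longrightarrow> s \<in> cocycles A 0" "s \<in> S \<Longrightarrow> s \<in> carrier (gr A 0)"
  using S_cocycles by auto

declare S_mult [simp]

lemma some_S [simp]: "(SOME s. s \<in> S) \<in> S"
  using S_nonempty by (simp add: some_in_eq)

text \<open>Equality of a/s and b/t. The factor \<open>u\<close> is what makes the relation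
  transitive when \<open>S\<close> contains zero divisors.\<close>

definition fr_rel :: "int \<Rightarrow> 'a \<Rightarrow> 'a \<Rightarrow> 'a \<Rightarrow> 'a \<Rightarrow> bool" where
  "fr_rel n a s b t \<longleftrightarrow> (\<exists>u \<in> S. act n u (act n t a) = act n u (act n s b))"

lemma fr_rel_trans:
  assumes "a \<in> carrier (gr A n)" "b \<in> carrier (gr A n)" "c \<in> carrier (gr A n)" "s \<in> S" "t \<in> S" "r \<in> S"
    and "fr_rel n a s b t" "fr_rel n b t c r"
  shows "fr_rel n a s c r"
proof -
  obtain u v where u: "u \<in> S" "act n u (act n t a) = act n u (act n s b)"
    and v: "v \<in> S" "act n v (act n r b) = act n v (act n t c)"
    using assms by (auto simp: fr_rel_def)
  \<comment> \<open>\<open>u\<close> and \<open>v\<close> come from the two given relations;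
    \<open>t\<close> is the middle denominator, which occurs on both sides.\<close>
  let ?w = "act 0 (act 0 u v) t"
  have "act n ?w (act n r a) = act n v (act n r (act n u (act n t a)))"
    using assms(1-6) u(1) v(1) by (simp add: act_act act_lcomm)
  also have "\<dots> = act n u (act n s (act n v (act n r b)))"
    unfolding u(2) using assms(1-6) u(1) v(1) by (simp add: act_lcomm)
  also have "\<dots> = act n ?w (act n s c)"
    unfolding v(2) using assms(1-6) u(1) v(1) by (simp add: act_act act_lcomm)
  finally show ?thesis using assms u v unfolding fr_rel_def by (intro bexI[of _ ?w]) simp_all
qed

lemma fr_rel_sym: "fr_rel n a s b t \<Longrightarrow> fr_rel n b t a s"
  unfolding fr_rel_def by metis

lemma fr_rel_refl: "\<lbrakk>a \<in> carrier (gr A n); s \<in> S\<rbrakk> \<Longrightarrow> fr_rel n a s a s"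
  unfolding fr_rel_def using S_nonempty by auto

lemma fr_alt: "fr n a s = encode (SOME p. fst p \<in> carrier (gr A n) \<and> snd p \<in> S \<and> fr_rel n a s (fst p) (snd p))"
  by (simp add: frac_def fr_rel_def)

lemma decode_fr:
  assumes "a \<in> carrier (gr A n)" "s \<in> S"
  shows "numer (fr n a s) \<in> carrier (gr A n)" "denom (fr n a s) \<in> S"
    "fr_rel n a s (numer (fr n a s)) (denom (fr n a s))"
proof -
  let ?P = "\<lambda>p. fst p \<in> carrier (gr A n) \<and> snd p \<in> S \<and> fr_rel n a s (fst p) (snd p)"
  have "?P (a, s)" using assms fr_rel_refl by simp
  then have "?P (SOME p. ?P p)" by (rule someI)
  then show "numer (fr n a s) \<in> carrier (gr A n)" "denom (fr n a s) \<in> S"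
    "fr_rel n a s (numer (fr n a s)) (denom (fr n a s))"
    unfolding fr_alt decode_encode[OF inf] by auto
qed

text \<open>Equivalent pairs have the same set of candidates, so the choice operator in
  \<open>frac\<close> returns the same pair for both.\<close>

lemma fr_eq_iff:
  assumes "a \<in> carrier (gr A n)" "b \<in> carrier (gr A n)" "s \<in> S" "t \<in> S"
  shows "fr n a s = fr n b t \<longleftrightarrow> fr_rel n a s b t"
proof
  assume "fr n a s = fr n b t"
  then show "fr_rel n a s b t"
    using decode_fr[of a n s] decode_fr[of b n t] assms fr_rel_trans[of a n _ b s _ t] fr_rel_sym by metis
next
  assume r: "fr_rel n a s b t"
  have "fr_rel n a s c v \<longleftrightarrow> fr_rel n b t c v" if "c \<in> carrier (gr A n)" "v \<in> S" for c v
    using fr_rel_trans[OF assms(1,2) that(1) assms(3,4) that(2) r]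
      fr_rel_trans[OF assms(2,1) that(1) assms(4,3) that(2) fr_rel_sym[OF r]] by blast
  then show "fr n a s = fr n b t" unfolding fr_alt by (metis (lifting))
qed

lemma fr_eqI:
  assumes "a \<in> carrier (gr A n)" "b \<in> carrier (gr A n)" "s \<in> S" "t \<in> S" "act n t a = act n s b"
  shows "fr n a s = fr n b t"
  using assms S_nonempty by (auto simp: fr_eq_iff fr_rel_def)

lemma fr_scale:
  assumes "a \<in> carrier (gr A n)" "s \<in> S" "t \<in> S"
  shows "fr n (act n t a) (act 0 t s) = fr n a s"
  using assms by (intro fr_eqI) (simp_all add: act_act act_lcomm)

lemma fr_carrier [simp]: "\<lbrakk>a \<in> carrier (gr A n); s \<in> S\<rbrakk> \<Longrightarrow> fr n a s \<in> carrier (gr F n)"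
  by (auto simp: frac_dga_def)

lemma fr_cases:
  assumes "x \<in> carrier (gr F n)"
  obtains a s where "a \<in> carrier (gr A n)" "s \<in> S" "x = fr n a s"
  using assms by (auto simp: frac_dga_def)

text \<open>Common denominators: with them the axioms for fractions reduce to the axioms for
  numerators.\<close>

lemma fr_cases2:
  assumes "x \<in> carrier (gr F n)" "y \<in> carrier (gr F m)"
  obtains a b s where "a \<in> carrier (gr A n)" "b \<in> carrier (gr A m)" "s \<in> S" "x = fr n a s" "y = fr m b s"
proof -
  obtain a s where a: "a \<in> carrier (gr A n)" "s \<in> S" "x = fr n a s" using assms(1) by (rule fr_cases)
  obtain b t where b: "b \<in> carrier (gr A m)" "t \<in> S" "y = fr m b t" using assms(2) by (rule fr_cases)
  show ?thesis
    using that[of "act n t a" "act m s b" "act 0 s t"] a b fr_scale[of a n s t] fr_scale[of b m t s]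
    by (simp add: act_comm0)
qed

lemma fr_cases3:
  assumes "x \<in> carrier (gr F n)" "y \<in> carrier (gr F m)" "z \<in> carrier (gr F l)"
  obtains a b c s where "a \<in> carrier (gr A n)" "b \<in> carrier (gr A m)" "c \<in> carrier (gr A l)" "s \<in> S"
    "x = fr n a s" "y = fr m b s" "z = fr l c s"
proof -
  obtain a b s where a: "a \<in> carrier (gr A n)" "b \<in> carrier (gr A m)" "s \<in> S" "x = fr n a s" "y = fr m b s"
    using assms(1,2) by (rule fr_cases2)
  obtain c t where c: "c \<in> carrier (gr A l)" "t \<in> S" "z = fr l c t" using assms(3) by (rule fr_cases)
  show ?thesis
    using that[of "act n t a" "act m t b" "act l s c" "act 0 s t"] a c
      fr_scale[of a n s t] fr_scale[of b m s t] fr_scale[of c l t s]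
    by (simp add: act_comm0)
qed

lemma fr_dif: 
  assumes "a \<in> carrier (gr A n)" "s \<in> S"
  shows "dif F n (fr n a s) = fr (n + 1) (dif A n a) s"
proof -
  note d = decode_fr[OF assms]
  let ?b = "numer (fr n a s)" and ?t = "denom (fr n a s)"
  obtain u where u: "u \<in> S" "act n u (act n ?t a) = act n u (act n s ?b)"
    using d(3) by (auto simp: fr_rel_def)
  have "act (n + 1) u (act (n + 1) ?t (dif A n a)) = act (n + 1) u (act (n + 1) s (dif A n ?b))"
    using arg_cong[OF u(2), of "dif A n"] assms d(1,2) u(1) by (simp add: dif_act)
  then have "fr_rel (n + 1) (dif A n a) s (dif A n ?b) ?t"
    unfolding fr_rel_def using u(1) by blast
  then show ?thesis
    using fr_eq_iff[of "dif A n a" "n + 1" "dif A n ?b" s ?t] assms d(1,2) by (simp add: frac_dga_def)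
qed

lemma fr_smult: 
  assumes "a \<in> carrier (gr A n)" "s \<in> S" "c \<in> carrier K"
  shows "c \<odot>\<^bsub>gr F n\<^esub> fr n a s = fr n (c \<odot>\<^bsub>gr A n\<^esub> a) s"
proof -
  note d = decode_fr[OF assms(1,2)]
  let ?b = "numer (fr n a s)" and ?t = "denom (fr n a s)"
  obtain u where u: "u \<in> S" "act n u (act n ?t a) = act n u (act n s ?b)"
    using d(3) by (auto simp: fr_rel_def)
  have "act n u (act n ?t (c \<odot>\<^bsub>gr A n\<^esub> a)) = act n u (act n s (c \<odot>\<^bsub>gr A n\<^esub> ?b))"
    using arg_cong[OF u(2), of "\<lambda>x. c \<odot>\<^bsub>gr A n\<^esub> x"] assms d(1,2) u(1) by (simp add: act_smult)
  then have "fr_rel n (c \<odot>\<^bsub>gr A n\<^esub> a) s (c \<odot>\<^bsub>gr A n\<^esub> ?b) ?t"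
    unfolding fr_rel_def using u(1) by blast
  then show ?thesis
    using fr_eq_iff[of "c \<odot>\<^bsub>gr A n\<^esub> a" n "c \<odot>\<^bsub>gr A n\<^esub> ?b" s ?t] assms d(1,2) by (simp add: frac_dga_def)
qed

lemma fr_rel_mul:
  assumes c: "a \<in> carrier (gr A i)" "b \<in> carrier (gr A i)" "a' \<in> carrier (gr A j)" "b' \<in> carrier (gr A j)"
    "s \<in> S" "t \<in> S" "s' \<in> S" "t' \<in> S"
    and r: "fr_rel i a s b t" "fr_rel j a' s' b' t'"
  shows "fr_rel (i + j) (mul A i j a a') (act 0 s s') (mul A i j b b') (act 0 t t')"
proof -
  obtain u where u: "u \<in> S" "act i u (act i t a) = act i u (act i s b)"
    using r(1) by (auto simp: fr_rel_def)
  obtain v where v: "v \<in> S" "act j v (act j t' a') = act j v (act j s' b')"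
    using r(2) by (auto simp: fr_rel_def)
  let ?n = "i + j"
  have *: "act ?n (act 0 u v) (act ?n (act 0 p q) (mul A i j x y)) = mul A i j (act i u (act i p x)) (act j v (act j q y))"
    if "x \<in> carrier (gr A i)" "y \<in> carrier (gr A j)" "p \<in> S" "q \<in> S" for x y p q
    using that u(1) v(1) by (simp add: act_act act_mul_left act_mul_right[where x = x and i = i] act_lcomm)
  have "act ?n (act 0 u v) (act ?n (act 0 t t') (mul A i j a a')) = act ?n (act 0 u v) (act ?n (act 0 s s') (mul A i j b b'))"
    using c by (simp only: * u(2) v(2))
  then show ?thesis
    unfolding fr_rel_def using u(1) v(1) by (intro bexI[of _ "act 0 u v"]) simp_all
qed

lemma fr_mul:
  assumes "a \<in> carrier (gr A i)" "s \<in> S" "a' \<in> carrier (gr A j)" "s' \<in> S"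
  shows "mul F i j (fr i a s) (fr j a' s') = fr (i + j) (mul A i j a a') (act 0 s s')"
proof -
  note d = decode_fr[OF assms(1,2)] and d' = decode_fr[OF assms(3,4)]
  have "fr (i + j) (mul A i j a a') (act 0 s s') =
      fr (i + j) (mul A i j (numer (fr i a s)) (numer (fr j a' s'))) (act 0 (denom (fr i a s)) (denom (fr j a' s')))"
    using fr_rel_mul[OF assms(1) d(1) assms(3) d'(1) assms(2) d(2) assms(4) d'(2) d(3) d'(3)]
    by (subst fr_eq_iff) (use assms d(1,2) d'(1,2) in simp_all)
  then show ?thesis by (simp add: frac_dga_def)
qed

lemma fr_rel_add:
  assumes c: "a \<in> carrier (gr A n)" "b \<in> carrier (gr A n)" "a' \<in> carrier (gr A n)" "b' \<in> carrier (gr A n)"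
    "s \<in> S" "t \<in> S" "s' \<in> S" "t' \<in> S"
    and r: "fr_rel n a s b t" "fr_rel n a' s' b' t'"
  shows "fr_rel n (act n s' a \<oplus>\<^bsub>gr A n\<^esub> act n s a') (act 0 s s') (act n t' b \<oplus>\<^bsub>gr A n\<^esub> act n t b') (act 0 t t')"
proof -
  obtain u where u: "u \<in> S" "act n u (act n t a) = act n u (act n s b)"
    using r(1) by (auto simp: fr_rel_def)
  obtain v where v: "v \<in> S" "act n v (act n t' a') = act n v (act n s' b')"
    using r(2) by (auto simp: fr_rel_def)
  have "act n (act 0 u v) (act n (act 0 t t') (act n s' a \<oplus>\<^bsub>gr A n\<^esub> act n s a')) =
      act n v (act n s' (act n t' (act n u (act n t a)))) \<oplus>\<^bsub>gr A n\<^esub>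
      act n u (act n s (act n t (act n v (act n t' a'))))"
    using c u(1) v(1) by (simp add: act_act act_add act_lcomm)
  also have "\<dots> = act n (act 0 u v) (act n (act 0 s s') (act n t' b \<oplus>\<^bsub>gr A n\<^esub> act n t b'))"
    unfolding u(2) v(2) using c u(1) v(1) by (simp add: act_act act_add act_lcomm)
  finally show ?thesis
    unfolding fr_rel_def using u(1) v(1) by (intro bexI[of _ "act 0 u v"]) simp_all
qed

lemma fr_add_gen:
  assumes "a \<in> carrier (gr A n)" "s \<in> S" "a' \<in> carrier (gr A n)" "s' \<in> S"
  shows "fr n a s \<oplus>\<^bsub>gr F n\<^esub> fr n a' s' = fr n (act n s' a \<oplus>\<^bsub>gr A n\<^esub> act n s a') (act 0 s s')"
proof -
  note d = decode_fr[OF assms(1,2)] and d' = decode_fr[OF assms(3,4)]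
  have "fr n (act n s' a \<oplus>\<^bsub>gr A n\<^esub> act n s a') (act 0 s s') =
      fr n (act n (denom (fr n a' s')) (numer (fr n a s)) \<oplus>\<^bsub>gr A n\<^esub> act n (denom (fr n a s)) (numer (fr n a' s')))
        (act 0 (denom (fr n a s)) (denom (fr n a' s')))"
    using fr_rel_add[OF assms(1) d(1) assms(3) d'(1) assms(2) d(2) assms(4) d'(2) d(3) d'(3)]
    by (subst fr_eq_iff) (use assms d(1,2) d'(1,2) in simp_all)
  then show ?thesis by (simp add: frac_dga_def)
qed

lemma fr_add:
  assumes "a \<in> carrier (gr A n)" "b \<in> carrier (gr A n)" "s \<in> S"
  shows "fr n a s \<oplus>\<^bsub>gr F n\<^esub> fr n b s = fr n (a \<oplus>\<^bsub>gr A n\<^esub> b) s"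
  using assms fr_scale[of "a \<oplus>\<^bsub>gr A n\<^esub> b" n s s] by (simp add: fr_add_gen act_add)

lemma fr_zero: "s \<in> S \<Longrightarrow> \<zero>\<^bsub>gr F n\<^esub> = fr n \<zero>\<^bsub>gr A n\<^esub> s"
  using fr_eqI[of "\<zero>\<^bsub>gr A n\<^esub>" n "\<zero>\<^bsub>gr A n\<^esub>" "SOME s. s \<in> S" s] by (simp add: frac_dga_def)

lemma fr_unity: "s \<in> S \<Longrightarrow> unity F = fr 0 s s"
  using fr_eqI[of "SOME s. s \<in> S" 0 s "SOME s. s \<in> S" s] by (simp add: frac_dga_def act_comm0)

lemma abelian_group_fr: "abelian_group (gr F n)"
proof (rule abelian_groupI)
  fix x y z assume "x \<in> carrier (gr F n)" "y \<in> carrier (gr F n)" "z \<in> carrier (gr F n)"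
  then obtain a b c s where *: "a \<in> carrier (gr A n)" "b \<in> carrier (gr A n)" "c \<in> carrier (gr A n)" "s \<in> S"
    "x = fr n a s" "y = fr n b s" "z = fr n c s" by (rule fr_cases3)
  then show "x \<oplus>\<^bsub>gr F n\<^esub> y \<oplus>\<^bsub>gr F n\<^esub> z = x \<oplus>\<^bsub>gr F n\<^esub> (y \<oplus>\<^bsub>gr F n\<^esub> z)" by (simp add: fr_add gr.a_assoc)
next
  fix x y assume "x \<in> carrier (gr F n)" "y \<in> carrier (gr F n)"
  then obtain a b s where *: "a \<in> carrier (gr A n)" "b \<in> carrier (gr A n)" "s \<in> S" "x = fr n a s" "y = fr n b s"
    by (rule fr_cases2)
  then show "x \<oplus>\<^bsub>gr F n\<^esub> y = y \<oplus>\<^bsub>gr F n\<^esub> x" "x \<oplus>\<^bsub>gr F n\<^esub> y \<in> carrier (gr F n)" by (simp_all add: fr_add gr.a_comm)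
next
  fix x assume "x \<in> carrier (gr F n)"
  then obtain a s where *: "a \<in> carrier (gr A n)" "s \<in> S" "x = fr n a s" by (rule fr_cases)
  then show "\<zero>\<^bsub>gr F n\<^esub> \<oplus>\<^bsub>gr F n\<^esub> x = x" by (simp add: fr_zero[of s] fr_add)
  show "\<exists>y \<in> carrier (gr F n). y \<oplus>\<^bsub>gr F n\<^esub> x = \<zero>\<^bsub>gr F n\<^esub>"
    using * by (intro bexI[of _ "fr n (\<ominus>\<^bsub>gr A n\<^esub> a) s"]) (simp_all add: fr_zero[of s] fr_add gr.l_neg)
qed (simp add: fr_zero[OF some_S])

lemma fr_neg:
  assumes "a \<in> carrier (gr A n)" "s \<in> S"
  shows "\<ominus>\<^bsub>gr F n\<^esub> fr n a s = fr n (\<ominus>\<^bsub>gr A n\<^esub> a) s"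
proof -
  interpret Fn: abelian_group "gr F n" by (rule abelian_group_fr)
  show ?thesis
    using assms by (intro Fn.minus_equality) (simp_all add: fr_add gr.l_neg fr_zero[of s])
qed

lemma fr_signed:
  assumes "a \<in> carrier (gr A n)" "s \<in> S"
  shows "signed (gr F n) k (fr n a s) = fr n (signed (gr A n) k a) s"
  using assms by (simp add: signed_def fr_neg)

lemma fr_mul_same:
  assumes "a \<in> carrier (gr A i)" "b \<in> carrier (gr A j)" "s \<in> S" "i + j = n"
  shows "mul F i j (fr i a s) (fr j b s) = fr n (mul A i j a b) (act 0 s s)"
  using fr_mul[of a i s b j s] assms by simp

lemma module_fr: "module K (gr F n)"
proof (intro module.intro module_axioms.intro)
  show "cring K" by (rule K.is_cring)
  show "abelian_group (gr F n)" by (rule abelian_group_fr)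
next
  fix c x assume "c \<in> carrier K" "x \<in> carrier (gr F n)"
  then show "c \<odot>\<^bsub>gr F n\<^esub> x \<in> carrier (gr F n)" by (auto elim!: fr_cases simp: fr_smult)
next
  fix c d x assume "c \<in> carrier K" "d \<in> carrier K" "x \<in> carrier (gr F n)"
  then show "(c \<oplus>\<^bsub>K\<^esub> d) \<odot>\<^bsub>gr F n\<^esub> x = c \<odot>\<^bsub>gr F n\<^esub> x \<oplus>\<^bsub>gr F n\<^esub> d \<odot>\<^bsub>gr F n\<^esub> x"
    by (auto elim!: fr_cases simp: fr_smult fr_add smult_l_distr)
next
  fix c x y assume c: "c \<in> carrier K" and xy: "x \<in> carrier (gr F n)" "y \<in> carrier (gr F n)"
  then obtain a b s where *: "a \<in> carrier (gr A n)" "b \<in> carrier (gr A n)" "s \<in> S" "x = fr n a s" "y = fr n b s"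
    by (elim fr_cases2[OF xy])
  then show "c \<odot>\<^bsub>gr F n\<^esub> (x \<oplus>\<^bsub>gr F n\<^esub> y) = c \<odot>\<^bsub>gr F n\<^esub> x \<oplus>\<^bsub>gr F n\<^esub> c \<odot>\<^bsub>gr F n\<^esub> y"
    using c by (simp add: fr_add fr_smult smult_r_distr)
next
  fix c d x assume "c \<in> carrier K" "d \<in> carrier K" "x \<in> carrier (gr F n)"
  then show "(c \<otimes>\<^bsub>K\<^esub> d) \<odot>\<^bsub>gr F n\<^esub> x = c \<odot>\<^bsub>gr F n\<^esub> (d \<odot>\<^bsub>gr F n\<^esub> x)"
    by (auto elim!: fr_cases simp: fr_smult smult_assoc1)
next
  fix x assume "x \<in> carrier (gr F n)"
  then show "\<one>\<^bsub>K\<^esub> \<odot>\<^bsub>gr F n\<^esub> x = x" by (auto elim!: fr_cases simp: fr_smult)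
qed

lemma cdga_frac_dga: "cdga K F"
proof (rule cdga.intro)
  show "module K (gr F n)" for n by (rule module_fr)
next
  fix y i j assume y: "y \<in> carrier (gr F j)"
  show "(\<lambda>x. mul F i j x y) \<in> linear_maps K (gr F i) (gr F (i + j))"
    unfolding linear_maps_def
  proof (intro CollectI conjI funcsetI ballI)
    fix x assume "x \<in> carrier (gr F i)"
    then show "mul F i j x y \<in> carrier (gr F (i + j))"
      using y by (auto elim!: fr_cases simp: fr_mul)
    fix x' assume "x' \<in> carrier (gr F i)"
    then obtain a a' b s where *: "a \<in> carrier (gr A i)" "a' \<in> carrier (gr A i)" "b \<in> carrier (gr A j)" "s \<in> S"
      "x = fr i a s" "x' = fr i a' s" "y = fr j b s"
      by (rule fr_cases3[OF \<open>x \<in> carrier (gr F i)\<close> _ y])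
    then show "mul F i j (x \<oplus>\<^bsub>gr F i\<^esub> x') y = mul F i j x y \<oplus>\<^bsub>gr F (i + j)\<^esub> mul F i j x' y"
      by (simp add: fr_add fr_mul mul_add_left)
  next
    fix c x assume c: "c \<in> carrier K" and "x \<in> carrier (gr F i)"
    then show "mul F i j (c \<odot>\<^bsub>gr F i\<^esub> x) y = c \<odot>\<^bsub>gr F (i + j)\<^esub> mul F i j x y"
      using y by (auto elim!: fr_cases simp: fr_smult fr_mul mul_smult_left)
  qed
next
  fix x i j assume x: "x \<in> carrier (gr F i)"
  show "(\<lambda>y. mul F i j x y) \<in> linear_maps K (gr F j) (gr F (i + j))"
    unfolding linear_maps_def
  proof (intro CollectI conjI funcsetI ballI)
    fix y assume "y \<in> carrier (gr F j)"
    then show "mul F i j x y \<in> carrier (gr F (i + j))"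
      using x by (auto elim!: fr_cases simp: fr_mul)
    fix y' assume "y' \<in> carrier (gr F j)"
    then obtain a b b' s where *: "a \<in> carrier (gr A i)" "b \<in> carrier (gr A j)" "b' \<in> carrier (gr A j)" "s \<in> S"
      "x = fr i a s" "y = fr j b s" "y' = fr j b' s"
      by (rule fr_cases3[OF x \<open>y \<in> carrier (gr F j)\<close>])
    then show "mul F i j x (y \<oplus>\<^bsub>gr F j\<^esub> y') = mul F i j x y \<oplus>\<^bsub>gr F (i + j)\<^esub> mul F i j x y'"
      by (simp add: fr_add fr_mul mul_add_right)
  next
    fix c y assume c: "c \<in> carrier K" and "y \<in> carrier (gr F j)"
    then show "mul F i j x (c \<odot>\<^bsub>gr F j\<^esub> y) = c \<odot>\<^bsub>gr F (i + j)\<^esub> mul F i j x y"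
      using x by (auto elim!: fr_cases simp: fr_smult fr_mul mul_smult_right)
  qed
next
  fix x i y j z k assume "x \<in> carrier (gr F i)" "y \<in> carrier (gr F j)" "z \<in> carrier (gr F k)"
  then obtain a b c s where *: "a \<in> carrier (gr A i)" "b \<in> carrier (gr A j)" "c \<in> carrier (gr A k)" "s \<in> S"
    "x = fr i a s" "y = fr j b s" "z = fr k c s" by (rule fr_cases3)
  have "mul F (i + j) k (mul F i j x y) z = fr (i + j + k) (mul A (i + j) k (mul A i j a b) c) (act 0 (act 0 s s) s)"
    using * by (simp add: fr_mul)
  also have "\<dots> = fr (i + (j + k)) (mul A i (j + k) a (mul A j k b c)) (act 0 s (act 0 s s))"
    using * by (simp add: mul_assoc act_comm0[of s "act 0 s s"] add.assoc)
  also have "\<dots> = mul F i (j + k) x (mul F j k y z)"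
    using * by (simp add: fr_mul)
  finally show "mul F (i + j) k (mul F i j x y) z = mul F i (j + k) x (mul F j k y z)" .
next
  show "unity F \<in> carrier (gr F 0)" by (simp add: fr_unity[OF some_S])
next
  fix x n assume "x \<in> carrier (gr F n)"
  then obtain a s where *: "a \<in> carrier (gr A n)" "s \<in> S" "x = fr n a s" by (rule fr_cases)
  then show "mul F 0 n (unity F) x = x"
    using fr_mul[of s 0 s a n s] fr_scale[of a n s s] by (simp add: fr_unity[of s])
  show "mul F n 0 x (unity F) = x"
    using * fr_mul[of a n s s 0 s] fr_scale[of a n s s] by (simp add: fr_unity[of s] act_commute[of s a n])
next
  fix x i y j assume "x \<in> carrier (gr F i)" "y \<in> carrier (gr F j)"
  then obtain a b s where *: "a \<in> carrier (gr A i)" "b \<in> carrier (gr A j)" "s \<in> S" "x = fr i a s" "y = fr j b s"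
    by (rule fr_cases2)
  \<comment> \<open>The product taken in the other order has degree \<open>j + i\<close>; it has to
    be recognized as an element of degree \<open>i + j\<close> before the sign can be moved.\<close>
  then have "mul A j i b a \<in> carrier (gr A (i + j))" using mul_closed[of b j a i] by (simp add: add.commute)
  then show "mul F i j x y = signed (gr F (i + j)) (i * j) (mul F j i y x)"
    using * mul_commute[of a i b j] by (simp add: fr_mul_same[of _ _ _ _ _ "i + j"] fr_signed)
next
  fix n
  show "dif F n \<in> linear_maps K (gr F n) (gr F (n + 1))"
    unfolding linear_maps_def
  proof (intro CollectI conjI funcsetI ballI)
    fix x assume x: "x \<in> carrier (gr F n)"
    then show "dif F n x \<in> carrier (gr F (n + 1))" by (auto elim!: fr_cases simp: fr_dif)
    fix y assume "y \<in> carrier (gr F n)"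
    then obtain a b s where "a \<in> carrier (gr A n)" "b \<in> carrier (gr A n)" "s \<in> S" "x = fr n a s" "y = fr n b s"
      by (rule fr_cases2[OF x])
    then show "dif F n (x \<oplus>\<^bsub>gr F n\<^esub> y) = dif F n x \<oplus>\<^bsub>gr F (n + 1)\<^esub> dif F n y"
      by (simp add: fr_add fr_dif dif_add)
  next
    fix c x assume "c \<in> carrier K" "x \<in> carrier (gr F n)"
    then show "dif F n (c \<odot>\<^bsub>gr F n\<^esub> x) = c \<odot>\<^bsub>gr F (n + 1)\<^esub> dif F n x"
      by (auto elim!: fr_cases simp: fr_smult fr_dif dif_smult)
  qed
next
  fix x n assume "x \<in> carrier (gr F n)"
  then obtain a s where *: "a \<in> carrier (gr A n)" "s \<in> S" "x = fr n a s" by (rule fr_cases)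
  have "dif F (n + 1) (dif F n x) = fr (n + 1 + 1) (dif A (n + 1) (dif A n a)) s"
    using * by (simp only: fr_dif dif_closed)
  also have "\<dots> = \<zero>\<^bsub>gr F (n + 2)\<^esub>"
    using * dif_dif[of a n] fr_zero[of s "n + 2"] by (simp add: add.commute)
  finally show "dif F (n + 1) (dif F n x) = \<zero>\<^bsub>gr F (n + 2)\<^esub>" .
next
  fix x i y j assume "x \<in> carrier (gr F i)" "y \<in> carrier (gr F j)"
  then obtain a b s where *: "a \<in> carrier (gr A i)" "b \<in> carrier (gr A j)" "s \<in> S" "x = fr i a s" "y = fr j b s"
    by (rule fr_cases2)
  let ?n = "i + j + 1"
  have c: "mul A (i + 1) j (dif A i a) b \<in> carrier (gr A ?n)" "mul A i (j + 1) a (dif A j b) \<in> carrier (gr A ?n)"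
    using mul_closed[OF dif_closed[OF *(1)] *(2)] mul_closed[OF *(1) dif_closed[OF *(2)]]
    by (simp_all add: algebra_simps)
  have "mul F (i + 1) j (dif F i x) y \<oplus>\<^bsub>gr F ?n\<^esub> signed (gr F ?n) i (mul F i (j + 1) x (dif F j y)) =
      fr ?n (mul A (i + 1) j (dif A i a) b) (act 0 s s) \<oplus>\<^bsub>gr F ?n\<^esub>
      signed (gr F ?n) i (fr ?n (mul A i (j + 1) a (dif A j b)) (act 0 s s))"
    using * by (simp add: fr_dif fr_mul_same[of _ _ _ _ _ ?n])
  also have "\<dots> = fr ?n (dif A (i + j) (mul A i j a b)) (act 0 s s)"
    using * c by (simp add: fr_signed fr_add leibniz)
  also have "\<dots> = dif F (i + j) (mul F i j x y)"
    using * by (simp add: fr_mul fr_dif)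
  finally show "dif F (i + j) (mul F i j x y) =
      mul F (i + 1) j (dif F i x) y \<oplus>\<^bsub>gr F ?n\<^esub> signed (gr F ?n) i (mul F i (j + 1) x (dif F j y))" by simp
qed

sublocale F: cdga K F by (rule cdga_frac_dga)

abbreviation "un \<equiv> frac_unit A S"

lemma un_eq: "a \<in> carrier (gr A n) \<Longrightarrow> s \<in> S \<Longrightarrow> un n a = fr n (act n s a) s"
  unfolding frac_unit_def by (simp, intro fr_eqI) (simp_all add: act_lcomm)

lemma un_hom: "un \<in> cdga_hom K A F"
proof (rule cdga_homI)
  fix n x y assume "x \<in> carrier (gr A n)" "y \<in> carrier (gr A n)"
  then show "un n (x \<oplus>\<^bsub>gr A n\<^esub> y) = un n x \<oplus>\<^bsub>gr F n\<^esub> un n y"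
    by (simp add: un_eq[OF _ some_S] fr_add act_add)
next
  fix n c x assume "c \<in> carrier K" "x \<in> carrier (gr A n)"
  then show "un n (c \<odot>\<^bsub>gr A n\<^esub> x) = c \<odot>\<^bsub>gr F n\<^esub> un n x"
    by (simp add: un_eq[OF _ some_S] fr_smult act_smult)
next
  fix i j x y assume xy: "x \<in> carrier (gr A i)" "y \<in> carrier (gr A j)"
  obtain s where s: "s \<in> S" using S_nonempty by blast
  have "mul F i j (un i x) (un j y) = fr (i + j) (mul A i j (act i s x) (act j s y)) (act 0 s s)"
    using xy s by (simp add: un_eq[of _ _ s] fr_mul)
  also have "\<dots> = fr (i + j) (act (i + j) s (act (i + j) s (mul A i j x y))) (act 0 s s)"
    using xy s by (simp add: act_mul_left act_mul_right[where x = x and i = i])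
  also have "\<dots> = un (i + j) (mul A i j x y)"
    using xy s by (simp add: un_eq[of _ _ s] fr_scale)
  finally show "un (i + j) (mul A i j x y) = mul F i j (un i x) (un j y)" by simp
next
  obtain s where s: "s \<in> S" using S_nonempty by blast
  show "un 0 (unity A) = unity F"
    using s by (simp add: un_eq[of _ _ s] fr_unity[of s] mul_unity)
next
  fix n x assume "x \<in> carrier (gr A n)"
  then show "un (n + 1) (dif A n x) = dif F n (un n x)"
    by (simp add: un_eq[OF _ some_S] fr_dif dif_act)
qed (simp_all add: un_eq[OF _ some_S], simp add: frac_unit_def)

sublocale un: cdga_mor K A F un
  by unfold_locales (rule un_hom)

end

lemma nonneg_frac_dga:
  assumes "cdga_frac K A S" "nonneg_graded A"
  shows "nonneg_graded (frac_dga A S)"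
proof -
  interpret cdga_frac K A S by fact
  show ?thesis
    unfolding nonneg_graded_def
  proof (intro allI impI)
    fix n :: int assume "n < 0"
    then have "carrier (gr A n) = {\<zero>\<^bsub>gr A n\<^esub>}" using assms(2) by (simp add: nonneg_graded_def)
    then show "carrier (gr F n) = {\<zero>\<^bsub>gr F n\<^esub>}"
      by (auto elim!: fr_cases simp: fr_zero)
  qed
qed

section \<open>Functoriality of the localization\<close>

locale cdga_frac_mor = A: cdga_frac K A S + B: cdga_frac K B T + cdga_mor K A B f
  for K :: "'k ring" and A :: "('k, 'a) dga" and S and B :: "('k, 'b) dga" and T and f +
  assumes f_S: "s \<in> S \<Longrightarrow> f 0 s \<in> T"
begin

abbreviation "fm \<equiv> frac_map A S B T f"

declare f_S [simp]

text \<open>Applying \<open>f\<close> to the relation between two representatives gives a relation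
  over \<open>T\<close>, because \<open>f 0 u\<close> is again an admissible factor.\<close>

lemma fm_fr:
  assumes "a \<in> carrier (gr A n)" "s \<in> S"
  shows "fm n (A.fr n a s) = B.fr n (f n a) (f 0 s)"
proof -
  note d = A.decode_fr[OF assms]
  let ?b = "numer (A.fr n a s)" and ?t = "denom (A.fr n a s)"
  obtain u where u: "u \<in> S" "A.act n u (A.act n ?t a) = A.act n u (A.act n s ?b)"
    using d(3) by (auto simp: A.fr_rel_def)
  have "B.act n (f 0 u) (B.act n (f 0 ?t) (f n a)) = B.act n (f 0 u) (B.act n (f 0 s) (f n ?b))"
    using arg_cong[OF u(2), of "f n"] assms d(1,2) u(1) by (simp add: f_act)
  then have "B.fr_rel n (f n a) (f 0 s) (f n ?b) (f 0 ?t)"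
    unfolding B.fr_rel_def using u(1) f_S by blast
  then show ?thesis
    using B.fr_eq_iff[of "f n a" n "f n ?b" "f 0 s" "f 0 ?t"] assms d(1,2) by (simp add: frac_map_def)
qed

lemma fm_hom: "fm \<in> cdga_hom K A.F B.F"
proof (rule cdga_homI)
  fix n x assume "x \<in> carrier (gr A.F n)"
  then obtain a s where *: "a \<in> carrier (gr A n)" "s \<in> S" "x = A.fr n a s" by (rule A.fr_cases)
  then show "fm n x \<in> carrier (gr B.F n)" "fm (n + 1) (dif A.F n x) = dif B.F n (fm n x)"
    by (simp_all add: fm_fr A.fr_dif B.fr_dif f_dif)
  fix c assume "c \<in> carrier K"
  then show "fm n (c \<odot>\<^bsub>gr A.F n\<^esub> x) = c \<odot>\<^bsub>gr B.F n\<^esub> fm n x"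
    using * by (simp add: fm_fr A.fr_smult B.fr_smult f_smult)
next
  fix n x y assume "x \<in> carrier (gr A.F n)" "y \<in> carrier (gr A.F n)"
  then obtain a b s where *: "a \<in> carrier (gr A n)" "b \<in> carrier (gr A n)" "s \<in> S" "x = A.fr n a s" "y = A.fr n b s"
    by (rule A.fr_cases2)
  then show "fm n (x \<oplus>\<^bsub>gr A.F n\<^esub> y) = fm n x \<oplus>\<^bsub>gr B.F n\<^esub> fm n y"
    by (simp add: fm_fr A.fr_add B.fr_add f_add)
next
  fix i j x y assume "x \<in> carrier (gr A.F i)" "y \<in> carrier (gr A.F j)"
  then obtain a b s where *: "a \<in> carrier (gr A i)" "b \<in> carrier (gr A j)" "s \<in> S" "x = A.fr i a s" "y = A.fr j b s"
    by (rule A.fr_cases2)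
  then show "fm (i + j) (mul A.F i j x y) = mul B.F i j (fm i x) (fm j y)"
    by (simp add: fm_fr A.fr_mul B.fr_mul f_mul f_act)
next
  show "fm 0 (unity A.F) = unity B.F"
    by (simp add: A.fr_unity[OF A.some_S] fm_fr B.fr_unity[OF f_S[OF A.some_S]])
qed (simp add: frac_map_def)

sublocale fm: cdga_mor K A.F B.F fm
  by unfold_locales (rule fm_hom)

lemma fm_un:
  assumes "a \<in> carrier (gr A n)"
  shows "fm n (A.un n a) = B.un n (f n a)"
  using assms by (simp add: A.un_eq[OF _ A.some_S] fm_fr f_act B.un_eq[OF _ f_S[OF A.some_S]])

end

text \<open>An idempotent of \<open>H\<^sup>0(A)\<close>, being a coset, is itself a multiplicative set of cocycles.\<close>

definition idempotents :: "('k, 'a) dga \<Rightarrow> 'a set set" where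
  "idempotents A = {e \<in> cohomology A 0. \<forall>s \<in> e. \<forall>t \<in> e. mul A 0 0 s t \<in> e}"

locale cdga_idem = cdga K A for K :: "'k ring" and A :: "('k, 'a) dga" +
  fixes S :: "'a set"
  assumes inf: "infinite (UNIV :: 'a set)" and idem: "S \<in> idempotents A"

sublocale cdga_idem \<subseteq> cdga_frac K A S
proof
  show "infinite (UNIV :: 'a set)" by (rule inf)
  have S: "S \<in> cohomology A 0" using idem by (simp add: idempotents_def)
  show "S \<subseteq> cocycles A 0" "S \<noteq> {}" using cohomology_mem[OF S] cohomology_nonempty[OF S] by auto
  show "act 0 s t \<in> S" if "s \<in> S" "t \<in> S" for s t using idem that by (simp add: idempotents_def)
qed

section \<open>Cohomology of the localization at an idempotent\<close>

context cdga_idem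
begin

lemma S_class: "s \<in> S \<Longrightarrow> S = coh_class A 0 s"
  using idem cohomology_mem(2) by (auto simp: idempotents_def)

lemma S_coh: "\<lbrakk>s \<in> S; t \<in> S\<rbrakk> \<Longrightarrow> s \<in> coh_class A 0 t"
  using S_class by blast

lemma fr_coboundary:
  assumes "b \<in> coboundaries A n" "s \<in> S"
  shows "fr n b s \<in> coboundaries F n"
proof -
  obtain y where "y \<in> carrier (gr A (n - 1))" "b = dif A (n - 1) y" using assms(1) by (rule coboundariesE)
  then show ?thesis
    using assms(2) fr_dif[of y "n - 1" s] F.coboundariesI[of "fr (n - 1) y s" n] by simp
qed

text \<open>A closed fraction can be written b/t with a cocycle \<open>b\<close>. As t and tt are
  cohomologous, b/t = tb/(tt) differs by an exact fraction from t(tb)/(tt) = tb/t, which is the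
  image of \<open>b\<close>.\<close>

lemma un_surj:
  assumes "x \<in> cocycles F n"
  shows "\<exists>a \<in> cocycles A n. x \<in> coh_class F n (un n a)"
proof -
  have "x \<in> carrier (gr F n)" using assms by simp
  then obtain a s where a: "a \<in> carrier (gr A n)" "s \<in> S" "x = fr n a s" by (rule fr_cases)
  have "fr (n + 1) (dif A n a) s = fr (n + 1) \<zero>\<^bsub>gr A (n + 1)\<^esub> s"
    using assms a by (simp add: F.cocycles_iff fr_dif fr_zero[of s])
  then obtain u where u: "u \<in> S" "act (n + 1) u (act (n + 1) s (dif A n a)) = \<zero>\<^bsub>gr A (n + 1)\<^esub>"
    using a by (auto simp: fr_eq_iff fr_rel_def)
  \<comment> \<open>\<open>u\<close> times \<open>s\<close> annihilates the differential of
    \<open>a\<close>, so extending the fraction by \<open>r\<close> makes the numerator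
    closed.\<close>
  define r where "r = act 0 u s"
  have r: "r \<in> S" using u a by (simp add: r_def)
  define b where "b = act n r a"
  have "b \<in> carrier (gr A n)" "dif A n b = \<zero>\<^bsub>gr A (n + 1)\<^esub>"
    using u a r by (simp_all add: b_def dif_act) (simp add: r_def act_act)
  then have b: "b \<in> cocycles A n" unfolding cocycles_iff by blast
  define t where "t = act 0 r s"
  have t: "t \<in> S" using r a by (simp add: t_def)
  have x: "x = fr n b t" using a r fr_scale[of a n s r] by (simp add: b_def t_def)
  obtain c where c: "c \<in> coboundaries A 0" "t = c \<oplus>\<^bsub>gr A 0\<^esub> act 0 t t"
    using S_coh[OF t S_mult[OF t t]] by (auto simp: coh_class_iff)
  have "x = fr n (act n t b) (act 0 t t)" using x t b fr_scale[of b n t t] by simp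
  also have "act n t b = act n c b \<oplus>\<^bsub>gr A n\<^esub> act n t (act n t b)"
    using act_add_left[of c "act 0 t t" b n] c t b by (simp add: act_act)
  also have "fr n \<dots> (act 0 t t) = fr n (act n c b) (act 0 t t) \<oplus>\<^bsub>gr F n\<^esub> fr n (act n t (act n t b)) (act 0 t t)"
    using c t b by (simp add: fr_add)
  also have "fr n (act n t (act n t b)) (act 0 t t) = un n b"
    using t b by (simp add: fr_scale un_eq[of _ _ t])
  finally have "x = fr n (act n c b) (act 0 t t) \<oplus>\<^bsub>gr F n\<^esub> un n b" .
  then show ?thesis
    using b fr_coboundary[of "act n c b" n "act 0 t t"] c t by (auto simp: F.coh_class_iff)
qed

lemma act_coboundary_cong:
  assumes "a \<in> cocycles A n" "s \<in> S" "t \<in> S"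
  shows "act n s a \<in> coboundaries A n \<longleftrightarrow> act n t a \<in> coboundaries A n"
  using coh_class_act[OF S_coh[OF assms(2,3)] coh_class_refl, of a n] assms
    coh_class_coboundary[of "act n s a" n "act n t a"] by simp

text \<open>The kernel of the canonical map on cohomology consists of the classes annihilated by the
  idempotent. With \<open>un_surj\<close>, the cohomology of the localization is the image of
  multiplication by the idempotent.\<close>

lemma un_coboundary_iff:
  assumes "a \<in> cocycles A n" "s \<in> S"
  shows "un n a \<in> coboundaries F n \<longleftrightarrow> act n s a \<in> coboundaries A n"
proof
  assume "un n a \<in> coboundaries F n"
  then obtain y where y: "y \<in> carrier (gr F (n - 1))" "un n a = dif F (n - 1) y" by (rule F.coboundariesE)
  obtain b t where b: "b \<in> carrier (gr A (n - 1))" "t \<in> S" "y = fr (n - 1) b t" using y(1) by (rule fr_cases)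
  have d: "dif A (n - 1) b \<in> carrier (gr A n)" using dif_closed[OF b(1)] by simp
  have "fr n (act n s a) s = fr n (dif A (n - 1) b) t"
    using y b assms fr_dif[of b "n - 1" t] by (simp add: un_eq[of _ _ s])
  then obtain u where u: "u \<in> S" "act n u (act n t (act n s a)) = act n u (act n s (dif A (n - 1) b))"
    using assms b d by (auto simp: fr_eq_iff fr_rel_def)
  let ?r = "act 0 u (act 0 t s)"
  have "act n ?r a = act n u (act n s (dif A (n - 1) b))"
    using u b assms by (simp add: act_act)
  also have "\<dots> \<in> coboundaries A n" using u b assms coboundariesI[of b n] by simp
  finally show "act n s a \<in> coboundaries A n"
    using act_coboundary_cong[OF assms(1), of s ?r] assms u b by simp
next
  assume "act n s a \<in> coboundaries A n"
  then show "un n a \<in> coboundaries F n" using fr_coboundary assms by (simp add: un_eq[of _ _ s])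
qed

text \<open>In the localization the idempotent acts as 1: the difference of sa and \<open>a\<close>
  is annihilated by \<open>s\<close> up to coboundaries.\<close>

lemma un_coh_class:
  assumes "a \<in> cocycles A n" "s \<in> S"
  shows "un n (act n s a) \<in> coh_class F n (un n a)"
proof -
  have "act n s (act n s a) \<in> coh_class A n (act n s a)"
    using coh_class_act[OF S_coh[OF S_mult[OF assms(2,2)] assms(2)] coh_class_refl, of a n] assms
    by (simp add: act_act)
  then have "act n s (act n s a \<ominus>\<^bsub>gr A n\<^esub> a) \<in> coboundaries A n"
    using assms by (simp add: coh_class_minus_iff gr.minus_eq act_add act_neg)
  then have "un n (act n s a \<ominus>\<^bsub>gr A n\<^esub> a) \<in> coboundaries F n"
    using un_coboundary_iff[of "act n s a \<ominus>\<^bsub>gr A n\<^esub> a" n s] assms by (simp add: gr.minus_eq)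
  then show ?thesis
    using assms by (simp add: F.coh_class_minus_iff gr.minus_eq F.gr.minus_eq un.f_add un.f_neg)
qed

end

section \<open>Products of cdgas\<close>

text \<open>The empty product, at which the recursion \<open>lprod\<close> ends. Any element of the
  carrier type could serve as its single element.\<close>

definition zero_dga :: "('k, 'a) dga" where
  "zero_dga = \<lparr>
     gr = (\<lambda>n. \<lparr>carrier = {undefined}, mult = (\<lambda>x y. undefined), one = undefined, zero = undefined,
       add = (\<lambda>x y. undefined), smult = (\<lambda>c x. undefined)\<rparr>),
     mul = (\<lambda>i j x y. undefined), unity = undefined, dif = (\<lambda>n x. undefined)\<rparr>"

definition bprod :: "('k, 'a) dga \<Rightarrow> ('k, 'a) dga \<Rightarrow> ('k, 'a) dga" where
  "bprod A B = \<lparr>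
     gr = (\<lambda>n. \<lparr>carrier = encode ` (carrier (gr A n) \<times> carrier (gr B n)),
       mult = (\<lambda>x y. undefined), one = undefined, zero = encode (\<zero>\<^bsub>gr A n\<^esub>, \<zero>\<^bsub>gr B n\<^esub>),
       add = (\<lambda>x y. encode (fst (decode x) \<oplus>\<^bsub>gr A n\<^esub> fst (decode y), snd (decode x) \<oplus>\<^bsub>gr B n\<^esub> snd (decode y))),
       smult = (\<lambda>c x. encode (c \<odot>\<^bsub>gr A n\<^esub> fst (decode x), c \<odot>\<^bsub>gr B n\<^esub> snd (decode x)))\<rparr>),
     mul = (\<lambda>i j x y. encode (mul A i j (fst (decode x)) (fst (decode y)), mul B i j (snd (decode x)) (snd (decode y)))),
     unity = encode (unity A, unity B),
     dif = (\<lambda>n x. encode (dif A n (fst (decode x)), dif B n (snd (decode x))))\<rparr>"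

definition bfst :: "('k, 'a) dga \<Rightarrow> ('k, 'a) dga \<Rightarrow> int \<Rightarrow> 'a \<Rightarrow> 'a" where
  "bfst A B n = (\<lambda>x \<in> carrier (gr (bprod A B) n). fst (decode x))"

definition bsnd :: "('k, 'a) dga \<Rightarrow> ('k, 'a) dga \<Rightarrow> int \<Rightarrow> 'a \<Rightarrow> 'a" where
  "bsnd A B n = (\<lambda>x \<in> carrier (gr (bprod A B) n). snd (decode x))"

definition bpair :: "('k, 'a) dga \<Rightarrow> (int \<Rightarrow> 'a \<Rightarrow> 'a) \<Rightarrow> (int \<Rightarrow> 'a \<Rightarrow> 'a) \<Rightarrow> int \<Rightarrow> 'a \<Rightarrow> 'a" where
  "bpair Z f g n = (\<lambda>z \<in> carrier (gr Z n). encode (f n z, g n z))"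

definition zmap :: "('k, 'a) dga \<Rightarrow> int \<Rightarrow> 'a \<Rightarrow> 'a" where
  "zmap X n = (\<lambda>x \<in> carrier (gr X n). undefined)"

lemma cdga_zero_dga:
  assumes "cring K"
  shows "cdga K (zero_dga :: ('k, 'a) dga)"
proof -
  have "module K (gr (zero_dga :: ('k, 'a) dga) n)" for n
  proof (intro module.intro module_axioms.intro assms)
    show "abelian_group (gr (zero_dga :: ('k, 'a) dga) n)"
      by (rule abelian_groupI) (auto simp: zero_dga_def)
  qed (auto simp: zero_dga_def)
  moreover have "\<ominus>\<^bsub>gr (zero_dga :: ('k, 'a) dga) n\<^esub> undefined = undefined" for n
  proof -
    interpret abelian_group "gr (zero_dga :: ('k, 'a) dga) n"
      by (rule abelian_groupI) (auto simp: zero_dga_def)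
    show ?thesis using a_inv_closed[of undefined] by (simp add: zero_dga_def)
  qed
  ultimately show ?thesis
    by (intro cdga.intro) (auto simp: zero_dga_def linear_maps_def signed_def)
qed

lemma zmap_in: "cdga K X \<Longrightarrow> zmap X \<in> cdga_hom K X zero_dga"
proof -
  assume "cdga K X"
  then interpret cdga K X .
  show ?thesis by (rule cdga_homI) (auto simp: zmap_def zero_dga_def)
qed

lemma zmap_unique: "f \<in> cdga_hom K X zero_dga \<Longrightarrow> cdga K X \<Longrightarrow> f = zmap X"
  by (rule cdga_hom_eqI[OF _ zmap_in]) (auto simp: cdga_hom_def linear_maps_def zero_dga_def zmap_def)

section \<open>Binary products with carriers in the given type\<close>

locale cdga_pair = A: cdga K A + B: cdga K B for K :: "'k ring" and A B :: "('k, 'a) dga" +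
  assumes inf: "infinite (UNIV :: 'a set)"
begin

abbreviation "P \<equiv> bprod A B"

lemma dec [simp]: "decode (encode p) = (p :: 'a \<times> 'a)"
  by (rule decode_encode[OF inf])

lemma enc_eq [simp]: "encode p = encode q \<longleftrightarrow> p = (q :: 'a \<times> 'a)"
  using inj_encode[OF inf] by (simp add: inj_eq)

lemma P_cases:
  assumes "x \<in> carrier (gr P n)"
  obtains a b where "a \<in> carrier (gr A n)" "b \<in> carrier (gr B n)" "x = encode (a, b)"
  using assms by (auto simp: bprod_def)

lemma P_simps [simp]:
  "encode (a, b) \<in> carrier (gr P n) \<longleftrightarrow> a \<in> carrier (gr A n) \<and> b \<in> carrier (gr B n)"
  "encode (a, b) \<oplus>\<^bsub>gr P n\<^esub> encode (a', b') = encode (a \<oplus>\<^bsub>gr A n\<^esub> a', b \<oplus>\<^bsub>gr B n\<^esub> b')"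
  "c \<odot>\<^bsub>gr P n\<^esub> encode (a, b) = encode (c \<odot>\<^bsub>gr A n\<^esub> a, c \<odot>\<^bsub>gr B n\<^esub> b)"
  "mul P i j (encode (a, b)) (encode (a', b')) = encode (mul A i j a a', mul B i j b b')"
  "dif P n (encode (a, b)) = encode (dif A n a, dif B n b)"
  "\<zero>\<^bsub>gr P n\<^esub> = encode (\<zero>\<^bsub>gr A n\<^esub>, \<zero>\<^bsub>gr B n\<^esub>)" "unity P = encode (unity A, unity B)"
  by (auto simp: bprod_def)

lemma abelian_group_P: "abelian_group (gr P n)"
proof (rule abelian_groupI)
  fix x assume "x \<in> carrier (gr P n)"
  then obtain a b where *: "a \<in> carrier (gr A n)" "b \<in> carrier (gr B n)" "x = encode (a, b)" by (rule P_cases)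
  show "\<exists>y \<in> carrier (gr P n). y \<oplus>\<^bsub>gr P n\<^esub> x = \<zero>\<^bsub>gr P n\<^esub>"
    using * by (intro bexI[of _ "encode (\<ominus>\<^bsub>gr A n\<^esub> a, \<ominus>\<^bsub>gr B n\<^esub> b)"]) (simp_all add: A.gr.l_neg B.gr.l_neg)
qed (auto elim!: P_cases simp: A.gr.a_ac B.gr.a_ac)

lemma signed_P:
  assumes "a \<in> carrier (gr A n)" "b \<in> carrier (gr B n)"
  shows "signed (gr P n) k (encode (a, b)) = encode (signed (gr A n) k a, signed (gr B n) k b)"
proof -
  interpret Pn: abelian_group "gr P n" by (rule abelian_group_P)
  have "\<ominus>\<^bsub>gr P n\<^esub> encode (a, b) = encode (\<ominus>\<^bsub>gr A n\<^esub> a, \<ominus>\<^bsub>gr B n\<^esub> b)"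
    using assms by (intro Pn.minus_equality) (simp_all add: A.gr.l_neg B.gr.l_neg)
  then show ?thesis by (simp add: signed_def)
qed

lemma cdga_P: "cdga K P"
proof (rule cdga.intro)
  show "module K (gr P n)" for n
    by (intro module.intro module_axioms.intro A.K.is_cring abelian_group_P)
      (auto elim!: P_cases simp: A.smult_l_distr A.smult_r_distr A.smult_assoc1 B.smult_l_distr B.smult_r_distr B.smult_assoc1)
  show "(\<lambda>x. mul P i j x y) \<in> linear_maps K (gr P i) (gr P (i + j))" if "y \<in> carrier (gr P j)" for y i j
    using that by (auto elim!: P_cases simp: linear_maps_def A.mul_add_left B.mul_add_left A.mul_smult_left B.mul_smult_left)
  show "(\<lambda>y. mul P i j x y) \<in> linear_maps K (gr P j) (gr P (i + j))" if "x \<in> carrier (gr P i)" for x i j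
    using that by (auto elim!: P_cases simp: linear_maps_def A.mul_add_right B.mul_add_right A.mul_smult_right B.mul_smult_right)
  show "mul P (i + j) k (mul P i j x y) z = mul P i (j + k) x (mul P j k y z)"
    if "x \<in> carrier (gr P i)" "y \<in> carrier (gr P j)" "z \<in> carrier (gr P k)" for x i y j z k
    using that by (auto elim!: P_cases simp: A.mul_assoc B.mul_assoc)
  show "unity P \<in> carrier (gr P 0)" by simp
  show "mul P 0 n (unity P) x = x" "mul P n 0 x (unity P) = x" if "x \<in> carrier (gr P n)" for x n
    using that by (auto elim!: P_cases simp: A.mul_unity B.mul_unity)
  show "mul P i j x y = signed (gr P (i + j)) (i * j) (mul P j i y x)"
    if xy: "x \<in> carrier (gr P i)" "y \<in> carrier (gr P j)" for x i y j
  proof -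
    obtain a b where x: "a \<in> carrier (gr A i)" "b \<in> carrier (gr B i)" "x = encode (a, b)"
      using xy(1) by (rule P_cases)
    obtain a' b' where y: "a' \<in> carrier (gr A j)" "b' \<in> carrier (gr B j)" "y = encode (a', b')"
      using xy(2) by (rule P_cases)
    have "mul A j i a' a \<in> carrier (gr A (i + j))" "mul B j i b' b \<in> carrier (gr B (i + j))"
      using A.mul_closed[of a' j a i] B.mul_closed[of b' j b i] x y by (simp_all add: add.commute)
    then show ?thesis
      using A.mul_commute[of a i a' j] B.mul_commute[of b i b' j] x y by (simp add: signed_P)
  qed
  show "dif P n \<in> linear_maps K (gr P n) (gr P (n + 1))" for n
    by (auto elim!: P_cases simp: linear_maps_def A.dif_add B.dif_add A.dif_smult B.dif_smult)
  show "dif P (n + 1) (dif P n x) = \<zero>\<^bsub>gr P (n + 2)\<^esub>" if "x \<in> carrier (gr P n)" for x n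
    using that by (auto elim!: P_cases simp: A.dif_dif B.dif_dif)
  show "dif P (i + j) (mul P i j x y) = mul P (i + 1) j (dif P i x) y \<oplus>\<^bsub>gr P (i + j + 1)\<^esub>
      signed (gr P (i + j + 1)) i (mul P i (j + 1) x (dif P j y))"
    if xy: "x \<in> carrier (gr P i)" "y \<in> carrier (gr P j)" for x i y j
  proof -
    obtain a b where x: "a \<in> carrier (gr A i)" "b \<in> carrier (gr B i)" "x = encode (a, b)"
      using xy(1) by (rule P_cases)
    obtain a' b' where y: "a' \<in> carrier (gr A j)" "b' \<in> carrier (gr B j)" "y = encode (a', b')"
      using xy(2) by (rule P_cases)
    have "mul A i (j + 1) a (dif A j a') \<in> carrier (gr A (i + j + 1))" "mul B i (j + 1) b (dif B j b') \<in> carrier (gr B (i + j + 1))"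
      using A.mul_closed[OF x(1) A.dif_closed[OF y(1)]] B.mul_closed[OF x(2) B.dif_closed[OF y(2)]]
      by (simp_all add: add.assoc)
    then show ?thesis using x y by (simp add: signed_P A.leibniz B.leibniz)
  qed
qed

sublocale P: cdga K P by (rule cdga_P)

lemma bfst_enc [simp]: "\<lbrakk>a \<in> carrier (gr A n); b \<in> carrier (gr B n)\<rbrakk> \<Longrightarrow> bfst A B n (encode (a, b)) = a"
  and bsnd_enc [simp]: "\<lbrakk>a \<in> carrier (gr A n); b \<in> carrier (gr B n)\<rbrakk> \<Longrightarrow> bsnd A B n (encode (a, b)) = b"
  by (simp_all add: bfst_def bsnd_def)

lemma bfst_in: "bfst A B \<in> cdga_hom K P A"
  by (rule cdga_homI) (auto elim!: P_cases, simp add: bfst_def)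

lemma bsnd_in: "bsnd A B \<in> cdga_hom K P B"
  by (rule cdga_homI) (auto elim!: P_cases, simp add: bsnd_def)

lemma bpair_in:
  assumes "cdga K Z" "f \<in> cdga_hom K Z A" "g \<in> cdga_hom K Z B"
  shows "bpair Z f g \<in> cdga_hom K Z P"
proof -
  interpret f: cdga_mor K Z A f using assms A.cdga_axioms by (simp add: cdga_mor_def cdga_mor_axioms_def)
  interpret g: cdga_mor K Z B g using assms B.cdga_axioms by (simp add: cdga_mor_def cdga_mor_axioms_def)
  show ?thesis
    by (rule cdga_homI)
      (simp_all add: bpair_def f.f_add g.f_add f.f_smult g.f_smult f.f_mul g.f_mul f.f_dif g.f_dif)
qed

lemma P_cocycle_iff: "encode (a, b) \<in> cocycles P n \<longleftrightarrow> a \<in> cocycles A n \<and> b \<in> cocycles B n"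
  unfolding P.cocycles_iff A.cocycles_iff B.cocycles_iff by auto

lemma P_coboundary_iff: "encode (a, b) \<in> coboundaries P n \<longleftrightarrow> a \<in> coboundaries A n \<and> b \<in> coboundaries B n"
proof
  assume "encode (a, b) \<in> coboundaries P n"
  then obtain y where "y \<in> carrier (gr P (n - 1))" "encode (a, b) = dif P (n - 1) y" by (rule P.coboundariesE)
  then show "a \<in> coboundaries A n \<and> b \<in> coboundaries B n"
    by (auto elim!: P_cases intro: A.coboundariesI B.coboundariesI)
next
  assume "a \<in> coboundaries A n \<and> b \<in> coboundaries B n"
  then obtain c d where "c \<in> carrier (gr A (n - 1))" "a = dif A (n - 1) c" "d \<in> carrier (gr B (n - 1))" "b = dif B (n - 1) d"
    by (meson A.coboundariesE B.coboundariesE)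
  then show "encode (a, b) \<in> coboundaries P n"
    using P.coboundariesI[of "encode (c, d)" n] by simp
qed

lemma bprod_unique:
  assumes "cdga K Z" "h \<in> cdga_hom K Z P" "k \<in> cdga_hom K Z P"
    and "hom_comp Z (bfst A B) h = hom_comp Z (bfst A B) k" "hom_comp Z (bsnd A B) h = hom_comp Z (bsnd A B) k"
  shows "h = k"
proof (rule cdga_hom_eqI[OF assms(2,3)])
  fix n z assume z: "z \<in> carrier (gr Z n)"
  have "h n z \<in> carrier (gr P n)" "k n z \<in> carrier (gr P n)"
    using assms z by (auto simp: cdga_hom_def linear_maps_def)
  moreover have "bfst A B n (h n z) = bfst A B n (k n z)" "bsnd A B n (h n z) = bsnd A B n (k n z)"
    using fun_cong[OF fun_cong[OF assms(4)], of n z] fun_cong[OF fun_cong[OF assms(5)], of n z] z by simp_all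
  ultimately show "h n z = k n z" by (auto elim!: P_cases)
qed

end

lemma nonneg_zero_dga: "nonneg_graded zero_dga"
  by (simp add: nonneg_graded_def zero_dga_def)

lemma nonneg_bprod:
  assumes "cdga_pair K A B" "nonneg_graded A" "nonneg_graded B"
  shows "nonneg_graded (bprod A B)"
  using assms(2,3) by (auto simp: nonneg_graded_def bprod_def)

text \<open>Cocycles and coboundaries of a product are pairs of such, so both conditions of
  \<open>quasi_iso_iff\<close> split into conditions on the two factors.\<close>

lemma bpair_quasi_iso:
  assumes "cdga_pair K A B" "cdga_pair K A' B'"
    and f: "f \<in> cdga_hom K A A'" "f \<in> quasi_iso K A A'" and g: "g \<in> cdga_hom K B B'" "g \<in> quasi_iso K B B'"
  shows "bpair (bprod A B) (hom_comp (bprod A B) f (bfst A B)) (hom_comp (bprod A B) g (bsnd A B)) \<in>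
    quasi_iso K (bprod A B) (bprod A' B')" (is "?h \<in> _")
proof -
  interpret S: cdga_pair K A B by fact
  interpret T: cdga_pair K A' B' by fact
  interpret f: cdga_mor K A A' f by unfold_locales (rule f)
  interpret g: cdga_mor K B B' g by unfold_locales (rule g)
  have hom: "?h \<in> cdga_hom K S.P T.P"
    by (intro T.bpair_in S.cdga_P hom_comp_in[OF S.cdga_P S.A.cdga_axioms T.A.cdga_axioms]
        hom_comp_in[OF S.cdga_P S.B.cdga_axioms T.B.cdga_axioms] f g S.bfst_in S.bsnd_in)
  interpret h: cdga_mor K S.P T.P ?h by unfold_locales (rule hom)
  have he: "?h n (encode (a, b)) = encode (f n a, g n b)" if "a \<in> carrier (gr A n)" "b \<in> carrier (gr B n)" for n a b
    using that by (simp add: bpair_def)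
  show ?thesis
    unfolding h.quasi_iso_iff
  proof (intro allI conjI ballI impI)
    fix n x assume x: "x \<in> cocycles S.P n" "?h n x \<in> coboundaries T.P n"
    obtain a b where ab: "a \<in> carrier (gr A n)" "b \<in> carrier (gr B n)" "x = encode (a, b)"
      using S.P_cases[OF S.P.cocycles_carrier[OF x(1)]] .
    then show "x \<in> coboundaries S.P n"
      using x f.quasi_isoD(1)[OF f(2), of a n] g.quasi_isoD(1)[OF g(2), of b n]
      by (simp add: he S.P_cocycle_iff S.P_coboundary_iff T.P_coboundary_iff)
  next
    fix n y assume y: "y \<in> cocycles T.P n"
    obtain a b where ab: "a \<in> carrier (gr A' n)" "b \<in> carrier (gr B' n)" "y = encode (a, b)"
      using T.P_cases[OF T.P.cocycles_carrier[OF y]] .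
    then have c: "a \<in> cocycles A' n" "b \<in> cocycles B' n" using y by (auto simp: T.P_cocycle_iff)
    obtain a' where a': "a' \<in> cocycles A n" "a \<in> coh_class A' n (f n a')" using f.quasi_isoD(2)[OF f(2) c(1)] by blast
    obtain b' where b': "b' \<in> cocycles B n" "b \<in> coh_class B' n (g n b')" using g.quasi_isoD(2)[OF g(2) c(2)] by blast
    obtain u v where uv: "u \<in> coboundaries A' n" "a = u \<oplus>\<^bsub>gr A' n\<^esub> f n a'" "v \<in> coboundaries B' n" "b = v \<oplus>\<^bsub>gr B' n\<^esub> g n b'"
      using a' b' by (auto simp: T.A.coh_class_iff T.B.coh_class_iff)
    show "\<exists>x \<in> cocycles S.P n. y \<in> coh_class T.P n (?h n x)"
      using ab uv a' b'
      by (intro bexI[of _ "encode (a', b')"])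
        (auto simp: S.P_cocycle_iff T.P.coh_class_iff he T.P_coboundary_iff intro!: bexI[of _ "encode (u, v)"])
  qed
qed

section \<open>The algebra \<open>H\<^sup>0\<close>\<close>

lemma (in abelian_group) minus_zero_imp_eq:
  assumes "x \<in> carrier G" "y \<in> carrier G" "x \<ominus> y = \<zero>"
  shows "x = y"
proof -
  have "x = (x \<ominus> y) \<oplus> y" using assms(1,2) by (simp add: minus_eq a_assoc l_neg)
  then show ?thesis using assms by simp
qed

context cdga
begin

lemma coh_class_nonempty: "x \<in> carrier (gr A n) \<Longrightarrow> coh_class A n x \<noteq> {}"
  using coh_class_refl by blast

text \<open>The unions in \<open>H0_algebra\<close> run over representatives and are unions of
  constant, nonempty families. For the sum, the elementwise sum of two cosets is again a full
  coset.\<close>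

lemma H0_rules:
  assumes "x \<in> cocycles A 0" "y \<in> cocycles A 0"
  shows H0_add: "coh_class A 0 x \<oplus>\<^bsub>H0_algebra A\<^esub> coh_class A 0 y = coh_class A 0 (x \<oplus>\<^bsub>gr A 0\<^esub> y)"
    and H0_mult: "coh_class A 0 x \<otimes>\<^bsub>H0_algebra A\<^esub> coh_class A 0 y = coh_class A 0 (mul A 0 0 x y)"
    and H0_smult: "c \<in> carrier K \<Longrightarrow> c \<odot>\<^bsub>H0_algebra A\<^esub> coh_class A 0 x = coh_class A 0 (c \<odot>\<^bsub>gr A 0\<^esub> x)"
proof -
  have "coh_class A 0 (mul A 0 0 x' y') = coh_class A 0 (mul A 0 0 x y)"
    if "x' \<in> coh_class A 0 x" "y' \<in> coh_class A 0 y" for x' y'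
    using coh_class_eq[OF coh_class_act[OF that assms]] assms by simp
  then have "(\<Union>x' \<in> coh_class A 0 x. \<Union>y' \<in> coh_class A 0 y. coh_class A 0 (mul A 0 0 x' y')) =
      (\<Union>x' \<in> coh_class A 0 x. \<Union>y' \<in> coh_class A 0 y. coh_class A 0 (mul A 0 0 x y))" by simp
  also have "\<dots> = coh_class A 0 (mul A 0 0 x y)"
    using coh_class_nonempty[of x 0] coh_class_nonempty[of y 0] assms by simp
  finally show "coh_class A 0 x \<otimes>\<^bsub>H0_algebra A\<^esub> coh_class A 0 y = coh_class A 0 (mul A 0 0 x y)"
    by (simp add: H0_algebra_def)
  show "c \<odot>\<^bsub>H0_algebra A\<^esub> coh_class A 0 x = coh_class A 0 (c \<odot>\<^bsub>gr A 0\<^esub> x)" if c: "c \<in> carrier K"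
  proof -
    have "coh_class A 0 (c \<odot>\<^bsub>gr A 0\<^esub> x') = coh_class A 0 (c \<odot>\<^bsub>gr A 0\<^esub> x)" if "x' \<in> coh_class A 0 x" for x'
      using coh_class_eq[OF coh_class_smult[OF c that]] assms c by simp
    then have "(\<Union>x' \<in> coh_class A 0 x. coh_class A 0 (c \<odot>\<^bsub>gr A 0\<^esub> x')) =
        (\<Union>x' \<in> coh_class A 0 x. coh_class A 0 (c \<odot>\<^bsub>gr A 0\<^esub> x))"
      by (rule SUP_cong[OF refl])
    also have "\<dots> = coh_class A 0 (c \<odot>\<^bsub>gr A 0\<^esub> x)"
      using coh_class_nonempty[of x 0] assms by simp
    finally show ?thesis by (simp add: H0_algebra_def)
  qed
  have "coh_class A 0 x <+>\<^bsub>gr A 0\<^esub> coh_class A 0 y = coh_class A 0 (x \<oplus>\<^bsub>gr A 0\<^esub> y)"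
  proof (intro equalityI subsetI)
    fix z assume "z \<in> coh_class A 0 x <+>\<^bsub>gr A 0\<^esub> coh_class A 0 y"
    then show "z \<in> coh_class A 0 (x \<oplus>\<^bsub>gr A 0\<^esub> y)"
      using coh_class_add[of _ 0 x _ y] assms by (auto simp: set_add_def set_mult_def)
  next
    fix z assume "z \<in> coh_class A 0 (x \<oplus>\<^bsub>gr A 0\<^esub> y)"
    then obtain b where b: "b \<in> coboundaries A 0" "z = b \<oplus>\<^bsub>gr A 0\<^esub> (x \<oplus>\<^bsub>gr A 0\<^esub> y)" by (auto simp: coh_class_iff)
    then have "z = (b \<oplus>\<^bsub>gr A 0\<^esub> x) \<oplus>\<^bsub>gr A 0\<^esub> y" using assms by (simp add: gr.a_assoc)
    moreover have "b \<oplus>\<^bsub>gr A 0\<^esub> x \<in> coh_class A 0 x" using b by (auto simp: coh_class_iff)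
    ultimately show "z \<in> coh_class A 0 x <+>\<^bsub>gr A 0\<^esub> coh_class A 0 y"
      using cocycles_carrier[OF assms(2), THEN coh_class_refl] by (auto simp: set_add_def set_mult_def)
  qed
  then show "coh_class A 0 x \<oplus>\<^bsub>H0_algebra A\<^esub> coh_class A 0 y = coh_class A 0 (x \<oplus>\<^bsub>gr A 0\<^esub> y)"
    by (simp add: H0_algebra_def)
qed

lemma H0_carrier: "carrier (H0_algebra A) = cohomology A 0"
  and H0_one: "\<one>\<^bsub>H0_algebra A\<^esub> = coh_class A 0 (unity A)"
  by (simp_all add: H0_algebra_def)

text \<open>An algebra isomorphism from \<open>H\<^sup>0\<close> to \<open>N\<close>, preceded by
  the quotient map and thus defined on cocycles. It replaces computations with cosets.\<close>

definition H0_char :: "('k, 's) module \<Rightarrow> ('a \<Rightarrow> 's) \<Rightarrow> bool" where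
  "H0_char N \<chi> \<longleftrightarrow> \<chi> ` cocycles A 0 = carrier N \<and>
     (\<forall>x \<in> cocycles A 0. \<forall>y \<in> cocycles A 0. \<chi> x = \<chi> y \<longleftrightarrow> x \<in> coh_class A 0 y) \<and>
     (\<forall>x \<in> cocycles A 0. \<forall>y \<in> cocycles A 0. \<chi> (x \<oplus>\<^bsub>gr A 0\<^esub> y) = \<chi> x \<oplus>\<^bsub>N\<^esub> \<chi> y) \<and>
     (\<forall>x \<in> cocycles A 0. \<forall>y \<in> cocycles A 0. \<chi> (mul A 0 0 x y) = \<chi> x \<otimes>\<^bsub>N\<^esub> \<chi> y) \<and>
     (\<forall>c \<in> carrier K. \<forall>x \<in> cocycles A 0. \<chi> (c \<odot>\<^bsub>gr A 0\<^esub> x) = c \<odot>\<^bsub>N\<^esub> \<chi> x) \<and>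
     \<chi> (unity A) = \<one>\<^bsub>N\<^esub>"

lemma algebra_isomorphic_H0_iff: "algebra_isomorphic K (H0_algebra A) N \<longleftrightarrow> (\<exists>\<chi>. H0_char N \<chi>)"
proof
  assume "algebra_isomorphic K (H0_algebra A) N"
  then obtain h where h: "h \<in> ring_iso (H0_algebra A) N"
      "\<forall>c \<in> carrier K. \<forall>x \<in> carrier (H0_algebra A). h (c \<odot>\<^bsub>H0_algebra A\<^esub> x) = c \<odot>\<^bsub>N\<^esub> h x"
    by (auto simp: algebra_isomorphic_def)
  have hom: "h \<in> ring_hom (H0_algebra A) N" and bij: "bij_betw h (cohomology A 0) (carrier N)"
    using h(1) by (auto simp: ring_iso_def H0_carrier)
  have "H0_char N (\<lambda>z. h (coh_class A 0 z))"
    unfolding H0_char_def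
  proof (intro conjI ballI)
    show "(\<lambda>z. h (coh_class A 0 z)) ` cocycles A 0 = carrier N"
      using bij by (auto simp: bij_betw_def cohomology_def image_image)
    fix x y assume xy: "x \<in> cocycles A 0" "y \<in> cocycles A 0"
    note c = cohomologyI[OF xy(1)] cohomologyI[OF xy(2)]
    show "h (coh_class A 0 x) = h (coh_class A 0 y) \<longleftrightarrow> x \<in> coh_class A 0 y"
      using bij c xy inj_on_eq_iff[of h "cohomology A 0"] by (simp add: bij_betw_def coh_class_eq_iff)
    show "h (coh_class A 0 (x \<oplus>\<^bsub>gr A 0\<^esub> y)) = h (coh_class A 0 x) \<oplus>\<^bsub>N\<^esub> h (coh_class A 0 y)"
      using ring_hom_add[OF hom] c xy by (simp add: H0_carrier H0_add[symmetric])
    show "h (coh_class A 0 (mul A 0 0 x y)) = h (coh_class A 0 x) \<otimes>\<^bsub>N\<^esub> h (coh_class A 0 y)"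
      using ring_hom_mult[OF hom] c xy by (simp add: H0_carrier H0_mult[symmetric])
    fix k assume "k \<in> carrier K"
    then show "h (coh_class A 0 (k \<odot>\<^bsub>gr A 0\<^esub> x)) = k \<odot>\<^bsub>N\<^esub> h (coh_class A 0 x)"
      using h(2) c xy by (simp add: H0_carrier H0_smult[OF xy(1,1), symmetric])
  next
    show "h (coh_class A 0 (unity A)) = \<one>\<^bsub>N\<^esub>" using ring_hom_one[OF hom] by (simp add: H0_one)
  qed
  then show "\<exists>\<chi>. H0_char N \<chi>" by blast
next
  assume "\<exists>\<chi>. H0_char N \<chi>"
  then obtain \<chi> where \<chi>: "H0_char N \<chi>" by blast
  define h where "h X = \<chi> (SOME x. x \<in> X)" for X
  have h: "h (coh_class A 0 x) = \<chi> x" if x: "x \<in> cocycles A 0" for x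
  proof -
    have s: "(SOME y. y \<in> coh_class A 0 x) \<in> coh_class A 0 x"
      by (rule someI[of _ x], rule coh_class_refl) (use x in simp)
    then show ?thesis
      using coh_class_cocycle[OF s x] x \<chi> unfolding h_def H0_char_def by blast
  qed
  have "h \<in> ring_iso (H0_algebra A) N"
    unfolding ring_iso_def
  proof (intro CollectI conjI ring_hom_memI)
    show "bij_betw h (carrier (H0_algebra A)) (carrier N)"
      unfolding H0_carrier
    proof (rule bij_betw_imageI)
      show "inj_on h (cohomology A 0)"
      proof (rule inj_onI)
        fix X Y assume "X \<in> cohomology A 0" "Y \<in> cohomology A 0" "h X = h Y"
        then obtain x y where "x \<in> cocycles A 0" "X = coh_class A 0 x" "y \<in> cocycles A 0" "Y = coh_class A 0 y"
          "\<chi> x = \<chi> y" by (metis cohomologyE h)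
        then show "X = Y" using \<chi> by (simp add: H0_char_def coh_class_eq_iff)
      qed
      show "h ` cohomology A 0 = carrier N"
        using \<chi> h by (simp add: cohomology_def image_image H0_char_def cong: image_cong)
    qed
    show "h \<one>\<^bsub>H0_algebra A\<^esub> = \<one>\<^bsub>N\<^esub>" using h \<chi> by (simp add: H0_one H0_char_def)
    fix X assume "X \<in> carrier (H0_algebra A)"
    then obtain x where x: "x \<in> cocycles A 0" "X = coh_class A 0 x" by (auto simp: H0_carrier elim: cohomologyE)
    have "\<chi> x \<in> carrier N" using \<chi> x(1) by (auto simp: H0_char_def)
    then show "h X \<in> carrier N" using x h by simp
    fix Y assume "Y \<in> carrier (H0_algebra A)"
    then obtain y where y: "y \<in> cocycles A 0" "Y = coh_class A 0 y" by (auto simp: H0_carrier elim: cohomologyE)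
    show "h (X \<otimes>\<^bsub>H0_algebra A\<^esub> Y) = h X \<otimes>\<^bsub>N\<^esub> h Y" "h (X \<oplus>\<^bsub>H0_algebra A\<^esub> Y) = h X \<oplus>\<^bsub>N\<^esub> h Y"
      using x y h \<chi> by (simp_all add: H0_mult H0_add H0_char_def)
  qed
  moreover have "h (c \<odot>\<^bsub>H0_algebra A\<^esub> X) = c \<odot>\<^bsub>N\<^esub> h X" if c: "c \<in> carrier K" and X: "X \<in> carrier (H0_algebra A)" for c X
  proof -
    obtain x where x: "x \<in> cocycles A 0" "X = coh_class A 0 x"
      using X by (auto simp: H0_carrier elim: cohomologyE)
    then show ?thesis using \<chi> c h by (simp add: H0_smult[OF x(1) x(1)] H0_char_def)
  qed
  ultimately show "algebra_isomorphic K (H0_algebra A) N" by (auto simp: algebra_isomorphic_def)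
qed

end

lemma base_algebra_simps [simp]:
  "carrier (base_algebra K) = carrier K" "\<zero>\<^bsub>base_algebra K\<^esub> = \<zero>\<^bsub>K\<^esub>" "\<one>\<^bsub>base_algebra K\<^esub> = \<one>\<^bsub>K\<^esub>"
  "x \<oplus>\<^bsub>base_algebra K\<^esub> y = x \<oplus>\<^bsub>K\<^esub> y" "x \<otimes>\<^bsub>base_algebra K\<^esub> y = x \<otimes>\<^bsub>K\<^esub> y"
  "c \<odot>\<^bsub>base_algebra K\<^esub> x = c \<otimes>\<^bsub>K\<^esub> x"
  by (simp_all add: base_algebra_def ring.defs)

lemma prod_module_simps [simp]:
  "carrier (prod_module J M) = (\<Pi>\<^sub>E j\<in>J. carrier (M j))"
  "\<one>\<^bsub>prod_module J M\<^esub> = (\<lambda>j\<in>J. \<one>\<^bsub>M j\<^esub>)" "\<zero>\<^bsub>prod_module J M\<^esub> = (\<lambda>j\<in>J. \<zero>\<^bsub>M j\<^esub>)"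
  "x \<oplus>\<^bsub>prod_module J M\<^esub> y = (\<lambda>j\<in>J. x j \<oplus>\<^bsub>M j\<^esub> y j)"
  "x \<otimes>\<^bsub>prod_module J M\<^esub> y = (\<lambda>j\<in>J. x j \<otimes>\<^bsub>M j\<^esub> y j)"
  "c \<odot>\<^bsub>prod_module J M\<^esub> x = (\<lambda>j\<in>J. c \<odot>\<^bsub>M j\<^esub> x j)"
  by (simp_all add: prod_module_def)

context cdga
begin

lemma smult_zero [simp]: "x \<in> carrier (gr A n) \<Longrightarrow> \<zero>\<^bsub>K\<^esub> \<odot>\<^bsub>gr A n\<^esub> x = \<zero>\<^bsub>gr A n\<^esub>"
  using module.smult_l_null[OF gr_module] .

lemma act_smult_unity:
  "\<lbrakk>c \<in> carrier K; x \<in> carrier (gr A n)\<rbrakk> \<Longrightarrow> act n (c \<odot>\<^bsub>gr A 0\<^esub> unity A) x = c \<odot>\<^bsub>gr A n\<^esub> x"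
  using mul_smult_left[of "unity A" 0 x n c] by simp

lemma gr_minusI:
  "\<lbrakk>x \<in> carrier (gr A n); y \<in> carrier (gr A n); x \<oplus>\<^bsub>gr A n\<^esub> y = z\<rbrakk> \<Longrightarrow> x = z \<ominus>\<^bsub>gr A n\<^esub> y"
  by (auto simp: gr.minus_eq gr.a_assoc gr.r_neg)

text \<open>An algebra isomorphism from \<open>H\<^sup>0\<close> to the field must be inverse to the
  structure map c \<mapsto> c 1. So one exists exactly if the structure map is bijective, and this
  can be said with multiples of \<open>unity A\<close> alone.\<close>

lemma homologically_connected_iff:
  "homologically_connected K A \<longleftrightarrow> (\<forall>n < 0. \<forall>x \<in> cocycles A n. x \<in> coboundaries A n) \<and>
     (\<forall>z \<in> cocycles A 0. \<exists>c \<in> carrier K. z \<in> coh_class A 0 (c \<odot>\<^bsub>gr A 0\<^esub> unity A)) \<and>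
     (\<forall>c \<in> carrier K. c \<odot>\<^bsub>gr A 0\<^esub> unity A \<in> coboundaries A 0 \<longrightarrow> c = \<zero>\<^bsub>K\<^esub>)"
  (is "_ \<longleftrightarrow> ?neg \<and> ?surj \<and> ?inj")
proof -
  have "algebra_isomorphic K (H0_algebra A) (base_algebra K) \<longleftrightarrow> ?surj \<and> ?inj"
    unfolding algebra_isomorphic_H0_iff
  proof
    assume "\<exists>\<chi>. H0_char (base_algebra K) \<chi>"
    then obtain \<chi> where \<chi>: "H0_char (base_algebra K) \<chi>" by blast
    have k: "\<chi> z \<in> carrier K" if "z \<in> cocycles A 0" for z
      using \<chi> that by (auto simp: H0_char_def)
    have u: "\<chi> (c \<odot>\<^bsub>gr A 0\<^esub> unity A) = c" if "c \<in> carrier K" for c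
      using \<chi> that by (simp add: H0_char_def)
    have ?surj
    proof
      fix z assume z: "z \<in> cocycles A 0"
      then have "\<chi> z = \<chi> (\<chi> z \<odot>\<^bsub>gr A 0\<^esub> unity A)" using k u by simp
      moreover have "\<chi> z \<odot>\<^bsub>gr A 0\<^esub> unity A \<in> cocycles A 0" using k z by simp
      ultimately have "z \<in> coh_class A 0 (\<chi> z \<odot>\<^bsub>gr A 0\<^esub> unity A)"
        using \<chi> z unfolding H0_char_def by blast
      then show "\<exists>c \<in> carrier K. z \<in> coh_class A 0 (c \<odot>\<^bsub>gr A 0\<^esub> unity A)" using k z by blast
    qed
    moreover have ?inj
    proof (intro ballI impI)
      fix c assume c: "c \<in> carrier K" "c \<odot>\<^bsub>gr A 0\<^esub> unity A \<in> coboundaries A 0"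
      have "c \<odot>\<^bsub>gr A 0\<^esub> unity A \<in> coh_class A 0 (\<zero>\<^bsub>K\<^esub> \<odot>\<^bsub>gr A 0\<^esub> unity A)"
        using c by (simp add: coh_class_zero)
      moreover have "c \<odot>\<^bsub>gr A 0\<^esub> unity A \<in> cocycles A 0" "\<zero>\<^bsub>K\<^esub> \<odot>\<^bsub>gr A 0\<^esub> unity A \<in> cocycles A 0"
        using c by simp_all
      ultimately have "\<chi> (c \<odot>\<^bsub>gr A 0\<^esub> unity A) = \<chi> (\<zero>\<^bsub>K\<^esub> \<odot>\<^bsub>gr A 0\<^esub> unity A)"
        using \<chi> unfolding H0_char_def by blast
      then show "c = \<zero>\<^bsub>K\<^esub>" unfolding u[OF c(1)] u[OF K.zero_closed] .
    qed
    ultimately show "?surj \<and> ?inj" by blast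
  next
    assume si: "?surj \<and> ?inj"
    \<comment> \<open>The scalar whose multiple of 1 is cohomologous to \<open>z\<close>;
      \<open>uniq\<close> shows that there is only one.\<close>
    define \<chi> where "\<chi> z = (SOME c. c \<in> carrier K \<and> z \<in> coh_class A 0 (c \<odot>\<^bsub>gr A 0\<^esub> unity A))" for z
    have \<chi>: "\<chi> z \<in> carrier K" "z \<in> coh_class A 0 (\<chi> z \<odot>\<^bsub>gr A 0\<^esub> unity A)" if "z \<in> cocycles A 0" for z
    proof -
      have "\<exists>c. c \<in> carrier K \<and> z \<in> coh_class A 0 (c \<odot>\<^bsub>gr A 0\<^esub> unity A)" using si that by blast
      from someI_ex[OF this] show "\<chi> z \<in> carrier K" "z \<in> coh_class A 0 (\<chi> z \<odot>\<^bsub>gr A 0\<^esub> unity A)"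
        by (simp_all add: \<chi>_def)
    qed
    have uniq: "c = d" if "c \<in> carrier K" "d \<in> carrier K"
        "c \<odot>\<^bsub>gr A 0\<^esub> unity A \<in> coh_class A 0 (d \<odot>\<^bsub>gr A 0\<^esub> unity A)" for c d
    proof -
      have "(c \<ominus>\<^bsub>K\<^esub> d) \<odot>\<^bsub>gr A 0\<^esub> unity A \<oplus>\<^bsub>gr A 0\<^esub> d \<odot>\<^bsub>gr A 0\<^esub> unity A = c \<odot>\<^bsub>gr A 0\<^esub> unity A"
        using that by (simp add: smult_l_distr[symmetric] K.minus_eq K.a_assoc K.l_neg)
      then have "(c \<ominus>\<^bsub>K\<^esub> d) \<odot>\<^bsub>gr A 0\<^esub> unity A = c \<odot>\<^bsub>gr A 0\<^esub> unity A \<ominus>\<^bsub>gr A 0\<^esub> d \<odot>\<^bsub>gr A 0\<^esub> unity A"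
        using that gr_minusI by simp
      then have "(c \<ominus>\<^bsub>K\<^esub> d) \<odot>\<^bsub>gr A 0\<^esub> unity A \<in> coboundaries A 0"
        using that by (simp add: coh_class_minus_iff)
      moreover have "c \<ominus>\<^bsub>K\<^esub> d \<in> carrier K" using that by simp
      ultimately have "c \<ominus>\<^bsub>K\<^esub> d = \<zero>\<^bsub>K\<^esub>" by (rule bspec[OF conjunct2[OF si], THEN mp, rotated])
      then show "c = d" by (rule K.minus_zero_imp_eq[OF that(1,2)])
    qed
    have eq: "\<chi> z = c" if "z \<in> cocycles A 0" "c \<in> carrier K" "z \<in> coh_class A 0 (c \<odot>\<^bsub>gr A 0\<^esub> unity A)" for z c
    proof (rule uniq[OF \<chi>(1)[OF that(1)] that(2)])
      show "\<chi> z \<odot>\<^bsub>gr A 0\<^esub> unity A \<in> coh_class A 0 (c \<odot>\<^bsub>gr A 0\<^esub> unity A)"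
        by (rule coh_class_trans[OF coh_class_sym[OF \<chi>(2)[OF that(1)]] that(3)]) (use \<chi>(1) that in simp_all)
    qed
    have "H0_char (base_algebra K) \<chi>"
      unfolding H0_char_def
    proof (intro conjI ballI)
      have "c \<in> \<chi> ` cocycles A 0" if "c \<in> carrier K" for c
        using eq[of "c \<odot>\<^bsub>gr A 0\<^esub> unity A" c] that by (intro image_eqI[of _ _ "c \<odot>\<^bsub>gr A 0\<^esub> unity A"]) simp_all
      then show "\<chi> ` cocycles A 0 = carrier (base_algebra K)" using \<chi>(1) by auto
      show "\<chi> (unity A) = \<one>\<^bsub>base_algebra K\<^esub>" using eq[of "unity A" "\<one>\<^bsub>K\<^esub>"] by simp
      fix x assume x: "x \<in> cocycles A 0"
      fix y assume y: "y \<in> cocycles A 0"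
      show "\<chi> x = \<chi> y \<longleftrightarrow> x \<in> coh_class A 0 y"
      proof
        assume "\<chi> x = \<chi> y"
        then show "x \<in> coh_class A 0 y"
          using \<chi>(2)[OF x] coh_class_sym[OF \<chi>(2)[OF y]] coh_class_trans[of x 0 "\<chi> x \<odot>\<^bsub>gr A 0\<^esub> unity A" y] \<chi>(1) x y
          by simp
      next
        assume "x \<in> coh_class A 0 y"
        then show "\<chi> x = \<chi> y"
          using eq[OF x \<chi>(1)[OF y]] coh_class_trans[OF _ \<chi>(2)[OF y]] \<chi>(1)[OF y] by simp
      qed
      show "\<chi> (x \<oplus>\<^bsub>gr A 0\<^esub> y) = \<chi> x \<oplus>\<^bsub>base_algebra K\<^esub> \<chi> y"
        using eq[of "x \<oplus>\<^bsub>gr A 0\<^esub> y" "\<chi> x \<oplus>\<^bsub>K\<^esub> \<chi> y"] coh_class_add[OF \<chi>(2)[OF x] \<chi>(2)[OF y]] \<chi>(1) x y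
        by (simp add: smult_l_distr)
      show "\<chi> (mul A 0 0 x y) = \<chi> x \<otimes>\<^bsub>base_algebra K\<^esub> \<chi> y"
        using eq[of "mul A 0 0 x y" "\<chi> x \<otimes>\<^bsub>K\<^esub> \<chi> y"] coh_class_act[OF \<chi>(2)[OF x] \<chi>(2)[OF y]] \<chi>(1) x y
        by (simp add: act_smult_unity smult_assoc1)
    next
      fix c x assume c: "c \<in> carrier K" and x: "x \<in> cocycles A 0"
      show "\<chi> (c \<odot>\<^bsub>gr A 0\<^esub> x) = c \<odot>\<^bsub>base_algebra K\<^esub> \<chi> x"
        using eq[of "c \<odot>\<^bsub>gr A 0\<^esub> x" "c \<otimes>\<^bsub>K\<^esub> \<chi> x"] coh_class_smult[OF c \<chi>(2)[OF x]] \<chi>(1) x c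
        by (simp add: smult_assoc1)
    qed
    then show "\<exists>\<chi>. H0_char (base_algebra K) \<chi>" by blast
  qed
  then show ?thesis by (auto simp: homologically_connected_def cohomology_trivial_iff)
qed

end

section \<open>Complete orthogonal systems of idempotents\<close>

lemma (in cdga) idempotents_mem:
  assumes "e \<in> idempotents A" "s \<in> e"
  shows "s \<in> cocycles A 0" "e = coh_class A 0 s" "act 0 s s \<in> coh_class A 0 s"
proof -
  have e: "e \<in> cohomology A 0" "act 0 s s \<in> e" using assms by (simp_all add: idempotents_def)
  show "s \<in> cocycles A 0" "e = coh_class A 0 s" using cohomology_mem[OF e(1) assms(2)] .
  then show "act 0 s s \<in> coh_class A 0 s" using e(2) by simp
qed

lemma (in cdga) idempotentsE:
  assumes "e \<in> idempotents A"
  obtains s where "s \<in> cocycles A 0" "s \<in> e" "e = coh_class A 0 s" "act 0 s s \<in> coh_class A 0 s"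
proof -
  obtain s where "s \<in> e" using cohomology_nonempty[of e 0] assms by (auto simp: idempotents_def)
  then show ?thesis using that[of s] idempotents_mem[OF assms] by blast
qed

text \<open>One representative suffices, because products respect cohomology classes.\<close>

lemma (in cdga) idempotentsI:
  assumes s: "s \<in> cocycles A 0" and ss: "act 0 s s \<in> coh_class A 0 s"
  shows "coh_class A 0 s \<in> idempotents A"
  unfolding idempotents_def
proof (intro CollectI conjI ballI)
  show "coh_class A 0 s \<in> cohomology A 0" using s by (rule cohomologyI)
  fix x y assume "x \<in> coh_class A 0 s" "y \<in> coh_class A 0 s"
  then show "mul A 0 0 x y \<in> coh_class A 0 s"
    using coh_class_trans[OF coh_class_act ss] s by simp
qed

lemma (in cdga) top_idempotent: "coh_class A 0 (unity A) \<in> idempotents A"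
  by (rule idempotentsI) simp_all

context cdga_mor
begin

lemma push_mem: "\<lbrakk>e \<in> idempotents A; s \<in> e\<rbrakk> \<Longrightarrow> coh_map A B f 0 e = coh_class B 0 (f 0 s)"
  using A.idempotents_mem[of e s] coh_map_class[of s 0] by simp

lemma push_mem': "\<lbrakk>e \<in> idempotents A; s \<in> e\<rbrakk> \<Longrightarrow> f 0 s \<in> coh_map A B f 0 e"
  using push_mem[of e s] A.idempotents_mem[of e s] by simp

lemma push_idempotents: "e \<in> idempotents A \<Longrightarrow> coh_map A B f 0 e \<in> idempotents B"
proof -
  assume e: "e \<in> idempotents A"
  then obtain s where s: "s \<in> cocycles A 0" "s \<in> e" "A.act 0 s s \<in> coh_class A 0 s" by (rule A.idempotentsE)
  have "B.act 0 (f 0 s) (f 0 s) \<in> coh_class B 0 (f 0 s)"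
    using f_coh_class[OF s(3)] s by (simp add: f_act)
  then show ?thesis using push_mem[OF e s(2)] B.idempotentsI s by simp
qed

lemma push_top: "coh_map A B f 0 (coh_class A 0 (unity A)) = coh_class B 0 (unity B)"
  by (simp add: coh_map_class)

text \<open>For surjectivity a representative \<open>t\<close> is lifted to a cocycle
  \<open>s\<close>; that the class of \<open>s\<close> is idempotent again follows from injectivity
  on cohomology.\<close>

lemma push_bij:
  assumes "f \<in> quasi_iso K A B"
  shows "bij_betw (coh_map A B f 0) (idempotents A) (idempotents B)"
proof (rule bij_betw_imageI)
  have "inj_on (coh_map A B f 0) (cohomology A 0)"
    using assms by (simp add: quasi_iso_def bij_betw_def)
  then show "inj_on (coh_map A B f 0) (idempotents A)"
    by (rule inj_on_subset) (auto simp: idempotents_def)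
  have "e \<in> coh_map A B f 0 ` idempotents A" if e: "e \<in> idempotents B" for e
  proof -
    obtain t where t: "t \<in> cocycles B 0" "e = coh_class B 0 t" "B.act 0 t t \<in> coh_class B 0 t"
      using e by (rule B.idempotentsE)
    obtain s where s: "s \<in> cocycles A 0" "t \<in> coh_class B 0 (f 0 s)"
      using quasi_isoD(2)[OF assms t(1)] by blast
    have st: "f 0 s \<in> coh_class B 0 t" using B.coh_class_sym[OF s(2)] s by simp
    have "B.act 0 (f 0 s) (f 0 s) \<in> coh_class B 0 (f 0 s)"
      using B.coh_class_trans[OF B.coh_class_act[OF st st] B.coh_class_trans[OF t(3) s(2)]] t s by simp
    then have "A.act 0 s s \<in> coh_class A 0 s"
      using quasi_isoD(3)[OF assms, of "A.act 0 s s" 0 s] s by (simp add: f_act)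
    then have "coh_class A 0 s \<in> idempotents A" using A.idempotentsI s by blast
    moreover have "coh_map A B f 0 (coh_class A 0 s) = e"
      using s t B.coh_class_eq[OF s(2)] by (simp add: coh_map_class)
    ultimately show ?thesis by blast
  qed
  then show "coh_map A B f 0 ` idempotents A = idempotents B" using push_idempotents by blast
qed

end

text \<open>
  Completeness, i.e. that the idempotents add up to 1, is expressed without sums: an additive set of
  cocycles that contains the coboundaries and the idempotents contains 1.
\<close>

definition idem_system :: "('k, 'a) dga \<Rightarrow> 'a set list \<Rightarrow> bool" where
  "idem_system A es \<longleftrightarrow> set es \<subseteq> idempotents A \<and>
     (\<forall>i < length es. \<forall>j < length es. i \<noteq> j \<longrightarrow> (\<forall>s \<in> es ! i. \<forall>t \<in> es ! j. mul A 0 0 s t \<in> coboundaries A 0)) \<and>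
     (\<forall>V \<subseteq> cocycles A 0. coboundaries A 0 \<subseteq> V \<and> (\<forall>x \<in> V. \<forall>y \<in> V. x \<oplus>\<^bsub>gr A 0\<^esub> y \<in> V) \<and> \<Union>(set es) \<subseteq> V \<longrightarrow>
       unity A \<in> V)"

lemma idem_systemD:
  assumes "idem_system A es"
  shows "set es \<subseteq> idempotents A" "i < length es \<Longrightarrow> es ! i \<in> idempotents A"
    "\<lbrakk>i < length es; j < length es; i \<noteq> j; s \<in> es ! i; t \<in> es ! j\<rbrakk> \<Longrightarrow> mul A 0 0 s t \<in> coboundaries A 0"
    "\<lbrakk>V \<subseteq> cocycles A 0; coboundaries A 0 \<subseteq> V; \<And>x y. x \<in> V \<Longrightarrow> y \<in> V \<Longrightarrow> x \<oplus>\<^bsub>gr A 0\<^esub> y \<in> V;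
      \<And>i. i < length es \<Longrightarrow> es ! i \<subseteq> V\<rbrakk> \<Longrightarrow> unity A \<in> V"
proof -
  show "set es \<subseteq> idempotents A" using assms by (simp add: idem_system_def)
  then show "i < length es \<Longrightarrow> es ! i \<in> idempotents A" by auto
  show "\<lbrakk>i < length es; j < length es; i \<noteq> j; s \<in> es ! i; t \<in> es ! j\<rbrakk> \<Longrightarrow> mul A 0 0 s t \<in> coboundaries A 0"
    using assms by (simp add: idem_system_def)
  assume V: "V \<subseteq> cocycles A 0" "coboundaries A 0 \<subseteq> V" "\<And>x y. x \<in> V \<Longrightarrow> y \<in> V \<Longrightarrow> x \<oplus>\<^bsub>gr A 0\<^esub> y \<in> V"
    "\<And>i. i < length es \<Longrightarrow> es ! i \<subseteq> V"
  have "\<Union>(set es) \<subseteq> V" using V(4) by (force simp: in_set_conv_nth)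
  moreover have "\<forall>V \<subseteq> cocycles A 0. coboundaries A 0 \<subseteq> V \<and> (\<forall>x \<in> V. \<forall>y \<in> V. x \<oplus>\<^bsub>gr A 0\<^esub> y \<in> V) \<and>
      \<Union>(set es) \<subseteq> V \<longrightarrow> unity A \<in> V"
    using assms by (simp add: idem_system_def)
  ultimately show "unity A \<in> V" using V(1-3) by (elim allE[of _ V] impE) simp_all
qed

context cdga_mor
begin

lemma idem_system_push:
  assumes "idem_system A es"
  shows "idem_system B (map (coh_map A B f 0) es)"
  unfolding idem_system_def
proof (intro conjI allI impI ballI)
  note D = idem_systemD[OF assms]
  show "set (map (coh_map A B f 0) es) \<subseteq> idempotents B" using D(1) push_idempotents by auto
  fix i j s t
  assume ij: "i < length (map (coh_map A B f 0) es)" "j < length (map (coh_map A B f 0) es)" "i \<noteq> j"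
    and st: "s \<in> map (coh_map A B f 0) es ! i" "t \<in> map (coh_map A B f 0) es ! j"
  have e: "es ! i \<in> idempotents A" "es ! j \<in> idempotents A" using D(2) ij by auto
  obtain x where x: "x \<in> cocycles A 0" "x \<in> es ! i" using e(1) by (rule A.idempotentsE)
  obtain y where y: "y \<in> cocycles A 0" "y \<in> es ! j" using e(2) by (rule A.idempotentsE)
  have "s \<in> coh_class B 0 (f 0 x)" "t \<in> coh_class B 0 (f 0 y)"
    using st ij push_mem[OF D(2) x(2)] push_mem[OF D(2) y(2)] by auto
  then have "B.act 0 s t \<in> coh_class B 0 (f 0 (A.act 0 x y))"
    using B.coh_class_act[of s "f 0 x" t 0 "f 0 y"] x y by (simp add: f_act)
  moreover have "f 0 (A.act 0 x y) \<in> coboundaries B 0" using D(3)[of i j x y] ij x y by simp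
  ultimately show "B.act 0 s t \<in> coboundaries B 0" using B.coh_class_coboundary by simp
next
  note D = idem_systemD[OF assms]
  fix V assume V: "V \<subseteq> cocycles B 0" and "coboundaries B 0 \<subseteq> V \<and> (\<forall>x \<in> V. \<forall>y \<in> V. x \<oplus>\<^bsub>gr B 0\<^esub> y \<in> V) \<and>
    \<Union>(set (map (coh_map A B f 0) es)) \<subseteq> V"
  then have V': "coboundaries B 0 \<subseteq> V" "\<And>x y. x \<in> V \<Longrightarrow> y \<in> V \<Longrightarrow> x \<oplus>\<^bsub>gr B 0\<^esub> y \<in> V"
    "\<And>e. e \<in> set es \<Longrightarrow> coh_map A B f 0 e \<subseteq> V" by auto
  \<comment> \<open>Completeness in \<open>A\<close> is applied to the preimage of
    \<open>V\<close>.\<close>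
  have "unity A \<in> {z \<in> cocycles A 0. f 0 z \<in> V}"
  proof (rule D(4))
    fix i assume i: "i < length es"
    show "es ! i \<subseteq> {z \<in> cocycles A 0. f 0 z \<in> V}"
      using push_mem'[OF D(2)[OF i]] A.idempotents_mem(1)[OF D(2)[OF i]] V'(3)[of "es ! i"] i by auto
  qed (use V' in \<open>auto simp: f_add\<close>)
  then show "unity B \<in> V" by simp
qed

lemma idem_system_reflect:
  assumes q: "f \<in> quasi_iso K A B" and es: "set es \<subseteq> idempotents A" and "idem_system B (map (coh_map A B f 0) es)"
  shows "idem_system A es"
  unfolding idem_system_def
proof (intro conjI allI impI ballI es)
  note D = idem_systemD[OF assms(3)]
  fix i j s t assume ij: "i < length es" "j < length es" "i \<noteq> j" and st: "s \<in> es ! i" "t \<in> es ! j"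
  have e: "es ! i \<in> idempotents A" "es ! j \<in> idempotents A" using es ij by auto
  have c: "s \<in> cocycles A 0" "t \<in> cocycles A 0" using A.idempotents_mem(1) e st by auto
  have "f 0 (A.act 0 s t) \<in> coboundaries B 0"
    using D(3)[of i j "f 0 s" "f 0 t"] ij push_mem'[OF e(1) st(1)] push_mem'[OF e(2) st(2)] c by (simp add: f_act)
  then show "A.act 0 s t \<in> coboundaries A 0" by (rule quasi_isoD(1)[OF q, rotated]) (use c in simp)
next
  note D = idem_systemD[OF assms(3)]
  fix V assume V: "V \<subseteq> cocycles A 0" and "coboundaries A 0 \<subseteq> V \<and> (\<forall>x \<in> V. \<forall>y \<in> V. x \<oplus>\<^bsub>gr A 0\<^esub> y \<in> V) \<and> \<Union>(set es) \<subseteq> V"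
  then have V': "coboundaries A 0 \<subseteq> V" "\<And>x y. x \<in> V \<Longrightarrow> y \<in> V \<Longrightarrow> x \<oplus>\<^bsub>gr A 0\<^esub> y \<in> V" "\<And>e. e \<in> set es \<Longrightarrow> e \<subseteq> V" by auto
  \<comment> \<open>In the other direction, completeness in \<open>B\<close> is applied to the
    cocycles cohomologous to an image of an element of \<open>V\<close>; injectivity on cohomology
    then brings 1 back into \<open>V\<close>.\<close>
  have "unity B \<in> {z. \<exists>v \<in> V. z \<in> coh_class B 0 (f 0 v)}"
  proof (rule D(4))
    show "{z. \<exists>v \<in> V. z \<in> coh_class B 0 (f 0 v)} \<subseteq> cocycles B 0"
      using V B.coh_class_cocycle by fastforce
    have "\<zero>\<^bsub>gr A 0\<^esub> \<in> V" using V'(1) by auto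
    then show "coboundaries B 0 \<subseteq> {z. \<exists>v \<in> V. z \<in> coh_class B 0 (f 0 v)}"
      by (auto intro!: bexI[of _ "\<zero>\<^bsub>gr A 0\<^esub>"] simp: B.coh_class_zero)
  next
    fix x y assume "x \<in> {z. \<exists>v \<in> V. z \<in> coh_class B 0 (f 0 v)}" "y \<in> {z. \<exists>v \<in> V. z \<in> coh_class B 0 (f 0 v)}"
    then obtain v w where vw: "v \<in> V" "x \<in> coh_class B 0 (f 0 v)" "w \<in> V" "y \<in> coh_class B 0 (f 0 w)" by blast
    then have c: "v \<in> cocycles A 0" "w \<in> cocycles A 0" using V by auto
    have "x \<oplus>\<^bsub>gr B 0\<^esub> y \<in> coh_class B 0 (f 0 (v \<oplus>\<^bsub>gr A 0\<^esub> w))"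
      using B.coh_class_add[OF vw(2,4)] c by (simp add: f_add)
    then show "x \<oplus>\<^bsub>gr B 0\<^esub> y \<in> {z. \<exists>v \<in> V. z \<in> coh_class B 0 (f 0 v)}" using V'(2)[OF vw(1,3)] by blast
  next
    fix i assume "i < length (map (coh_map A B f 0) es)"
    then have i: "i < length es" by simp
    then have e: "es ! i \<in> idempotents A" using es by auto
    obtain s where s: "s \<in> cocycles A 0" "s \<in> es ! i" using e by (rule A.idempotentsE)
    show "map (coh_map A B f 0) es ! i \<subseteq> {z. \<exists>v \<in> V. z \<in> coh_class B 0 (f 0 v)}"
      using push_mem[OF e s(2)] V'(3)[of "es ! i"] s(2) i by auto
  qed
  then obtain v where v: "v \<in> V" "unity B \<in> coh_class B 0 (f 0 v)" by blast
  then have vc: "v \<in> cocycles A 0" using V by auto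
  have "unity A \<in> coh_class A 0 v" using quasi_isoD(3)[OF q, of "unity A" 0 v] v vc by simp
  then obtain b where "b \<in> coboundaries A 0" "unity A = b \<oplus>\<^bsub>gr A 0\<^esub> v" by (auto simp: A.coh_class_iff)
  then show "unity A \<in> V" using V' v by auto
qed

end

text \<open>An idempotent of the field is 0 or 1. If all entries were 0, the coboundaries would be
  an additive set that violates completeness; if two entries were 1, orthogonality would make 1
  exact.\<close>

lemma (in cdga) connected_idem_system:
  assumes "field K" and conn: "homologically_connected K A" and es: "idem_system A es"
  shows "\<exists>!i. i < length es \<and> es ! i = coh_class A 0 (unity A)"
proof -
  interpret K: field K by fact
  note D = idem_systemD[OF es] and C = conn[unfolded homologically_connected_iff]
  have inj: "c = \<zero>\<^bsub>K\<^esub>" if "c \<in> carrier K" "c \<odot>\<^bsub>gr A 0\<^esub> unity A \<in> coboundaries A 0" for c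
    using C that by blast
  have unit: "unity A \<notin> coboundaries A 0" using inj[of "\<one>\<^bsub>K\<^esub>"] by auto
  have zero_one: "es ! i = coboundaries A 0 \<or> es ! i = coh_class A 0 (unity A)" if i: "i < length es" for i
  proof -
    obtain s where s: "s \<in> cocycles A 0" "es ! i = coh_class A 0 s" "act 0 s s \<in> coh_class A 0 s"
      using D(2)[OF i] by (rule idempotentsE)
    obtain c where c: "c \<in> carrier K" "s \<in> coh_class A 0 (c \<odot>\<^bsub>gr A 0\<^esub> unity A)" using C s(1) by blast
    let ?u = "\<lambda>c. c \<odot>\<^bsub>gr A 0\<^esub> unity A"
    have 1: "act 0 s s \<in> coh_class A 0 (?u (c \<otimes>\<^bsub>K\<^esub> c))"
      using coh_class_act[OF c(2) c(2)] c(1) by (simp add: act_smult_unity smult_assoc1)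
    have 2: "act 0 s s \<in> coh_class A 0 (?u c)" by (rule coh_class_trans[OF s(3) c(2)]) (use c(1) in simp)
    have "?u (c \<otimes>\<^bsub>K\<^esub> c) \<in> coh_class A 0 (?u c)"
      by (rule coh_class_trans[OF coh_class_sym[OF 1] 2]) (use c(1) in simp_all)
    moreover have "?u (c \<otimes>\<^bsub>K\<^esub> c \<ominus>\<^bsub>K\<^esub> c) \<oplus>\<^bsub>gr A 0\<^esub> ?u c = ?u (c \<otimes>\<^bsub>K\<^esub> c)"
      using c(1) by (simp add: smult_l_distr[symmetric] K.minus_eq K.a_assoc K.l_neg)
    ultimately have "?u (c \<otimes>\<^bsub>K\<^esub> c \<ominus>\<^bsub>K\<^esub> c) \<in> coboundaries A 0"
      using c(1) coh_class_minus_iff[of "?u c" 0 "?u (c \<otimes>\<^bsub>K\<^esub> c)"]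
        gr_minusI[of "?u (c \<otimes>\<^bsub>K\<^esub> c \<ominus>\<^bsub>K\<^esub> c)" 0 "?u c" "?u (c \<otimes>\<^bsub>K\<^esub> c)"] by simp
    then have "c \<otimes>\<^bsub>K\<^esub> c \<ominus>\<^bsub>K\<^esub> c = \<zero>\<^bsub>K\<^esub>" by (rule inj[rotated]) (use c(1) in simp)
    then have cc: "c \<otimes>\<^bsub>K\<^esub> c = c" by (rule K.minus_zero_imp_eq[OF K.m_closed[OF c(1) c(1)] c(1)])
    have ei: "es ! i = coh_class A 0 (?u c)"
      unfolding s(2) by (rule coh_class_eq[OF c(2)]) (use c(1) in simp)
    have "c = \<zero>\<^bsub>K\<^esub> \<or> c = \<one>\<^bsub>K\<^esub>"
      using K.m_lcancel[of c c "\<one>\<^bsub>K\<^esub>"] cc c(1) by auto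
    then show ?thesis
      unfolding ei by (elim disjE) (simp_all add: coh_class_zero)
  qed
  have "\<exists>i < length es. es ! i = coh_class A 0 (unity A)"
  proof (rule ccontr)
    assume n: "\<not> ?thesis"
    have "unity A \<in> coboundaries A 0"
      by (rule D(4)) (use n zero_one in auto)
    then show False using unit by contradiction
  qed
  then obtain i where i: "i < length es" "es ! i = coh_class A 0 (unity A)" by blast
  moreover have "j = i" if j: "j < length es" "es ! j = coh_class A 0 (unity A)" for j
  proof (rule ccontr)
    assume "j \<noteq> i"
    then have "mul A 0 0 (unity A) (unity A) \<in> coboundaries A 0" using D(3)[OF j(1) i(1)] i j
      coh_class_refl[OF unity_in] by metis
    then show False using unit by simp
  qed
  ultimately show ?thesis by blast
qed

section \<open>Localization at an idempotent and quasi-isomorphisms\<close>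

text \<open>Localizing replaces cohomology by the image of the idempotent. Injectivity is therefore
  tested on elements sa, and surjectivity only up to what an element of \<open>T\<close>
  annihilates. This covers the projections of a decomposition, which are not quasi-isomorphisms
  before localization in general.\<close>

lemma frac_map_quasi_iso:
  assumes X: "cdga_idem K A S" and Y: "cdga_idem K B T" and f: "f \<in> cdga_hom K A B"
    and ST: "\<And>s. s \<in> S \<Longrightarrow> f 0 s \<in> T"
    and inj: "\<And>n a s. \<lbrakk>a \<in> cocycles A n; s \<in> S; f n (mul A 0 n s a) \<in> coboundaries B n\<rbrakk> \<Longrightarrow> mul A 0 n s a \<in> coboundaries A n"
    and surj: "\<And>n b. b \<in> cocycles B n \<Longrightarrow> \<exists>a \<in> cocycles A n. \<exists>t \<in> T. mul B 0 n t (b \<ominus>\<^bsub>gr B n\<^esub> f n a) \<in> coboundaries B n"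
  shows "frac_map A S B T f \<in> quasi_iso K (frac_dga A S) (frac_dga B T)"
proof -
  interpret X: cdga_idem K A S by fact
  interpret Y: cdga_idem K B T by fact
  interpret M: cdga_frac_mor K A S B T f by unfold_locales (use f ST in auto)
  show ?thesis
    unfolding M.fm.quasi_iso_iff
  proof (intro allI conjI ballI impI)
    fix n x assume x: "x \<in> cocycles X.F n" "M.fm n x \<in> coboundaries Y.F n"
    obtain a where a: "a \<in> cocycles A n" "x \<in> coh_class X.F n (X.un n a)" using X.un_surj[OF x(1)] by blast
    obtain s where s: "s \<in> S" using X.S_nonempty by blast
    have "M.fm n x \<in> coh_class Y.F n (Y.un n (f n a))"
      using M.fm.f_coh_class[OF a(2)] a(1) by (simp add: M.fm_un)
    then have "Y.un n (f n a) \<in> coboundaries Y.F n"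
      using x(2) Y.F.coh_class_coboundary[of "M.fm n x" n "Y.un n (f n a)"] a(1) by simp
    then have "f n (X.act n s a) \<in> coboundaries B n"
      using Y.un_coboundary_iff[of "f n a" n "f 0 s"] a(1) s ST by (simp add: M.f_act)
    then have "X.un n a \<in> coboundaries X.F n"
      using inj a(1) s X.un_coboundary_iff by blast
    then show "x \<in> coboundaries X.F n" using X.F.coh_class_coboundary[OF a(2)] a(1) by simp
  next
    fix n y assume y: "y \<in> cocycles Y.F n"
    obtain b where b: "b \<in> cocycles B n" "y \<in> coh_class Y.F n (Y.un n b)" using Y.un_surj[OF y] by blast
    obtain a t where a: "a \<in> cocycles A n" "t \<in> T" "Y.act n t (b \<ominus>\<^bsub>gr B n\<^esub> f n a) \<in> coboundaries B n"
      using surj[OF b(1)] by blast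
    have "Y.un n (b \<ominus>\<^bsub>gr B n\<^esub> f n a) \<in> coboundaries Y.F n"
      using Y.un_coboundary_iff[of "b \<ominus>\<^bsub>gr B n\<^esub> f n a" n t] a b by (simp add: Y.gr.minus_eq)
    then have "Y.un n b \<in> coh_class Y.F n (Y.un n (f n a))"
      using a b by (simp add: Y.F.coh_class_minus_iff Y.gr.minus_eq Y.F.gr.minus_eq Y.un.f_add Y.un.f_neg)
    then have "y \<in> coh_class Y.F n (M.fm n (X.un n a))"
      using Y.F.coh_class_trans[OF b(2)] a(1) by (simp add: M.fm_un)
    then show "\<exists>x \<in> cocycles X.F n. y \<in> coh_class Y.F n (M.fm n x)" using a(1) by (intro bexI[of _ "X.un n a"]) simp_all
  qed
qed

lemma frac_map_quasi_iso_lift: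
  assumes X: "cdga_idem K A S" and Y: "cdga_idem K B T" and q: "f \<in> quasi_iso K A B"
    and ST: "\<And>s. s \<in> S \<Longrightarrow> f 0 s \<in> T"
  shows "frac_map A S B T f \<in> quasi_iso K (frac_dga A S) (frac_dga B T)"
proof -
  interpret X: cdga_idem K A S by fact
  interpret Y: cdga_idem K B T by fact
  have f: "f \<in> cdga_hom K A B" using q by (simp add: quasi_iso_def)
  interpret f: cdga_mor K A B f by unfold_locales (rule f)
  show ?thesis
  proof (rule frac_map_quasi_iso[OF X Y f ST])
    show "X.act n s a \<in> coboundaries A n"
      if "a \<in> cocycles A n" "s \<in> S" "f n (X.act n s a) \<in> coboundaries B n" for n a s
      by (rule f.quasi_isoD(1)[OF q _ that(3)]) (use that in simp)
    fix n b assume b: "b \<in> cocycles B n"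
    then obtain a where a: "a \<in> cocycles A n" "b \<in> coh_class B n (f n a)" using f.quasi_isoD(2)[OF q] by blast
    then have "b \<ominus>\<^bsub>gr B n\<^esub> f n a \<in> coboundaries B n" using b by (simp add: Y.coh_class_minus_iff)
    then show "\<exists>a \<in> cocycles A n. \<exists>t \<in> T. Y.act n t (b \<ominus>\<^bsub>gr B n\<^esub> f n a) \<in> coboundaries B n"
      using a(1) Y.act_coboundaries[OF Y.S_rules(1)] Y.S_nonempty by blast
  qed
qed

text \<open>With 1 among the denominators, \<open>un_coboundary_iff\<close> can be read for s =
  1.\<close>

lemma frac_unit_top_quasi_iso:
  assumes "cdga_idem K A S" "unity A \<in> S"
  shows "frac_unit A S \<in> quasi_iso K A (frac_dga A S)"
proof -
  interpret X: cdga_idem K A S by fact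
  show ?thesis
    unfolding X.un.quasi_iso_iff using X.un_surj X.un_coboundary_iff[OF _ assms(2)] by auto
qed

section \<open>Decompositions of a cdga and of its cohomology\<close>

text \<open>Says that the map from \<open>A\<close> to the product of the \<open>Bs\<close> is a
  quasi-isomorphism, in terms of components. Thus no product has to be formed:
  \<open>cdga_prod_list\<close> has carriers in another type, and a product in the same type
  involves the coding.\<close>

definition joint_quasi_iso :: "'k ring \<Rightarrow> ('k, 'a) dga \<Rightarrow> ('k, 'b) dga list \<Rightarrow> (nat \<Rightarrow> int \<Rightarrow> 'a \<Rightarrow> 'b) \<Rightarrow> bool" where
  "joint_quasi_iso K A Bs p \<longleftrightarrow> (\<forall>i < length Bs. p i \<in> cdga_hom K A (Bs ! i)) \<and>
     (\<forall>n. \<forall>x \<in> cocycles A n. (\<forall>i < length Bs. p i n x \<in> coboundaries (Bs ! i) n) \<longrightarrow> x \<in> coboundaries A n) \<and>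
     (\<forall>n y. (\<forall>i < length Bs. y i \<in> cocycles (Bs ! i) n) \<longrightarrow>
       (\<exists>x \<in> cocycles A n. \<forall>i < length Bs. y i \<in> coh_class (Bs ! i) n (p i n x)))"

definition strict_product :: "'k ring \<Rightarrow> ('k, 'a) dga \<Rightarrow> ('k, 'b) dga list \<Rightarrow> (nat \<Rightarrow> int \<Rightarrow> 'a \<Rightarrow> 'b) \<Rightarrow> bool" where
  "strict_product K A Bs p \<longleftrightarrow> (\<forall>i < length Bs. p i \<in> cdga_hom K A (Bs ! i)) \<and>
     (\<forall>n. \<forall>x \<in> carrier (gr A n). \<forall>y \<in> carrier (gr A n). (\<forall>i < length Bs. p i n x = p i n y) \<longrightarrow> x = y) \<and>
     (\<forall>n y. (\<forall>i < length Bs. y i \<in> carrier (gr (Bs ! i) n)) \<longrightarrow>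
       (\<exists>x \<in> carrier (gr A n). \<forall>i < length Bs. p i n x = y i))"

locale cdga_family = cdga K A for K :: "'k ring" and A :: "('k, 'a) dga" +
  fixes Bs :: "('k, 'b) dga list" and p :: "nat \<Rightarrow> int \<Rightarrow> 'a \<Rightarrow> 'b"
  assumes Bs_cdga: "B \<in> set Bs \<Longrightarrow> cdga K B"
    and p_hom: "i < length Bs \<Longrightarrow> p i \<in> cdga_hom K A (Bs ! i)"
begin

lemma B_cdga: "i < length Bs \<Longrightarrow> cdga K (Bs ! i)"
  by (rule Bs_cdga) simp

lemma p_mor: "i < length Bs \<Longrightarrow> cdga_mor K A (Bs ! i) (p i)"
  using B_cdga[of i] p_hom[of i] cdga_axioms by (simp add: cdga_mor_def cdga_mor_axioms_def)

text \<open>Primitives chosen in each factor are glued to a primitive in \<open>A\<close>, and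
  closedness is tested in each factor.\<close>

lemma strict_product_joint:
  assumes "strict_product K A Bs p"
  shows "joint_quasi_iso K A Bs p"
  unfolding joint_quasi_iso_def
proof (intro conjI allI impI ballI)
  show "p i \<in> cdga_hom K A (Bs ! i)" if "i < length Bs" for i using p_hom that .
  have inj: "x = y" if "x \<in> carrier (gr A n)" "y \<in> carrier (gr A n)" "\<And>i. i < length Bs \<Longrightarrow> p i n x = p i n y" for n x y
    using assms that unfolding strict_product_def by blast
  have surj: "\<exists>x \<in> carrier (gr A n). \<forall>i < length Bs. p i n x = y i"
    if "\<And>i. i < length Bs \<Longrightarrow> y i \<in> carrier (gr (Bs ! i) n)" for n y
    using assms that unfolding strict_product_def by blast
  {
    fix n x assume x: "x \<in> cocycles A n" "\<forall>i < length Bs. p i n x \<in> coboundaries (Bs ! i) n"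
    have "\<forall>i < length Bs. \<exists>y. y \<in> carrier (gr (Bs ! i) (n - 1)) \<and> p i n x = dif (Bs ! i) (n - 1) y"
      using x(2) by (auto simp: coboundaries_def)
    then obtain y where y: "\<And>i. i < length Bs \<Longrightarrow> y i \<in> carrier (gr (Bs ! i) (n - 1)) \<and> p i n x = dif (Bs ! i) (n - 1) (y i)"
      by metis
    obtain w where w: "w \<in> carrier (gr A (n - 1))" "\<forall>i < length Bs. p i (n - 1) w = y i"
      using surj[of y "n - 1"] y by blast
    have "x = dif A (n - 1) w"
    proof (rule inj)
      show "x \<in> carrier (gr A n)" using x(1) by simp
      show "dif A (n - 1) w \<in> carrier (gr A n)" using dif_closed[OF w(1)] by simp
      fix i assume i: "i < length Bs"
      interpret m: cdga_mor K A "Bs ! i" "p i" using p_mor[OF i] .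
      show "p i n x = p i n (dif A (n - 1) w)" using m.f_dif[OF w(1)] y[OF i] w(2) i by simp
    qed
    then show "x \<in> coboundaries A n" using coboundariesI[OF w(1)] by simp
  next
    fix n y assume y: "\<forall>i < length Bs. y i \<in> cocycles (Bs ! i) n"
    have yc: "y i \<in> carrier (gr (Bs ! i) n)" "dif (Bs ! i) n (y i) = \<zero>\<^bsub>gr (Bs ! i) (n + 1)\<^esub>" if "i < length Bs" for i
      using y that cdga.cocycles_iff[OF B_cdga[OF that]] by blast+
    obtain x where x: "x \<in> carrier (gr A n)" "\<forall>i < length Bs. p i n x = y i" using surj[of y n] yc by blast
    have "dif A n x = \<zero>\<^bsub>gr A (n + 1)\<^esub>"
    proof (rule inj)
      fix i assume i: "i < length Bs"
      interpret m: cdga_mor K A "Bs ! i" "p i" using p_mor[OF i] .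
      show "p i (n + 1) (dif A n x) = p i (n + 1) \<zero>\<^bsub>gr A (n + 1)\<^esub>"
        using m.f_dif[OF x(1)] yc[OF i] x(2) i by simp
    qed (use x in auto)
    then have "x \<in> cocycles A n" using x(1) unfolding cocycles_iff by blast
    moreover have "y i \<in> coh_class (Bs ! i) n (p i n x)" if "i < length Bs" for i
      using x(2) cdga.coh_class_refl[OF B_cdga[OF that] yc(1)[OF that]] that by simp
    ultimately show "\<exists>x \<in> cocycles A n. \<forall>i < length Bs. y i \<in> coh_class (Bs ! i) n (p i n x)" by blast
  }
qed

end

lemma strict_product_iso:
  assumes "cdga_family K A Bs p" "strict_product K A Bs p"
  shows "(\<lambda>n. \<lambda>x \<in> carrier (gr A n). \<lambda>i \<in> {..<length Bs}. p i n x) \<in> cdga_iso K A (cdga_prod_list Bs)" (is "?h \<in> _")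
proof -
  interpret cdga_family K A Bs p by fact
  have sim [simp]: "gr (cdga_prod_list Bs) n = prod_module {..<length Bs} (\<lambda>j. gr (Bs ! j) n)"
    "mul (cdga_prod_list Bs) i j x y = (\<lambda>k\<in>{..<length Bs}. mul (Bs ! k) i j (x k) (y k))"
    "unity (cdga_prod_list Bs) = (\<lambda>k\<in>{..<length Bs}. unity (Bs ! k))"
    "dif (cdga_prod_list Bs) n x = (\<lambda>k\<in>{..<length Bs}. dif (Bs ! k) n (x k))" for n i j x y
    by (simp_all add: cdga_prod_def)
  note R = cdga_mor.f_rules[OF p_mor] cdga_mor.f_unity[OF p_mor]
  have "?h \<in> cdga_hom K A (cdga_prod_list Bs)"
    by (rule cdga_homI) (auto simp: R fun_eq_iff restrict_def split: if_splits)
  moreover have "bij_betw (?h n) (carrier (gr A n)) (carrier (gr (cdga_prod_list Bs) n))" for n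
  proof (rule bij_betw_imageI)
    show "inj_on (?h n) (carrier (gr A n))"
    proof (rule inj_onI)
      fix x y assume xy: "x \<in> carrier (gr A n)" "y \<in> carrier (gr A n)" "?h n x = ?h n y"
      have "p i n x = p i n y" if "i < length Bs" for i
        using fun_cong[OF xy(3), of i] xy(1,2) that by simp
      then show "x = y" using assms(2) xy(1,2) unfolding strict_product_def by blast
    qed
    have "z \<in> ?h n ` carrier (gr A n)" if z: "z \<in> carrier (gr (cdga_prod_list Bs) n)" for z
    proof -
      have "\<forall>i < length Bs. z i \<in> carrier (gr (Bs ! i) n)" using z by auto
      then obtain x where x: "x \<in> carrier (gr A n)" "\<forall>i < length Bs. p i n x = z i"
        using assms(2) unfolding strict_product_def by meson
      have "z = ?h n x" using x z by (auto simp: PiE_def extensional_def restrict_def fun_eq_iff)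
      then show ?thesis using x(1) by blast
    qed
    then show "?h n ` carrier (gr A n) = carrier (gr (cdga_prod_list Bs) n)"
      by (auto simp: R split: if_splits)
  qed
  ultimately show ?thesis by (simp add: cdga_iso_def)
qed

lemma strict_product_is_cdga_prod:
  assumes "cdga_family K A Bs p" "strict_product K A Bs p"
  shows "is_cdga_prod K A Bs p"
  using strict_product_iso[OF assms] assms(2) unfolding is_cdga_prod_def strict_product_def by blast

section \<open>Idempotents defined by a decomposition\<close>

locale cdga_joint = cdga_family K A Bs p for K :: "'k ring" and A :: "('k, 'a) dga" and Bs :: "('k, 'b) dga list" and p +
  assumes joint: "joint_quasi_iso K A Bs p"
begin

lemma joint_inj:
  "\<lbrakk>x \<in> cocycles A n; \<And>i. i < length Bs \<Longrightarrow> p i n x \<in> coboundaries (Bs ! i) n\<rbrakk> \<Longrightarrow> x \<in> coboundaries A n"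
  using joint unfolding joint_quasi_iso_def by blast

lemma joint_surj:
  "(\<And>i. i < length Bs \<Longrightarrow> y i \<in> cocycles (Bs ! i) n) \<Longrightarrow>
    \<exists>x \<in> cocycles A n. \<forall>i < length Bs. y i \<in> coh_class (Bs ! i) n (p i n x)"
  using joint unfolding joint_quasi_iso_def by blast

lemma joint_class:
  assumes "x \<in> cocycles A n" "y \<in> cocycles A n" "\<And>i. i < length Bs \<Longrightarrow> p i n x \<in> coh_class (Bs ! i) n (p i n y)"
  shows "x \<in> coh_class A n y"
proof -
  have "x \<ominus>\<^bsub>gr A n\<^esub> y \<in> coboundaries A n"
  proof (rule joint_inj)
    fix i assume i: "i < length Bs"
    interpret m: cdga_mor K A "Bs ! i" "p i" using p_mor[OF i] .
    show "p i n (x \<ominus>\<^bsub>gr A n\<^esub> y) \<in> coboundaries (Bs ! i) n"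
      using assms(3)[OF i] assms(1,2) by (simp add: m.B.coh_class_minus_iff gr.minus_eq m.B.gr.minus_eq m.f_add m.f_neg)
  qed (use assms in \<open>simp add: gr.minus_eq\<close>)
  then show ?thesis using assms(1,2) by (simp add: coh_class_minus_iff)
qed

definition \<delta> :: "nat \<Rightarrow> nat \<Rightarrow> 'b" where
  "\<delta> i j = (if i = j then unity (Bs ! j) else \<zero>\<^bsub>gr (Bs ! j) 0\<^esub>)"

text \<open>\<open>z i\<close> represents the idempotent that belongs to the \<open>i\<close>-th
  factor: its components are cohomologous to 1 at \<open>i\<close> and to 0 elsewhere.\<close>

definition units :: "(nat \<Rightarrow> 'a) \<Rightarrow> bool" where
  "units z \<longleftrightarrow> (\<forall>i < length Bs. z i \<in> cocycles A 0 \<and> (\<forall>j < length Bs. p j 0 (z i) \<in> coh_class (Bs ! j) 0 (\<delta> i j)))"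

lemma ex_class:
  assumes "\<And>i. i < length Bs \<Longrightarrow> y i \<in> cocycles (Bs ! i) n"
  shows "\<exists>x \<in> cocycles A n. \<forall>i < length Bs. p i n x \<in> coh_class (Bs ! i) n (y i)"
proof -
  obtain x where x: "x \<in> cocycles A n" "\<forall>i < length Bs. y i \<in> coh_class (Bs ! i) n (p i n x)"
    using joint_surj assms by blast
  have "p i n x \<in> coh_class (Bs ! i) n (y i)" if i: "i < length Bs" for i
  proof -
    interpret m: cdga_mor K A "Bs ! i" "p i" using p_mor[OF i] .
    show ?thesis by (rule m.B.coh_class_sym) (use x i in simp_all)
  qed
  then show ?thesis using x(1) by blast
qed

lemma \<delta>_cocycle: "j < length Bs \<Longrightarrow> \<delta> i j \<in> cocycles (Bs ! j) 0"
  using cdga.unity_cocycle[OF B_cdga] cdga.cocycles_closed(1)[OF B_cdga] by (simp add: \<delta>_def)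

lemma ex_units: "\<exists>z. units z"
proof -
  have "\<exists>x. x \<in> cocycles A 0 \<and> (\<forall>j < length Bs. p j 0 x \<in> coh_class (Bs ! j) 0 (\<delta> i j))" for i
    using ex_class[of "\<delta> i" 0] \<delta>_cocycle by blast
  then show ?thesis unfolding units_def by metis
qed

context
  fixes z assumes z: "units z"
begin

lemma z_cocycle: "i < length Bs \<Longrightarrow> z i \<in> cocycles A 0"
  and z_class: "i < length Bs \<Longrightarrow> j < length Bs \<Longrightarrow> p j 0 (z i) \<in> coh_class (Bs ! j) 0 (\<delta> i j)"
  using z by (auto simp: units_def)

lemma z_coboundary: "i < length Bs \<Longrightarrow> j < length Bs \<Longrightarrow> i \<noteq> j \<Longrightarrow> p j 0 (z i) \<in> coboundaries (Bs ! j) 0"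
  using z_class[of i j] cdga.coh_class_zero[OF B_cdga, of j 0] by (simp add: \<delta>_def)

text \<open>In each component this is 1 * 1 = 1 or 0 * 0 = 0.\<close>

lemma z_idempotent: "i < length Bs \<Longrightarrow> act 0 (z i) (z i) \<in> coh_class A 0 (z i)"
proof (rule joint_class)
  fix j assume i: "i < length Bs" and j: "j < length Bs"
  interpret m: cdga_mor K A "Bs ! j" "p j" using p_mor[OF j] .
  have \<delta>: "\<delta> i j \<in> cocycles (Bs ! j) 0" "m.B.act 0 (\<delta> i j) (\<delta> i j) = \<delta> i j"
    using \<delta>_cocycle[OF j] by (simp_all add: \<delta>_def)
  have "m.B.act 0 (p j 0 (z i)) (p j 0 (z i)) \<in> coh_class (Bs ! j) 0 (\<delta> i j)"
    using m.B.coh_class_act[OF z_class[OF i j] z_class[OF i j]] \<delta> by simp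
  then have "m.B.act 0 (p j 0 (z i)) (p j 0 (z i)) \<in> coh_class (Bs ! j) 0 (p j 0 (z i))"
    by (rule m.B.coh_class_trans[OF _ m.B.coh_class_sym[OF z_class[OF i j]]]) (use \<delta>(1) z_cocycle[OF i] in simp_all)
  then show "p j 0 (act 0 (z i) (z i)) \<in> coh_class (Bs ! j) 0 (p j 0 (z i))"
    using z_cocycle[OF i] by (simp add: m.f_act)
qed (simp_all add: z_cocycle)

text \<open>In each component at least one of the two factors is exact.\<close>

lemma z_orthogonal:
  assumes i: "i < length Bs" and k: "k < length Bs" and ik: "i \<noteq> k"
  shows "act 0 (z i) (z k) \<in> coboundaries A 0"
proof (rule joint_inj)
  show "act 0 (z i) (z k) \<in> cocycles A 0" using z_cocycle i k by simp
  fix j assume j: "j < length Bs"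
  interpret m: cdga_mor K A "Bs ! j" "p j" using p_mor[OF j] .
  have c: "z i \<in> cocycles A 0" "z k \<in> cocycles A 0" using z_cocycle i k by auto
  have "m.B.act 0 (p j 0 (z i)) (p j 0 (z k)) \<in> coboundaries (Bs ! j) 0"
  proof (cases "i = j")
    case True
    then have "p j 0 (z k) \<in> coboundaries (Bs ! j) 0" using z_coboundary[OF k j] ik by simp
    then show ?thesis by (rule m.B.act_coboundaries[rotated]) (use c in simp)
  next
    case False
    then have "p j 0 (z i) \<in> coboundaries (Bs ! j) 0" using z_coboundary[OF i j] by simp
    then show ?thesis by (rule m.B.coboundary_act) (use c in simp)
  qed
  then show "p j 0 (act 0 (z i) (z k)) \<in> coboundaries (Bs ! j) 0" using c by (simp add: m.f_act)
qed

definition unit_classes :: "'a set list" where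
  "unit_classes = map (\<lambda>i. coh_class A 0 (z i)) [0..<length Bs]"

lemma unit_classes_simps [simp]: "length unit_classes = length Bs"
  "i < length Bs \<Longrightarrow> unit_classes ! i = coh_class A 0 (z i)"
  by (simp_all add: unit_classes_def)

text \<open>Completeness is shown by starting from the coboundaries and adding one unit after
  another until all components are 1.\<close>

lemma idem_system_unit_classes: "idem_system A unit_classes"
  unfolding idem_system_def
proof (intro conjI allI impI ballI)
  show "set unit_classes \<subseteq> idempotents A"
    using idempotentsI[OF z_cocycle z_idempotent] by (auto simp: unit_classes_def)
next
  fix i j s t assume "i < length unit_classes" "j < length unit_classes" "i \<noteq> j" "s \<in> unit_classes ! i" "t \<in> unit_classes ! j"
  then have *: "i < length Bs" "j < length Bs" "i \<noteq> j" "s \<in> coh_class A 0 (z i)" "t \<in> coh_class A 0 (z j)" by simp_all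
  show "act 0 s t \<in> coboundaries A 0"
    using coh_class_coboundary[OF coh_class_act[OF *(4,5)]] z_orthogonal[OF *(1-3)] z_cocycle * by simp
next
  fix V assume V: "V \<subseteq> cocycles A 0" and
    "coboundaries A 0 \<subseteq> V \<and> (\<forall>x \<in> V. \<forall>y \<in> V. x \<oplus>\<^bsub>gr A 0\<^esub> y \<in> V) \<and> \<Union>(set unit_classes) \<subseteq> V"
  then have V': "coboundaries A 0 \<subseteq> V" "\<And>x y. x \<in> V \<Longrightarrow> y \<in> V \<Longrightarrow> x \<oplus>\<^bsub>gr A 0\<^esub> y \<in> V"
    "\<And>i. i < length Bs \<Longrightarrow> coh_class A 0 (z i) \<subseteq> V" by (auto simp: unit_classes_def UN_subset_iff)
  have coh: "x \<in> V" if "x \<in> coh_class A 0 y" "y \<in> V" for x y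
    using that V' by (auto simp: coh_class_iff)
  \<comment> \<open>The components of the sum of the first \<open>k\<close> units.\<close>
  define w where "w k i = (if i < k then unity (Bs ! i) else \<zero>\<^bsub>gr (Bs ! i) 0\<^esub>)" for k i :: nat
  have wc: "w k i \<in> cocycles (Bs ! i) 0" if "i < length Bs" for k i
    using cdga.unity_cocycle[OF B_cdga] cdga.cocycles_closed(1)[OF B_cdga] that by (simp add: w_def)
  have main: "x \<in> V" if "k \<le> length Bs" "x \<in> cocycles A 0" "\<And>i. i < length Bs \<Longrightarrow> p i 0 x \<in> coh_class (Bs ! i) 0 (w k i)" for k x
    using that
  proof (induction k arbitrary: x)
    case 0
    have "x \<in> coboundaries A 0"
    proof (rule joint_inj[OF 0(2)])
      fix i assume "i < length Bs"
      then show "p i 0 x \<in> coboundaries (Bs ! i) 0"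
        using 0(3)[of i] cdga.coh_class_zero[OF B_cdga, of i 0] by (simp add: w_def)
    qed
    then show ?case using V' by auto
  next
    case (Suc k)
    obtain y where y: "y \<in> cocycles A 0" "\<forall>i < length Bs. p i 0 y \<in> coh_class (Bs ! i) 0 (w k i)"
      using ex_class[of "w k" 0] wc by blast
    have k: "k < length Bs" using Suc by simp
    have yV: "y \<in> V" using Suc.IH[of y] y k by simp
    have zV: "z k \<in> V" using V'(3)[OF k] z_cocycle[OF k] by auto
    have "x \<in> coh_class A 0 (y \<oplus>\<^bsub>gr A 0\<^esub> z k)"
    proof (rule joint_class)
      show "x \<in> cocycles A 0" by (rule Suc(3))
      show "y \<oplus>\<^bsub>gr A 0\<^esub> z k \<in> cocycles A 0" using y z_cocycle[OF k] by simp
      fix i assume i: "i < length Bs"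
      interpret m: cdga_mor K A "Bs ! i" "p i" using p_mor[OF i] .
      have "w (Suc k) i = w k i \<oplus>\<^bsub>gr (Bs ! i) 0\<^esub> \<delta> k i" by (auto simp: w_def \<delta>_def)
      then have "p i 0 (y \<oplus>\<^bsub>gr A 0\<^esub> z k) \<in> coh_class (Bs ! i) 0 (w (Suc k) i)"
        using m.B.coh_class_add[of "p i 0 y" 0 "w k i" "p i 0 (z k)" "\<delta> k i"] y i z_class[OF k i] wc[OF i]
          \<delta>_cocycle[OF i] z_cocycle[OF k] by (simp add: m.f_add)
      then show "p i 0 x \<in> coh_class (Bs ! i) 0 (p i 0 (y \<oplus>\<^bsub>gr A 0\<^esub> z k))"
        by (rule m.B.coh_class_trans[OF Suc(4)[OF i] m.B.coh_class_sym])
          (use y z_cocycle[OF k] wc[OF i] in simp_all)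
    qed
    then show ?case using coh V'(2)[OF yV zV] by blast
  qed
  have "p i 0 (unity A) \<in> coh_class (Bs ! i) 0 (w (length Bs) i)" if i: "i < length Bs" for i
  proof -
    interpret m: cdga_mor K A "Bs ! i" "p i" using p_mor[OF i] .
    show ?thesis using i by (simp add: w_def)
  qed
  then show "unity A \<in> V" using main[of "length Bs" "unity A"] by simp
qed

lemma push_unit_class:
  assumes i: "i < length Bs"
  shows "coh_map A (Bs ! i) (p i) 0 (unit_classes ! i) = coh_class (Bs ! i) 0 (unity (Bs ! i))"
proof -
  interpret m: cdga_mor K A "Bs ! i" "p i" using p_mor[OF i] .
  show ?thesis
    using m.coh_map_class[of "z i" 0] z_cocycle[OF i] m.B.coh_class_eq[OF z_class[OF i i]] i by (simp add: \<delta>_def)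
qed

end

text \<open>On \<open>H\<^sup>0\<close>, multiplication by the \<open>i\<close>-th unit kills all components but the \<open>i\<close>-th.\<close>

lemma frac_map_unit_quasi_iso:
  assumes z: "units z" and i: "i < length Bs" and inf: "infinite (UNIV :: 'a set)" "infinite (UNIV :: 'b set)"
  shows "frac_map A (coh_class A 0 (z i)) (Bs ! i) (coh_class (Bs ! i) 0 (unity (Bs ! i))) (p i) \<in>
    quasi_iso K (frac_dga A (coh_class A 0 (z i))) (frac_dga (Bs ! i) (coh_class (Bs ! i) 0 (unity (Bs ! i))))"
proof -
  interpret m: cdga_mor K A "Bs ! i" "p i" using p_mor[OF i] .
  note zi = z_cocycle[OF z i]
  define S where "S = coh_class A 0 (z i)"
  define T where "T = coh_class (Bs ! i) 0 (unity (Bs ! i))"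
  interpret X: cdga_idem K A S
    by unfold_locales (use inf idempotentsI[OF zi z_idempotent[OF z i]] in \<open>auto simp: S_def\<close>)
  interpret Y: cdga_idem K "Bs ! i" T
    by unfold_locales (use inf m.B.top_idempotent in \<open>auto simp: T_def\<close>)
  show ?thesis
    unfolding S_def[symmetric] T_def[symmetric]
  proof (rule frac_map_quasi_iso[OF X.cdga_idem_axioms Y.cdga_idem_axioms p_hom[OF i]])
    fix s assume "s \<in> S"
    then have "p i 0 s \<in> coh_class (Bs ! i) 0 (p i 0 (z i))"
      unfolding S_def by (rule m.f_coh_class) (use zi in simp)
    then show "p i 0 s \<in> T"
      unfolding T_def by (rule m.B.coh_class_trans[OF _ z_class[OF z i i, unfolded \<delta>_def if_P[OF refl]]]) simp
  next
    fix n a s assume a: "a \<in> cocycles A n" and sS: "s \<in> S" and c: "p i n (act n s a) \<in> coboundaries (Bs ! i) n"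
    have s: "s \<in> coh_class A 0 (z i)" using sS by (simp add: S_def)
    have sc: "s \<in> cocycles A 0" using coh_class_cocycle[OF s zi] .
    show "act n s a \<in> coboundaries A n"
    proof (rule joint_inj)
      show "act n s a \<in> cocycles A n" using sc a by simp
      fix j assume j: "j < length Bs"
      interpret mj: cdga_mor K A "Bs ! j" "p j" using p_mor[OF j] .
      show "p j n (act n s a) \<in> coboundaries (Bs ! j) n"
      proof (cases "i = j")
        case True
        then show ?thesis using c by simp
      next
        case False
        have "p j 0 s \<in> coboundaries (Bs ! j) 0"
          using mj.B.coh_class_coboundary[OF mj.f_coh_class[OF s]] z_coboundary[OF z i j False] zi by simp
        then have "mj.B.act n (p j 0 s) (p j n a) \<in> coboundaries (Bs ! j) n"
          by (rule mj.B.coboundary_act) (use a in simp)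
        then show ?thesis using sc a by (simp add: mj.f_act)
      qed
    qed
  next
    fix n b assume b: "b \<in> cocycles (Bs ! i) n"
    \<comment> \<open>Surjectivity holds already before localization: \<open>b\<close> is extended
      by 0 to the other components.\<close>
    define y where "y j = (if j = i then b else \<zero>\<^bsub>gr (Bs ! j) n\<^esub>)" for j
    have "y j \<in> cocycles (Bs ! j) n" if "j < length Bs" for j
      using b cdga.cocycles_closed(1)[OF B_cdga[OF that]] by (simp add: y_def)
    then obtain a where a: "a \<in> cocycles A n" "\<forall>j < length Bs. y j \<in> coh_class (Bs ! j) n (p j n a)"
      using joint_surj by blast
    then have "b \<in> coh_class (Bs ! i) n (p i n a)" using i by (auto simp: y_def)
    then have "b \<ominus>\<^bsub>gr (Bs ! i) n\<^esub> p i n a \<in> coboundaries (Bs ! i) n" using a b by (simp add: m.B.coh_class_minus_iff)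
    then show "\<exists>a \<in> cocycles A n. \<exists>t \<in> T.
        m.B.act n t (b \<ominus>\<^bsub>gr (Bs ! i) n\<^esub> p i n a) \<in> coboundaries (Bs ! i) n"
      unfolding T_def using a(1) m.B.coh_class_refl[OF m.B.unity_in] m.B.act_coboundaries[OF m.B.unity_cocycle] by blast
  qed
qed

text \<open>The isomorphisms from \<open>H\<^sup>0\<close> of the factors to the field are the
  coordinates of an isomorphism from \<open>H\<^sup>0\<close> of \<open>A\<close> to a power of the
  field. Vanishing in negative degrees is tested in each component.\<close>

lemma joint_disconnected:
  assumes ne: "Bs \<noteq> []" and conn: "\<And>B. B \<in> set Bs \<Longrightarrow> homologically_connected K B"
  shows "homologically_disconnected K A"
proof -
  have "\<forall>i < length Bs. \<exists>\<chi>. cdga.H0_char K (Bs ! i) (base_algebra K) \<chi>"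
  proof (intro allI impI)
    fix i assume i: "i < length Bs"
    then have "algebra_isomorphic K (H0_algebra (Bs ! i)) (base_algebra K)"
      using conn[of "Bs ! i"] by (simp add: homologically_connected_def)
    then show "\<exists>\<chi>. cdga.H0_char K (Bs ! i) (base_algebra K) \<chi>"
      using cdga.algebra_isomorphic_H0_iff[OF B_cdga[OF i]] by blast
  qed
  then obtain \<chi> where \<chi>: "\<And>i. i < length Bs \<Longrightarrow> cdga.H0_char K (Bs ! i) (base_algebra K) (\<chi> i)" by metis
  define X where "X x = (\<lambda>i\<in>{..<length Bs}. \<chi> i (p i 0 x))" for x
  have pc: "p i 0 x \<in> cocycles (Bs ! i) 0" if "i < length Bs" "x \<in> cocycles A 0" for i x
    using cdga_mor.f_cocycles[OF p_mor] that by blast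
  have img: "\<chi> i ` cocycles (Bs ! i) 0 = carrier K"
    and eq: "\<lbrakk>x \<in> cocycles (Bs ! i) 0; y \<in> cocycles (Bs ! i) 0\<rbrakk> \<Longrightarrow> \<chi> i x = \<chi> i y \<longleftrightarrow> x \<in> coh_class (Bs ! i) 0 y"
    and add: "\<lbrakk>x \<in> cocycles (Bs ! i) 0; y \<in> cocycles (Bs ! i) 0\<rbrakk> \<Longrightarrow> \<chi> i (x \<oplus>\<^bsub>gr (Bs ! i) 0\<^esub> y) = \<chi> i x \<oplus>\<^bsub>K\<^esub> \<chi> i y"
    and mult: "\<lbrakk>x \<in> cocycles (Bs ! i) 0; y \<in> cocycles (Bs ! i) 0\<rbrakk> \<Longrightarrow> \<chi> i (mul (Bs ! i) 0 0 x y) = \<chi> i x \<otimes>\<^bsub>K\<^esub> \<chi> i y"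
    and smult: "\<lbrakk>x \<in> cocycles (Bs ! i) 0; c \<in> carrier K\<rbrakk> \<Longrightarrow> \<chi> i (c \<odot>\<^bsub>gr (Bs ! i) 0\<^esub> x) = c \<otimes>\<^bsub>K\<^esub> \<chi> i x"
    and one: "\<chi> i (unity (Bs ! i)) = \<one>\<^bsub>K\<^esub>" if "i < length Bs" for i x y c
    using \<chi>[OF that] unfolding cdga.H0_char_def[OF B_cdga[OF that]] by simp_all
  let ?N = "prod_module {..<length Bs} (\<lambda>_. base_algebra K)"
  have "H0_char ?N X"
    unfolding H0_char_def
  proof (intro conjI ballI)
    have "y \<in> X ` cocycles A 0" if y: "y \<in> carrier ?N" for y
    proof -
      have "\<forall>i < length Bs. \<exists>w. w \<in> cocycles (Bs ! i) 0 \<and> \<chi> i w = y i"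
      proof (intro allI impI)
        fix i assume i: "i < length Bs"
        have "y i \<in> carrier K" using y i by auto
        then show "\<exists>w. w \<in> cocycles (Bs ! i) 0 \<and> \<chi> i w = y i" unfolding img[OF i, symmetric] by auto
      qed
      then obtain w where w: "\<And>i. i < length Bs \<Longrightarrow> w i \<in> cocycles (Bs ! i) 0" "\<And>i. i < length Bs \<Longrightarrow> \<chi> i (w i) = y i"
        by metis
      obtain x where x: "x \<in> cocycles A 0" "\<forall>i < length Bs. p i 0 x \<in> coh_class (Bs ! i) 0 (w i)"
        using ex_class[of w 0] w(1) by blast
      have "\<chi> i (p i 0 x) = y i" if "i < length Bs" for i
        using eq[OF that pc[OF that x(1)] w(1)[OF that]] x(2) w(2)[OF that] that by simp
      then have "y = X x" using y by (auto simp: X_def PiE_def extensional_def restrict_def fun_eq_iff)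
      then show ?thesis using x(1) by blast
    qed
    moreover have "X x \<in> carrier ?N" if "x \<in> cocycles A 0" for x
      using img pc that by (fastforce simp: X_def)
    ultimately show "X ` cocycles A 0 = carrier ?N" by blast
  next
    fix x y assume x: "x \<in> cocycles A 0" and y: "y \<in> cocycles A 0"
    have "X x = X y \<longleftrightarrow> (\<forall>i < length Bs. \<chi> i (p i 0 x) = \<chi> i (p i 0 y))"
      by (auto simp: X_def fun_eq_iff restrict_def)
    also have "\<dots> \<longleftrightarrow> (\<forall>i < length Bs. p i 0 x \<in> coh_class (Bs ! i) 0 (p i 0 y))"
      using eq pc x y by simp
    also have "\<dots> \<longleftrightarrow> x \<in> coh_class A 0 y"
      using joint_class[OF x y] cdga_mor.f_coh_class[OF p_mor] y by auto
    finally show "X x = X y \<longleftrightarrow> x \<in> coh_class A 0 y" .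
    show "X (x \<oplus>\<^bsub>gr A 0\<^esub> y) = X x \<oplus>\<^bsub>?N\<^esub> X y"
      using x y pc add cdga_mor.f_add[OF p_mor] by (auto simp: X_def fun_eq_iff restrict_def)
    show "X (mul A 0 0 x y) = X x \<otimes>\<^bsub>?N\<^esub> X y"
      using x y pc mult cdga_mor.f_act[OF p_mor] by (auto simp: X_def fun_eq_iff restrict_def)
  next
    fix c x assume c: "c \<in> carrier K" and x: "x \<in> cocycles A 0"
    then show "X (c \<odot>\<^bsub>gr A 0\<^esub> x) = c \<odot>\<^bsub>?N\<^esub> X x"
      using pc smult cdga_mor.f_smult[OF p_mor] by (auto simp: X_def fun_eq_iff restrict_def)
  next
    show "X (unity A) = \<one>\<^bsub>?N\<^esub>"
      using one cdga_mor.f_unity[OF p_mor] by (auto simp: X_def fun_eq_iff restrict_def)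
  qed
  then have "algebra_isomorphic K (H0_algebra A) ?N" using algebra_isomorphic_H0_iff by blast
  moreover have "\<forall>n < 0. cohomology A n = {coboundaries A n}"
    unfolding cohomology_trivial_iff
  proof (intro allI impI ballI)
    fix n :: int and x assume n: "n < 0" and x: "x \<in> cocycles A n"
    show "x \<in> coboundaries A n"
    proof (rule joint_inj[OF x])
      fix i assume i: "i < length Bs"
      show "p i n x \<in> coboundaries (Bs ! i) n"
        using conn[of "Bs ! i"] i n cdga.homologically_connected_iff[OF B_cdga[OF i]] cdga_mor.f_cocycles[OF p_mor[OF i] x]
        by auto
    qed
  qed
  ultimately show ?thesis
    unfolding homologically_disconnected_def using ne by (intro conjI exI[of _ "{..<length Bs}"]) (auto simp: lessThan_empty_iff)
qed

end

section \<open>Decompositions defined by idempotents\<close>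

lemma cdga_idem_of_system:
  assumes "cdga K A" "idem_system A es" "infinite (UNIV :: 'a set)" "i < length es"
  shows "cdga_idem K (A :: ('k, 'a) dga) (es ! i)"
  using assms idem_systemD(2)[OF assms(2,4)] by (simp add: cdga_idem_def cdga_idem_axioms_def)

text \<open>A class is the sum of its products with the idempotents. Injectivity uses completeness
  in its additive form; for surjectivity one term sa is added for each localization, and
  orthogonality leaves the other components unchanged.\<close>

lemma idem_system_joint:
  fixes A :: "('k, 'a) dga"
  assumes A: "cdga K A" and es: "idem_system A es" and inf: "infinite (UNIV :: 'a set)"
  shows "joint_quasi_iso K A (map (frac_dga A) es) (\<lambda>i. frac_unit A (es ! i))"
  unfolding joint_quasi_iso_def length_map
proof (intro conjI allI impI ballI)
  interpret cdga K A by fact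
  note D = idem_systemD[OF es] and E = cdga_idem_of_system[OF A es inf]
  have un: "cdga_mor K A (frac_dga A (es ! i)) (frac_unit A (es ! i))" if "i < length es" for i
  proof -
    interpret X: cdga_idem K A "es ! i" using E[OF that] .
    show ?thesis by (rule X.un.cdga_mor_axioms)
  qed
  show "frac_unit A (es ! i) \<in> cdga_hom K A (map (frac_dga A) es ! i)" if "i < length es" for i
    using cdga_mor.f_hom[OF un[OF that]] that by simp
  {
    fix n x assume x: "x \<in> cocycles A n"
      and b: "\<forall>i < length es. frac_unit A (es ! i) n x \<in> coboundaries (map (frac_dga A) es ! i) n"
    \<comment> \<open>The cocycles that annihilate the class of \<open>x\<close> form an additive
      set containing all idempotents of the system, hence also 1.\<close>
    have "unity A \<in> {s \<in> cocycles A 0. act n s x \<in> coboundaries A n}"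
    proof (rule D(4))
      fix i assume i: "i < length es"
      interpret X: cdga_idem K A "es ! i" using E[OF i] .
      show "es ! i \<subseteq> {s \<in> cocycles A 0. act n s x \<in> coboundaries A n}"
        using X.un_coboundary_iff[OF x] b i X.S_cocycles by auto
    qed (use x in \<open>auto simp: act_add_left\<close>)
    then show "x \<in> coboundaries A n" using x by simp
  next
    fix n y assume y: "\<forall>i < length es. y i \<in> cocycles (map (frac_dga A) es ! i) n"
    \<comment> \<open>The exactness of the components that are not yet treated is part of the
      induction, since the new term is added to them.\<close>
    have "\<exists>x \<in> cocycles A n. \<forall>i < length es. if i < k then y i \<in> coh_class (frac_dga A (es ! i)) n (frac_unit A (es ! i) n x)
        else frac_unit A (es ! i) n x \<in> coboundaries (frac_dga A (es ! i)) n" if "k \<le> length es" for k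
      using that
    proof (induction k)
      case 0
      have "frac_unit A (es ! i) n \<zero>\<^bsub>gr A n\<^esub> \<in> coboundaries (frac_dga A (es ! i)) n" if "i < length es" for i
        using cdga_mor.f_coboundaries[OF un[OF that] coboundaries_zero] .
      then show ?case by (intro bexI[of _ "\<zero>\<^bsub>gr A n\<^esub>"]) simp_all
    next
      case (Suc k)
      then obtain x where x: "x \<in> cocycles A n"
        "\<forall>i < length es. if i < k then y i \<in> coh_class (frac_dga A (es ! i)) n (frac_unit A (es ! i) n x)
          else frac_unit A (es ! i) n x \<in> coboundaries (frac_dga A (es ! i)) n" by auto
      have k: "k < length es" using Suc by simp
      interpret X: cdga_idem K A "es ! k" using E[OF k] .
      obtain a where a: "a \<in> cocycles A n" "y k \<in> coh_class X.F n (X.un n a)"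
        using X.un_surj[of "y k" n] y k by auto
      obtain s where s: "s \<in> es ! k" using X.S_nonempty by blast
      \<comment> \<open>The factor \<open>s\<close> makes the new term exact in the other components
        and, by \<open>un_coh_class\<close>, leaves its class in the \<open>k\<close>-th
        unchanged.\<close>
      have sa: "act n s a \<in> cocycles A n" using a s by simp
      have ac: "a \<in> carrier (gr A n)" "s \<in> cocycles A 0" using a s by simp_all
      show ?case
      proof (intro bexI[of _ "x \<oplus>\<^bsub>gr A n\<^esub> act n s a"] allI impI)
        show "x \<oplus>\<^bsub>gr A n\<^esub> act n s a \<in> cocycles A n" using x(1) sa by simp
        fix i assume i: "i < length es"
        interpret Y: cdga_idem K A "es ! i" using E[OF i] .
        have add: "Y.un n (x \<oplus>\<^bsub>gr A n\<^esub> act n s a) = Y.un n x \<oplus>\<^bsub>gr Y.F n\<^esub> Y.un n (act n s a)"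
          by (rule Y.un.f_add) (use x sa in simp_all)
        have ux: "Y.un n x \<in> carrier (gr Y.F n)" "Y.un n (act n s a) \<in> carrier (gr Y.F n)"
          by (rule Y.un.f_closed, use x(1) sa in simp)+
        have c: "Y.un n (act n s a) \<in> coboundaries Y.F n" if "i \<noteq> k"
        proof -
          obtain t where t: "t \<in> es ! i" using Y.S_nonempty by blast
          have "act n (act 0 t s) a \<in> coboundaries A n"
            using coboundary_act[OF D(3)[OF i k that t s] a(1)] .
          then have "act n t (act n s a) \<in> coboundaries A n"
            using act_act[of t s a n] Y.S_rules(2)[OF t] ac by simp
          then show ?thesis using Y.un_coboundary_iff[OF sa t] by blast
        qed
        show "if i < Suc k then y i \<in> coh_class Y.F n (Y.un n (x \<oplus>\<^bsub>gr A n\<^esub> act n s a))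
            else Y.un n (x \<oplus>\<^bsub>gr A n\<^esub> act n s a) \<in> coboundaries Y.F n"
        proof (cases "i < k \<or> k < i")
          case True
          then have cb: "Y.un n (act n s a) \<in> coboundaries Y.F n" using c by blast
          show ?thesis
          proof (cases "i < k")
            case True
            have "y i \<in> coh_class Y.F n (Y.un n x)" using x(2) i True by auto
            moreover have "Y.un n x \<in> coh_class Y.F n (Y.un n (x \<oplus>\<^bsub>gr A n\<^esub> act n s a))"
            proof (rule Y.F.coh_class_sym[OF _ ux(1)])
              show "Y.un n (x \<oplus>\<^bsub>gr A n\<^esub> act n s a) \<in> coh_class Y.F n (Y.un n x)"
                unfolding add Y.F.coh_class_iff using cb Y.F.gr.a_comm[OF ux] by blast
            qed
            moreover have "Y.un n (x \<oplus>\<^bsub>gr A n\<^esub> act n s a) \<in> carrier (gr Y.F n)"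
              unfolding add using ux by (rule Y.F.gr.a_closed)
            ultimately show ?thesis using True Y.F.coh_class_trans by auto
          next
            case False
            then have "Y.un n x \<in> coboundaries Y.F n" using x(2) i by auto
            then show ?thesis using False True cb unfolding add by (auto intro: Y.F.coboundaries_add)
          qed
        next
          case False
          then have ik: "i = k" by simp
          have u: "X.un n x \<in> coh_class X.F n \<zero>\<^bsub>gr X.F n\<^esub>" using x(2) k by (auto simp: X.F.coh_class_zero)
          note ua = X.un.f_closed[OF ac(1)]
          have "X.un n (x \<oplus>\<^bsub>gr A n\<^esub> act n s a) = X.un n x \<oplus>\<^bsub>gr X.F n\<^esub> X.un n (act n s a)"
            using add unfolding ik .
          then have "X.un n (x \<oplus>\<^bsub>gr A n\<^esub> act n s a) \<in> coh_class X.F n (\<zero>\<^bsub>gr X.F n\<^esub> \<oplus>\<^bsub>gr X.F n\<^esub> X.un n a)"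
            using X.F.coh_class_add[OF u X.un_coh_class[OF a(1) s] X.F.gr.zero_closed ua] by simp
          then have w: "X.un n (x \<oplus>\<^bsub>gr A n\<^esub> act n s a) \<in> coh_class X.F n (X.un n a)" using ua by simp
          have "y k \<in> coh_class X.F n (X.un n (x \<oplus>\<^bsub>gr A n\<^esub> act n s a))"
            by (rule X.F.coh_class_trans[OF a(2) X.F.coh_class_sym[OF w ua]])
              (rule X.un.f_closed, use x(1) sa in simp)
          then show ?thesis using ik by simp
        qed
      qed
    qed
    from this[of "length es"] obtain x where "x \<in> cocycles A n"
      "\<forall>i < length es. y i \<in> coh_class (frac_dga A (es ! i)) n (frac_unit A (es ! i) n x)" by auto
    then show "\<exists>x \<in> cocycles A n. \<forall>i < length es. y i \<in> coh_class (map (frac_dga A) es ! i) n (frac_unit A (es ! i) n x)"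
      by auto
  }
qed

text \<open>
  In the non-negatively graded case there are no coboundaries in degree 0, so the idempotents are
  idempotents of \<open>A\<^sup>0\<close> itself and \<open>A\<close> is the product of its localizations.
\<close>

lemma idem_system_strict_product:
  fixes A :: "('k, 'a) dga"
  assumes A: "cdga K A" and es: "idem_system A es" and inf: "infinite (UNIV :: 'a set)" and nonneg: "nonneg_graded A"
  shows "strict_product K A (map (frac_dga A) es) (\<lambda>i. frac_unit A (es ! i))"
  unfolding strict_product_def length_map
proof (intro conjI allI impI ballI)
  interpret cdga K A by fact
  note D = idem_systemD[OF es] and E = cdga_idem_of_system[OF A es inf]
  have cob: "coboundaries A 0 = {\<zero>\<^bsub>gr A 0\<^esub>}"
  proof -
    have "carrier (gr A (- 1)) = {\<zero>\<^bsub>gr A (- 1)\<^esub>}" using nonneg by (simp add: nonneg_graded_def)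
    then show ?thesis using dif_zero[of "- 1"] by (simp add: coboundaries_def)
  qed
  have single: "s = t" if i: "i < length es" and s: "s \<in> es ! i" and t: "t \<in> es ! i" for i s t
  proof -
    interpret X: cdga_idem K A "es ! i" using E[OF i] .
    obtain b where "b \<in> coboundaries A 0" "s = b \<oplus>\<^bsub>gr A 0\<^esub> t"
      using X.S_coh[OF s t] by (auto simp: coh_class_iff)
    then show "s = t" using cob X.S_rules(2)[OF t] by simp
  qed
  \<comment> \<open>\<open>s\<close> is strictly idempotent and the only denominator, so the
    fraction sx/s is determined by sx.\<close>
  have rel: "frac_unit A (es ! i) n x = frac_unit A (es ! i) n y \<longleftrightarrow> act n s x = act n s y"
    if i: "i < length es" and s: "s \<in> es ! i" and xy: "x \<in> carrier (gr A n)" "y \<in> carrier (gr A n)" for i s n x y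
  proof -
    interpret X: cdga_idem K A "es ! i" using E[OF i] .
    have "act 0 s s = s" using single[OF i X.S_mult[OF s s] s] .
    then have ss: "act n s (act n s z) = act n s z" if "z \<in> carrier (gr A n)" for z
      using act_act[of s s z n] X.S_rules(2)[OF s] that by simp
    have "X.un n x = X.un n y \<longleftrightarrow> X.fr_rel n (act n s x) s (act n s y) s"
      unfolding X.un_eq[OF xy(1) s] X.un_eq[OF xy(2) s]
      by (rule X.fr_eq_iff) (use xy s in simp_all)
    also have "\<dots> \<longleftrightarrow> act n s x = act n s y"
      unfolding X.fr_rel_def ss[OF xy(1)] ss[OF xy(2)]
      using single[OF i _ s] s ss xy by metis
    finally show ?thesis .
  qed
  show "frac_unit A (es ! i) \<in> cdga_hom K A (map (frac_dga A) es ! i)" if "i < length es" for i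
  proof -
    interpret X: cdga_idem K A "es ! i" using E[OF that] .
    show ?thesis using X.un_hom that by simp
  qed
  {
    fix n x y assume x: "x \<in> carrier (gr A n)" and y: "y \<in> carrier (gr A n)"
      and eq: "\<forall>i < length es. frac_unit A (es ! i) n x = frac_unit A (es ! i) n y"
    have "unity A \<in> {s \<in> cocycles A 0. act n s x = act n s y}"
    proof (rule D(4))
      fix i assume i: "i < length es"
      interpret X: cdga_idem K A "es ! i" using E[OF i] .
      show "es ! i \<subseteq> {s \<in> cocycles A 0. act n s x = act n s y}"
        using rel[OF i _ x y] eq i X.S_cocycles by auto
    qed (use x y cob in \<open>auto simp: act_add_left\<close>)
    then show "x = y" using x y by simp
  next
    fix n y assume y: "\<forall>i < length es. y i \<in> carrier (gr (map (frac_dga A) es ! i) n)"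
    have "\<exists>x \<in> carrier (gr A n). \<forall>i < length es. if i < k then frac_unit A (es ! i) n x = y i
        else \<forall>s \<in> es ! i. act n s x = \<zero>\<^bsub>gr A n\<^esub>" if "k \<le> length es" for k
      using that
    proof (induction k)
      case 0
      have "act n s \<zero>\<^bsub>gr A n\<^esub> = \<zero>\<^bsub>gr A n\<^esub>" if "i < length es" "s \<in> es ! i" for i s
        using idempotents_mem(1)[OF D(2)[OF that(1)] that(2)] by simp
      then show ?case by (intro bexI[of _ "\<zero>\<^bsub>gr A n\<^esub>"]) simp_all
    next
      case (Suc k)
      then obtain x where x: "x \<in> carrier (gr A n)"
        "\<forall>i < length es. if i < k then frac_unit A (es ! i) n x = y i else \<forall>s \<in> es ! i. act n s x = \<zero>\<^bsub>gr A n\<^esub>" by auto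
      have k: "k < length es" using Suc by simp
      interpret X: cdga_idem K A "es ! k" using E[OF k] .
      have "y k \<in> carrier (gr X.F n)" using y k by auto
      then obtain a s where a: "a \<in> carrier (gr A n)" "s \<in> es ! k" "y k = X.fr n a s" by (rule X.fr_cases)
      note sc = X.S_rules(2)[OF a(2)]
      have ss: "act 0 s s = s" using single[OF k X.S_mult[OF a(2,2)] a(2)] .
      \<comment> \<open>Because ss = s, the fraction a/s equals sa/s, the image of
        \<open>a\<close>.\<close>
      have yk: "y k = X.un n a"
        using X.fr_scale[OF a(1,2,2)] a(3) X.un_eq[OF a(1,2)] ss by simp
      have sa: "act n s a \<in> carrier (gr A n)" using a(1) sc by simp
      show ?case
      proof (intro bexI[of _ "x \<oplus>\<^bsub>gr A n\<^esub> act n s a"] allI impI)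
        show xs: "x \<oplus>\<^bsub>gr A n\<^esub> act n s a \<in> carrier (gr A n)" using x(1) sa by simp
        fix i assume i: "i < length es"
        interpret Y: cdga_idem K A "es ! i" using E[OF i] .
        have zero: "act n t (act n s a) = \<zero>\<^bsub>gr A n\<^esub>" if "i \<noteq> k" "t \<in> es ! i" for t
        proof -
          have "act 0 t s = \<zero>\<^bsub>gr A 0\<^esub>" using D(3)[OF i k that a(2)] cob by blast
          then show ?thesis using act_act[of t s a n] Y.S_rules(2)[OF that(2)] sc a(1) by simp
        qed
        have act_sum: "act n t (x \<oplus>\<^bsub>gr A n\<^esub> act n s a) = act n t x \<oplus>\<^bsub>gr A n\<^esub> act n t (act n s a)" if "t \<in> es ! i" for t
          using act_add[OF Y.S_rules(2)[OF that] x(1) sa] .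
        show "if i < Suc k then Y.un n (x \<oplus>\<^bsub>gr A n\<^esub> act n s a) = y i
            else \<forall>t \<in> es ! i. act n t (x \<oplus>\<^bsub>gr A n\<^esub> act n s a) = \<zero>\<^bsub>gr A n\<^esub>"
        proof (cases "i = k")
          case True
          have "act n s x = \<zero>\<^bsub>gr A n\<^esub>" using x(2) k a(2) by auto
          then have "act n s (x \<oplus>\<^bsub>gr A n\<^esub> act n s a) = act n s a"
            using act_add[OF sc x(1) sa] act_act[OF sc sc a(1)] ss sa by simp
          then show ?thesis using rel[OF k a(2) xs a(1)] yk True by simp
        next
          case False
          show ?thesis
          proof (cases "i < k")
            case True
            obtain t where t: "t \<in> es ! i" using Y.S_nonempty by blast
            have "act n t (x \<oplus>\<^bsub>gr A n\<^esub> act n s a) = act n t x"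
              using act_sum[OF t] zero[OF False t] act_closed[OF Y.S_rules(2)[OF t] x(1)] by simp
            then show ?thesis using rel[OF i t xs x(1)] x(2) i True by simp
          next
            case nk: False
            then show ?thesis using act_sum zero[OF False] x(2) i False by auto
          qed
        qed
      qed
    qed
    from this[of "length es"] obtain x where "x \<in> carrier (gr A n)" "\<forall>i < length es. frac_unit A (es ! i) n x = y i" by auto
    then show "\<exists>x \<in> carrier (gr A n). \<forall>i < length es. frac_unit A (es ! i) n x = y i" by blast
  }
qed

text \<open>\<open>X\<close> gives coordinates on \<open>H\<^sup>0\<close> with values in the field.
  The unit vectors are lifted to cocycles \<open>z i\<close>, whose classes form the system.
  Multiplication by \<open>z i\<close> keeps the \<open>i\<close>-th coordinate only, so
  \<open>H\<^sup>0\<close> of the localization is the field; negative cohomology vanishes because it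
  comes from that of \<open>A\<close>.\<close>

lemma disconnected_idem_system:
  fixes A :: "('k, 'a) dga"
  assumes A: "cdga K A" and inf: "infinite (UNIV :: 'a set)" and dc: "homologically_disconnected K A"
  shows "\<exists>es. es \<noteq> [] \<and> idem_system A es \<and> (\<forall>e \<in> set es. homologically_connected K (frac_dga A e))"
proof -
  interpret cdga K A by fact
  obtain J :: "nat set" where J: "finite J" "J \<noteq> {}"
      "algebra_isomorphic K (H0_algebra A) (prod_module J (\<lambda>_. base_algebra K))"
    and neg: "\<forall>n < 0. cohomology A n = {coboundaries A n}"
    using dc by (auto simp: homologically_disconnected_def)
  let ?N = "prod_module J (\<lambda>_. base_algebra K)"
  obtain X where X: "H0_char ?N X" using J(3) algebra_isomorphic_H0_iff by blast
  have img: "X ` cocycles A 0 = (\<Pi>\<^sub>E j\<in>J. carrier K)"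
    and eq: "\<lbrakk>x \<in> cocycles A 0; y \<in> cocycles A 0\<rbrakk> \<Longrightarrow> X x = X y \<longleftrightarrow> x \<in> coh_class A 0 y"
    and add: "\<lbrakk>x \<in> cocycles A 0; y \<in> cocycles A 0; j \<in> J\<rbrakk> \<Longrightarrow> X (x \<oplus>\<^bsub>gr A 0\<^esub> y) j = X x j \<oplus>\<^bsub>K\<^esub> X y j"
    and mult: "\<lbrakk>x \<in> cocycles A 0; y \<in> cocycles A 0; j \<in> J\<rbrakk> \<Longrightarrow> X (act 0 x y) j = X x j \<otimes>\<^bsub>K\<^esub> X y j"
    and smult: "\<lbrakk>c \<in> carrier K; x \<in> cocycles A 0; j \<in> J\<rbrakk> \<Longrightarrow> X (c \<odot>\<^bsub>gr A 0\<^esub> x) j = c \<otimes>\<^bsub>K\<^esub> X x j"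
    and one: "j \<in> J \<Longrightarrow> X (unity A) j = \<one>\<^bsub>K\<^esub>" for x y c j
    using X by (auto simp: H0_char_def)
  have XK: "X x j \<in> carrier K" if "x \<in> cocycles A 0" "j \<in> J" for x j
    using img that by (auto simp: PiE_def)
  have ext: "x \<in> coh_class A 0 y" if "x \<in> cocycles A 0" "y \<in> cocycles A 0" "\<And>j. j \<in> J \<Longrightarrow> X x j = X y j" for x y
  proof -
    have "X x \<in> (\<Pi>\<^sub>E j\<in>J. carrier K)" "X y \<in> (\<Pi>\<^sub>E j\<in>J. carrier K)" using img that by blast+
    then have "X x = X y" by (rule PiE_ext) (rule that(3))
    then show ?thesis using eq that by blast
  qed
  have ex: "\<exists>x \<in> cocycles A 0. \<forall>j \<in> J. X x j = c j" if "\<And>j. j \<in> J \<Longrightarrow> c j \<in> carrier K" for c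
  proof -
    have "restrict c J \<in> X ` cocycles A 0" unfolding img using that by auto
    then show ?thesis by (metis imageE restrict_apply')
  qed
  have cong: "X x j = X y j" if "x \<in> coh_class A 0 y" "y \<in> cocycles A 0" for x y j
    using eq[of x y] that coh_class_cocycle by metis
  have zeroX: "X \<zero>\<^bsub>gr A 0\<^esub> j = \<zero>\<^bsub>K\<^esub>" if "j \<in> J" for j
    using add[of "\<zero>\<^bsub>gr A 0\<^esub>" "\<zero>\<^bsub>gr A 0\<^esub>" j] XK[of "\<zero>\<^bsub>gr A 0\<^esub>" j] that by simp
  have cobX: "x \<in> coboundaries A 0 \<longleftrightarrow> (\<forall>j \<in> J. X x j = \<zero>\<^bsub>K\<^esub>)" if "x \<in> cocycles A 0" for x
    using ext[of x "\<zero>\<^bsub>gr A 0\<^esub>"] cong[of x "\<zero>\<^bsub>gr A 0\<^esub>"] that zeroX by (auto simp: coh_class_zero)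
  define d where "d i j = (if i = j then \<one>\<^bsub>K\<^esub> else \<zero>\<^bsub>K\<^esub>)" for i j :: nat
  have "\<exists>x \<in> cocycles A 0. \<forall>j \<in> J. X x j = d i j" for i
    by (rule ex) (simp add: d_def)
  then obtain z where z: "\<And>i. z i \<in> cocycles A 0" "\<And>i j. j \<in> J \<Longrightarrow> X (z i) j = d i j" by metis
  have zX: "X s j = d i j" "s \<in> cocycles A 0" if "s \<in> coh_class A 0 (z i)" "j \<in> J" for s i j
    using cong[OF that(1) z(1)] z(2)[OF that(2)] coh_class_cocycle[OF that(1) z(1)] by auto
  \<comment> \<open>Systems are lists compared by position, so orthogonality needs an enumeration of
    \<open>J\<close> without repetition.\<close>
  obtain js where js: "set js = J" "distinct js" using finite_distinct_list[OF J(1)] by blast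
  define es where "es = map (\<lambda>i. coh_class A 0 (z i)) js"
  have idem: "coh_class A 0 (z i) \<in> idempotents A" for i
  proof (rule idempotentsI[OF z(1)], rule ext)
    fix j assume "j \<in> J"
    then show "X (act 0 (z i) (z i)) j = X (z i) j" using mult z by (simp add: d_def)
  qed (use z(1) in simp_all)
  have sys: "idem_system A es"
    unfolding idem_system_def
  proof (intro conjI allI impI ballI)
    show "set es \<subseteq> idempotents A" using idem by (auto simp: es_def)
  next
    fix i j s t assume ij: "i < length es" "j < length es" "i \<noteq> j" and st: "s \<in> es ! i" "t \<in> es ! j"
    have ij': "js ! i \<noteq> js ! j" using js(2) ij by (simp add: es_def nth_eq_iff_index_eq)
    have s: "s \<in> coh_class A 0 (z (js ! i))" and t: "t \<in> coh_class A 0 (z (js ! j))" using st ij by (simp_all add: es_def)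
    have c: "s \<in> cocycles A 0" "t \<in> cocycles A 0" using coh_class_cocycle[OF s z(1)] coh_class_cocycle[OF t z(1)] .
    have "X (act 0 s t) l = \<zero>\<^bsub>K\<^esub>" if "l \<in> J" for l
      using mult[OF c that] zX(1)[OF s that] zX(1)[OF t that] ij' by (simp add: d_def)
    then show "act 0 s t \<in> coboundaries A 0" using cobX[of "act 0 s t"] c by simp
  next
    fix V assume V: "V \<subseteq> cocycles A 0" and "coboundaries A 0 \<subseteq> V \<and> (\<forall>x \<in> V. \<forall>y \<in> V. x \<oplus>\<^bsub>gr A 0\<^esub> y \<in> V) \<and> \<Union>(set es) \<subseteq> V"
    then have V': "coboundaries A 0 \<subseteq> V" "\<And>x y. x \<in> V \<Longrightarrow> y \<in> V \<Longrightarrow> x \<oplus>\<^bsub>gr A 0\<^esub> y \<in> V"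
      "\<And>i. i \<in> J \<Longrightarrow> coh_class A 0 (z i) \<subseteq> V" by (auto simp: es_def js(1) UN_subset_iff)
    have coh: "x \<in> V" if "x \<in> coh_class A 0 y" "y \<in> V" for x y
      using that V' by (auto simp: coh_class_iff)
    have if_closed: "(if Q then \<one>\<^bsub>K\<^esub> else \<zero>\<^bsub>K\<^esub>) \<in> carrier K" for Q by simp
    \<comment> \<open>Induction over subsets: a cocycle lies in \<open>V\<close> if its coordinates
      are the indicator function of \<open>F\<close>. For F = J this applies to 1.\<close>
    have main: "\<forall>x \<in> cocycles A 0. (\<forall>j \<in> J. X x j = (if j \<in> F then \<one>\<^bsub>K\<^esub> else \<zero>\<^bsub>K\<^esub>)) \<longrightarrow> x \<in> V" if "finite F" "F \<subseteq> J" for F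
      using that
    proof (induction F)
      case empty
      then show ?case using cobX V'(1) by auto
    next
      case (insert i F)
      show ?case
      proof (intro ballI impI)
        fix x assume x: "x \<in> cocycles A 0" "\<forall>j \<in> J. X x j = (if j \<in> insert i F then \<one>\<^bsub>K\<^esub> else \<zero>\<^bsub>K\<^esub>)"
        obtain y where y: "y \<in> cocycles A 0" "\<forall>j \<in> J. X y j = (if j \<in> F then \<one>\<^bsub>K\<^esub> else \<zero>\<^bsub>K\<^esub>)"
          using ex[of "\<lambda>j. if j \<in> F then \<one>\<^bsub>K\<^esub> else \<zero>\<^bsub>K\<^esub>", OF if_closed] by blast
        have yV: "y \<in> V" using insert y by blast
        have zV: "z i \<in> V" using V'(3)[of i] insert.prems coh_class_refl[OF cocycles_carrier[OF z(1)]] by blast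
        have "x \<in> coh_class A 0 (y \<oplus>\<^bsub>gr A 0\<^esub> z i)"
        proof (rule ext[OF x(1)])
          show "y \<oplus>\<^bsub>gr A 0\<^esub> z i \<in> cocycles A 0" using y z(1) by simp
          fix j assume j: "j \<in> J"
          show "X x j = X (y \<oplus>\<^bsub>gr A 0\<^esub> z i) j"
            using add[OF y(1) z(1) j] x(2) y(2) z(2)[OF j] j insert.hyps by (auto simp: d_def)
        qed
        then show "x \<in> V" using coh V'(2)[OF yV zV] by blast
      qed
    qed
    show "unity A \<in> V" using main[OF J(1) subset_refl] one by simp
  qed
  have "homologically_connected K (frac_dga A (coh_class A 0 (z i)))" if i: "i \<in> J" for i
  proof -
    define S where "S = coh_class A 0 (z i)"
    interpret Y: cdga_idem K A S
      by unfold_locales (use inf idem in \<open>auto simp: S_def\<close>)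
    obtain s where s: "s \<in> S" using Y.S_nonempty by blast
    have sc: "s \<in> cocycles A 0" "\<And>j. j \<in> J \<Longrightarrow> X s j = d i j" using zX s i by (auto simp: S_def)
    let ?u = "\<lambda>c. c \<odot>\<^bsub>gr A 0\<^esub> unity A"
    have u: "?u c \<in> cocycles A 0" "Y.un 0 (?u c) = c \<odot>\<^bsub>gr Y.F 0\<^esub> unity Y.F" if "c \<in> carrier K" for c
      using that Y.un.f_smult[OF unity_in that] by simp_all
    show ?thesis
      unfolding S_def[symmetric] Y.F.homologically_connected_iff
    proof (intro conjI allI impI ballI)
      fix n :: int and x assume n: "n < 0" and x: "x \<in> cocycles Y.F n"
      obtain a where a: "a \<in> cocycles A n" "x \<in> coh_class Y.F n (Y.un n a)" using Y.un_surj[OF x] by blast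
      have "a \<in> coboundaries A n" using neg n a(1) cohomology_trivial_iff by blast
      then have "Y.un n a \<in> coboundaries Y.F n" by (rule Y.un.f_coboundaries)
      then show "x \<in> coboundaries Y.F n"
        using Y.F.coh_class_coboundary[OF a(2)] Y.un.f_closed[OF cocycles_carrier[OF a(1)]] by blast
    next
      fix x assume x: "x \<in> cocycles Y.F 0"
      obtain a where a: "a \<in> cocycles A 0" "x \<in> coh_class Y.F 0 (Y.un 0 a)" using Y.un_surj[OF x] by blast
      \<comment> \<open>The \<open>i\<close>-th coordinate is the only one that survives
        multiplication by \<open>s\<close>, so the image of \<open>a\<close> is cohomologous to this
        multiple of 1.\<close>
      define c where "c = X a i"
      have c: "c \<in> carrier K" using XK a(1) i by (simp add: c_def)
      have m: "a \<ominus>\<^bsub>gr A 0\<^esub> ?u c \<in> cocycles A 0" "s \<in> cocycles A 0" using a(1) u(1)[OF c] sc by (simp_all add: gr.minus_eq)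
      have "X (act 0 s a) j = X (act 0 s (?u c)) j" if j: "j \<in> J" for j
        using mult[OF sc(1) a(1) j] mult[OF sc(1) u(1)[OF c] j] smult[OF c unity_cocycle j] one[OF j] sc(2)[OF j] c XK[OF a(1) j]
        by (auto simp: d_def c_def)
      then have "act 0 s a \<in> coh_class A 0 (act 0 s (?u c))"
        by (intro ext act_cocycles sc(1) a(1) u(1)[OF c])
      then have "act 0 s (a \<ominus>\<^bsub>gr A 0\<^esub> ?u c) \<in> coboundaries A 0"
        using a(1) u(1)[OF c] sc(1) c by (simp add: coh_class_minus_iff gr.minus_eq act_add act_neg)
      then have "Y.un 0 (a \<ominus>\<^bsub>gr A 0\<^esub> ?u c) \<in> coboundaries Y.F 0"
        using Y.un_coboundary_iff[OF m(1) s] by blast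
      then have "Y.un 0 a \<in> coh_class Y.F 0 (Y.un 0 (?u c))"
        using a(1) c by (simp add: Y.F.coh_class_minus_iff gr.minus_eq Y.F.gr.minus_eq Y.un.f_add Y.un.f_neg)
      then have "x \<in> coh_class Y.F 0 (c \<odot>\<^bsub>gr Y.F 0\<^esub> unity Y.F)"
        using Y.F.coh_class_trans[OF a(2), of "c \<odot>\<^bsub>gr Y.F 0\<^esub> unity Y.F"] u(2)[OF c]
          Y.F.smult_closed[OF c Y.F.unity_in] by simp
      then show "\<exists>c \<in> carrier K. x \<in> coh_class Y.F 0 (c \<odot>\<^bsub>gr Y.F 0\<^esub> unity Y.F)" using c by blast
    next
      fix c assume c: "c \<in> carrier K" "c \<odot>\<^bsub>gr Y.F 0\<^esub> unity Y.F \<in> coboundaries Y.F 0"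
      then have b: "act 0 s (?u c) \<in> coboundaries A 0"
        using Y.un_coboundary_iff[OF u(1)[OF c(1)] s] u(2)[OF c(1)] by simp
      \<comment> \<open>The \<open>i\<close>-th coordinate of this product is \<open>c\<close>
        itself, as \<open>s\<close> has coordinate 1 there.\<close>
      have "X (act 0 s (?u c)) i = \<zero>\<^bsub>K\<^esub>"
        using cobX[of "act 0 s (?u c)"] b i act_cocycles[OF sc(1) u(1)[OF c(1)]] by blast
      then show "c = \<zero>\<^bsub>K\<^esub>"
        using mult[OF sc(1) u(1)[OF c(1)] i] smult[OF c(1) unity_cocycle i] one[OF i] sc(2)[OF i] c(1) by (simp add: d_def)
    qed
  qed
  then have "\<forall>e \<in> set es. homologically_connected K (frac_dga A e)" by (auto simp: es_def js(1))
  moreover have "es \<noteq> []" using js(1) J(2) by (auto simp: es_def)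
  ultimately show ?thesis using sys by blast
qed

section \<open>The homotopy categories\<close>

text \<open>\<open>R\<close> will be either non-negativity of the grading or no condition at all.\<close>

locale cdga_class =
  fixes K :: "'k ring" and R :: "('k, 'a) dga \<Rightarrow> bool"
  assumes K_field: "field K" and inf: "infinite (UNIV :: 'a set)"
    and R_zero: "R zero_dga"
    and R_bprod: "\<lbrakk>cdga_pair K A B; R A; R B\<rbrakk> \<Longrightarrow> R (bprod A B)"
    and R_frac: "\<lbrakk>cdga_frac K A S; R A\<rbrakk> \<Longrightarrow> R (frac_dga A S)"
begin

abbreviation "CR \<equiv> full_subcat (cdga_cat K) R"

lemma pairI: "cdga K A \<Longrightarrow> cdga K B \<Longrightarrow> cdga_pair K (A :: ('k, 'a) dga) B"
  using inf by (simp add: cdga_pair_def cdga_pair_axioms_def)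

lemma hom_id_quasi_iso:
  fixes A :: "('k, 'a) dga"
  assumes "cdga K A"
  shows "hom_id A \<in> quasi_iso K A A"
proof -
  interpret m: cdga_mor K A A "hom_id A"
    using assms hom_id_in by (simp add: cdga_mor_def cdga_mor_axioms_def)
  have "hom_id A n x = x" if "x \<in> cocycles A n" for n x using that by simp
  then show ?thesis
    unfolding m.quasi_iso_iff using m.A.coh_class_refl[OF m.A.cocycles_carrier] by (metis (no_types))
qed

lemma loc_products_CR: "loc_products CR (quasi_iso K) bprod bfst bsnd (\<lambda>Z X Y f g. bpair Z f g) zero_dga zmap"
proof (intro loc_products.intro loc_pair.intro loc_products_axioms.intro)
  show "category CR" by (rule category_full_subcat[OF category_cdga_cat])
  show "zero_dga \<in> Obj CR"
    using cdga_zero_dga[OF domain.axioms(1)[OF field.axioms(1)[OF K_field]]] R_zero by simp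
next
  fix X Y Z f g assume "X \<in> Obj CR" "Y \<in> Obj CR" "Z \<in> Obj CR" "f \<in> Hom CR Z X" "g \<in> Hom CR Z Y"
  then have O: "cdga K X" "cdga K Y" "cdga K Z" "f \<in> cdga_hom K Z X" "g \<in> cdga_hom K Z Y" by simp_all
  interpret P: cdga_pair K X Y using pairI O by blast
  have p: "bpair Z f g \<in> cdga_hom K Z P.P" using P.bpair_in O by blast
  then show "bpair Z f g \<in> Hom CR Z (bprod X Y)" by simp
  have c: "f n z \<in> carrier (gr X n)" "g n z \<in> carrier (gr Y n)" if "z \<in> carrier (gr Z n)" for n z
    using O that by (auto simp: cdga_hom_def linear_maps_def)
  have "hom_comp Z (bfst X Y) (bpair Z f g) = f"
    by (rule cdga_hom_eqI[OF hom_comp_in[OF O(3) P.cdga_P O(1) p P.bfst_in] O(4)]) (simp add: bpair_def c)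
  then show "Comp CR Z (bprod X Y) X (bfst X Y) (bpair Z f g) = f" by simp
  have "hom_comp Z (bsnd X Y) (bpair Z f g) = g"
    by (rule cdga_hom_eqI[OF hom_comp_in[OF O(3) P.cdga_P O(2) p P.bsnd_in] O(5)]) (simp add: bpair_def c)
  then show "Comp CR Z (bprod X Y) Y (bsnd X Y) (bpair Z f g) = g" by simp
next
  fix X Y Z h k assume "X \<in> Obj CR" "Y \<in> Obj CR" "Z \<in> Obj CR" "h \<in> Hom CR Z (bprod X Y)" "k \<in> Hom CR Z (bprod X Y)"
    "Comp CR Z (bprod X Y) X (bfst X Y) h = Comp CR Z (bprod X Y) X (bfst X Y) k"
    "Comp CR Z (bprod X Y) Y (bsnd X Y) h = Comp CR Z (bprod X Y) Y (bsnd X Y) k"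
  then show "h = k" using cdga_pair.bprod_unique[OF pairI, of X Y Z h k] by simp
next
  fix X X' Y f assume "X \<in> Obj CR" "X' \<in> Obj CR" "Y \<in> Obj CR" "f \<in> Hom CR X X'" "f \<in> quasi_iso K X X'"
  then have O: "cdga K X" "cdga K X'" "cdga K Y" "f \<in> cdga_hom K X X'" "f \<in> quasi_iso K X X'" by simp_all
  interpret P: cdga_pair K X Y using pairI O by blast
  \<comment> \<open>The second component is rewritten as a composite with the identity, so that
    \<open>bpair_quasi_iso\<close> applies to the pair of \<open>f\<close> and
    \<open>hom_id Y\<close>.\<close>
  have "hom_comp P.P (hom_id Y) (bsnd X Y) = bsnd X Y"
    by (rule cdga_hom_eqI[OF hom_comp_in[OF P.cdga_P O(3,3) P.bsnd_in hom_id_in[OF O(3)]] P.bsnd_in])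
      (auto elim!: P.P_cases)
  then show "bpair (bprod X Y) (Comp CR (bprod X Y) X X' f (bfst X Y)) (bsnd X Y) \<in> quasi_iso K (bprod X Y) (bprod X' Y)"
    using bpair_quasi_iso[OF pairI[OF O(1,3)] pairI[OF O(2,3)] O(4,5) hom_id_in[OF O(3)] hom_id_quasi_iso[OF O(3)]]
    by simp
next
  fix X Y Y' g assume "X \<in> Obj CR" "Y \<in> Obj CR" "Y' \<in> Obj CR" "g \<in> Hom CR Y Y'" "g \<in> quasi_iso K Y Y'"
  then have O: "cdga K X" "cdga K Y" "cdga K Y'" "g \<in> cdga_hom K Y Y'" "g \<in> quasi_iso K Y Y'" by simp_all
  interpret P: cdga_pair K X Y using pairI O by blast
  have "hom_comp P.P (hom_id X) (bfst X Y) = bfst X Y"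
    by (rule cdga_hom_eqI[OF hom_comp_in[OF P.cdga_P O(1,1) P.bfst_in hom_id_in[OF O(1)]] P.bfst_in])
      (auto elim!: P.P_cases)
  then show "bpair (bprod X Y) (bfst X Y) (Comp CR (bprod X Y) Y Y' g (bsnd X Y)) \<in> quasi_iso K (bprod X Y) (bprod X Y')"
    using bpair_quasi_iso[OF pairI[OF O(1,2)] pairI[OF O(1,3)] hom_id_in[OF O(1)] hom_id_quasi_iso[OF O(1)] O(4,5)]
    by simp
next
  fix X assume "X \<in> Obj CR"
  then show "zmap X \<in> Hom CR X zero_dga" by (simp add: zmap_in)
next
  fix X f assume "X \<in> Obj CR" "f \<in> Hom CR X zero_dga"
  then show "f = zmap X" by (simp add: zmap_unique)
next
  fix X Y assume "X \<in> Obj CR" "Y \<in> Obj CR"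
  then show "bprod X Y \<in> Obj CR" "bfst X Y \<in> Hom CR (bprod X Y) X" "bsnd X Y \<in> Hom CR (bprod X Y) Y"
    using cdga_pair.cdga_P[OF pairI] cdga_pair.bfst_in[OF pairI] cdga_pair.bsnd_in[OF pairI] R_bprod[OF pairI]
    by simp_all
qed

sublocale prods: loc_products CR "quasi_iso K" bprod bfst bsnd "\<lambda>Z X Y f g. bpair Z f g" zero_dga zmap
  by (rule loc_products_CR)

abbreviation "push \<equiv> \<lambda>X Y f e. coh_map X Y f 0 e"
abbreviation "topc \<equiv> \<lambda>X. coh_class X 0 (unity X)"

lemma idemI: "cdga K A \<Longrightarrow> e \<in> idempotents A \<Longrightarrow> cdga_idem K (A :: ('k, 'a) dga) e"
  using inf by (simp add: cdga_idem_def cdga_idem_axioms_def)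

lemma morI: "cdga K A \<Longrightarrow> cdga K B \<Longrightarrow> f \<in> cdga_hom K A B \<Longrightarrow> cdga_mor K A B f"
  by (simp add: cdga_mor_def cdga_mor_axioms_def)

lemma frac_morI:
  fixes A B :: "('k, 'a) dga"
  assumes "cdga K A" "cdga K B" "f \<in> cdga_hom K A B" "e \<in> idempotents A"
  shows "cdga_frac_mor K A e B (push A B f e) f"
proof -
  interpret m: cdga_mor K A B f using morI assms by blast
  interpret X: cdga_idem K A e using idemI assms by blast
  interpret Y: cdga_idem K B "push A B f e" using idemI m.push_idempotents assms by blast
  show ?thesis by unfold_locales (use m.push_mem' assms in auto)
qed

lemma loc_idempotents_CR:
  "loc_idempotents CR (quasi_iso K) idempotents push topc frac_dga frac_unit
     (\<lambda>X Y f e. frac_map X e Y (push X Y f e) f) idem_system (homologically_connected K)"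
proof (intro loc_idempotents.intro loc_pair.intro loc_idempotents_axioms.intro)
  show "category CR" by (rule category_full_subcat[OF category_cdga_cat])
next
  fix X Y f assume "X \<in> Obj CR" "Y \<in> Obj CR" "f \<in> Hom CR X Y"
  then interpret m: cdga_mor K X Y f by (simp add: morI)
  show "push X Y f (topc X) = topc Y" by (rule m.push_top)
  show "idem_system Y (map (push X Y f) es)" if "idem_system X es" for es using m.idem_system_push that .
  fix e assume e: "e \<in> idempotents X"
  show "push X Y f e \<in> idempotents Y" using m.push_idempotents e .
  interpret M: cdga_frac_mor K X e Y "push X Y f e" f
    using frac_morI[OF m.A.cdga_axioms m.B.cdga_axioms m.f_hom e] .
  show "frac_map X e Y (push X Y f e) f \<in> Hom CR (frac_dga X e) (frac_dga Y (push X Y f e))" using M.fm_hom by simp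
  have "hom_comp X M.fm M.A.un = hom_comp X M.B.un f"
    by (rule cdga_hom_eqI[OF hom_comp_in[OF m.A.cdga_axioms M.A.cdga_frac_dga M.B.cdga_frac_dga M.A.un_hom M.fm_hom]
          hom_comp_in[OF m.A.cdga_axioms m.B.cdga_axioms M.B.cdga_frac_dga m.f_hom M.B.un_hom]]) (simp add: M.fm_un)
  then show "Comp CR X (frac_dga X e) (frac_dga Y (push X Y f e)) (frac_map X e Y (push X Y f e) f) (frac_unit X e) =
      Comp CR X Y (frac_dga Y (push X Y f e)) (frac_unit Y (push X Y f e)) f" by simp
next
  fix X Y f assume "X \<in> Obj CR" "Y \<in> Obj CR" "f \<in> Hom CR X Y" and q: "f \<in> quasi_iso K X Y"
  then interpret m: cdga_mor K X Y f by (simp add: morI)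
  show "bij_betw (push X Y f) (idempotents X) (idempotents Y)" using m.push_bij[OF q] .
  show "idem_system X es" if "set es \<subseteq> idempotents X" "idem_system Y (map (push X Y f) es)" for es
    using m.idem_system_reflect[OF q that] .
  fix e assume e: "e \<in> idempotents X"
  show "frac_map X e Y (push X Y f e) f \<in> quasi_iso K (frac_dga X e) (frac_dga Y (push X Y f e))"
    using frac_map_quasi_iso_lift[OF idemI[OF m.A.cdga_axioms e] idemI[OF m.B.cdga_axioms m.push_idempotents[OF e]] q]
      m.push_mem'[OF e] by blast
next
  fix X assume "X \<in> Obj CR"
  then interpret X: cdga K X by simp
  have RX: "R X" using \<open>X \<in> Obj CR\<close> by simp
  show "topc X \<in> idempotents X" by (rule X.top_idempotent)
  show "frac_unit X (topc X) \<in> quasi_iso K X (frac_dga X (topc X))"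
    using frac_unit_top_quasi_iso[OF idemI[OF X.cdga_axioms X.top_idempotent]] X.coh_class_refl[OF X.unity_in] by blast
  show "set es \<subseteq> idempotents X" if "idem_system X es" for es using idem_systemD(1) that .
  show "\<exists>!i. i < length es \<and> es ! i = topc X" if "homologically_connected K X" "idem_system X es" for es
    using X.connected_idem_system[OF K_field that] .
  fix e assume e: "e \<in> idempotents X"
  interpret E: cdga_idem K X e using idemI[OF X.cdga_axioms e] .
  show "frac_dga X e \<in> Obj CR" using E.cdga_frac_dga R_frac[OF E.cdga_frac_axioms RX] by simp
  show "frac_unit X e \<in> Hom CR X (frac_dga X e)" using E.un_hom by simp
  interpret m: cdga_mor K X X "hom_id X" using morI[OF X.cdga_axioms X.cdga_axioms hom_id_in[OF X.cdga_axioms]] .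
  obtain s where s: "s \<in> e" using E.S_nonempty by blast
  have "hom_id X 0 s = s" using E.S_rules(2)[OF s] by simp
  then have pe': "push X X (hom_id X) e = e"
    using m.push_mem[OF e s] E.S_class[OF s, symmetric] by (simp only:)
  then show "push X X (Ident CR X) e = e" by simp
  interpret M: cdga_frac_mor K X e X e "hom_id X"
    using frac_morI[OF X.cdga_axioms X.cdga_axioms m.f_hom e] unfolding pe' .
  have "M.fm = hom_id E.F"
    by (rule cdga_hom_eqI[OF M.fm_hom hom_id_in[OF E.cdga_frac_dga]]) (auto elim!: E.fr_cases simp: M.fm_fr)
  then show "frac_map X e X (push X X (Ident CR X) e) (Ident CR X) = Ident CR (frac_dga X e)"
    using pe' by simp
next
  fix X Y Z f g e
  assume "X \<in> Obj CR" "Y \<in> Obj CR" "Z \<in> Obj CR" "f \<in> Hom CR X Y" "g \<in> Hom CR Y Z" and e: "e \<in> idempotents X"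
  then have O: "cdga K X" "cdga K Y" "cdga K Z" "f \<in> cdga_hom K X Y" "g \<in> cdga_hom K Y Z" by simp_all
  note h = hom_comp_in[OF O]
  interpret f: cdga_mor K X Y f using morI O by blast
  interpret g: cdga_mor K Y Z g using morI O by blast
  interpret h: cdga_mor K X Z "hom_comp X g f" using morI[OF O(1,3) h] .
  interpret E: cdga_idem K X e using idemI[OF O(1) e] .
  note e' = f.push_idempotents[OF e]
  obtain s where s: "s \<in> e" using E.S_nonempty by blast
  have pc: "push X Z (hom_comp X g f) e = push Y Z g (push X Y f e)"
    using h.push_mem[OF e s] g.push_mem[OF e' f.push_mem'[OF e s]] E.S_rules(2)[OF s] by simp
  then show "push X Z (Comp CR X Y Z g f) e = push Y Z g (push X Y f e)" by simp
  interpret F: cdga_frac_mor K X e Y "push X Y f e" f using frac_morI[OF O(1,2,4) e] .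
  interpret G: cdga_frac_mor K Y "push X Y f e" Z "push Y Z g (push X Y f e)" g using frac_morI[OF O(2,3,5) e'] .
  interpret H: cdga_frac_mor K X e Z "push Y Z g (push X Y f e)" "hom_comp X g f"
    using frac_morI[OF O(1,3) h e] unfolding pc .
  \<comment> \<open>Both sides send a/s to g(f(a)) / g(f(s)).\<close>
  have "H.fm = hom_comp E.F G.fm F.fm"
  proof (rule cdga_hom_eqI[OF H.fm_hom hom_comp_in[OF E.cdga_frac_dga F.B.cdga_frac_dga G.B.cdga_frac_dga F.fm_hom G.fm_hom]])
    fix n x assume x: "x \<in> carrier (gr E.F n)"
    then obtain a s where a: "a \<in> carrier (gr X n)" "s \<in> e" "x = E.fr n a s" by (rule E.fr_cases)
    have "H.fm n x = G.B.fr n (g n (f n a)) (g 0 (f 0 s))"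
      unfolding a(3) H.fm_fr[OF a(1,2)] using a(1) E.S_rules(2)[OF a(2)] by simp
    also have "\<dots> = G.fm n (F.fm n x)"
      unfolding a(3) F.fm_fr[OF a(1,2)] using G.fm_fr[OF f.f_closed[OF a(1)] F.f_S[OF a(2)]] by simp
    finally show "H.fm n x = hom_comp E.F G.fm F.fm n x" using x by simp
  qed
  then show "frac_map X e Z (push X Z (Comp CR X Y Z g f) e) (Comp CR X Y Z g f) =
      Comp CR (frac_dga X e) (frac_dga Y (push X Y f e)) (frac_dga Z (push Y Z g (push X Y f e)))
        (frac_map Y (push X Y f e) Z (push Y Z g (push X Y f e)) g) (frac_map X e Y (push X Y f e) f)"
    using pc by simp
qed

sublocale idem: loc_idempotents CR "quasi_iso K" idempotents push topc frac_dga frac_unit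
  "\<lambda>X Y f e. frac_map X e Y (push X Y f e) f" idem_system "homologically_connected K"
  by (rule loc_idempotents_CR)

section \<open>Products of lists of cdgas\<close>

lemma familyI:
  assumes "cdga K A" "\<And>B. B \<in> set Bs \<Longrightarrow> cdga K B" "joint_quasi_iso K A Bs p"
  shows "cdga_joint K (A :: ('k, 'a) dga) (Bs :: ('k, 'a) dga list) p"
  using assms by (simp add: cdga_joint_def cdga_joint_axioms_def cdga_family_def cdga_family_axioms_def joint_quasi_iso_def)

lemma lprod_CR:
  assumes "\<And>B. B \<in> set Bs \<Longrightarrow> cdga K B \<and> R B"
  shows "cdga K (prods.lprod Bs)" "R (prods.lprod Bs)"
  using prods.lprod_Obj[of Bs] assms by auto

lemma lproj_hom:
  assumes "\<And>B. B \<in> set Bs \<Longrightarrow> cdga K B \<and> R B" "i < length Bs"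
  shows "prods.lproj Bs i \<in> cdga_hom K (prods.lprod Bs) (Bs ! i)"
  using prods.lproj_in[of Bs i] assms by auto

lemma lprod_strict_product:
  assumes "\<And>B. B \<in> set Bs \<Longrightarrow> cdga K B \<and> R B"
  shows "strict_product K (prods.lprod Bs) Bs (prods.lproj Bs)"
  unfolding strict_product_def
proof (intro conjI allI impI ballI)
  show "prods.lproj Bs i \<in> cdga_hom K (prods.lprod Bs) (Bs ! i)" if "i < length Bs" for i
    using lproj_hom assms that by blast
  show "x = y" if "x \<in> carrier (gr (prods.lprod Bs) n)" "y \<in> carrier (gr (prods.lprod Bs) n)"
    "\<forall>i < length Bs. prods.lproj Bs i n x = prods.lproj Bs i n y" for n x y
    using assms that
  proof (induction Bs arbitrary: x y)
    case Nil
    then show ?case unfolding prods.lprod.simps by (simp add: zero_dga_def)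
  next
    case (Cons B Bs)
    interpret P: cdga_pair K B "prods.lprod Bs" using pairI lprod_CR(1)[of Bs] Cons.prems(1) by simp
    obtain a b where x: "a \<in> carrier (gr B n)" "b \<in> carrier (gr (prods.lprod Bs) n)" "x = encode (a, b)"
      using Cons.prems(2) P.P_cases[of x n] by auto
    obtain c d where y: "c \<in> carrier (gr B n)" "d \<in> carrier (gr (prods.lprod Bs) n)" "y = encode (c, d)"
      using Cons.prems(3) P.P_cases[of y n] by auto
    have "a = c" using Cons.prems(4)[rule_format, of 0] x y by simp
    moreover have "b = d"
    proof (rule Cons.IH)
      show "\<forall>i < length Bs. prods.lproj Bs i n b = prods.lproj Bs i n d"
        using Cons.prems(4)[rule_format, of "Suc _"] x y by simp
    qed (use Cons.prems x y in auto)
    ultimately show ?case using x y by simp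
  qed
  show "\<exists>x \<in> carrier (gr (prods.lprod Bs) n). \<forall>i < length Bs. prods.lproj Bs i n x = y i"
    if "\<forall>i < length Bs. y i \<in> carrier (gr (Bs ! i) n)" for n y
    using assms that
  proof (induction Bs arbitrary: y)
    case Nil
    then show ?case unfolding prods.lprod.simps by (simp add: zero_dga_def)
  next
    case (Cons B Bs)
    interpret P: cdga_pair K B "prods.lprod Bs" using pairI lprod_CR(1)[of Bs] Cons.prems(1) by simp
    obtain b where b: "b \<in> carrier (gr (prods.lprod Bs) n)" "\<forall>i < length Bs. prods.lproj Bs i n b = y (Suc i)"
      using Cons.IH[of "\<lambda>i. y (Suc i)"] Cons.prems by fastforce
    have y0: "y 0 \<in> carrier (gr B n)" using Cons.prems(2)[rule_format, of 0] by simp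
    have "prods.lproj (B # Bs) i n (encode (y 0, b)) = y i" if "i < length (B # Bs)" for i
      using that b y0 by (cases i) simp_all
    then show ?case using b y0 by (intro bexI[of _ "encode (y 0, b)"]) simp_all
  qed
qed

lemma family_lprod:
  assumes "\<And>B. B \<in> set Bs \<Longrightarrow> cdga K B \<and> R B"
  shows "cdga_family K (prods.lprod Bs) Bs (prods.lproj Bs)"
  using lprod_CR[OF assms] lproj_hom[OF assms] assms by (simp add: cdga_family_def cdga_family_axioms_def)

lemma joint_lprod:
  assumes "\<And>B. B \<in> set Bs \<Longrightarrow> cdga K B \<and> R B"
  shows "joint_quasi_iso K (prods.lprod Bs) Bs (prods.lproj Bs)"
  using cdga_family.strict_product_joint[OF family_lprod lprod_strict_product] assms by blast

text \<open>Turns the componentwise notion into a single weak equivalence to the product object, as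
  \<open>product_cone_localization\<close> demands.\<close>

lemma joint_tuple:
  assumes A: "cdga K A" "R A" and Bs: "\<And>B. B \<in> set Bs \<Longrightarrow> cdga K B \<and> R B" and joint: "joint_quasi_iso K A Bs p"
  shows "\<exists>m. m \<in> cdga_hom K A (prods.lprod Bs) \<and> m \<in> quasi_iso K A (prods.lprod Bs) \<and>
    (\<forall>i < length Bs. hom_comp A (prods.lproj Bs i) m = p i)"
proof -
  interpret J: cdga_joint K A Bs p using familyI[OF A(1) _ joint] Bs by blast
  note P = lprod_CR[OF Bs]
  interpret L: cdga_joint K "prods.lprod Bs" Bs "prods.lproj Bs"
    using familyI[OF P(1) _ joint_lprod[OF Bs]] Bs by blast
  obtain m where m: "m \<in> cdga_hom K A (prods.lprod Bs)" "\<forall>i < length Bs. hom_comp A (prods.lproj Bs i) m = p i"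
    using prods.lprod_tuple_ex[of Bs A p] A Bs J.p_hom by auto
  interpret m: cdga_mor K A "prods.lprod Bs" m using morI[OF A(1) P(1) m(1)] .
  have pm: "prods.lproj Bs i n (m n x) = p i n x" if "i < length Bs" "x \<in> carrier (gr A n)" for i n x
    using m(2) that hom_comp_apply[OF that(2), of "prods.lproj Bs i" m] by simp
  have "m \<in> quasi_iso K A (prods.lprod Bs)"
    unfolding m.quasi_iso_iff
  proof (intro allI conjI ballI impI)
    fix n x assume x: "x \<in> cocycles A n" "m n x \<in> coboundaries (prods.lprod Bs) n"
    show "x \<in> coboundaries A n"
    proof (rule J.joint_inj[OF x(1)])
      fix i assume i: "i < length Bs"
      show "p i n x \<in> coboundaries (Bs ! i) n"
        using cdga_mor.f_coboundaries[OF L.p_mor[OF i] x(2)] pm[OF i] x(1) by simp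
    qed
  next
    fix n y assume y: "y \<in> cocycles (prods.lprod Bs) n"
    have "prods.lproj Bs i n y \<in> cocycles (Bs ! i) n" if "i < length Bs" for i
      using cdga_mor.f_cocycles[OF L.p_mor[OF that] y] .
    then obtain x where x: "x \<in> cocycles A n" "\<forall>i < length Bs. prods.lproj Bs i n y \<in> coh_class (Bs ! i) n (p i n x)"
      using J.joint_surj[of "\<lambda>i. prods.lproj Bs i n y" n] by blast
    have "y \<in> coh_class (prods.lprod Bs) n (m n x)"
      by (rule L.joint_class) (use y x pm in simp_all)
    then show "\<exists>x \<in> cocycles A n. y \<in> coh_class (prods.lprod Bs) n (m n x)" using x(1) by blast
  qed
  then show ?thesis using m by blast
qed

section \<open>Splittings of disconnected cdgas and the resulting equivalence\<close>

abbreviation "D \<equiv> localization CR (quasi_iso K)"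
abbreviation "zcl \<equiv> zz_class CR (quasi_iso K)"

text \<open>Both universal properties meet here. The cone comes from the weak equivalence to
  \<open>lprod Bs\<close>; the maps out of \<open>A\<close> are governed by the idempotents of the
  decomposition, \<open>p i\<close> becoming a quasi-isomorphism after localization at the
  \<open>i\<close>-th.\<close>

lemma joint_connected_splitting:
  assumes A: "cdga K A" "R A" and Bs: "\<And>B. B \<in> set Bs \<Longrightarrow> cdga K B \<and> R B \<and> homologically_connected K B"
    and ne: "Bs \<noteq> []" and joint: "joint_quasi_iso K A Bs p"
  shows "connected_splitting D (homologically_connected K) A Bs (\<lambda>i. zcl A (Bs ! i) [Fwd A (Bs ! i) (p i)])"
proof -
  interpret J: cdga_joint K A Bs p using familyI[OF A(1) _ joint] Bs by blast
  obtain z where z: "J.units z" using J.ex_units by blast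
  obtain m where m: "m \<in> cdga_hom K A (prods.lprod Bs)" "m \<in> quasi_iso K A (prods.lprod Bs)"
    "\<forall>i < length Bs. hom_comp A (prods.lproj Bs i) m = p i"
    using joint_tuple[OF A _ joint] Bs by blast
  have cone: "product_cone D A Bs (\<lambda>i. zcl A (Bs ! i) [Fwd A (Bs ! i) (p i)])"
    by (rule prods.product_cone_localization[of Bs A m]) (use A Bs m in auto)
  show ?thesis
  proof (rule idem.connected_splitting_localization[of A "J.unit_classes z" Bs p])
    show "A \<in> Obj CR" using A by simp
    show "idem_system A (J.unit_classes z)" by (rule J.idem_system_unit_classes[OF z])
    show "length Bs = length (J.unit_classes z)" by (simp add: z)
    fix i assume i: "i < length Bs"
    then have "Bs ! i \<in> set Bs" by simp
    then show "Bs ! i \<in> Obj CR \<and> homologically_connected K (Bs ! i) \<and> p i \<in> Hom CR A (Bs ! i) \<and>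
        push A (Bs ! i) (p i) (J.unit_classes z ! i) = topc (Bs ! i) \<and>
        frac_map A (J.unit_classes z ! i) (Bs ! i) (push A (Bs ! i) (p i) (J.unit_classes z ! i)) (p i)
          \<in> quasi_iso K (frac_dga A (J.unit_classes z ! i)) (frac_dga (Bs ! i) (topc (Bs ! i)))"
      using Bs J.p_hom[OF i] J.push_unit_class[OF z i] J.frac_map_unit_quasi_iso[OF z i inf inf] i z by simp
  qed (use ne cone in auto)
qed

text \<open>The prescribed projections are known to agree with the constructed ones only at indices
  of factors.\<close>

lemma connected_splitting_cong:
  assumes "connected_splitting E Q A Bs \<pi>" "\<And>i. i < length Bs \<Longrightarrow> \<pi> i = \<rho> i"
  shows "connected_splitting E Q A Bs \<rho>"
proof -
  have "product_cone E A Bs \<rho>"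
    using assms unfolding connected_splitting_def product_cone_def by simp
  moreover have "(fst ig < length Bs \<and> snd ig \<in> Hom E (Bs ! fst ig) X \<and> Comp E A (Bs ! fst ig) X (snd ig) (\<rho> (fst ig)) = h) \<longleftrightarrow>
      (fst ig < length Bs \<and> snd ig \<in> Hom E (Bs ! fst ig) X \<and> Comp E A (Bs ! fst ig) X (snd ig) (\<pi> (fst ig)) = h)" for ig X h
    using assms(2)[of "fst ig"] by auto
  ultimately show ?thesis using assms(1) unfolding connected_splitting_def by simp
qed

text \<open>\<open>\<pi>\<close> is kept apart from the one-letter zigzags of \<open>p\<close>
  because in the \<int>-graded case the projections are prescribed as zigzags through a product.
  Each list of connected objects is realized by its product \<open>lprod Bs\<close>, which is
  disconnected by \<open>joint_disconnected\<close>.\<close>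

lemma equivalence:
  assumes Fs: "\<And>A. \<lbrakk>cdga K A; R A; homologically_disconnected K A\<rbrakk> \<Longrightarrow> Fs A \<noteq> [] \<and>
      (\<forall>B \<in> set (Fs A). cdga K B \<and> R B \<and> homologically_connected K B) \<and> joint_quasi_iso K A (Fs A) (p A)"
    and \<pi>: "\<And>A i. \<lbrakk>cdga K A; R A; homologically_disconnected K A; i < length (Fs A)\<rbrakk> \<Longrightarrow>
      zcl A (Fs A ! i) [Fwd A (Fs A ! i) (p A i)] = \<pi> A i"
  shows "\<exists>\<Phi>. FObj \<Phi> = Fs \<and>
    is_equivalence (full_subcat D (homologically_disconnected K)) (Prod_cat (full_subcat D (homologically_connected K))) \<Phi> \<and>
    natural_projections D (full_subcat D (homologically_disconnected K)) \<Phi> \<pi>"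
proof (rule category.splitting_equivalence[OF prods.category_localization])
  fix A assume "A \<in> Obj D" and dc: "homologically_disconnected K A"
  then have A: "cdga K A" "R A" by (auto simp: prods.localization_simps)
  show "connected_splitting D (homologically_connected K) A (Fs A) (\<pi> A)"
    by (rule connected_splitting_cong[OF joint_connected_splitting[OF A, of "Fs A" "p A"]])
      (use Fs[OF A dc] \<pi>[OF A dc] in auto)
next
  fix Bs assume "Bs \<in> Obj (Prod_cat (full_subcat D (homologically_connected K)))"
  then have Bs: "Bs \<noteq> []" "\<And>B. B \<in> set Bs \<Longrightarrow> cdga K B \<and> R B \<and> homologically_connected K B"
    by (auto simp: Prod_cat_simps prods.localization_simps)
  then have BR: "\<And>B. B \<in> set Bs \<Longrightarrow> cdga K B \<and> R B" by blast
  interpret J: cdga_joint K "prods.lprod Bs" Bs "prods.lproj Bs"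
    using familyI[OF lprod_CR(1)[OF BR] _ joint_lprod[OF BR]] BR by blast
  show "\<exists>A \<rho>. homologically_disconnected K A \<and> connected_splitting D (homologically_connected K) A Bs \<rho>"
    using joint_connected_splitting[OF lprod_CR[OF BR] Bs(2,1) joint_lprod[OF BR]] J.joint_disconnected Bs by blast
qed

end

section \<open>Finite carrier types\<close>

lemma (in field) char_zero_infinite:
  assumes "\<forall>n :: nat. n > 0 \<longrightarrow> [n] \<cdot>\<^bsub>R\<^esub> \<one> \<noteq> \<zero>"
  shows "infinite (carrier R)"
proof
  assume "finite (carrier R)"
  moreover have "inj (\<lambda>n :: nat. [n] \<cdot>\<^bsub>R\<^esub> \<one>)"
  proof (rule linorder_injI)
    fix m n :: nat assume "m < n"
    show "[m] \<cdot>\<^bsub>R\<^esub> \<one> \<noteq> [n] \<cdot>\<^bsub>R\<^esub> \<one>"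
    proof
      assume e: "[m] \<cdot>\<^bsub>R\<^esub> \<one> = [n] \<cdot>\<^bsub>R\<^esub> \<one>"
      have "[n] \<cdot>\<^bsub>R\<^esub> \<one> = [m] \<cdot>\<^bsub>R\<^esub> \<one> \<oplus> [(n - m)] \<cdot>\<^bsub>R\<^esub> \<one>"
        using add.nat_pow_mult[of \<one> m "n - m"] \<open>m < n\<close> by simp
      then have "[(n - m)] \<cdot>\<^bsub>R\<^esub> \<one> = \<zero>" using e by (metis add.l_cancel_one' add.nat_pow_closed one_closed)
      then show False using assms \<open>m < n\<close> by simp
    qed
  qed
  moreover have "range (\<lambda>n :: nat. [n] \<cdot>\<^bsub>R\<^esub> \<one>) \<subseteq> carrier R" by auto
  ultimately show False using finite_subset finite_imageD by blast
qed

text \<open>\<open>H\<^sup>0\<close> would be in bijection with the field or a nonempty power of it,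
  which is infinite in characteristic 0; but its elements are subsets of a finite type.\<close>

lemma finite_universe:
  fixes A :: "('k, 'a) dga"
  assumes "field K" and char_zero: "\<forall>n :: nat. n > 0 \<longrightarrow> [n] \<cdot>\<^bsub>K\<^esub> \<one>\<^bsub>K\<^esub> \<noteq> \<zero>\<^bsub>K\<^esub>" and fin: "finite (UNIV :: 'a set)"
  shows "\<not> homologically_connected K A" "\<not> homologically_disconnected K A"
proof -
  have inf: "infinite (carrier K)" using field.char_zero_infinite[OF assms(1,2)] .
  have finH: "finite (carrier (H0_algebra A))"
    using fin by (metis Finite_Set.finite_set finite_subset subset_UNIV)
  have iso: "finite (carrier N)" if "algebra_isomorphic K (H0_algebra A) N" for N :: "('k, 'n) module"
    using that finH bij_betw_finite by (auto simp: algebra_isomorphic_def ring_iso_def)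
  show "\<not> homologically_connected K A"
    using iso[of "base_algebra K"] inf by (auto simp: homologically_connected_def)
  show "\<not> homologically_disconnected K A"
  proof
    assume "homologically_disconnected K A"
    then obtain J :: "nat set" where J: "J \<noteq> {}" "algebra_isomorphic K (H0_algebra A) (prod_module J (\<lambda>_. base_algebra K))"
      by (auto simp: homologically_disconnected_def)
    then obtain j where j: "j \<in> J" by blast
    have f: "finite (\<Pi>\<^sub>E j\<in>J. carrier K)" using iso[OF J(2)] by simp
    have "carrier K \<subseteq> (\<lambda>x. x j) ` (\<Pi>\<^sub>E j\<in>J. carrier K)"
      using j by (auto intro!: image_eqI[of _ _ "restrict (\<lambda>_. _) J"])
    then show False using finite_surj[OF f] inf by blast
  qed
qed

lemma empty_equivalence:
  assumes "category D" "category E" "Obj D = {}" "Obj E = {}"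
  shows "is_equivalence D E \<Phi>"
  using assms by (simp add: is_equivalence_def is_functor_def natural_iso_def)

lemma cdga_class_nonneg:
  "field K \<Longrightarrow> infinite (UNIV :: 'a set) \<Longrightarrow> cdga_class K (nonneg_graded :: ('k, 'a) dga \<Rightarrow> bool)"
  by (rule cdga_class.intro) (auto simp: nonneg_zero_dga nonneg_bprod nonneg_frac_dga)

lemma cdga_class_all:
  "field K \<Longrightarrow> infinite (UNIV :: 'a set) \<Longrightarrow> cdga_class K (\<lambda>_ :: ('k, 'a) dga. True)"
  by (rule cdga_class.intro) auto

theorem theoremB:
  fixes K :: "'k ring"
  assumes "field K"
    and char_zero: "\<forall>n :: nat. n > 0 \<longrightarrow> [n] \<cdot>\<^bsub>K\<^esub> \<one>\<^bsub>K\<^esub> \<noteq> \<zero>\<^bsub>K\<^esub>"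
  shows
    "(\<forall>A :: ('k, 'a) dga. cdga K A \<and> nonneg_graded A \<and> homologically_disconnected K A \<longrightarrow>
       (\<exists>As :: ('k, 'a) dga list. As \<noteq> [] \<and>
          (\<forall>B \<in> set As. cdga K B \<and> nonneg_graded B \<and> homologically_connected K B) \<and>
          cdga_iso K A (cdga_prod_list As) \<noteq> {})) \<and>
     (\<exists>(\<Phi> :: (('k, 'a) dga, ('k, 'a) ho_mor, ('k, 'a) dga list, (nat \<times> ('k, 'a) ho_mor) list) func) p.
       is_equivalence (ho_dc_nonneg K) (Prod_cat (ho_c_nonneg K)) \<Phi> \<and>
       (\<forall>A \<in> Obj (ho_dc_nonneg K). is_cdga_prod K A (FObj \<Phi> A) (p A)) \<and>
       natural_projections (ho_cdga_nonneg K) (ho_dc_nonneg K) \<Phi>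
         (\<lambda>A i. zz_class (cdga_nonneg_cat K) (quasi_iso K) A (FObj \<Phi> A ! i)
            [Fwd A (FObj \<Phi> A ! i) (p A i)])) \<and>
     (\<forall>A :: ('k, 'a) dga. cdga K A \<and> homologically_disconnected K A \<longrightarrow>
       (\<exists>(As :: ('k, 'a) dga list) P. As \<noteq> [] \<and>
          (\<forall>B \<in> set As. cdga K B \<and> homologically_connected K B) \<and>
          cdga K P \<and> cdga_iso K P (cdga_prod_list As) \<noteq> {} \<and>
          weakly_equivalent (cdga_cat K) (quasi_iso K) A P)) \<and>
     (\<exists>(\<Phi> :: (('k, 'a) dga, ('k, 'a) ho_mor, ('k, 'a) dga list, (nat \<times> ('k, 'a) ho_mor) list) func) P \<theta> p.
       is_equivalence (ho_dc K) (Prod_cat (ho_c K)) \<Phi> \<and>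
       (\<forall>A \<in> Obj (ho_dc K). cdga K (P A) \<and> is_cdga_prod K (P A) (FObj \<Phi> A) (p A) \<and>
          weak_zigzag (cdga_cat K) (quasi_iso K) A (P A) (\<theta> A)) \<and>
       natural_projections (ho_cdga K) (ho_dc K) \<Phi>
         (\<lambda>A i. zz_class (cdga_cat K) (quasi_iso K) A (FObj \<Phi> A ! i)
            (\<theta> A @ [Fwd (P A) (FObj \<Phi> A ! i) (p A i)])))"
  proof (cases "finite (UNIV :: 'a set)")
  \<comment> \<open>There are no objects on either side of the two equivalences, and the other
    claims range over the empty class.\<close>
  case True
  note F = finite_universe[OF assms True]
  note cat = category_full_subcat[OF loc_pair.category_localization[OF loc_pair.intro]]
  have cats: "category (cdga_cat K :: (('k, 'a) dga, _) cat)" "category (cdga_nonneg_cat K :: (('k, 'a) dga, _) cat)"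
    using category_cdga_cat category_full_subcat[OF category_cdga_cat] by (auto simp: cdga_nonneg_cat_def)
  have empty: "Obj (ho_dc_nonneg K :: (('k, 'a) dga, _) cat) = {}" "Obj (ho_dc K :: (('k, 'a) dga, _) cat) = {}"
    "Obj (Prod_cat (ho_c_nonneg K :: (('k, 'a) dga, _) cat)) = {}" "Obj (Prod_cat (ho_c K :: (('k, 'a) dga, _) cat)) = {}"
    using F by (auto simp: ho_dc_nonneg_def ho_dc_def ho_c_nonneg_def ho_c_def Prod_cat_simps)
  have c: "category (ho_dc_nonneg K :: (('k, 'a) dga, _) cat)" "category (ho_dc K :: (('k, 'a) dga, _) cat)"
    "category (Prod_cat (ho_c_nonneg K :: (('k, 'a) dga, _) cat))" "category (Prod_cat (ho_c K :: (('k, 'a) dga, _) cat))"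
    unfolding ho_dc_nonneg_def ho_dc_def ho_c_nonneg_def ho_c_def ho_cdga_def ho_cdga_nonneg_def
    by (rule cat[OF cats(2)] cat[OF cats(1)] category_Prod_cat[OF cat[OF cats(2)]] category_Prod_cat[OF cat[OF cats(1)]])+
  have "is_equivalence (ho_dc_nonneg K :: (('k, 'a) dga, _) cat) (Prod_cat (ho_c_nonneg K :: (('k, 'a) dga, _) cat)) \<Phi>"
    "is_equivalence (ho_dc K :: (('k, 'a) dga, _) cat) (Prod_cat (ho_c K :: (('k, 'a) dga, _) cat)) \<Phi>" for \<Phi>
    using empty_equivalence[OF c(1) c(3) empty(1) empty(3)] empty_equivalence[OF c(2) c(4) empty(2) empty(4)] by blast+
  then show ?thesis
    using F empty by (simp add: natural_projections_def)
next
  case inf: False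
  \<comment> \<open>One system is fixed for each algebra, independently of the grading condition, so
    both equivalences use the same factors and the same maps to them.\<close>
  define es where "es A = (SOME es. es \<noteq> [] \<and> idem_system A es \<and> (\<forall>e \<in> set es. homologically_connected K (frac_dga A e)))"
    for A :: "('k, 'a) dga"
  define Fs where "Fs A = map (frac_dga A) (es A)" for A :: "('k, 'a) dga"
  define u where "u A i = frac_unit A (es A ! i)" for A :: "('k, 'a) dga" and i
  have es: "es A \<noteq> []" "idem_system A (es A)" "\<forall>e \<in> set (es A). homologically_connected K (frac_dga A e)"
    if "cdga K A" "homologically_disconnected K A" for A :: "('k, 'a) dga"
    using someI_ex[OF disconnected_idem_system[OF that(1) inf that(2)]] by (auto simp: es_def)
  have idem: "cdga_idem K A e" if "cdga K A" "homologically_disconnected K A" "e \<in> set (es A)" for A :: "('k, 'a) dga" and e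
    using idem_systemD(1)[OF es(2)[OF that(1,2)]] that inf by (auto simp: cdga_idem_def cdga_idem_axioms_def)
  have frac: "cdga K (frac_dga A e)" "nonneg_graded A \<Longrightarrow> nonneg_graded (frac_dga A e)"
    if "cdga K A" "homologically_disconnected K A" "e \<in> set (es A)" for A :: "('k, 'a) dga" and e
  proof -
    interpret X: cdga_idem K A e using idem[OF that] .
    show "cdga K (frac_dga A e)" by (rule X.cdga_frac_dga)
    show "nonneg_graded A \<Longrightarrow> nonneg_graded (frac_dga A e)" by (rule nonneg_frac_dga[OF X.cdga_frac_axioms])
  qed
  have Fs: "Fs A \<noteq> []" "\<forall>B \<in> set (Fs A). cdga K B \<and> homologically_connected K B"
    "nonneg_graded A \<Longrightarrow> \<forall>B \<in> set (Fs A). nonneg_graded B"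
    if "cdga K A" "homologically_disconnected K A" for A
    using es[OF that] frac[OF that] by (auto simp: Fs_def)
  have joint: "joint_quasi_iso K A (Fs A) (u A)" if "cdga K A" "homologically_disconnected K A" for A
    using idem_system_joint[OF that(1) es(2)[OF that] inf] by (simp add: Fs_def u_def[abs_def])
  have family: "cdga_family K A (Fs A) (u A)" if "cdga K A" "homologically_disconnected K A" for A
    using that Fs[OF that] joint[OF that] by (simp add: cdga_family_def cdga_family_axioms_def joint_quasi_iso_def)
  have strict: "strict_product K A (Fs A) (u A)" if "cdga K A" "homologically_disconnected K A" "nonneg_graded A" for A
    using idem_system_strict_product[OF that(1) es(2)[OF that(1,2)] inf that(3)] by (simp add: Fs_def u_def[abs_def])
  interpret N: cdga_class K "nonneg_graded :: ('k, 'a) dga \<Rightarrow> bool" by (rule cdga_class_nonneg[OF assms(1) inf])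
  interpret Z: cdga_class K "\<lambda>_ :: ('k, 'a) dga. True" by (rule cdga_class_all[OF assms(1) inf])
  \<comment> \<open>The \<int>-graded case is the instance with the trivial condition, whose full
    subcategory is \<open>cdga_cat K\<close> itself.\<close>
  have ZC: "full_subcat (cdga_cat K) (\<lambda>_ :: ('k, 'a) dga. True) = cdga_cat K"
    by (simp add: full_subcat_def)
  have BZ: "\<And>B. B \<in> set (Fs A) \<Longrightarrow> cdga K B \<and> True" if "cdga K A" "homologically_disconnected K A" for A
    using Fs(2)[OF that] by blast
  \<comment> \<open>In the \<int>-graded case the map from \<open>A\<close> to the product of its
    localizations is only a quasi-isomorphism. \<open>P A\<close> is this product with carriers in
    the given type, and \<open>\<theta> A\<close> consists of the comparison map \<open>m A\<close>
    alone.\<close>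
  define P where "P A = Z.prods.lprod (Fs A)" for A
  define q where "q A = Z.prods.lproj (Fs A)" for A
  define m where "m A = (SOME m. m \<in> cdga_hom K A (P A) \<and> m \<in> quasi_iso K A (P A) \<and>
    (\<forall>i < length (Fs A). hom_comp A (q A i) m = u A i))" for A
  have m: "m A \<in> cdga_hom K A (P A)" "m A \<in> quasi_iso K A (P A)"
    "\<And>i. i < length (Fs A) \<Longrightarrow> hom_comp A (q A i) (m A) = u A i"
    if "cdga K A" "homologically_disconnected K A" for A
    using someI_ex[OF Z.joint_tuple[OF that(1) TrueI BZ[OF that] joint[OF that]]] by (auto simp: m_def P_def q_def)
  have PA: "cdga K (P A)" "strict_product K (P A) (Fs A) (q A)" "cdga_family K (P A) (Fs A) (q A)"
    if "cdga K A" "homologically_disconnected K A" for A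
    using Z.lprod_CR(1)[OF BZ[OF that]] Z.lprod_strict_product[OF BZ[OF that]] Z.family_lprod[OF BZ[OF that]]
    by (simp_all add: P_def q_def)
  define \<theta> where "\<theta> A = [Fwd A (P A) (m A)]" for A
  have \<theta>: "weak_zigzag (cdga_cat K) (quasi_iso K) A (P A) (\<theta> A)"
    if "cdga K A" "homologically_disconnected K A" for A
    unfolding weak_zigzag_def \<theta>_def using that PA[OF that] m[OF that] by (auto intro!: zigzag.intros)
  have part1: "\<exists>As :: ('k, 'a) dga list. As \<noteq> [] \<and>
      (\<forall>B \<in> set As. cdga K B \<and> nonneg_graded B \<and> homologically_connected K B) \<and> cdga_iso K A (cdga_prod_list As) \<noteq> {}"
    if A: "cdga K A" "nonneg_graded A" "homologically_disconnected K A" for A :: "('k, 'a) dga"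
    using Fs[OF A(1,3)] A(2) strict_product_iso[OF family[OF A(1,3)] strict[OF A(1,3,2)]] by (intro exI[of _ "Fs A"]) blast
  obtain \<Phi> where \<Phi>: "FObj \<Phi> = Fs" "is_equivalence (ho_dc_nonneg K) (Prod_cat (ho_c_nonneg K)) \<Phi>"
    "natural_projections (ho_cdga_nonneg K) (ho_dc_nonneg K) \<Phi>
       (\<lambda>A i. zz_class (cdga_nonneg_cat K) (quasi_iso K) A (Fs A ! i) [Fwd A (Fs A ! i) (u A i)])"
    using N.equivalence[of Fs u, OF _ refl] Fs joint
    unfolding ho_dc_nonneg_def ho_c_nonneg_def ho_cdga_nonneg_def cdga_nonneg_cat_def by blast
  have prod\<Phi>: "is_cdga_prod K A (FObj \<Phi> A) (u A)" if "A \<in> Obj (ho_dc_nonneg K)" for A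
  proof -
    have "cdga K A" "nonneg_graded A" "homologically_disconnected K A"
      using that by (auto simp: ho_dc_nonneg_def ho_cdga_nonneg_def cdga_nonneg_cat_def N.prods.localization_simps)
    then show ?thesis using strict_product_is_cdga_prod[OF family strict] \<Phi>(1) by simp
  qed
  \<comment> \<open>\<open>u A i\<close> is \<open>q A i\<close> after \<open>m A\<close>, so the
    zigzag through \<open>P A\<close> is congruent to the single letter used in the construction of
    the splitting.\<close>
  have cl: "zz_class (cdga_cat K) (quasi_iso K) A (Fs A ! i) [Fwd A (Fs A ! i) (u A i)] =
      zz_class (cdga_cat K) (quasi_iso K) A (Fs A ! i) (\<theta> A @ [Fwd (P A) (Fs A ! i) (q A i)])"
    if A: "cdga K A" "homologically_disconnected K A" and i: "i < length (Fs A)" for A i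
  proof -
    have B: "cdga K (Fs A ! i)" "q A i \<in> cdga_hom K (P A) (Fs A ! i)" "u A i \<in> cdga_hom K A (Fs A ! i)"
      using Fs(2)[OF A] i PA(2)[OF A] joint[OF A] by (auto simp: strict_product_def joint_quasi_iso_def)
    have "zz_eq (cdga_cat K) (quasi_iso K) A (Fs A ! i) [Fwd A (P A) (m A), Fwd (P A) (Fs A ! i) (q A i)]
        [Fwd A (Fs A ! i) (Comp (cdga_cat K) A (P A) (Fs A ! i) (q A i) (m A))]"
      by (rule zz_comp) (use A PA[OF A] B m[OF A] in simp_all)
    then have "zz_eq (cdga_cat K) (quasi_iso K) A (Fs A ! i) [Fwd A (Fs A ! i) (u A i)] (\<theta> A @ [Fwd (P A) (Fs A ! i) (q A i)])"
      using m(3)[OF A i] by (simp add: \<theta>_def zz_sym)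
    moreover have "zigzag (cdga_cat K) (quasi_iso K) A (Fs A ! i) [Fwd A (Fs A ! i) (u A i)]"
      using A B by (auto intro!: zigzag.intros)
    ultimately show ?thesis using Z.prods.cl_eq_iff unfolding ZC by blast
  qed
  have part3: "\<exists>(As :: ('k, 'a) dga list) P. As \<noteq> [] \<and> (\<forall>B \<in> set As. cdga K B \<and> homologically_connected K B) \<and>
      cdga K P \<and> cdga_iso K P (cdga_prod_list As) \<noteq> {} \<and> weakly_equivalent (cdga_cat K) (quasi_iso K) A P"
    if A: "cdga K A" "homologically_disconnected K A" for A :: "('k, 'a) dga"
    using Fs[OF A] PA(1)[OF A] strict_product_iso[OF PA(3,2)[OF A]] \<theta>[OF A] unfolding weakly_equivalent_def
    by (intro exI[of _ "Fs A"] exI[of _ "P A"]) blast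
  obtain \<Psi> where \<Psi>: "FObj \<Psi> = Fs" "is_equivalence (ho_dc K) (Prod_cat (ho_c K)) \<Psi>"
    "natural_projections (ho_cdga K) (ho_dc K) \<Psi>
       (\<lambda>A i. zz_class (cdga_cat K) (quasi_iso K) A (Fs A ! i) (\<theta> A @ [Fwd (P A) (Fs A ! i) (q A i)]))"
    using Z.equivalence[of Fs u "\<lambda>A i. zz_class (cdga_cat K) (quasi_iso K) A (Fs A ! i) (\<theta> A @ [Fwd (P A) (Fs A ! i) (q A i)])",
        unfolded ZC] Fs joint cl
    unfolding ho_dc_def ho_c_def ho_cdga_def by blast
  have prod\<Psi>: "cdga K (P A) \<and> is_cdga_prod K (P A) (FObj \<Psi> A) (q A) \<and> weak_zigzag (cdga_cat K) (quasi_iso K) A (P A) (\<theta> A)"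
    if "A \<in> Obj (ho_dc K)" for A
  proof -
    have A: "cdga K A" "homologically_disconnected K A"
      using that Z.prods.localization_simps(1) by (auto simp: ho_dc_def ho_cdga_def ZC)
    then show ?thesis using PA[OF A] \<theta>[OF A] strict_product_is_cdga_prod \<Psi>(1) by simp
  qed
  show ?thesis
  proof (intro conjI allI impI)
    show "\<exists>(\<Phi> :: (('k, 'a) dga, ('k, 'a) ho_mor, ('k, 'a) dga list, (nat \<times> ('k, 'a) ho_mor) list) func) p.
       is_equivalence (ho_dc_nonneg K) (Prod_cat (ho_c_nonneg K)) \<Phi> \<and>
       (\<forall>A \<in> Obj (ho_dc_nonneg K). is_cdga_prod K A (FObj \<Phi> A) (p A)) \<and>
       natural_projections (ho_cdga_nonneg K) (ho_dc_nonneg K) \<Phi>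
         (\<lambda>A i. zz_class (cdga_nonneg_cat K) (quasi_iso K) A (FObj \<Phi> A ! i)
            [Fwd A (FObj \<Phi> A ! i) (p A i)])"
      using \<Phi> prod\<Phi> by (intro exI[of _ \<Phi>] exI[of _ u]) simp
    show "\<exists>(\<Phi> :: (('k, 'a) dga, ('k, 'a) ho_mor, ('k, 'a) dga list, (nat \<times> ('k, 'a) ho_mor) list) func) P \<theta> p.
       is_equivalence (ho_dc K) (Prod_cat (ho_c K)) \<Phi> \<and>
       (\<forall>A \<in> Obj (ho_dc K). cdga K (P A) \<and> is_cdga_prod K (P A) (FObj \<Phi> A) (p A) \<and>
          weak_zigzag (cdga_cat K) (quasi_iso K) A (P A) (\<theta> A)) \<and>
       natural_projections (ho_cdga K) (ho_dc K) \<Phi>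
         (\<lambda>A i. zz_class (cdga_cat K) (quasi_iso K) A (FObj \<Phi> A ! i)
            (\<theta> A @ [Fwd (P A) (FObj \<Phi> A ! i) (p A i)]))"
      using \<Psi> prod\<Psi> by (intro exI[of _ \<Psi>] exI[of _ P] exI[of _ \<theta>] exI[of _ q]) simp
  qed (use part1 part3 in blast)+
qed

end
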